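(* Let $G$ be a Fuchsian group acting on $\mathbb D$, let $n\ge3$ be an integer and $\bullet\in\{A,B\}$. The kernel of the differential at the origin of the (lifted) higher Bers map $\tilde\beta^\bullet_n$ is given by $$\ker D_0\tilde\beta^\bullet_n\big|_{L^\infty_{(-1,1)}(\mathbb D^c,G)}=\psi_2^{-1}\Big(\big(\mathcal A^{n+1}_2(G)\big)^\perp\Big),$$ where $\perp$ denotes the orthogonal subspace (in $L^\infty_2(\mathbb D^c,G)$) for the pairing $\langle\cdot,\cdot\rangle^G_2$.
   Context: $\mathbb D$ is the unit disc, $\mathbb D^c$ the interior of its complement in $\hat{\mathbb C}$, on which $G$ also acts; $\lambda(z)=(|z|^2-1)^{-1}$ is the Poincaré density of $\mathbb D^c$; $\mathcal F$ is a fundamental domain for $G$ in $\mathbb D^c$. $L^\infty_{(-1,1)}(\mathbb D^c,G)$: essentially bounded measurable $\mu$ on $\mathbb D^c$ with $\mu(z)=\mu(gz)\overline{g'(z)}/g'(z)$ a.e. for all $g\in G$. For an integer $q\ge2$: $L^1_q(\mathbb D^c,G)$ and $L^\infty_q(\mathbb D^c,G)$ are the Banach spaces of measurable $f$ on $\mathbb D^c$ with $f(gz)g'(z)^q=f(z)$ for all $g\in G$ and with finite norm $\int_{\mathcal F}\lambda^{2-q}|f|\,d^2z$, resp. $\operatorname{ess\,sup}_{\mathcal F}\lambda^{-q}|f|$. $A^1_q(\mathbb D^c,G)$ is the subspace of $L^1_q(\mathbb D^c,G)$ of holomorphic functions, with $f(z)=O(|z|^{-2q})$ as $z\to\infty$.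 The group is omitted from the notation if $G=\mathbb 1$. The Weil–Petersson pairing is $\langle f,h\rangle^G_q=\int_{\mathcal F}f\,\overline h\,\lambda^{2-2q}\,d^2z$. The Poincaré series operator is $\Theta_q[f](z)=\sum_{g\in G}f(gz)g'(z)^q$. For $z\in\mathbb D$ and an integer $l\ge 2q$ put $\omega^l_z(w)=(w-z)^{-l}$, $w\in\mathbb D^c$, and $$\mathcal A^l_q(G)=\mathrm{cl}_{A^1_q(\mathbb D^c,G)}\big(\mathrm{span}_{\mathbb C}\{\Theta_q[\omega^l_z]:z\in\mathbb D\}\big)\subset A^1_q(\mathbb D^c,G).$$ $\psi_2:L^\infty_{(-1,1)}(\mathbb D^c,G)\to L^\infty_2(\mathbb D^c,G)$ is the isometric bijection $\psi_2(\nu)=\bar\nu\lambda^2$. Higher Schwarzians: with $S_f=(f''/f')'-\tfrac12(f''/f')^2$, $\sigma^A_3[f]=S_f$, $\sigma^A_{n+1}[f]=\sigma^A_n[f]'-(n-1)\frac{f''}{f'}\sigma^A_n[f]$, and $\sigma^B_n[f]=-2(f')^{\frac n2-1}\frac{d^{n-1}}{dz^{n-1}}\big((f')^{1-\frac n2}\big)$ (same branch of the square root in both places for odd $n$). For $\mu$ in the open unit ball of $L^\infty(\mathbb D^c)$, extended by $0$ to $\mathbb D$, $w^\mu$ is the quasiconformal homeomorphism of $\hat{\mathbb C}$ with $\bar\partial w=\mu\,\partial w$, $w^\mu(0)=0$, $(w^\mu)'(0)=1$, $(w^\mu)''(0)=0$. The lifted higher Bers map is $\tilde\beta^\bullet_n(\mu)=\sigma^\bullet_n[w^\mu|_{\mathbb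 D}]\in B_{n-1}(\mathbb D)$, where $B_{q}(\mathbb D)$ is the Banach space of holomorphic $f$ on $\mathbb D$ with $\sup_{\mathbb D}|f(z)|(1-|z|^2)^q<\infty$; $D_0\tilde\beta^\bullet_n:L^\infty(\mathbb D^c)\to B_{n-1}(\mathbb D)$ is its derivative at $0$. *)

theory Defs
  imports
    "HOL-Complex_Analysis.Complex_Analysis"
    "HOL-Probability.Essential_Supremum"
    "HOL-Library.Landau_Symbols"
    "HOL-Algebra.Bij"
begin

section \<open>The Riemann sphere and Fuchsian groups\<close>

text \<open>The Riemann sphere is \<open>complex option\<close>, with \<open>None\<close> in the role of the point at infinity, and
  it carries the topology of the one-point compactification of the plane.\<close>

type_synonym sphere = "complex option"

abbreviation sphere_top :: "sphere topology" where
  "sphere_top \<equiv> Alexandroff_compactification euclidean"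

text \<open>The coordinate expression of a self-map of the sphere; it is meaningful where the
  value is finite.\<close>

definition chart :: "(sphere \<Rightarrow> sphere) \<Rightarrow> complex \<Rightarrow> complex" where
  "chart g z = the (g (Some z))"

definition su11_map :: "complex \<Rightarrow> complex \<Rightarrow> sphere \<Rightarrow> sphere" where
  "su11_map a b p =
     (case p of
        None \<Rightarrow> if b = 0 then None else Some (a / cnj b)
      | Some z \<Rightarrow> if cnj b * z + cnj a = 0 then None
                  else Some ((a * z + b) / (cnj b * z + cnj a)))"

definition disc_automorphisms :: "(sphere \<Rightarrow> sphere) set" where
  "disc_automorphisms = {su11_map a b |a b. (cmod a)\<^sup>2 - (cmod b)\<^sup>2 = 1}"

text \<open>Discreteness is isolation of the identity, measured in the matrix entries \<open>a\<close>, \<open>b\<close>. The elements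
  of the group are maps, not matrices, so a sum over the group counts \<open>(a, b)\<close> and \<open>(-a, -b)\<close> once.\<close>

definition fuchsian_group :: "(sphere \<Rightarrow> sphere) set \<Rightarrow> bool" where
  "fuchsian_group G \<longleftrightarrow>
     subgroup G (BijGroup UNIV) \<and> G \<subseteq> disc_automorphisms \<and>
     (\<exists>\<epsilon>>0. \<forall>a b. (cmod a)\<^sup>2 - (cmod b)\<^sup>2 = 1 \<and> su11_map a b \<in> G \<and>
               cmod (a - 1) < \<epsilon> \<and> cmod b < \<epsilon> \<longrightarrow> su11_map a b = id)"

text \<open>The finite part of the interior of the complement of the disc. The omitted point at infinity is
  a null set; for holomorphic functions the behaviour there is prescribed by a growth condition.\<close>

definition Dc :: "complex set" where
  "Dc = {z. cmod z > 1}"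

text \<open>Fundamental domains in the sense of integration: tiling up to null sets. This covers open,
  closed and half-open fundamental polygons.\<close>

definition fundamental_domain :: "(sphere \<Rightarrow> sphere) set \<Rightarrow> complex set \<Rightarrow> bool" where
  "fundamental_domain G F \<longleftrightarrow>
     F \<in> sets lebesgue \<and> F \<subseteq> Dc \<and>
     negligible {z \<in> Dc. \<forall>g\<in>G. Some z \<notin> g ` Some ` F} \<and>
     (\<forall>g\<in>G. g \<noteq> id \<longrightarrow> negligible {z \<in> F. g (Some z) \<in> Some ` F})"

definition poincare_density :: "complex \<Rightarrow> real" where
  "poincare_density z = inverse ((cmod z)\<^sup>2 - 1)"


section \<open>Function spaces on the exterior of the disc\<close>

text \<open>Elements of these spaces are represented by functions on the plane of which only the values on
  \<open>Dc\<close> matter; no quotient by almost everywhere equality is formed.\<close>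

definition ess_bounded :: "complex measure \<Rightarrow> (complex \<Rightarrow> complex) \<Rightarrow> bool" where
  "ess_bounded M f \<longleftrightarrow> f \<in> borel_measurable M \<and> esssup M (\<lambda>z. ereal (cmod (f z))) < \<infinity>"

definition Linf :: "(complex \<Rightarrow> complex) set" where
  "Linf = {\<mu>. ess_bounded (lebesgue_on Dc) \<mu>}"

definition Linf_norm :: "(complex \<Rightarrow> complex) \<Rightarrow> real" where
  "Linf_norm \<mu> = real_of_ereal (esssup (lebesgue_on Dc) (\<lambda>z. ereal (cmod (\<mu> z))))"

definition Linf_m11 :: "(sphere \<Rightarrow> sphere) set \<Rightarrow> (complex \<Rightarrow> complex) set" where
  "Linf_m11 G = {\<mu> \<in> Linf. \<forall>g\<in>G. AE z in lebesgue_on Dc.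
      \<mu> z = \<mu> (chart g z) * cnj (deriv (chart g) z) / deriv (chart g) z}"

definition automorphic :: "nat \<Rightarrow> (sphere \<Rightarrow> sphere) set \<Rightarrow> (complex \<Rightarrow> complex) \<Rightarrow> bool" where
  "automorphic q G f \<longleftrightarrow>
     (\<forall>g\<in>G. AE z in lebesgue_on Dc. f (chart g z) * deriv (chart g) z ^ q = f z)"

definition Linf_q :: "nat \<Rightarrow> (sphere \<Rightarrow> sphere) set \<Rightarrow> complex set \<Rightarrow> (complex \<Rightarrow> complex) set" where
  "Linf_q q G F = {f \<in> borel_measurable (lebesgue_on Dc). automorphic q G f \<and>
      esssup (lebesgue_on F) (\<lambda>z. ereal (poincare_density z powi (- int q) * cmod (f z))) < \<infinity>}"

definition L1_q :: "nat \<Rightarrow> (sphere \<Rightarrow> sphere) set \<Rightarrow> complex set \<Rightarrow> (complex \<Rightarrow> complex) set" where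
  "L1_q q G F = {f \<in> borel_measurable (lebesgue_on Dc). automorphic q G f \<and>
      integrable (lebesgue_on F) (\<lambda>z. poincare_density z powi (2 - int q) * cmod (f z))}"

definition L1_q_norm :: "nat \<Rightarrow> complex set \<Rightarrow> (complex \<Rightarrow> complex) \<Rightarrow> real" where
  "L1_q_norm q F f = (LINT z|lebesgue_on F. poincare_density z powi (2 - int q) * cmod (f z))"

definition A1_q :: "nat \<Rightarrow> (sphere \<Rightarrow> sphere) set \<Rightarrow> complex set \<Rightarrow> (complex \<Rightarrow> complex) set" where
  "A1_q q G F = {f \<in> L1_q q G F. f holomorphic_on Dc \<and>
      f \<in> O[at_infinity](\<lambda>z. 1 / z ^ (2 * q))}"

definition WP_pairing ::
  "nat \<Rightarrow> complex set \<Rightarrow> (complex \<Rightarrow> complex) \<Rightarrow> (complex \<Rightarrow> complex) \<Rightarrow> complex" where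
  "WP_pairing q F f h =
     (LINT z|lebesgue_on F. f z * cnj (h z) * of_real (poincare_density z powi (2 - 2 * int q)))"

definition WP_orthogonal ::
  "nat \<Rightarrow> (sphere \<Rightarrow> sphere) set \<Rightarrow> complex set \<Rightarrow> (complex \<Rightarrow> complex) set \<Rightarrow> (complex \<Rightarrow> complex) set"
where
  "WP_orthogonal q G F X = {h \<in> Linf_q q G F. \<forall>f\<in>X. WP_pairing q F f h = 0}"

definition psi2 :: "(complex \<Rightarrow> complex) \<Rightarrow> complex \<Rightarrow> complex" where
  "psi2 \<nu> z = cnj (\<nu> z) * of_real ((poincare_density z)\<^sup>2)"


section \<open>Poincare series\<close>

text \<open>At the pole of \<open>g\<close> the term \<open>f (g z) * g' z ^ q\<close> of the Poincare series has the form
  "value at infinity times infinity" and is defined by continuity. The limit matters: for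
  \<open>f w = (w - z) ^ (- 2 * q)\<close> it is nonzero.\<close>

definition weight_action ::
  "nat \<Rightarrow> (sphere \<Rightarrow> sphere) \<Rightarrow> (complex \<Rightarrow> complex) \<Rightarrow> complex \<Rightarrow> complex" where
  "weight_action q g f z =
     (if g (Some z) = None
      then Lim (at z) (\<lambda>u. f (chart g u) * deriv (chart g) u ^ q)
      else f (chart g z) * deriv (chart g) z ^ q)"

definition poincare_series ::
  "nat \<Rightarrow> (sphere \<Rightarrow> sphere) set \<Rightarrow> (complex \<Rightarrow> complex) \<Rightarrow> complex \<Rightarrow> complex" where
  "poincare_series q G f z = (\<Sum>\<^sub>\<infinity>g\<in>G. weight_action q g f z)"

definition omega_kernel :: "nat \<Rightarrow> complex \<Rightarrow> complex \<Rightarrow> complex" where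
  "omega_kernel l z w = inverse ((w - z) ^ l)"

definition poincare_span ::
  "nat \<Rightarrow> nat \<Rightarrow> (sphere \<Rightarrow> sphere) set \<Rightarrow> (complex \<Rightarrow> complex) set" where
  "poincare_span q l G =
     {\<lambda>w. \<Sum>z\<in>Z. c z * poincare_series q G (omega_kernel l z) w |Z c. finite Z \<and> Z \<subseteq> ball 0 1}"

definition poincare_closure ::
  "nat \<Rightarrow> nat \<Rightarrow> (sphere \<Rightarrow> sphere) set \<Rightarrow> complex set \<Rightarrow> (complex \<Rightarrow> complex) set" where
  "poincare_closure q l G F =
     {f \<in> A1_q q G F. \<forall>\<epsilon>>0. \<exists>h \<in> poincare_span q l G \<inter> A1_q q G F.
        L1_q_norm q F (\<lambda>z. f z - h z) < \<epsilon>}"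


section \<open>Higher Schwarzians\<close>

definition pre_schwarzian :: "(complex \<Rightarrow> complex) \<Rightarrow> complex \<Rightarrow> complex" where
  "pre_schwarzian f z = deriv (deriv f) z / deriv f z"

definition schwarzian :: "(complex \<Rightarrow> complex) \<Rightarrow> complex \<Rightarrow> complex" where
  "schwarzian f z = deriv (pre_schwarzian f) z - (pre_schwarzian f z)\<^sup>2 / 2"

text \<open>The index \<open>n\<close> of \<open>sigmaA\<close> starts at 3; the values for \<open>n < 3\<close> have no meaning.\<close>

primrec sigmaA :: "nat \<Rightarrow> (complex \<Rightarrow> complex) \<Rightarrow> complex \<Rightarrow> complex" where
  "sigmaA 0 f = schwarzian f"
| "sigmaA (Suc n) f =
     (if n < 3 then schwarzian f
      else (\<lambda>z. deriv (sigmaA n f) z - of_nat (n - 1) * pre_schwarzian f z * sigmaA n f z))"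

text \<open>With \<open>s\<close> a square root of \<open>f'\<close> on the disc, \<open>f'\<close> to the power \<open>1 - n/2\<close> is \<open>s powi (2 - n)\<close>. Replacing
  \<open>s\<close> by \<open>- s\<close> does not change the result.\<close>

definition sqrt_deriv :: "(complex \<Rightarrow> complex) \<Rightarrow> complex \<Rightarrow> complex" where
  "sqrt_deriv f = (SOME s. s holomorphic_on ball 0 1 \<and> (\<forall>z\<in>ball 0 1. (s z)\<^sup>2 = deriv f z))"

definition sigmaB :: "nat \<Rightarrow> (complex \<Rightarrow> complex) \<Rightarrow> complex \<Rightarrow> complex" where
  "sigmaB n f z =
     - 2 * sqrt_deriv f z powi (int n - 2) *
     (deriv ^^ (n - 1)) (\<lambda>u. sqrt_deriv f u powi (2 - int n)) z"

datatype schwarzian_kind = Kind_A | Kind_B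

fun sigma :: "schwarzian_kind \<Rightarrow> nat \<Rightarrow> (complex \<Rightarrow> complex) \<Rightarrow> complex \<Rightarrow> complex" where
  "sigma Kind_A = sigmaA"
| "sigma Kind_B = sigmaB"


section \<open>Quasiconformal maps\<close>

definition d_z :: "(complex \<Rightarrow> complex) \<Rightarrow> complex \<Rightarrow> complex" where
  "d_z \<phi> z = (frechet_derivative \<phi> (at z) 1 - \<i> * frechet_derivative \<phi> (at z) \<i>) / 2"

definition d_zbar :: "(complex \<Rightarrow> complex) \<Rightarrow> complex \<Rightarrow> complex" where
  "d_zbar \<phi> z = (frechet_derivative \<phi> (at z) 1 + \<i> * frechet_derivative \<phi> (at z) \<i>) / 2"

definition test_functions :: "complex set \<Rightarrow> (complex \<Rightarrow> complex) set" where
  "test_functions \<Omega> = {\<phi>. \<phi> differentiable_on UNIV \<and>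
      (\<forall>v. continuous_on UNIV (\<lambda>z. frechet_derivative \<phi> (at z) v)) \<and>
      compact (closure {z. \<phi> z \<noteq> 0}) \<and> closure {z. \<phi> z \<noteq> 0} \<subseteq> \<Omega>}"

definition locally_L2 :: "complex set \<Rightarrow> (complex \<Rightarrow> complex) \<Rightarrow> bool" where
  "locally_L2 \<Omega> p \<longleftrightarrow> p \<in> borel_measurable (lebesgue_on \<Omega>) \<and>
     (\<forall>K. compact K \<and> K \<subseteq> \<Omega> \<longrightarrow> integrable (lebesgue_on K) (\<lambda>z. (cmod (p z))\<^sup>2))"

definition weak_d_z :: "complex set \<Rightarrow> (complex \<Rightarrow> complex) \<Rightarrow> (complex \<Rightarrow> complex) \<Rightarrow> bool" where
  "weak_d_z \<Omega> f p \<longleftrightarrow> (\<forall>\<phi>\<in>test_functions \<Omega>.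
     (LINT z|lebesgue_on \<Omega>. f z * d_z \<phi> z) = - (LINT z|lebesgue_on \<Omega>. p z * \<phi> z))"

definition weak_d_zbar :: "complex set \<Rightarrow> (complex \<Rightarrow> complex) \<Rightarrow> (complex \<Rightarrow> complex) \<Rightarrow> bool" where
  "weak_d_zbar \<Omega> f p \<longleftrightarrow> (\<forall>\<phi>\<in>test_functions \<Omega>.
     (LINT z|lebesgue_on \<Omega>. f z * d_zbar \<phi> z) = - (LINT z|lebesgue_on \<Omega>. p z * \<phi> z))"

text \<open>The analytic definition of quasiconformality: a homeomorphism in the Sobolev class \<open>W\<^sup>1\<^sup>,\<^sup>2\<close>, locally,
  which satisfies the Beltrami equation with coefficient \<open>\<mu>\<close> of supremum norm less than 1. The
  equation is imposed in the coordinate of the plane away from infinity and its preimage; these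
  isolated points are removable. Homeomorphisms satisfying it preserve orientation.\<close>

definition beltrami_homeo :: "(complex \<Rightarrow> complex) \<Rightarrow> (sphere \<Rightarrow> sphere) \<Rightarrow> bool" where
  "beltrami_homeo \<mu> W \<longleftrightarrow> homeomorphic_map sphere_top sphere_top W \<and>
     (let \<Omega> = {z. W (Some z) \<noteq> None} in
      \<exists>p pbar. locally_L2 \<Omega> p \<and> locally_L2 \<Omega> pbar \<and>
        weak_d_z \<Omega> (chart W) p \<and> weak_d_zbar \<Omega> (chart W) pbar \<and>
        (AE z in lebesgue_on \<Omega>. pbar z = \<mu> z * p z))"

definition extend_by_0 :: "(complex \<Rightarrow> complex) \<Rightarrow> complex \<Rightarrow> complex" where
  "extend_by_0 \<mu> z = (if z \<in> Dc then \<mu> z else 0)"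

definition normalised_beltrami_homeo :: "(complex \<Rightarrow> complex) \<Rightarrow> (sphere \<Rightarrow> sphere) \<Rightarrow> bool" where
  "normalised_beltrami_homeo \<mu> W \<longleftrightarrow> beltrami_homeo (extend_by_0 \<mu>) W \<and>
     W (Some 0) = Some 0 \<and>
     (chart W has_field_derivative 1) (at 0) \<and>
     (deriv (chart W) has_field_derivative 0) (at 0)"


section \<open>The lifted higher Bers maps and their differential at 0\<close>

text \<open>Here \<open>w\<close> sends a Beltrami coefficient \<open>\<mu>\<close> to the normalised solution of its Beltrami equation.\<close>

definition lifted_bers ::
  "((complex \<Rightarrow> complex) \<Rightarrow> sphere \<Rightarrow> sphere) \<Rightarrow> schwarzian_kind \<Rightarrow> nat \<Rightarrow>
   (complex \<Rightarrow> complex) \<Rightarrow> complex \<Rightarrow> complex" where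
  "lifted_bers w k n \<mu> = sigma k n (chart (w \<mu>))"

definition B_space :: "nat \<Rightarrow> (complex \<Rightarrow> complex) set" where
  "B_space q = {f. f holomorphic_on ball 0 1 \<and>
      bdd_above ((\<lambda>z. cmod (f z) * (1 - (cmod z)\<^sup>2) ^ q) ` ball 0 1)}"

definition B_norm :: "nat \<Rightarrow> (complex \<Rightarrow> complex) \<Rightarrow> real" where
  "B_norm q f = (SUP z\<in>ball 0 1. cmod (f z) * (1 - (cmod z)\<^sup>2) ^ q)"

text \<open>\<open>D\<close> is the complex Frechet derivative at 0 of a map \<open>\<beta>\<close> from the unit ball of \<open>Linf\<close> to \<open>B_space q\<close>.
  The spaces depend on \<open>q\<close> and consist of representatives, so the derivative is spelled out
  here instead of being an instance of \<open>has_derivative\<close>.\<close>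

definition has_differential_at_0 ::
  "nat \<Rightarrow> ((complex \<Rightarrow> complex) \<Rightarrow> complex \<Rightarrow> complex) \<Rightarrow>
   ((complex \<Rightarrow> complex) \<Rightarrow> complex \<Rightarrow> complex) \<Rightarrow> bool" where
  "has_differential_at_0 q \<beta> D \<longleftrightarrow>
     (\<forall>\<mu>\<in>Linf. D \<mu> \<in> B_space q) \<and>
     (\<forall>\<mu>\<in>Linf. \<forall>\<nu>\<in>Linf. \<forall>z\<in>ball 0 1. D (\<lambda>u. \<mu> u + \<nu> u) z = D \<mu> z + D \<nu> z) \<and>
     (\<forall>c. \<forall>\<mu>\<in>Linf. \<forall>z\<in>ball 0 1. D (\<lambda>u. c * \<mu> u) z = c * D \<mu> z) \<and>
     (\<exists>C. \<forall>\<mu>\<in>Linf. B_norm q (D \<mu>) \<le> C * Linf_norm \<mu>) \<and>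
     (\<forall>\<epsilon>>0. \<exists>\<delta>>0. \<forall>\<mu>\<in>Linf. Linf_norm \<mu> < \<delta> \<longrightarrow>
        (\<lambda>z. \<beta> \<mu> z - \<beta> (\<lambda>_. 0) z - D \<mu> z) \<in> B_space q \<and>
        B_norm q (\<lambda>z. \<beta> \<mu> z - \<beta> (\<lambda>_. 0) z - D \<mu> z) \<le> \<epsilon> * Linf_norm \<mu>)"

definition differential_at_0 ::
  "nat \<Rightarrow> ((complex \<Rightarrow> complex) \<Rightarrow> complex \<Rightarrow> complex) \<Rightarrow>
   (complex \<Rightarrow> complex) \<Rightarrow> complex \<Rightarrow> complex" where
  "differential_at_0 q \<beta> = (SOME D. has_differential_at_0 q \<beta> D)"

end

theory Submission
  imports Defs
begin

text \<open>For \<open>z\<close> in the disc, \<open>\<phi> = f'(z) / (f - f(z)) - 1 / (w - z)\<close> is bounded and satisfies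
  the weak equation \<open>dbar \<phi> = \<mu> (d \<phi> - 1 / (w - z)^2)\<close>. An energy estimate, with logarithmic cutoffs at \<open>z\<close> and at the pole, makes \<open>\<phi>\<close> small of
  first order in \<open>\<mu>\<close> in the Dirichlet norm, and its derivative \<open>\<phi>'(z) = -S\<^sub>f(z)/6\<close> is then a constant multiple of
  \<open>\<integral> \<mu>(\<zeta>) / (\<zeta> - z)^4\<close> up to an error of second order; no existence theory for quasiconformal maps is needed.
  A Riccati comparison bounds \<open>f''/f'\<close>, and Cauchy estimates carry the expansion over to the higher Schwarzians: the
  differential at 0 is a nonzero multiple of \<open>\<integral> \<mu>(\<zeta>) / (\<zeta> - z)^(n+1)\<close>. For invariant \<open>\<mu>\<close>, unfolding the Poincare
  series identifies this integral with the pairing against the series of \<open>\<omega>\<^sub>z\<close> over the fundamental domain.\<close>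

text \<open>The maps \<open>w \<mu>\<close> are given, not constructed, and are only locally of
  Sobolev class, so everything has to follow from the weak Beltrami equation of a single map. The
  Beurling transform is replaced by the equality of the Dirichlet energies of d f and dbar f for
  compactly supported f; for coefficients of norm at most 1/4 it lets the term with
  \<open>\<mu>\<close> be absorbed. It needs compact support, whereas \<open>\<phi>\<close> lives on
  the plane without z and the pole and is merely bounded. Points and infinity have capacity zero, so
  cutoffs of small energy exist and boundedness suffices. The fourth power arises because the source
  of the weak equation is \<open>\<mu>\<close> times the inverse square of the distance, and the
  equation is tested with that inverse square once more. The error of the Schwarzian is of order k^2
  with weight (1 - |z|)^(-2), uniformly in z; this is the weight of \<open>B_space 2\<close>, so
  Frechet differentiability comes out and not only directional derivatives. The normalisation at 0
  enters through f''(0) = 0, the initial value of the Riccati comparison: composing with a Moebius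
  map keeps the Schwarzian but makes f''/f' large.\<close>

type_synonym cfun = "complex \<Rightarrow> complex"

abbreviation energy :: "cfun \<Rightarrow> ennreal" where
  "energy f \<equiv> \<integral>\<^sup>+z. ennreal ((cmod (f z))\<^sup>2) \<partial>lborel"

lemmas integrable_dom = Bochner_Integration.integrable_bound

lemmas continuous_bmeas = borel_measurable_continuous_onI
lemmas continuous_measurable_leb = continuous_imp_measurable_on_sets_lebesgue

abbreviation leb :: "'a::euclidean_space set \<Rightarrow> 'a measure" where "leb S \<equiv> lebesgue_on S"

abbreviation bmeas :: "'a measure \<Rightarrow> ('a \<Rightarrow> 'b::topological_space) set" where "bmeas M \<equiv> borel_measurable M"

section \<open>Complex derivatives of continuously differentiable functions\<close>

text \<open>The Wirtinger derivatives are carried as explicit witnesses. The operators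
  \<open>d_z\<close> and \<open>d_zbar\<close> are total functions built on
  \<open>frechet_derivative\<close> and say nothing without differentiability;
  \<open>wirt_d_z\<close> and \<open>wirt_d_zbar\<close> connect the two where test functions
  require it.\<close>

definition wirt :: "cfun => complex => complex => complex => bool" where
 "wirt f a b z \<longleftrightarrow> (f has_derivative (%h. a * h + b * cnj h)) (at z)"

definition C1_on :: "complex set => cfun => cfun => cfun => bool" where
 "C1_on U f a b \<longleftrightarrow> (\<forall>z\<in>U. wirt f (a z) (b z) z) & continuous_on U a & continuous_on U b"

lemma wirt_const [simp]: "wirt (%_. c) 0 0 z"
 by (simp add: wirt_def)

lemma wirt_field: "(f has_field_derivative a) (at z) ==> wirt f a 0 z"
 by (simp add: wirt_def has_field_derivative_def)

lemma wirt_cnj [simp]: "wirt cnj 0 1 z"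
 by (simp add: wirt_def bounded_linear_cnj bounded_linear_imp_has_derivative)

lemma wirt_add: "wirt f a b z ==> wirt g c d z ==> wirt (%z. f z + g z) (a + c) (b + d) z"
 unfolding wirt_def by (drule (1) has_derivative_add) (simp add: algebra_simps)

lemma wirt_diff: "wirt f a b z ==> wirt g c d z ==> wirt (%z. f z - g z) (a - c) (b - d) z"
 unfolding wirt_def by (drule (1) has_derivative_diff) (simp add: algebra_simps)

lemma wirt_mult: "wirt f a b z ==> wirt g c d z ==>
  wirt (%z. f z * g z) (a * g z + f z * c) (b * g z + f z * d) z"
 unfolding wirt_def by (drule (1) has_derivative_mult) (simp add: algebra_simps)

lemma wirt_cnj_comp: "wirt f a b z ==> wirt (%z. cnj (f z)) (cnj b) (cnj a) z"
 unfolding wirt_def by (drule has_derivative_cnj) (simp add: algebra_simps)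

lemma wirt_compose_field:
 assumes "wirt f a b z" "(F has_field_derivative d) (at (f z))"
 shows "wirt (%z. F (f z)) (d * a) (d * b) z"
proof -
 have "(F has_derivative (*) d) (at (f z))"
  using assms(2) by (simp add: has_field_derivative_def)
 from has_derivative_compose[OF assms(1)[unfolded wirt_def] this]
 show ?thesis by (simp add: wirt_def algebra_simps)
qed

lemma wirt_compose_inner:
 assumes "(g has_field_derivative d) (at z)" "wirt f a b (g z)"
 shows "wirt (%z. f (g z)) (a * d) (b * cnj d) z"
proof -
 have "(g has_derivative (*) d) (at z)"
  using assms(1) by (simp add: has_field_derivative_def)
 from has_derivative_compose[OF this assms(2)[unfolded wirt_def]]
 show ?thesis by (simp add: wirt_def algebra_simps)
qed

lemma wirt_transform:
 assumes "wirt f a b z" "open U" "z : U" "\<And>w. w : U ==> f w = g w"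
 shows "wirt g a b z"
 using has_derivative_transform_within_open[OF assms(1)[unfolded wirt_def] assms(2,3)] assms(4)
 by (simp add: wirt_def)

lemma wirt_linear_eq:
 fixes a b c d :: complex
 assumes "(%h. a * h + b * cnj h) = (%h. c * h + d * cnj h)"
 shows "a = c & b = d"
proof -
 have 1: "a + b = c + d" using fun_cong[OF assms, of 1] by simp
 have "\<i> * (a - b) = \<i> * (c - d)" using fun_cong[OF assms, of \<i>] by (simp add: algebra_simps)
 hence "a - b = c - d" by simp
 hence "a - b + (a + b) = c - d + (c + d)" using 1 by simp
 hence "a = c" by simp
 with 1 show ?thesis by simp
qed

lemma wirt_unique:
 assumes "wirt f a b z" "wirt f c d z"
 shows "a = c" "b = d"
 using has_derivative_unique[OF assms[unfolded wirt_def]] wirt_linear_eq by blast+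

lemma wirt_frechet: "wirt f a b z ==> frechet_derivative f (at z) = (%h. a * h + b * cnj h)"
 unfolding wirt_def by (metis frechet_derivative_at)

lemma wirt_d_z: "wirt f a b z ==> d_z f z = a" and wirt_d_zbar: "wirt f a b z ==> d_zbar f z = b"
 by (simp_all add: d_z_def d_zbar_def wirt_frechet algebra_simps)

lemma wirt_imp_continuous: "wirt f a b z ==> isCont f z"
 unfolding wirt_def by (rule has_derivative_continuous)

lemma wirt_field_iff: "wirt f a 0 z \<longleftrightarrow> (f has_field_derivative a) (at z)"
 by (simp add: wirt_def has_field_derivative_def)

text \<open>Radial functions are written through the squared distance, which is smooth at the centre
  too and has the Wirtinger derivatives \<open>cnj (z - p)\<close> and \<open>z - p\<close>.\<close>

lemma wirt_radial:
 assumes "(s has_real_derivative d) (at ((cmod (z - p))^2))"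
 shows "wirt (%z. of_real (s ((cmod (z - p))^2))) (of_real d * cnj (z - p)) (of_real d * (z - p)) z"
proof -
 have "((%z. (cmod (z - p))^2) has_derivative (%h. 2 * ((z - p) \<bullet> h))) (at z)"
  unfolding power2_norm_eq_inner
  by (auto intro!: derivative_eq_intros simp: inner_commute)
 from has_derivative_compose[OF this, of s "(*) d"]
 have "((%z. s ((cmod (z - p))^2)) has_derivative (%h. d * (2 * ((z - p) \<bullet> h)))) (at z)"
  using assms by (simp add: has_field_derivative_def)
 hence "((%z. complex_of_real (s ((cmod (z - p))^2))) has_derivative (%h. of_real (d * (2 * ((z - p) \<bullet> h))))) (at z)"
  by (rule has_derivative_of_real)
 moreover have "(%h. complex_of_real (d * (2 * ((z - p) \<bullet> h)))) = (%h. of_real d * cnj (z - p) * h + of_real d * (z - p) * cnj h)"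
  by (auto simp: complex_eq_iff inner_complex_def algebra_simps)
 ultimately show ?thesis by (simp add: wirt_def)
qed

lemma C1_on_imp_continuous: "C1_on U f a b ==> continuous_on U f"
 unfolding C1_on_def by (meson wirt_imp_continuous continuous_at_imp_continuous_on)

lemma C1_on_subset: "C1_on U f a b ==> V \<subseteq> U ==> C1_on V f a b"
 unfolding C1_on_def by (auto intro: continuous_on_subset)

lemma C1_on_mult:
 assumes "C1_on U f a b" "C1_on U g c d"
 shows "C1_on U (%z. f z * g z) (%z. a z * g z + f z * c z) (%z. b z * g z + f z * d z)"
 using assms C1_on_imp_continuous[OF assms(1)] C1_on_imp_continuous[OF assms(2)]
 unfolding C1_on_def by (auto intro!: wirt_mult continuous_intros)

lemma C1_on_add:
 assumes "C1_on U f a b" "C1_on U g c d"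
 shows "C1_on U (%z. f z + g z) (%z. a z + c z) (%z. b z + d z)"
 using assms unfolding C1_on_def by (auto intro!: wirt_add continuous_intros)

lemma C1_on_const: "C1_on U (%z. c) (%z. 0) (%z. 0)"
 unfolding C1_on_def by auto

lemma C1_on_diff:
 assumes "C1_on U f a b" "C1_on U g c d"
 shows "C1_on U (%z. f z - g z) (%z. a z - c z) (%z. b z - d z)"
 using assms unfolding C1_on_def by (auto intro!: wirt_diff continuous_intros)

lemma C1_on_cnj:
 assumes "C1_on U f a b"
 shows "C1_on U (%z. cnj (f z)) (%z. cnj (b z)) (%z. cnj (a z))"
 using assms unfolding C1_on_def by (auto intro!: wirt_cnj_comp continuous_intros)

lemma C1_on_cong:
 assumes "C1_on U f a b" "\<And>z. z : U ==> a z = a' z" "\<And>z. z : U ==> b z = b' z"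
 shows "C1_on U f a' b'"
proof -
 have "continuous_on U a'" "continuous_on U b'"
  using assms continuous_on_cong unfolding C1_on_def by metis+
 with assms show ?thesis unfolding C1_on_def by auto
qed

lemma C1_on_holomorphic:
 assumes "f holomorphic_on U" "open U"
 shows "C1_on U f (deriv f) (%z. 0)"
 unfolding C1_on_def
 using assms holomorphic_deriv[OF assms] holomorphic_on_imp_continuous_on wirt_field holomorphic_derivI
 by (metis continuous_on_const)

lemma C1_on_zero_deriv:
 assumes "C1_on UNIV f a b" "closed K" "\<And>z. z ~: K ==> f z = 0" "z ~: K"
 shows "a z = 0" "b z = 0"
proof -
 have "wirt f 0 0 z"
  by (rule wirt_transform[of "%_. 0" 0 0 z "- K"]) (use assms in auto)
 moreover have "wirt f (a z) (b z) z" using assms(1) by (simp add: C1_on_def)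
 ultimately show "a z = 0" "b z = 0" using wirt_unique by blast+
qed

text \<open>Off \<open>K\<close> the function and both derivatives vanish, so the open sets
  \<open>U\<close> and \<open>- K\<close> cover the plane with compatible data.\<close>

lemma C1_on_extend:
 assumes f: "C1_on U f a b" and U: "open U" and K: "compact K" "K \<subseteq> U"
  and 0: "\<And>z. z : U ==> z ~: K ==> f z = 0"
 shows "C1_on UNIV (%z. if z : U then f z else 0) (%z. if z : U then a z else 0)
   (%z. if z : U then b z else 0)"
proof -
 have clK: "closed K" using K compact_imp_closed by blast
 have ab0: "a z = 0 & b z = 0" if "z : U" "z ~: K" for z
 proof -
  have "wirt f 0 0 z"
   by (rule wirt_transform[of "%_. 0" 0 0 z "U - K"]) (use that clK U 0 in auto)
  with f that show ?thesis using wirt_unique unfolding C1_on_def by blast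
 qed
 have UK: "U \<union> - K = UNIV" using K by auto
 have cont: "continuous_on UNIV (%z. if z : U then c z else (0::complex))"
  if c: "continuous_on U c" "\<And>z. z : U ==> z ~: K ==> c z = 0" for c
 proof -
  have "continuous_on U (%z. if z : U then c z else 0)"
   using c(1) by (subst continuous_on_cong[OF refl, of _ _ c]) auto
  moreover have "continuous_on (-K) (%z. if z : U then c z else 0)"
   by (subst continuous_on_cong[OF refl, of _ _ "%_. 0"]) (use c in auto)
  ultimately have "continuous_on (U \<union> - K) (%z. if z : U then c z else 0)"
   by (rule continuous_on_open_Un[OF U open_Compl[OF clK]])
  thus ?thesis by (simp only: UK)
 qed
 have "wirt (%z. if z : U then f z else 0) (if z : U then a z else 0) (if z : U then b z else 0) z" for z
 proof (cases "z : U")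
  case True
  hence "wirt f (a z) (b z) z" using f by (simp add: C1_on_def)
  hence "wirt (%z. if z : U then f z else 0) (a z) (b z) z"
   by (rule wirt_transform[OF _ U True]) simp
  thus ?thesis using True by simp
 next
  case False
  hence "z ~: K" using K by auto
  have "wirt (%z. if z : U then f z else 0) 0 0 z"
   by (rule wirt_transform[OF wirt_const open_Compl[OF clK]]) (use \<open>z ~: K\<close> 0 in auto)
  thus ?thesis using False by simp
 qed
 thus ?thesis using cont[of a] cont[of b] f ab0 unfolding C1_on_def by auto
qed

lemma test_functionsI:
 assumes f: "C1_on UNIV f a b" and K: "compact K" "K \<subseteq> Om" "\<And>z. z ~: K ==> f z = 0"
 shows "f : test_functions Om" "d_z f = a" "d_zbar f = b"
proof -
 have w: "wirt f (a z) (b z) z" for z using f by (simp add: C1_on_def)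
 thus "d_z f = a" "d_zbar f = b" using wirt_d_z[OF w] wirt_d_zbar[OF w] by auto
 have "{z. f z ~= 0} \<subseteq> K" using K by auto
 hence cl: "closure {z. f z ~= 0} \<subseteq> K"
  by (simp add: K(1) closure_minimal compact_imp_closed)
 hence "compact (closure {z. f z ~= 0})"
  using K(1) bounded_subset compact_eq_bounded_closed closed_closure by blast
 moreover have "f differentiable_on UNIV"
  using w unfolding wirt_def differentiable_on_def differentiable_def by blast
 moreover have "continuous_on UNIV (%z. frechet_derivative f (at z) v)" for v
  using f by (auto simp: wirt_frechet[OF w] C1_on_def intro!: continuous_intros)
 ultimately show "f : test_functions Om" using cl K by (auto simp: test_functions_def)
qed

section \<open>Integration by parts for compactly supported functions\<close>

lemma integrable_csupp:
 fixes g :: "complex => 'b::{banach, second_countable_topology}"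
 assumes "continuous_on UNIV g" "compact K" "\<And>z. z ~: K ==> g z = 0"
 shows "integrable lborel g"
proof -
 have "integrable lborel (%x. indicator K x *\<^sub>R g x)"
  using assms by (intro borel_integrable_compact) (auto intro: continuous_on_subset)
 moreover have "(%x. indicator K x *\<^sub>R g x) = g" using assms(3) by (auto simp: indicator_def)
 ultimately show ?thesis by simp
qed

lemma bounded_compact_support:
 fixes g :: "complex => 'b::real_normed_vector"
 assumes "continuous_on UNIV g" "compact K" "\<And>z. z ~: K ==> g z = 0"
 obtains B where "B >= 0" "\<And>z. norm (g z) <= B"
proof -
 have "compact (g ` K)" using assms by (meson compact_continuous_image continuous_on_subset top_greatest)
 then obtain B where "\<And>x. x : g ` K ==> norm x <= B" using compact_imp_bounded bounded_iff by metis
 hence "norm (g z) <= max B 0" for z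
  using assms(3)[of z] by (cases "z : K") (auto simp: le_max_iff_disj)
 thus ?thesis using that[of "max B 0"] by auto
qed

lemma integral_translate:
 fixes f :: "complex => 'b::{banach, second_countable_topology}"
 assumes "f : bmeas borel"
 shows "(LINT z|lborel. f (c + z)) = integral\<^sup>L lborel f"
proof -
 have "integral\<^sup>L (distr lborel borel ((+) c)) f = (LINT z|lborel. f (c + z))"
  by (rule integral_distr) (use assms in auto)
 thus ?thesis by (simp add: lborel_distr_plus)
qed

lemma integrable_translate:
 fixes f :: "complex => 'b::{banach, second_countable_topology}"
 assumes "integrable lborel f"
 shows "integrable lborel (%z. f (c + z))"
proof -
 have "integrable (distr lborel borel ((+) c)) f" using assms by (simp add: lborel_distr_plus)
 thus ?thesis by (subst (asm) integrable_distr_eq) (use assms in auto)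
qed

lemma C1_lipschitz:
 assumes f: "C1_on UNIV f a b" and B: "\<And>z. cmod (a z) <= A" "\<And>z. cmod (b z) <= B"
 shows "cmod (f y - f x) <= (A + B) * cmod (y - x)"
proof (rule differentiable_bound[of UNIV f "%z h. a z * h + b z * cnj h"])
 fix z
 show "(f has_derivative (%h. a z * h + b z * cnj h)) (at z within UNIV)"
  using f by (simp add: C1_on_def wirt_def)
 show "onorm (%h. a z * h + b z * cnj h) <= A + B"
 proof (rule onorm_bound)
  show "0 <= A + B" using B[of 0] by (meson add_nonneg_nonneg norm_ge_zero order_trans)
  fix h
  have "cmod (a z * h + b z * cnj h) <= cmod (a z) * cmod h + cmod (b z) * cmod h"
   by (metis complex_mod_cnj norm_mult norm_triangle_ineq)
  also have "... <= A * cmod h + B * cmod h" using B by (intro add_mono mult_right_mono) auto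
  finally show "cmod (a z * h + b z * cnj h) <= (A + B) * cmod h" by (simp add: algebra_simps)
 qed
qed auto

text \<open>Translation invariance of Lebesgue measure takes the place of Stokes: every difference
  quotient of \<open>f\<close> has integral 0, and dominated convergence gives the same for the
  derivative in direction \<open>h\<close>. The directions 1 and \<open>\<i>\<close> separate
  \<open>a\<close> from \<open>b\<close>.\<close>

lemma integral_wirt_zero:
 assumes f: "C1_on UNIV f a b" and K: "compact K" "\<And>z. z ~: K ==> f z = 0"
 shows "integral\<^sup>L lborel a = 0" "integral\<^sup>L lborel b = 0"
proof -
 have cl: "closed K" using K compact_imp_closed by blast
 note z = C1_on_zero_deriv[OF f cl K(2)]
 have ca: "continuous_on UNIV a" and cb: "continuous_on UNIV b" and cf: "continuous_on UNIV f"
  using f C1_on_imp_continuous[OF f] by (auto simp: C1_on_def)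
 obtain A where A: "A >= 0" "\<And>z. cmod (a z) <= A"
  using bounded_compact_support[OF ca K(1)] z by metis
 obtain B where B: "B >= 0" "\<And>z. cmod (b z) <= B"
  using bounded_compact_support[OF cb K(1)] z by metis
 obtain R where R: "K \<subseteq> ball 0 R" "R > 0"
  using K compact_imp_bounded bounded_subset_ballD by blast
 have ia: "integrable lborel a" and ib: "integrable lborel b" and int_f: "integrable lborel f"
  using integrable_csupp[OF ca K(1)] integrable_csupp[OF cb K(1)] integrable_csupp[OF cf K(1)] z K by auto
 have main: "(LINT z|lborel. a z * h + b z * cnj h) = 0" if h: "cmod h = 1" for h
 proof -
  define g where "g n z = (f (h / of_nat (Suc n) + z) - f z) * of_nat (Suc n)" for n z
  have "(%n. integral\<^sup>L lborel (g n)) \<longlonglongrightarrow> (LINT z|lborel. a z * h + b z * cnj h)"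
  \<comment> \<open>The steps \<open>h / of_nat (Suc n)\<close> have length at most 1, so all
    quotients live in the ball of radius \<open>R + 1\<close>, where the Lipschitz constant
    \<open>A + B\<close> bounds them.\<close>
  proof (rule integral_dominated_convergence[where w="%z. indicator (cball 0 (R + 1)) z *\<^sub>R (A + B)"])
   show "(%z. a z * h + b z * cnj h) : bmeas lborel" using ca cb
   by (auto intro!: continuous_bmeas continuous_intros)
   show "g n : bmeas lborel" for n
   unfolding g_def by (auto intro!: continuous_bmeas continuous_intros continuous_on_compose2[OF cf] cf)
   show "integrable lborel (%z::complex. indicator (cball 0 (R + 1)) z *\<^sub>R (A + B))"
   by (intro borel_integrable_compact) auto
   show "AE z in lborel. (%n. g n z) \<longlonglongrightarrow> a z * h + b z * cnj h"
   proof (rule AE_I2)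
   fix z
   have "(f has_derivative (%h. a z * h + b z * cnj h)) (at z)" using f by (simp add: C1_on_def wirt_def)
   moreover have "((%t. z + of_real t * h) has_derivative (%t. of_real t * h)) (at (0::real))"
   by (auto intro!: derivative_eq_intros)
   ultimately have "((%t::real. f (z + of_real t * h)) has_derivative
   (%t. a z * (of_real t * h) + b z * cnj (of_real t * h))) (at 0)"
   by (intro has_derivative_compose[of "%t. z + of_real t * h" _ 0 UNIV f]) auto
   hence "((%t::real. f (z + of_real t * h)) has_vector_derivative a z * h + b z * cnj h) (at 0)"
   unfolding has_vector_derivative_def
   by (rule has_derivative_eq_rhs) (auto simp: scaleR_conv_of_real algebra_simps)
   hence "((%t. cmod (f (z + of_real t * h) - f z - t *\<^sub>R (a z * h + b z * cnj h)) / \<bar>t\<bar>) \<longlongrightarrow> 0) (at (0::real))"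
   by (simp add: has_vector_derivative_def has_derivative_at)
   hence "((%t. cmod ((f (z + of_real t * h) - f z) /\<^sub>R t - (a z * h + b z * cnj h))) \<longlongrightarrow> 0) (at (0::real))"
   proof (rule Lim_transform_eventually)
   have "cmod (f (z + of_real t * h) - f z - t *\<^sub>R v) / \<bar>t\<bar> = cmod ((f (z + of_real t * h) - f z) /\<^sub>R t - v)"
   if "t ~= 0" for t :: real and v
   proof -
   have "(f (z + of_real t * h) - f z) /\<^sub>R t - v = inverse t *\<^sub>R (f (z + of_real t * h) - f z - t *\<^sub>R v)"
   using that by (simp add: scaleR_diff_right)
   thus ?thesis by (simp add: divide_inverse mult.commute)
   qed
   thus "\<forall>\<^sub>F t in at (0::real). cmod (f (z + of_real t * h) - f z - t *\<^sub>R (a z * h + b z * cnj h)) / \<bar>t\<bar> = cmod ((f (z + of_real t * h) - f z) /\<^sub>R t - (a z * h + b z * cnj h))"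
   by (auto simp: eventually_at_filter)
   qed
   hence lim: "((%t. (f (z + of_real t * h) - f z) /\<^sub>R t) \<longlongrightarrow> a z * h + b z * cnj h) (at (0::real))"
   by (rule LIM_zero_cancel[OF tendsto_norm_zero_cancel])
   have "(%n. (f (z + of_real (inverse (real (Suc n))) * h) - f z) /\<^sub>R inverse (real (Suc n))) \<longlonglongrightarrow> a z * h + b z * cnj h"
   by (rule tendsto_compose_eventually[OF lim LIMSEQ_inverse_real_of_nat]) auto
   thus "(%n. g n z) \<longlonglongrightarrow> a z * h + b z * cnj h"
   by (simp add: g_def scaleR_conv_of_real field_simps)
   qed
   show "AE z in lborel. norm (g n z) <= indicator (cball 0 (R + 1)) z *\<^sub>R (A + B)" for n
   proof (rule AE_I2)
   fix z
   show "norm (g n z) <= indicator (cball 0 (R + 1)) z *\<^sub>R (A + B)"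
   proof (cases "cmod z <= R + 1")
   case True
   have "cmod (f (h / of_nat (Suc n) + z) - f z) <= (A + B) * cmod (h / of_nat (Suc n))"
   using C1_lipschitz[OF f A(2) B(2), of "h / of_nat (Suc n) + z" z] by simp
   hence "norm (g n z) <= (A + B) * cmod (h / of_nat (Suc n)) * real (Suc n)"
   unfolding g_def by (simp add: norm_mult mult_right_mono del: of_nat_Suc)
   also have "... = A + B" using h by (simp add: norm_divide del: of_nat_Suc)
   finally show ?thesis using True by simp
   next
   case False
   have "cmod (h / of_nat (Suc n)) <= 1" using h by (simp add: norm_divide del: of_nat_Suc) 
   hence "cmod (h / of_nat (Suc n) + z) >= R"
   using False norm_triangle_ineq2[of z "- (h / of_nat (Suc n))"] by (simp add: add.commute)
   hence "f (h / of_nat (Suc n) + z) = 0" "f z = 0" using False R K(2) by (force simp: subset_iff)+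
   thus ?thesis using A B by (simp add: g_def)
   qed
   qed
  qed
  moreover have "integral\<^sup>L lborel (g n) = 0" for n
  proof -
   have "integral\<^sup>L lborel (g n) = (integral\<^sup>L lborel (%z. f (h / of_nat (Suc n) + z)) - integral\<^sup>L lborel f) * of_nat (Suc n)"
   unfolding g_def using int_f integrable_translate[OF int_f] by (simp del: of_nat_Suc)
   also have "integral\<^sup>L lborel (%z. f (h / of_nat (Suc n) + z)) = integral\<^sup>L lborel f"
   by (rule integral_translate) (use cf continuous_bmeas in auto)
   finally show ?thesis by simp
  qed
  ultimately show ?thesis by (simp add: LIMSEQ_const_iff)
 qed
 have 1: "integral\<^sup>L lborel a + integral\<^sup>L lborel b = 0" using main[of 1] ia ib by simp
 have "\<i> * (integral\<^sup>L lborel a - integral\<^sup>L lborel b) = 0" using main[of \<i>] ia ib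
  by (simp add: algebra_simps)
 hence 2: "integral\<^sup>L lborel a = integral\<^sup>L lborel b" by simp
 show "integral\<^sup>L lborel a = 0" "integral\<^sup>L lborel b = 0" using 1 2 by auto
qed

text \<open>Two integrations by parts: both energies equal minus the integral of
  \<open>f z * cnj (c z)\<close>, where \<open>c\<close> is the mixed second derivative shared by
  \<open>a\<close> and \<open>b\<close>. This is the L2 isometry of the Beurling transform.\<close>

lemma dirichlet_identity:
 assumes f: "C1_on UNIV f a b" and a: "C1_on UNIV a aa c" and b: "C1_on UNIV b c bb"
  and K: "compact K" "\<And>z. z ~: K ==> f z = 0"
 shows "(LINT z|lborel. (cmod (a z))^2) = (LINT z|lborel. (cmod (b z))^2)"
proof -
 have cl: "closed K" using K compact_imp_closed by blast
 note z = C1_on_zero_deriv[OF f cl K(2)]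
 have conts: "continuous_on UNIV f" "continuous_on UNIV a" "continuous_on UNIV b" "continuous_on UNIV c"
  using f a b C1_on_imp_continuous[OF f] C1_on_imp_continuous[OF a] C1_on_imp_continuous[OF b] by (auto simp: C1_on_def)
 have "(LINT z|lborel. a z * cnj (a z) + f z * cnj (c z)) = 0"
  by (rule integral_wirt_zero(1)[OF C1_on_mult[OF f C1_on_cnj[OF a]] K(1)]) (use K in auto)
 moreover have "(LINT z|lborel. b z * cnj (b z) + f z * cnj (c z)) = 0"
  by (rule integral_wirt_zero(2)[OF C1_on_mult[OF f C1_on_cnj[OF b]] K(1)]) (use K in auto)
 moreover have "integrable lborel (%z. a z * cnj (a z))" "integrable lborel (%z. b z * cnj (b z))" "integrable lborel (%z. f z * cnj (c z))"
  by (rule integrable_csupp[OF _ K(1)], use conts K z in \<open>auto intro!: continuous_intros\<close>)+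
 ultimately have "(LINT z|lborel. a z * cnj (a z)) = (LINT z|lborel. b z * cnj (b z))"
  by simp (metis add_right_cancel)
 hence "(LINT z|lborel. complex_of_real ((cmod (a z))^2)) = (LINT z|lborel. complex_of_real ((cmod (b z))^2))"
  by (simp only: complex_norm_square)
 thus ?thesis by (simp only: integral_complex_of_real of_real_eq_iff)
qed

section \<open>Convolution and mollification\<close>

definition conv :: "cfun => cfun => complex => complex" where
 "conv f k z = (\<integral>\<zeta>. f \<zeta> * k (z - \<zeta>) \<partial>lborel)"

lemma uniformly_continuous_compact_support:
 fixes g :: cfun
 assumes "continuous_on UNIV g" "compact K" "\<And>z. z ~: K ==> g z = 0" "e > 0"
 obtains d where "d > 0" "\<And>x y. dist x y < d ==> cmod (g x - g y) < e"
proof -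
 obtain R where R: "K \<subseteq> ball 0 R" "R > 0"
  using assms(2) compact_imp_bounded bounded_subset_ballD by blast
 have "uniformly_continuous_on (cball 0 (R + 1)) g"
  by (rule compact_uniformly_continuous) (use continuous_on_subset[OF assms(1)] in auto)
 then obtain d where d: "d > 0"
  "\<And>x y. x : cball 0 (R+1) ==> y : cball 0 (R+1) ==> dist x y < d ==> dist (g x) (g y) < e"
  unfolding uniformly_continuous_on_def using assms(4) by metis
 show ?thesis
 proof (rule that[of "min d 1"])
  fix x y :: complex assume xy: "dist x y < min d 1"
  show "cmod (g x - g y) < e"
  proof (cases "cmod x < R \<or> cmod y < R")
   case True
   have "cmod x <= cmod y + 1" "cmod y <= cmod x + 1"
   using xy norm_triangle_ineq2[of x y] norm_triangle_ineq3[of y x] by (auto simp: dist_norm norm_minus_commute)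
   hence "x : cball 0 (R+1)" "y : cball 0 (R+1)" using True R by auto
   thus ?thesis using d(2)[of x y] xy by (simp add: dist_norm)
  next
   case False
   hence "x ~: K" "y ~: K" using R by (auto simp: subset_iff)
   thus ?thesis using assms by simp
  qed
 qed (use d in auto)
qed

lemma conv_integrable:
 fixes f k :: cfun
 assumes f: "integrable lborel f" and k: "continuous_on UNIV k" "compact K" "\<And>z. z ~: K ==> k z = 0"
 shows "integrable lborel (%\<zeta>. f \<zeta> * k (z - \<zeta>))"
proof -
 obtain B where B: "B >= 0" "\<And>z. cmod (k z) <= B" using bounded_compact_support[OF k] by metis
 have [measurable]: "(%\<zeta>. k (z - \<zeta>)) : bmeas borel"
  by (intro continuous_bmeas continuous_on_compose2[OF k(1)] continuous_intros) auto
 have [measurable]: "f : bmeas borel" using f by (auto dest: borel_measurable_integrable)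
 show ?thesis
  by (rule integrable_dom[OF integrable_mult_left[OF integrable_norm[OF f], of B]])
   (auto simp: norm_mult B intro!: mult_left_mono order_trans[OF B(2)])
qed

lemma conv_continuous:
 fixes f k :: cfun
 assumes f: "integrable lborel f" and k: "continuous_on UNIV k" "compact K" "\<And>z. z ~: K ==> k z = 0"
 shows "continuous_on UNIV (conv f k)"
 unfolding continuous_on_iff
proof (intro ballI allI impI)
 fix z and e :: real assume e: "e > 0"
 define I where "I = (\<integral>\<zeta>. cmod (f \<zeta>) \<partial>lborel)"
 have I: "I >= 0" unfolding I_def by simp
 define e' where "e' = e / (I + 1)"
 have e': "e' > 0" using e I by (simp add: e'_def)
 then obtain d where d: "d > 0" "\<And>x y. dist x y < d ==> cmod (k x - k y) < e'"
  using uniformly_continuous_compact_support[OF k] by metis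
 have "dist (conv f k w) (conv f k z) < e" if "dist w z < d" for w
 proof -
  have "conv f k w - conv f k z = (\<integral>\<zeta>. f \<zeta> * k (w - \<zeta>) - f \<zeta> * k (z - \<zeta>) \<partial>lborel)"
   unfolding conv_def using conv_integrable[OF f k] by simp
  also have "cmod ... <= (\<integral>\<zeta>. cmod (f \<zeta>) * e' \<partial>lborel)"
  proof (rule Bochner_Integration.integral_norm_bound_integral)
   show "cmod (f x * k (w - x) - f x * k (z - x)) <= cmod (f x) * e'" for x
   proof -
   have "cmod (k (w - x) - k (z - x)) <= e'" using d(2)[of "w - x" "z - x"] that by (simp add: dist_norm)
   thus ?thesis by (metis mult_left_mono norm_ge_zero norm_mult right_diff_distrib)
   qed
  qed (use f conv_integrable[OF f k] in auto)
  also have "... = I * e'" by (simp add: I_def)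
  also have "... < (I + 1) * e'" using e' by simp
  also have "... = e" using I by (simp add: e'_def)
  finally show ?thesis by (simp add: dist_norm)
 qed
 thus "\<exists>d>0. \<forall>w\<in>UNIV. dist w z < d --> dist (conv f k w) (conv f k z) < e" using d by auto
qed

text \<open>Uniformity in \<open>z\<close> comes from the uniform continuity of the derivatives; it
  permits differentiation under the integral sign in \<open>conv_C1\<close> when \<open>f\<close> is
  merely integrable.\<close>

lemma C1_uniform_differentiable:
 assumes k: "C1_on UNIV k a b" and K: "compact K" "\<And>z. z ~: K ==> k z = 0" and e: "e > 0"
 obtains d where "d > 0" "\<And>z h. cmod h < d ==> cmod (k (z + h) - k z - (a z * h + b z * cnj h)) <= e * cmod h"
proof -
 have cl: "closed K" using K compact_imp_closed by blast
 note z0 = C1_on_zero_deriv[OF k cl K(2)]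
 obtain d1 where d1: "d1 > 0" "\<And>x y. dist x y < d1 ==> cmod (a x - a y) < e/2"
  using uniformly_continuous_compact_support[of a K "e/2"] k K z0 e unfolding C1_on_def by auto
 obtain d2 where d2: "d2 > 0" "\<And>x y. dist x y < d2 ==> cmod (b x - b y) < e/2"
  using uniformly_continuous_compact_support[of b K "e/2"] k K z0 e unfolding C1_on_def by auto
 show ?thesis
 proof (rule that[of "min d1 d2"])
  fix z h assume h: "cmod h < min d1 d2"
  define g where "g y = k y - (a z * y + b z * cnj y)" for y
  have "cmod (g (z + h) - g z) <= e * cmod (z + h - z)"
  proof (rule differentiable_bound[of "ball z (min d1 d2)" g "%y u. (a y - a z) * u + (b y - b z) * cnj u"])
   fix y assume y: "y : ball z (min d1 d2)"
   have "wirt g (a y - (a z * 1 + 0)) (b y - (0 + b z * 1)) y"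
   proof -
   have "wirt k (a y) (b y) y" using k by (simp add: C1_on_def)
   moreover have "wirt (%y. a z * y + b z * cnj y) (a z) (b z) y"
   unfolding wirt_def by (auto intro!: derivative_eq_intros)
   ultimately show ?thesis unfolding g_def by (auto dest: wirt_diff)
   qed
   thus "(g has_derivative (%u. (a y - a z) * u + (b y - b z) * cnj u)) (at y within ball z (min d1 d2))"
   by (simp add: wirt_def has_derivative_at_withinI)
   show "onorm (%u. (a y - a z) * u + (b y - b z) * cnj u) <= e"
   proof (rule onorm_bound)
   fix u
   have "cmod ((a y - a z) * u + (b y - b z) * cnj u) <= cmod (a y - a z) * cmod u + cmod (b y - b z) * cmod u"
   by (metis complex_mod_cnj norm_mult norm_triangle_ineq)
   also have "... <= e/2 * cmod u + e/2 * cmod u"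
   using y d1(2)[of y z] d2(2)[of y z] by (intro add_mono mult_right_mono) (auto simp: dist_commute)
   finally show "cmod ((a y - a z) * u + (b y - b z) * cnj u) <= e * cmod u" by simp
   qed (use e in simp)
  qed (use h d1 d2 in \<open>auto simp: dist_norm\<close>)
  moreover have "g (z + h) - g z = k (z + h) - k z - (a z * h + b z * cnj h)"
   by (simp add: g_def algebra_simps)
  ultimately show "cmod (k (z + h) - k z - (a z * h + b z * cnj h)) <= e * cmod h" by simp
 qed (use d1 d2 in auto)
qed

lemma conv_C1:
 assumes f: "integrable lborel f" and k: "C1_on UNIV k a b" and K: "compact K" "\<And>z. z ~: K ==> k z = 0"
 shows "C1_on UNIV (conv f k) (conv f a) (conv f b)"
proof -
 have cl: "closed K" using K compact_imp_closed by blast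
 note z0 = C1_on_zero_deriv[OF k cl K(2)]
 have ca: "continuous_on UNIV a" and cb: "continuous_on UNIV b" and ck: "continuous_on UNIV k"
  using k C1_on_imp_continuous[OF k] by (auto simp: C1_on_def)
 note ia = conv_integrable[OF f ca K(1) z0(1)] and ib = conv_integrable[OF f cb K(1) z0(2)]
  and ik = conv_integrable[OF f ck K]
 define I where "I = (\<integral>\<zeta>. cmod (f \<zeta>) \<partial>lborel)"
 have I: "I >= 0" unfolding I_def by simp
 have "wirt (conv f k) (conv f a z) (conv f b z) z" for z
  unfolding wirt_def has_derivative_at_alt
 proof (intro conjI allI impI)
  show "bounded_linear (%h. conv f a z * h + conv f b z * cnj h)"
   by (intro bounded_linear_add bounded_linear_mult_right bounded_linear_const_mult bounded_linear_cnj)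
  fix e :: real assume e: "e > 0"
  define e' where "e' = e / (I + 1)"
  have e': "e' > 0" using e I by (simp add: e'_def)
  then obtain d where d: "d > 0" "\<And>z h. cmod h < d ==> cmod (k (z + h) - k z - (a z * h + b z * cnj h)) <= e' * cmod h"
   using C1_uniform_differentiable[OF k K] by metis
  have "cmod (conv f k y - conv f k z - (conv f a z * (y - z) + conv f b z * cnj (y - z))) <= e * cmod (y - z)"
   if y: "cmod (y - z) < d" for y
  proof -
   define h where "h = y - z"
   have yz: "y - x = (z - x) + h" for x by (simp add: h_def)
   have eq: "conv f k y - conv f k z - (conv f a z * h + conv f b z * cnj h)
   = (LINT x|lborel. f x * k (y - x) - f x * k (z - x) - (f x * a (z - x) * h + f x * b (z - x) * cnj h))"
   unfolding conv_def using ia ib ik by simp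
   have "cmod (LINT x|lborel. f x * k (y - x) - f x * k (z - x) - (f x * a (z - x) * h + f x * b (z - x) * cnj h)) <= (LINT x|lborel. cmod (f x) * (e' * cmod h))"
   proof (rule Bochner_Integration.integral_norm_bound_integral)
   fix x
   have "f x * k (y - x) - f x * k (z - x) - (f x * a (z - x) * h + f x * b (z - x) * cnj h)
   = f x * (k ((z - x) + h) - k (z - x) - (a (z - x) * h + b (z - x) * cnj h))"
   by (simp add: algebra_simps yz)
   thus "cmod (f x * k (y - x) - f x * k (z - x) - (f x * a (z - x) * h + f x * b (z - x) * cnj h)) <= cmod (f x) * (e' * cmod h)"
   using d(2)[of h "z - x"] y by (simp add: norm_mult h_def mult_left_mono)
   qed (use f ia ib ik in auto)
   also have "... = I * (e' * cmod h)" unfolding I_def by (rule integral_mult_left_zero)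
   also have "... = I * e' * cmod h" by (rule mult.assoc[symmetric])
   also have "... <= (I + 1) * e' * cmod h" using e' I by (intro mult_right_mono) auto
   also have "(I + 1) * e' = e" using I by (simp add: e'_def)
   finally show ?thesis unfolding eq[symmetric] by (simp add: h_def)
  qed
  thus "\<exists>d>0. ALL y. cmod (y - z) < d --> cmod (conv f k y - conv f k z - (conv f a z * (y - z) + conv f b z * cnj (y - z))) <= e * cmod (y - z)"
   using d by auto
 qed
 thus ?thesis
  using conv_continuous[OF f ca K(1) z0(1)] conv_continuous[OF f cb K(1) z0(2)] by (auto simp: C1_on_def)
qed

text \<open>Second derivatives belong to the notion because \<open>dirichlet_identity\<close> needs
  a common mixed derivative \<open>c\<close>. The clause \<open>k z = of_real (cmod (k z))\<close>
  says that \<open>k\<close> is real and nonnegative.\<close>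

definition mollifier :: "real => cfun => cfun => cfun =>
  cfun => cfun => cfun => bool" where
 "mollifier r k a b aa c bb \<longleftrightarrow> C1_on UNIV k a b & C1_on UNIV a aa c & C1_on UNIV b c bb \<and>
  (ALL z. cmod z >= r --> k z = 0) & (ALL z. k z = of_real (cmod (k z))) & integral\<^sup>L lborel k = 1"

lemma has_real_derivative_max_power:
 assumes "n >= 2"
 shows "((%t::real. (max 0 (r - t))^n) has_real_derivative (- of_nat n * (max 0 (r - t))^(n-1))) (at t)"
proof -
 have n: "n ~= 0" "n - 1 > 0" using assms by auto
 consider "t < r" | "t > r" | "t = r" by linarith
 thus ?thesis
 proof cases
  case 1
  have "((%t::real. (r - t)^n) has_real_derivative (- of_nat n * (r - t)^(n-1))) (at t)"
   by (auto intro!: derivative_eq_intros)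
  thus ?thesis
   by (rule has_field_derivative_transform_within_open[of _ _ _ "{..<r}", THEN DERIV_cong]) (use 1 in auto)
 next
  case 2
  have "((%t::real. 0) has_real_derivative 0) (at t)" by auto
  thus ?thesis
   by (rule has_field_derivative_transform_within_open[of _ _ _ "{r<..}", THEN DERIV_cong]) (use 2 n in auto)
 next
  case 3
  have "((%y. ((max 0 (r - y))^n) / (y - r)) \<longlongrightarrow> 0) (at r)"
  proof (rule tendsto_norm_zero_cancel, rule tendsto_sandwich[of "%_. 0" _ _ "%y. \<bar>y - r\<bar>^(n-1)"])
   show "((%y. \<bar>y - r\<bar> ^ (n - 1)) \<longlongrightarrow> 0) (at r)"
   by (rule tendsto_eq_intros tendsto_rabs_zero | (use n in simp))+
   have "norm (max 0 (r - y) ^ n / (y - r)) <= \<bar>y - r\<bar> ^ (n - 1)" for y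
   proof (cases "y = r")
   case False
   have "max 0 (r - y) ^ n <= \<bar>y - r\<bar> ^ n" by (intro power_mono) auto
   also have "... = \<bar>y - r\<bar> ^ (n - 1) * \<bar>y - r\<bar>" using n by (metis power_minus_mult gr_zeroI)
   finally show ?thesis using False by (simp add: divide_le_eq abs_mult)
   qed auto
   thus "\<forall>\<^sub>F y in at r. norm (max 0 (r - y) ^ n / (y - r)) <= \<bar>y - r\<bar> ^ (n - 1)" by simp
  qed auto
  thus ?thesis using 3 n by (simp add: has_field_derivative_iff power_0_left)
 qed
qed

lemma C1_on_max_power:
 assumes "n >= 2"
 shows "C1_on UNIV (%z. of_real ((max 0 (r - (cmod (z - p))^2))^n))
  (%z. of_real (- of_nat n * (max 0 (r - (cmod (z - p))^2))^(n-1)) * cnj (z - p))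
  (%z. of_real (- of_nat n * (max 0 (r - (cmod (z - p))^2))^(n-1)) * (z - p))"
 unfolding C1_on_def
proof (intro conjI ballI)
 fix z
 show "wirt (%z. complex_of_real ((max 0 (r - (cmod (z - p))^2))^n))
  (of_real (- of_nat n * (max 0 (r - (cmod (z - p))^2))^(n-1)) * cnj (z - p))
  (of_real (- of_nat n * (max 0 (r - (cmod (z - p))^2))^(n-1)) * (z - p)) z"
  by (rule wirt_radial[of "%t. (max 0 (r - t))^n"]) (rule has_real_derivative_max_power[OF assms])
qed (auto intro!: continuous_intros)

lemma mollifier_exists:
 assumes r: "r > 0"
 obtains k a b aa c bb where "mollifier r k a b aa c bb"
proof -
 \<comment> \<open>Radial truncated powers: the exponent 3 is the least for which the second
   derivatives, which involve \<open>s 1\<close>, are continuous.\<close>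
 define s where "s j z = complex_of_real ((max 0 (r^2 - (cmod (z - 0))^2))^j)" for j z
 have C: "C1_on UNIV (s j) (%z. (- of_nat j * s (j-1) z) * cnj z) (%z. (- of_nat j * s (j-1) z) * z)" if "j >= 2" for j
  using C1_on_max_power[OF that, of "r^2" 0] unfolding s_def by simp
 define I where "I = (LINT z|lborel. (max 0 (r^2 - (cmod z)^2))^3)"
 have s0: "s j z = 0" if "z ~: cball 0 r" "j > 0" for j z
 proof -
  have "r^2 <= (cmod z)^2" using that r by (intro power_mono) auto
  thus ?thesis using that by (simp add: s_def max_def)
 qed
 have intI: "integrable lborel (%z::complex. (max 0 (r^2 - (cmod z)^2))^3)"
 proof (rule integrable_csupp[of _ "cball 0 r"])
  show "(max 0 (r^2 - (cmod z)^2))^3 = 0" if "z ~: cball 0 r" for z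
   using s0[OF that, of 3] unfolding s_def by (simp del: of_real_power add: of_real_eq_0_iff)
 qed (auto intro!: continuous_intros)
 have "I > 0"
 proof -
  have "I ~= 0"
  proof
   assume "I = 0"
   hence "AE z in lborel. (max 0 (r^2 - (cmod z)^2))^3 = 0"
   unfolding I_def using integral_nonneg_eq_0_iff_AE[OF intI] by auto
   hence "AE z in lborel. z ~: ball (0::complex) r"
   proof eventually_elim
   case (elim z)
   hence "r^2 <= (cmod z)^2" by (simp add: max_def split: if_splits)
   hence "r <= cmod z" using r by (simp add: abs_le_square_iff[symmetric])
   thus ?case by simp
   qed
   hence "ball (0::complex) r : null_sets lborel" by (simp add: AE_iff_null_sets)
   hence "emeasure lborel (ball (0::complex) r) = 0" by auto
   thus False using r open_not_negligible[of "ball (0::complex) r"] by (simp add: negligible_iff_emeasure0)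
  qed
  moreover have "I >= 0" unfolding I_def by simp
  ultimately show ?thesis by simp
 qed
 have prod1: "C1_on UNIV (%z. (- of_nat j * s (j-1) z) * cnj z)
   (%z. (of_nat j * of_nat (j-1)) * s (j-2) z * cnj z * cnj z)
   (%z. (of_nat j * of_nat (j-1)) * s (j-2) z * z * cnj z - of_nat j * s (j-1) z)"
 and prod2: "C1_on UNIV (%z. (- of_nat j * s (j-1) z) * z)
   (%z. (of_nat j * of_nat (j-1)) * s (j-2) z * z * cnj z - of_nat j * s (j-1) z)
   (%z. (of_nat j * of_nat (j-1)) * s (j-2) z * z * z)" if "j >= 3" for j
 proof -
  have c: "C1_on UNIV cnj (%_. 0) (%_. 1)" and i: "C1_on UNIV (%z. z) (%_. 1) (%_. 0)"
   unfolding C1_on_def by (auto intro!: wirt_field)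
  have sj: "C1_on UNIV (s (j-1)) (%z. (- of_nat (j-1) * s (j-1-1) z) * cnj z) (%z. (- of_nat (j-1) * s (j-1-1) z) * z)"
   using C[of "j-1"] that by auto
  have j2: "j - 1 - 1 = j - 2" by simp
  note A = C1_on_mult[OF C1_on_const[of UNIV "- of_nat j"] sj, unfolded j2]
  show "C1_on UNIV (%z. (- of_nat j * s (j-1) z) * cnj z)
   (%z. (of_nat j * of_nat (j-1)) * s (j-2) z * cnj z * cnj z)
   (%z. (of_nat j * of_nat (j-1)) * s (j-2) z * z * cnj z - of_nat j * s (j-1) z)"
   by (rule C1_on_cong[OF C1_on_mult[OF A c]]) (auto simp: algebra_simps)
  show "C1_on UNIV (%z. (- of_nat j * s (j-1) z) * z)
   (%z. (of_nat j * of_nat (j-1)) * s (j-2) z * z * cnj z - of_nat j * s (j-1) z)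
   (%z. (of_nat j * of_nat (j-1)) * s (j-2) z * z * z)"
   by (rule C1_on_cong[OF C1_on_mult[OF A i]]) (auto simp: algebra_simps)
 qed
 define q where "q = complex_of_real (1 / I)"
 have scale: "C1_on UNIV (%z. q * f z) (%z. q * a z) (%z. q * b z)" if "C1_on UNIV f a b" for f a b
  by (rule C1_on_cong[OF C1_on_mult[OF C1_on_const[of UNIV q] that]]) auto
 have "mollifier r (%z. q * s 3 z) (%z. q * ((- of_nat 3 * s (3-1) z) * cnj z)) (%z. q * ((- of_nat 3 * s (3-1) z) * z))
   (%z. q * ((of_nat 3 * of_nat (3-1)) * s (3-2) z * cnj z * cnj z))
   (%z. q * ((of_nat 3 * of_nat (3-1)) * s (3-2) z * z * cnj z - of_nat 3 * s (3-1) z))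
   (%z. q * ((of_nat 3 * of_nat (3-1)) * s (3-2) z * z * z))"
  unfolding mollifier_def
 proof (intro conjI allI impI)
  show "q * s 3 z = 0" if "r <= cmod z" for z
  proof -
   have "r^2 <= (cmod z)^2" using that r by (intro power_mono) auto
   thus ?thesis by (simp add: s_def max_def)
  qed
  show "q * s 3 z = of_real (cmod (q * s 3 z))" for z
   using \<open>I > 0\<close> by (simp add: q_def s_def norm_mult norm_power norm_divide)
  have "integral\<^sup>L lborel (%z. q * s 3 z) = q * complex_of_real I"
   unfolding s_def I_def by (simp del: of_real_power)
  thus "integral\<^sup>L lborel (%z. q * s 3 z) = 1" using \<open>I > 0\<close> by (simp add: q_def)
 qed (intro scale C prod1 prod2; simp)+
 thus ?thesis using that by blast
qed

lemma lborel_reflect: "distr lborel borel (%x. c - x) = (lborel :: complex measure)"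
proof -
 have "lborel = density (distr lborel borel (%x::complex. c + (-1) *\<^sub>R x)) (%x. ennreal (\<bar>-1\<bar> ^ DIM(complex)))"
  by (rule lborel_affine) simp
 thus ?thesis by (simp add: density_1)
qed

lemma integral_reflect:
 fixes f :: "complex => 'b::{banach, second_countable_topology}"
 assumes "f : bmeas borel"
 shows "(LINT z|lborel. f (c - z)) = integral\<^sup>L lborel f"
proof -
 have "integral\<^sup>L (distr lborel borel (%x. c - x)) f = (LINT z|lborel. f (c - z))"
  by (rule integral_distr) (use assms in auto)
 thus ?thesis by (simp add: lborel_reflect)
qed

lemma integrable_reflect:
 fixes f :: "complex => 'b::{banach, second_countable_topology}"
 assumes "integrable lborel f"
 shows "integrable lborel (%z. f (c - z))"
proof -
 have "integrable (distr lborel borel (%x. c - x)) f" using assms by (simp add: lborel_reflect)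
 thus ?thesis by (subst (asm) integrable_distr_eq) (use assms in auto)
qed

lemma nn_integral_translate:
 assumes "f : bmeas borel"
 shows "(\<integral>\<^sup>+z. f (z - c) \<partial>lborel) = (\<integral>\<^sup>+z. f z \<partial>(lborel::complex measure))"
proof -
 have "(\<integral>\<^sup>+z. f z \<partial>distr lborel borel ((+) (-c))) = (\<integral>\<^sup>+z. f (-c + z) \<partial>lborel)"
  by (rule nn_integral_distr) (use assms in auto)
 thus ?thesis by (simp add: lborel_distr_plus)
qed

text \<open>What the norm estimates use of a mollifier: it is a continuous probability density of
  small support.\<close>

definition weight :: "cfun => real => bool" where
 "weight k r \<longleftrightarrow> continuous_on UNIV k & (ALL z. cmod z >= r --> k z = 0) & (ALL z. k z = of_real (cmod (k z))) & integral\<^sup>L lborel k = 1"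

lemma mollifier_weight: "mollifier r k a b aa c bb ==> weight k r"
 unfolding mollifier_def weight_def using C1_on_imp_continuous by blast

lemma weight_integrable: "weight k r ==> integrable lborel k"
 by (rule integrable_csupp[of k "cball 0 r"]) (auto simp: weight_def)

lemma weight_integral_norm:
 assumes "weight k r" shows "(LINT z|lborel. cmod (k z)) = 1"
proof -
 have "complex_of_real (LINT z|lborel. cmod (k z)) = (LINT z|lborel. complex_of_real (cmod (k z)))" by simp
 also have "... = (LINT z|lborel. k z)" using assms by (metis (no_types, lifting) weight_def)
 also have "... = 1" using assms by (simp add: weight_def)
 finally show ?thesis using of_real_eq_1_iff by blast
qed

lemma weight_conv_integrable:
 fixes f :: cfun
 shows "weight k r ==> integrable lborel f ==> integrable lborel (%\<zeta>. f \<zeta> * k (z - \<zeta>))"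
 by (rule conv_integrable[of f k "cball 0 r"]) (auto simp: weight_def)

lemma weight_reflect:
 assumes "weight k r"
 shows "integrable lborel (%\<zeta>. k (z - \<zeta>))" "(\<integral>\<zeta>. k (z - \<zeta>) \<partial>lborel) = 1"
  "integrable lborel (%\<zeta>. cmod (k (z - \<zeta>)))" "(\<integral>\<zeta>. cmod (k (z - \<zeta>)) \<partial>lborel) = 1"
proof -
 have m: "k : bmeas borel" using assms by (auto simp: weight_def intro: continuous_bmeas)
 show 1: "integrable lborel (%\<zeta>. k (z - \<zeta>))" by (rule integrable_reflect[OF weight_integrable[OF assms]])
 show "(\<integral>\<zeta>. k (z - \<zeta>) \<partial>lborel) = 1" using integral_reflect[OF m] assms by (simp add: weight_def)
 show "integrable lborel (%\<zeta>. cmod (k (z - \<zeta>)))" using 1 by simp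
 show "(\<integral>\<zeta>. cmod (k (z - \<zeta>)) \<partial>lborel) = 1"
  using integral_reflect[of "%z. cmod (k z)" z] m weight_integral_norm[OF assms] by simp
qed

lemma conv_support:
 assumes "weight k r" "\<And>z. cmod z >= R ==> f z = 0" "cmod z >= R + r"
 shows "conv f k z = 0"
proof -
 have "f \<zeta> * k (z - \<zeta>) = 0" for \<zeta>
 proof (cases "cmod \<zeta> >= R")
  case False
  hence "cmod (z - \<zeta>) >= r" using assms(3) norm_triangle_ineq2[of z \<zeta>] by linarith
  thus ?thesis using assms by (simp add: weight_def)
 qed (use assms in auto)
 hence "(%\<zeta>. f \<zeta> * k (z - \<zeta>)) = (%_. 0)" by (rule ext)
 thus ?thesis by (simp only: conv_def) simp
qed

lemma conv_local_zero:
 assumes "weight k r" "AE z in lborel. z : ball p (s + r) --> f z = 0" "z : ball p s"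
 shows "conv f k z = 0"
proof -
 have "AE \<zeta> in lborel. f \<zeta> * k (z - \<zeta>) = 0"
  using assms(2)
 proof eventually_elim
  case (elim \<zeta>)
  show ?case
  proof (cases "cmod (z - \<zeta>) >= r")
   case False
   have "dist p \<zeta> < s + r" using assms(3) False dist_triangle[of p \<zeta> z] by (simp add: dist_norm)
   thus ?thesis using elim by simp
  qed (use assms(1) in \<open>simp add: weight_def\<close>)
 qed
 thus ?thesis unfolding conv_def by (rule integral_eq_zero_AE)
qed

lemma conv_weight_continuous:
 assumes "weight k r" "integrable lborel f" shows "continuous_on UNIV (conv f k)"
 by (rule conv_continuous[OF assms(2), of k "cball 0 r"]) (use assms in \<open>auto simp: weight_def\<close>)

lemma conv_weight_diff:
 assumes "weight k r" "integrable lborel f" "integrable lborel g"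
 shows "conv (%z. f z - g z) k z = conv f k z - conv g k z"
 using weight_conv_integrable[OF assms(1,2)] weight_conv_integrable[OF assms(1,3)]
 unfolding conv_def by (simp add: left_diff_distrib)

text \<open>Averaging against the translates of a probability density preserves total mass; this
  yields the contraction property of convolution in L1 as well as in L2.\<close>

lemma fubini_weight:
 assumes "weight k r" and [measurable]: "\<phi> : bmeas borel"
 shows "(\<integral>\<^sup>+z. (\<integral>\<^sup>+\<zeta>. \<phi> \<zeta> * ennreal (cmod (k (z - \<zeta>))) \<partial>lborel) \<partial>lborel) = (\<integral>\<^sup>+\<zeta>. \<phi> \<zeta> \<partial>lborel)"
proof -
 have k[measurable]: "k : bmeas borel"
  using assms by (auto simp: weight_def intro: continuous_bmeas)
 have "(\<integral>\<^sup>+z. (\<integral>\<^sup>+\<zeta>. \<phi> \<zeta> * ennreal (cmod (k (z - \<zeta>))) \<partial>lborel) \<partial>lborel)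
  = (\<integral>\<^sup>+\<zeta>. (\<integral>\<^sup>+z. \<phi> \<zeta> * ennreal (cmod (k (z - \<zeta>))) \<partial>lborel) \<partial>lborel)"
  by (rule lborel_pair.Fubini') measurable
 also have "... = (\<integral>\<^sup>+\<zeta>. \<phi> \<zeta> * (\<integral>\<^sup>+z. ennreal (cmod (k (z - \<zeta>))) \<partial>lborel) \<partial>lborel)"
  by (subst nn_integral_cmult) auto
 also have "... = (\<integral>\<^sup>+\<zeta>. \<phi> \<zeta> \<partial>lborel)"
 proof -
  have "(\<integral>\<^sup>+z. ennreal (cmod (k (z - \<zeta>))) \<partial>lborel) = 1" for \<zeta>
  proof -
   have "(\<integral>\<^sup>+z. ennreal (cmod (k (z - \<zeta>))) \<partial>lborel) = (\<integral>\<^sup>+z. ennreal (cmod (k z)) \<partial>lborel)"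
   by (rule nn_integral_translate) measurable
   also have "... = ennreal (LINT z|lborel. cmod (k z))"
   by (rule nn_integral_eq_integral) (use weight_integrable[OF assms(1)] in auto)
   finally show ?thesis using weight_integral_norm[OF assms(1)] by simp
  qed
  thus ?thesis by simp
 qed
 finally show ?thesis .
qed

lemma conv_L1:
 assumes k: "weight k r" and f: "integrable lborel f"
 shows "(\<integral>\<^sup>+z. ennreal (cmod (conv f k z)) \<partial>lborel) <= (\<integral>\<^sup>+z. ennreal (cmod (f z)) \<partial>lborel)"
proof -
 have [measurable]: "f : bmeas borel" using f by (auto dest: borel_measurable_integrable)
 have "(\<integral>\<^sup>+z. ennreal (cmod (conv f k z)) \<partial>lborel) <= (\<integral>\<^sup>+z. (\<integral>\<^sup>+\<zeta>. ennreal (cmod (f \<zeta>)) * ennreal (cmod (k (z - \<zeta>))) \<partial>lborel) \<partial>lborel)"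
 proof (rule nn_integral_mono)
  fix z
  have "ennreal (cmod (conv f k z)) <= (\<integral>\<^sup>+\<zeta>. ennreal (cmod (f \<zeta> * k (z - \<zeta>))) \<partial>lborel)"
   unfolding conv_def using integral_norm_bound_ennreal[OF weight_conv_integrable[OF k f]] by simp
  thus "ennreal (cmod (conv f k z)) <= (\<integral>\<^sup>+\<zeta>. ennreal (cmod (f \<zeta>)) * ennreal (cmod (k (z - \<zeta>))) \<partial>lborel)"
   by (simp add: norm_mult ennreal_mult)
 qed
 also have "... = (\<integral>\<^sup>+z. ennreal (cmod (f z)) \<partial>lborel)"
  by (rule fubini_weight[OF k]) measurable
 finally show ?thesis .
qed

lemma conv_L2:
 assumes k: "weight k r" and f: "integrable lborel f" and f2: "integrable lborel (%z. (cmod (f z))^2)"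
 shows "(energy (%z. conv f k z)) <= (energy f)"
proof -
 have [measurable]: "f : bmeas borel" using f by (auto dest: borel_measurable_integrable)
 have kc: "continuous_on UNIV k" using k by (simp add: weight_def)
 have [measurable]: "k : bmeas borel" using kc by (rule continuous_bmeas)
 have kz: "k z = 0" if "z ~: cball 0 r" for z using k that by (simp add: weight_def)
 obtain B where B: "\<And>z. cmod (k z) <= B" using bounded_compact_support[OF kc compact_cball kz] by blast
 have "(energy (%z. conv f k z)) <= (\<integral>\<^sup>+z. (\<integral>\<^sup>+\<zeta>. ennreal ((cmod (f \<zeta>))^2) * ennreal (cmod (k (z - \<zeta>))) \<partial>lborel) \<partial>lborel)"
 proof (rule nn_integral_mono)
  fix z
  define w where "w \<zeta> = cmod (k (z - \<zeta>))" for \<zeta>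
  define A where "A = (\<integral>\<zeta>. cmod (f \<zeta>) * w \<zeta> \<partial>lborel)"
  have w[measurable]: "w : bmeas borel" unfolding w_def by measurable
  have wi: "integrable lborel w" "(\<integral>\<zeta>. w \<zeta> \<partial>lborel) = 1" unfolding w_def using weight_reflect[OF k] by auto
  have i1: "integrable lborel (%\<zeta>. cmod (f \<zeta>) * w \<zeta>)"
   using integrable_norm[OF weight_conv_integrable[OF k f, of z]] by (simp add: norm_mult w_def)
  have i2: "integrable lborel (%\<zeta>. (cmod (f \<zeta>))^2 * w \<zeta>)"
  proof (rule integrable_dom[OF integrable_mult_left[OF f2, of B]])
   show "AE \<zeta> in lborel. norm ((cmod (f \<zeta>))^2 * w \<zeta>) <= norm ((cmod (f \<zeta>))^2 * B)"
   using B order_trans[OF norm_ge_zero B] by (auto simp: w_def abs_mult intro!: mult_left_mono)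
  qed measurable
  \<comment> \<open>Jensen's inequality in disguise: the variance of \<open>cmod (f \<zeta>)\<close>
    under the probability density \<open>w\<close>, whose mean is \<open>A\<close>, is
    nonnegative.\<close>
  have "0 <= (\<integral>\<zeta>. (cmod (f \<zeta>) - A)^2 * w \<zeta> \<partial>lborel)" by (simp add: w_def)
  also have "(\<integral>\<zeta>. (cmod (f \<zeta>) - A)^2 * w \<zeta> \<partial>lborel)
   = (\<integral>\<zeta>. (cmod (f \<zeta>))^2 * w \<zeta> - 2 * A * (cmod (f \<zeta>) * w \<zeta>) + A^2 * w \<zeta> \<partial>lborel)"
   by (rule Bochner_Integration.integral_cong) (auto simp: power2_eq_square algebra_simps)
  also have "... = (\<integral>\<zeta>. (cmod (f \<zeta>))^2 * w \<zeta> \<partial>lborel) - A^2"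
   using i1 i2 wi by (simp add: A_def power2_eq_square)
  finally have "A^2 <= (\<integral>\<zeta>. (cmod (f \<zeta>))^2 * w \<zeta> \<partial>lborel)" by simp
  moreover have "cmod (conv f k z) <= A"
   using integral_norm_bound[of lborel "%\<zeta>. f \<zeta> * k (z - \<zeta>)"] by (simp add: conv_def A_def w_def norm_mult)
  hence "(cmod (conv f k z))^2 <= A^2" by (intro power_mono) auto
  ultimately have "(cmod (conv f k z))^2 <= (\<integral>\<zeta>. (cmod (f \<zeta>))^2 * w \<zeta> \<partial>lborel)" by simp
  hence "ennreal ((cmod (conv f k z))^2) <= ennreal (\<integral>\<zeta>. (cmod (f \<zeta>))^2 * w \<zeta> \<partial>lborel)" by (rule ennreal_leI)
  also have "... = (\<integral>\<^sup>+\<zeta>. ennreal ((cmod (f \<zeta>))^2 * w \<zeta>) \<partial>lborel)"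
   by (rule nn_integral_eq_integral[symmetric, OF i2]) (simp add: w_def)
  also have "... = (\<integral>\<^sup>+\<zeta>. ennreal ((cmod (f \<zeta>))^2) * ennreal (w \<zeta>) \<partial>lborel)"
   by (simp add: ennreal_mult w_def)
  finally show "ennreal ((cmod (conv f k z))^2) <= (\<integral>\<^sup>+\<zeta>. ennreal ((cmod (f \<zeta>))^2) * ennreal (cmod (k (z - \<zeta>))) \<partial>lborel)"
   by (simp add: w_def)
 qed
 also have "... = (energy f)"
  by (rule fubini_weight[OF k]) measurable
 finally show ?thesis .
qed

lemma conv_uniform:
 assumes F: "continuous_on UNIV F" "ALL z. cmod z >= R --> F z = 0" and e: "e > 0"
 shows "\<exists>d>0. ALL k r z. weight k r --> r < d --> cmod (conv F k z - F z) <= e"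
proof -
 have Fi: "integrable lborel F" by (rule integrable_csupp[of F "cball 0 R"]) (use F in auto)
 have F0: "z ~: cball 0 R ==> F z = 0" for z using F(2) by simp
 have "\<exists>d>0. ALL x y. dist x y < d --> cmod (F x - F y) < e"
  by (rule uniformly_continuous_compact_support[of F "cball 0 R" e]) (use F0 F(1) e in auto)
 then obtain d where d: "d > 0" "\<And>x y. dist x y < d ==> cmod (F x - F y) < e" by blast
 have "cmod (conv F k z - F z) <= e" if k: "weight k r" "r < d" for k r z
 proof -
  have "conv F k z - F z = (\<integral>\<zeta>. F \<zeta> * k (z - \<zeta>) \<partial>lborel) - (\<integral>\<zeta>. F z * k (z - \<zeta>) \<partial>lborel)"
   using weight_reflect[OF k(1)] by (simp add: conv_def)
  also have "... = (\<integral>\<zeta>. F \<zeta> * k (z - \<zeta>) - F z * k (z - \<zeta>) \<partial>lborel)"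
   using weight_reflect[OF k(1)] weight_conv_integrable[OF k(1) Fi] by simp
  finally have eq: "conv F k z - F z = (\<integral>\<zeta>. F \<zeta> * k (z - \<zeta>) - F z * k (z - \<zeta>) \<partial>lborel)" .
  have "cmod (\<integral>\<zeta>. F \<zeta> * k (z - \<zeta>) - F z * k (z - \<zeta>) \<partial>lborel) <= (\<integral>\<zeta>. e * cmod (k (z - \<zeta>)) \<partial>lborel)"
  proof (rule Bochner_Integration.integral_norm_bound_integral)
   fix \<zeta>
   have "F \<zeta> * k (z - \<zeta>) - F z * k (z - \<zeta>) = (F \<zeta> - F z) * k (z - \<zeta>)" by (simp add: algebra_simps)
   moreover have "cmod ((F \<zeta> - F z) * k (z - \<zeta>)) <= e * cmod (k (z - \<zeta>))"
   proof (cases "cmod (z - \<zeta>) >= r")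
   case True thus ?thesis using k by (simp add: weight_def)
   next
   case False
   hence "cmod (F \<zeta> - F z) <= e" using d(2)[of \<zeta> z] k by (simp add: dist_norm norm_minus_commute)
   thus ?thesis by (simp add: norm_mult mult_right_mono)
   qed
   ultimately show "cmod (F \<zeta> * k (z - \<zeta>) - F z * k (z - \<zeta>)) <= e * cmod (k (z - \<zeta>))" by simp
  qed (use weight_reflect[OF k(1)] weight_conv_integrable[OF k(1) Fi] in auto)
  also have "... = e" using weight_reflect[OF k(1)] by simp
  finally show ?thesis unfolding eq .
 qed
 thus ?thesis using d(1) by blast
qed

text \<open>A measurable function is an almost everywhere limit of continuous ones. Truncating
  \<open>f\<close> at height n, clipping the approximants to about the same height and cutting them
  off near the support of \<open>f\<close> supplies a dominating function, so the limit holds in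
  L1.\<close>

lemma L1_approx_continuous:
 fixes f :: cfun
 assumes f: "integrable lborel f" and R': "ALL z. cmod z >= R --> f z = 0" and e: "e > 0"
 obtains g where "continuous_on UNIV g" "\<And>z. cmod z >= R + 1 ==> g z = 0" "(LINT z|lborel. cmod (f z - g z)) < e"
proof -
 have R: "f z = 0" if "cmod z >= R" for z using R' that by blast
 have fm[measurable]: "f : bmeas borel" using f by (auto dest: borel_measurable_integrable)
 define fM where "fM M z = (if cmod (f z) <= M then f z else 0)" for M :: real and z
 have fMm[measurable]: "fM M : bmeas borel" for M unfolding fM_def by measurable
 have "(%n. \<integral>z. cmod (f z - fM (real n) z) \<partial>lborel) \<longlonglongrightarrow> (\<integral>z. (0::real) \<partial>(lborel::complex measure))"
 proof (rule integral_dominated_convergence[where w="%z. cmod (f z)"])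
  show "AE z in lborel. (%n. cmod (f z - fM (real n) z)) \<longlonglongrightarrow> 0"
  proof (rule AE_I2)
   fix z
   obtain N :: nat where "cmod (f z) <= real N" using real_arch_simple by blast
   hence "\<forall>\<^sub>F n in sequentially. cmod (f z - fM (real n) z) = 0"
   unfolding eventually_sequentially fM_def by (intro exI[of _ N]) auto
   thus "(%n. cmod (f z - fM (real n) z)) \<longlonglongrightarrow> 0" by (rule tendsto_eventually)
  qed
  show "AE z in lborel. norm (cmod (f z - fM (real n) z)) <= cmod (f z)" for n by (auto simp: fM_def)
 qed (use f in auto)
 hence "\<forall>\<^sub>F n in sequentially. (LINT z|lborel. cmod (f z - fM (real n) z)) < e/2"
  using order_tendstoD(2)[of _ 0 sequentially "e/2"] e by simp
 then obtain n where n: "(LINT z|lborel. cmod (f z - fM (real n) z)) < e/2"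
  by (auto simp: eventually_sequentially)
 \<comment> \<open>Above the truncation height and positive: clipping at \<open>M\<close> is
   continuous and leaves the truncated function unchanged.\<close>
 define M where "M = real n + 1"
 have M: "M > 0" by (simp add: M_def)
 have "fM (real n) measurable_on UNIV"
  by (rule lebesgue_measurable_imp_measurable_on) (auto intro: measurable_completion)
 then obtain N h where N: "negligible N" "\<And>j. continuous_on UNIV (h j)"
  "\<And>x. x ~: N ==> (%j. h j x) \<longlonglongrightarrow> fM (real n) x"
  unfolding measurable_on_def by auto
 define clip where "clip w = of_real (M / max M (cmod w)) * w" for w :: complex
 have clip_c: "continuous_on UNIV clip" unfolding clip_def using M by (intro continuous_intros) auto
 have clip_b: "cmod (clip w) <= M" for w
 proof -
  have "cmod (clip w) = M / max M (cmod w) * cmod w" using M by (simp add: clip_def norm_mult norm_divide)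
  also have "... <= M / max M (cmod w) * max M (cmod w)" using M by (intro mult_left_mono) auto
  also have "... = M" using M by simp
  finally show ?thesis .
 qed
 have clip_id: "clip w = w" if "cmod w <= M" for w using that M by (simp add: clip_def max_def)
 define cut where "cut z = complex_of_real (max 0 (min 1 (R + 1 - cmod z)))" for z
 have cut_c: "continuous_on UNIV cut" unfolding cut_def by (intro continuous_intros)
 have cut_b: "cmod (cut z) <= 1" for z by (simp add: cut_def)
 define g where "g j z = cut z * clip (h j z)" for j z
 have g_c: "continuous_on UNIV (g j)" for j
  unfolding g_def by (intro continuous_intros cut_c continuous_on_compose2[OF clip_c N(2)]) auto
 have g0: "g j z = 0" if "cmod z >= R + 1" for j z using that by (simp add: g_def cut_def)
 have gi: "integrable lborel (g j)" for j
  by (rule integrable_csupp[OF g_c, of "cball 0 (R+1)"]) (use g0 in auto)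
 have fMn: "fM (real n) z = cut z * clip (fM (real n) z)" for z
 proof (cases "cmod z >= R")
  case True thus ?thesis using R by (simp add: fM_def clip_def)
 next
  case False
  hence "cut z = 1" by (simp add: cut_def)
  thus ?thesis using clip_id[of "fM (real n) z"] by (simp add: fM_def M_def)
 qed
 have [measurable]: "g j : bmeas borel" for j using g_c by (rule continuous_bmeas)
 have "(%j. \<integral>z. cmod (fM (real n) z - g j z) \<partial>lborel) \<longlonglongrightarrow> (\<integral>z. (0::real) \<partial>(lborel::complex measure))"
 proof (rule integral_dominated_convergence[where w="%z. indicator (cball 0 (R + 1)) z *\<^sub>R (2 * M)"])
  show "integrable lborel (%z::complex. indicator (cball 0 (R + 1)) z *\<^sub>R (2 * M))"
   by (intro borel_integrable_compact) auto
  have "AE z in lebesgue. z ~: N" using N(1) by (simp add: negligible_iff_null_sets AE_not_in)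
  hence "AE z in lborel. z ~: N" by (simp add: AE_completion_iff)
  thus "AE z in lborel. (%j. cmod (fM (real n) z - g j z)) \<longlonglongrightarrow> 0"
  proof eventually_elim
   case (elim z)
   have "isCont clip w" for w using clip_c by (simp add: continuous_on_eq_continuous_at)
   hence "(%j. g j z) \<longlonglongrightarrow> cut z * clip (fM (real n) z)"
   unfolding g_def by (intro tendsto_mult tendsto_const isCont_tendsto_compose[OF _ N(3)[OF elim]])
   hence "(%j. g j z) \<longlonglongrightarrow> fM (real n) z" using fMn[of z] by simp
   hence "(%j. cmod (fM (real n) z - g j z)) \<longlonglongrightarrow> cmod (fM (real n) z - fM (real n) z)"
   by (intro tendsto_intros)
   thus ?case by simp
  qed
  show "AE z in lborel. norm (cmod (fM (real n) z - g j z)) <= indicator (cball 0 (R + 1)) z *\<^sub>R (2 * M)" for j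
  proof (rule AE_I2)
   fix z
   have b: "cmod (g j z) <= M"
   using mult_mono[OF cut_b[of z] clip_b[of "h j z"]] by (simp add: g_def norm_mult)
   have b2: "cmod (fM (real n) z) <= M" by (simp add: fM_def M_def)
   show "norm (cmod (fM (real n) z - g j z)) <= indicator (cball 0 (R + 1)) z *\<^sub>R (2 * M)"
   proof (cases "cmod z <= R + 1")
   case True
   thus ?thesis using norm_triangle_ineq4[of "fM (real n) z" "g j z"] b b2 by simp
   next
   case False thus ?thesis using R[of z] g0[of z j] by (simp add: fM_def)
   qed
  qed
 qed auto
 hence "\<forall>\<^sub>F j in sequentially. (LINT z|lborel. cmod (fM (real n) z - g j z)) < e/2"
  using order_tendstoD(2)[of _ 0 sequentially "e/2"] e by simp
 then obtain j where j: "(LINT z|lborel. cmod (fM (real n) z - g j z)) < e/2"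
  by (auto simp: eventually_sequentially)
 have fMi: "integrable lborel (fM (real n))"
  by (rule integrable_dom[OF f]) (auto simp: fM_def)
 have "(LINT z|lborel. cmod (f z - g j z)) <= (LINT z|lborel. cmod (f z - fM (real n) z) + cmod (fM (real n) z - g j z))"
  by (rule integral_mono) (use f gi fMi norm_triangle_ineq in \<open>auto intro!: order_trans[OF _ norm_triangle_ineq]\<close>)
 also have "... = (LINT z|lborel. cmod (f z - fM (real n) z)) + (LINT z|lborel. cmod (fM (real n) z - g j z))"
  using f gi fMi by simp
 also have "... < e" using n j by simp
 finally have fin: "(LINT z|lborel. cmod (f z - g j z)) < e" .
 show ?thesis
 proof (rule that[of "g j"])
  show "continuous_on UNIV (g j)" by (rule g_c)
  show "(LINT z|lborel. cmod (f z - g j z)) < e" by (rule fin)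
  fix z assume "R + 1 <= cmod z"
  thus "g j z = 0" by (rule g0)
 qed
qed

text \<open>A continuous approximant \<open>g\<close> converges uniformly on a fixed ball; replacing
  \<open>f\<close> by \<open>g\<close> costs the L1 distance twice, once before and once after
  convolution, which contracts L1.\<close>

lemma conv_L1_converge:
 assumes f: "integrable lborel f" and R': "ALL z. cmod z >= R --> f z = 0" and e: "e > 0"
 shows "\<exists>d>0. ALL k r. weight k r --> r < d --> (LINT z|lborel. cmod (conv f k z - f z)) < e"
proof -
 have R: "f z = 0" if "cmod z >= R" for z using R' that by blast
 have e4: "e/4 > 0" using e by simp
 obtain g where g: "continuous_on UNIV g" "\<And>z. cmod z >= R + 1 ==> g z = 0" "(LINT z|lborel. cmod (f z - g z)) < e/4"
  using L1_approx_continuous[OF f R' e4] by blast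
 have gi: "integrable lborel g" by (rule integrable_csupp[OF g(1), of "cball 0 (R+1)"]) (use g in auto)
 define V where "V = measure lborel (cball (0::complex) (R + 2)) + 1"
 have V: "V > 0" by (simp add: V_def add_pos_nonneg add_nonneg_pos)
 have g2: "ALL z. cmod z >= R + 1 --> g z = 0" using g(2) by blast
 have eV: "e / (4 * V) > 0" using e V by simp
 obtain d where d: "d > 0" "ALL k r z. weight k r --> r < d --> cmod (conv g k z - g z) <= e / (4 * V)"
  using conv_uniform[OF g(1) g2 eV] by blast
 have "(LINT z|lborel. cmod (conv f k z - f z)) < e" if k: "weight k r" "r < min d 1" for k r
 proof -
  have ci: "integrable lborel (conv h k)" if "integrable lborel h" "\<And>z. cmod z >= R + 1 ==> h z = 0" for h
   by (rule integrable_csupp[OF conv_weight_continuous[OF k(1) that(1)], of "cball 0 (R+1+r)"])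
   (use conv_support[OF k(1), of "R+1" h] that in auto)
  have cf: "integrable lborel (conv f k)" and cg: "integrable lborel (conv g k)" using ci f gi R g by auto
  have fg: "integrable lborel (%z. f z - g z)" using f gi by auto
  have "(LINT z|lborel. cmod (conv f k z - f z)) <=
   (LINT z|lborel. cmod (conv (%z. f z - g z) k z) + cmod (conv g k z - g z) + cmod (f z - g z))"
  proof (rule integral_mono)
   fix z
   have eqz: "conv f k z - f z = conv (%z. f z - g z) k z + (conv g k z - g z) - (f z - g z)"
   by (simp add: conv_weight_diff[OF k(1) f gi])
   show "cmod (conv f k z - f z) <= cmod (conv (%z. f z - g z) k z) + cmod (conv g k z - g z) + cmod (f z - g z)"
   unfolding eqz
   using norm_triangle_ineq4[of "conv (%z. f z - g z) k z + (conv g k z - g z)" "f z - g z"]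
   norm_triangle_ineq[of "conv (%z. f z - g z) k z" "conv g k z - g z"] by linarith
  qed (use f gi cf cg ci[OF fg] R g in auto)
  also have "... = (LINT z|lborel. cmod (conv (%z. f z - g z) k z)) + (LINT z|lborel. cmod (conv g k z - g z)) + (LINT z|lborel. cmod (f z - g z))"
   using f gi cf cg ci[OF fg] R g by simp
  also have "... < e/4 + e/4 + e/4"
  proof -
   have "ennreal (LINT z|lborel. cmod (conv (%z. f z - g z) k z)) <= ennreal (LINT z|lborel. cmod (f z - g z))"
   using conv_L1[OF k(1) fg] ci[OF fg] R g(2) fg by (simp add: nn_integral_eq_integral)
   hence 1: "(LINT z|lborel. cmod (conv (%z. f z - g z) k z)) <= (LINT z|lborel. cmod (f z - g z))"
   by (simp add: ennreal_le_iff)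
   have "(LINT z|lborel. cmod (conv g k z - g z)) <= (LINT z|lborel. indicator (cball (0::complex) (R+2)) z *\<^sub>R (e / (4*V)))"
   proof (rule integral_mono)
   show "integrable lborel (%z::complex. indicator (cball 0 (R + 2)) z *\<^sub>R (e / (4*V)))"
   by (intro borel_integrable_compact) auto
   fix z
   show "cmod (conv g k z - g z) <= indicator (cball 0 (R+2)) z *\<^sub>R (e / (4*V))"
   proof (cases "cmod z <= R + 2")
   case True thus ?thesis using d(2) k by simp
   next
   case False
   hence "conv g k z = 0" "g z = 0" using conv_support[OF k(1), of "R+1" g z] k g(2) by auto
   thus ?thesis using False by simp
   qed
   qed (use cg gi in auto)
   also have "... = measure lborel (cball (0::complex) (R+2)) * (e / (4*V))" by simp
   also have "... <= V * (e / (4*V))" using e V by (intro mult_right_mono) (auto simp: V_def)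
   also have "... = e/4" using V by simp
   finally show ?thesis using 1 g(3) by linarith
  qed
  finally show ?thesis using e by simp
 qed
 thus ?thesis using d(1) by (intro exI[of _ "min d 1"]) auto
qed

section \<open>Weak derivatives\<close>

text \<open>Borel representatives on the whole plane are required because convolution and Fubini
  work with \<open>lborel\<close>, while the weak derivatives of a quasiconformal map are given for
  the completed measure on a subset.\<close>

definition sobolev :: "cfun => cfun => cfun => real => bool" where
 "sobolev F P Q R \<longleftrightarrow> continuous_on UNIV F & P : bmeas borel & Q : bmeas borel \<and>
  integrable lborel (%z. (cmod (P z))^2) & integrable lborel (%z. (cmod (Q z))^2) \<and>
  (ALL z. cmod z >= R --> F z = 0 & P z = 0 & Q z = 0) \<and>
  (ALL \<tau> a b. C1_on UNIV \<tau> a b & (EX K. compact K & (ALL z. z ~: K --> \<tau> z = 0)) -->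
   (LINT z|lborel. F z * a z) = - (LINT z|lborel. P z * \<tau> z) \<and>
   (LINT z|lborel. F z * b z) = - (LINT z|lborel. Q z * \<tau> z))"

lemma L2_compact_imp_L1:
 fixes f :: cfun
 assumes [measurable]: "f : bmeas borel" and 2: "integrable lborel (%z. (cmod (f z))^2)" "ALL z. cmod z >= R --> f z = 0"
 shows "integrable lborel f"
proof (rule integrable_dom)
 show "integrable lborel (%z::complex. indicator (cball 0 R) z *\<^sub>R (1::real) + (cmod (f z))^2)"
  by (intro Bochner_Integration.integrable_add borel_integrable_compact 2) auto
 show "AE z in lborel. norm (f z) <= norm (indicator (cball 0 R) z *\<^sub>R (1::real) + (cmod (f z))^2)"
 proof (rule AE_I2)
  fix z
  have "2 * cmod (f z) <= 1 + (cmod (f z))^2"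
   using zero_le_power2[of "cmod (f z) - 1"] by (simp add: power2_diff)
  hence "cmod (f z) <= 1 + (cmod (f z))^2" using norm_ge_zero[of "f z"] by linarith
  thus "norm (f z) <= norm (indicator (cball 0 R) z *\<^sub>R (1::real) + (cmod (f z))^2)"
   using 2(2) by (cases "cmod z >= R") (auto simp: not_le less_imp_le)
 qed
qed measurable

lemma sobolev_integrable:
 assumes "sobolev F P Q R"
 shows "integrable lborel F" "integrable lborel P" "integrable lborel Q"
proof -
 show "integrable lborel F"
  by (rule integrable_csupp[of F "cball 0 R"]) (use assms in \<open>auto simp: sobolev_def\<close>)
 show "integrable lborel P" "integrable lborel Q"
  by (rule L2_compact_imp_L1[of _ R]; use assms in \<open>simp add: sobolev_def\<close>)+
qed

text \<open>The reflected translate of \<open>k\<close> is an admissible test function, and the weak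
  equation moves the derivative from the kernel to \<open>F\<close>: mollified functions have the
  mollified weak derivatives.\<close>

lemma sobolev_conv:
 assumes S: "sobolev F P Q R" and k: "mollifier r k a b aa c bb"
 shows "conv F a = conv P k" "conv F b = conv Q k"
proof -
 have *: "conv F a z = conv P k z & conv F b z = conv Q k z" for z
 proof -
  have C: "C1_on UNIV (%\<zeta>. k (z - \<zeta>)) (%\<zeta>. - a (z - \<zeta>)) (%\<zeta>. - b (z - \<zeta>))"
   unfolding C1_on_def
  proof (intro conjI ballI)
   fix \<zeta>
   have "((%\<zeta>. z - \<zeta>) has_field_derivative -1) (at \<zeta>)" by (auto intro!: derivative_eq_intros)
   moreover have "wirt k (a (z - \<zeta>)) (b (z - \<zeta>)) (z - \<zeta>)" using k by (simp add: mollifier_def C1_on_def)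
   ultimately show "wirt (%\<zeta>. k (z - \<zeta>)) (- a (z - \<zeta>)) (- b (z - \<zeta>)) \<zeta>"
   by (auto dest: wirt_compose_inner)
  next
   have "continuous_on UNIV a" "continuous_on UNIV b" using k by (auto simp: mollifier_def C1_on_def)
   thus "continuous_on UNIV (%\<zeta>. - a (z - \<zeta>))" "continuous_on UNIV (%\<zeta>. - b (z - \<zeta>))"
   by (auto intro!: continuous_intros elim: continuous_on_compose2)
  qed
  have "EX K. compact K & (ALL \<zeta>. \<zeta> ~: K --> k (z - \<zeta>) = 0)"
   by (rule exI[of _ "cball z r"]) (use k in \<open>auto simp: mollifier_def dist_norm\<close>)
  with C have "(\<integral>\<zeta>. F \<zeta> * (- a (z - \<zeta>)) \<partial>lborel) = - (\<integral>\<zeta>. P \<zeta> * k (z - \<zeta>) \<partial>lborel) \<and>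
   (\<integral>\<zeta>. F \<zeta> * (- b (z - \<zeta>)) \<partial>lborel) = - (\<integral>\<zeta>. Q \<zeta> * k (z - \<zeta>) \<partial>lborel)"
   using S unfolding sobolev_def by blast
  thus ?thesis by (simp add: conv_def)
 qed
 show "conv F a = conv P k" "conv F b = conv Q k" using * by (simp_all add: fun_eq_iff)
qed

text \<open>A list of what later limits consume: uniform convergence of the functions, L1
  convergence of the derivatives, the energy of the d derivatives bounded by that of
  \<open>Q\<close> (which already combines the Dirichlet identity with L2 contraction), and local
  vanishing of the dbar derivatives for Weyl's lemma.\<close>

definition approx_seq :: "cfun => cfun => cfun => real =>
  (nat => complex => complex) => (nat => complex => complex) => (nat => complex => complex) => bool" where
 "approx_seq F P Q R Fn An Bn \<longleftrightarrow>
  (ALL n. C1_on UNIV (Fn n) (An n) (Bn n)) \<and>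
  (ALL n z. cmod z >= R + 1 --> Fn n z = 0) \<and>
  (\<forall>e>0. \<forall>\<^sub>F n in sequentially. ALL z. cmod (Fn n z - F z) <= e) \<and>
  (%n. \<integral>z. cmod (An n z - P z) \<partial>lborel) \<longlonglongrightarrow> 0 \<and>
  (%n. \<integral>z. cmod (Bn n z - Q z) \<partial>lborel) \<longlonglongrightarrow> 0 \<and>
  (ALL n. (energy (An n)) <= (energy Q)) \<and>
  (ALL p s. s > 0 --> (AE z in lborel. z : ball p s --> Q z = 0) -->
   (\<forall>\<^sub>F n in sequentially. \<forall>z\<in>ball p (s/2). Bn n z = 0))"

lemma sobolev_approx:
 assumes S: "sobolev F P Q R"
 shows "EX Fn An Bn. approx_seq F P Q R Fn An Bn"
proof -
 have "EX k a b aa c bb. mollifier (inverse (real (Suc n))) k a b aa c bb" for n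
  using mollifier_exists[of "inverse (real (Suc n))"] by (metis inverse_positive_iff_positive of_nat_0_less_iff zero_less_Suc)
 then obtain k a b aa c bb where M: "\<And>n. mollifier (inverse (real (Suc n))) (k n) (a n) (b n) (aa n) (c n) (bb n)"
  by metis
 note W = mollifier_weight[OF M]
 have r0: "\<forall>\<^sub>F n in sequentially. inverse (real (Suc n)) < d" if "d > 0" for d
  using order_tendstoD(2)[OF LIMSEQ_inverse_real_of_nat that] .
 have r1: "inverse (real (Suc n)) <= 1" for n by (simp add: inverse_le_1_iff)
 note int = sobolev_integrable[OF S]
 have SF: "continuous_on UNIV F" "ALL z. cmod z >= R --> F z = 0" "ALL z. cmod z >= R --> P z = 0" "ALL z. cmod z >= R --> Q z = 0"
  "integrable lborel (%z. (cmod (Q z))^2)"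
  using S by (auto simp: sobolev_def)
 define Fn where "Fn n = conv F (k n)" for n
 define An where "An n = conv P (k n)" for n
 define Bn where "Bn n = conv Q (k n)" for n
 have supp: "k n z = 0" if "z ~: cball 0 1" for n z using W[of n] r1[of n] that by (simp add: weight_def)
 have supp': "a n z = 0" "b n z = 0" if "z ~: cball 0 1" for n z
 proof -
  have "C1_on UNIV (k n) (a n) (b n)" using M[of n] by (simp add: mollifier_def)
  from C1_on_zero_deriv[OF this closed_cball[of 0 1] _ that] supp show "a n z = 0" "b n z = 0" by auto
 qed
 have C1: "C1_on UNIV (Fn n) (An n) (Bn n)" for n
 proof -
  have "C1_on UNIV (k n) (a n) (b n)" using M[of n] by (simp add: mollifier_def)
  from conv_C1[OF int(1) this compact_cball[of 0 1] supp]
  show ?thesis using sobolev_conv[OF S M[of n]] by (simp add: Fn_def An_def Bn_def)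
 qed
 have C2: "C1_on UNIV (An n) (conv F (aa n)) (conv F (c n))" "C1_on UNIV (Bn n) (conv F (c n)) (conv F (bb n))" for n
 proof -
  have "C1_on UNIV (a n) (aa n) (c n)" "C1_on UNIV (b n) (c n) (bb n)" using M[of n] by (auto simp: mollifier_def)
  from conv_C1[OF int(1) this(1) compact_cball[of 0 1] supp'(1)] conv_C1[OF int(1) this(2) compact_cball[of 0 1] supp'(2)]
  show "C1_on UNIV (An n) (conv F (aa n)) (conv F (c n))" "C1_on UNIV (Bn n) (conv F (c n)) (conv F (bb n))"
   using sobolev_conv[OF S M[of n]] by (simp_all add: An_def Bn_def)
 qed
 have F0: "Fn n z = 0" if "cmod z >= R + 1" for n z
  unfolding Fn_def by (rule conv_support[OF W[of n], of R]) (use SF r1[of n] that in auto)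
 have AB0: "An n z = 0" "Bn n z = 0" if "z ~: cball 0 (R + 1)" for n z
  using C1_on_zero_deriv[OF C1[of n] closed_cball _ that] F0 by auto
 have cAB: "continuous_on UNIV (An n)" "continuous_on UNIV (Bn n)" for n using C1[of n] by (auto simp: C1_on_def)
 have iAB: "integrable lborel (%z. (cmod (An n z))^2)" "integrable lborel (%z. (cmod (Bn n z))^2)" for n
  by (rule integrable_csupp[of _ "cball 0 (R+1)"]; use AB0 in \<open>auto intro!: continuous_intros cAB\<close>)+
 show ?thesis
 proof (rule exI[of _ Fn], rule exI[of _ An], rule exI[of _ Bn], unfold approx_seq_def, intro conjI)
  show "ALL n. C1_on UNIV (Fn n) (An n) (Bn n)" using C1 by blast
  show "ALL n z. cmod z >= R + 1 --> Fn n z = 0" using F0 by blast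
  show "\<forall>e>0. \<forall>\<^sub>F n in sequentially. ALL z. cmod (Fn n z - F z) <= e"
  proof (intro allI impI)
   fix e :: real assume "e > 0"
   obtain d where d: "d > 0" "ALL k r z. weight k r --> r < d --> cmod (conv F k z - F z) <= e"
   using conv_uniform[OF SF(1,2) \<open>e > 0\<close>] by blast
   show "\<forall>\<^sub>F n in sequentially. ALL z. cmod (Fn n z - F z) <= e"
   using r0[OF d(1)] by eventually_elim (unfold Fn_def, use d(2) W in blast)
  qed
  have conv0: "(%n. \<integral>z. cmod (conv h (k n) z - h z) \<partial>lborel) \<longlonglongrightarrow> 0"
   if h: "integrable lborel h" "ALL z. cmod z >= R --> h z = 0" for h
   unfolding tendsto_iff
  proof (intro allI impI)
   fix e :: real assume "e > 0"
   obtain d where d: "d > 0" "ALL k r. weight k r --> r < d --> (LINT z|lborel. cmod (conv h k z - h z)) < e"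
   using conv_L1_converge[OF h \<open>e > 0\<close>] by blast
   show "\<forall>\<^sub>F n in sequentially. dist (LINT z|lborel. cmod (conv h (k n) z - h z)) 0 < e"
   using r0[OF d(1)] by eventually_elim (use d(2)[rule_format, OF W] in simp)
  qed
  show "(%n. \<integral>z. cmod (An n z - P z) \<partial>lborel) \<longlonglongrightarrow> 0" "(%n. \<integral>z. cmod (Bn n z - Q z) \<partial>lborel) \<longlonglongrightarrow> 0"
   unfolding An_def Bn_def using conv0[OF int(2) SF(3)] conv0[OF int(3) SF(4)] by auto
  show "ALL n. (energy (An n)) <= (energy Q)"
  proof
   fix n
   have "(energy (An n)) = ennreal (LINT z|lborel. (cmod (An n z))^2)"
   by (rule nn_integral_eq_integral[OF iAB(1)]) simp
   \<comment> \<open>Here the second derivatives of the mollified functions enter; for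
     \<open>F\<close> itself the identity makes no sense.\<close>
   also have "(LINT z|lborel. (cmod (An n z))^2) = (LINT z|lborel. (cmod (Bn n z))^2)"
   by (rule dirichlet_identity[OF C1 C2 compact_cball[of 0 "R+1"]]) (use F0 in auto)
   also have "ennreal ... = (energy (Bn n))"
   by (rule nn_integral_eq_integral[OF iAB(2), symmetric]) simp
   also have "... <= (energy Q)"
   unfolding Bn_def by (rule conv_L2[OF W int(3) SF(5)])
   finally show "(energy (An n)) <= (energy Q)" .
  qed
  show "ALL p s. s > 0 --> (AE z in lborel. z : ball p s --> Q z = 0) -->
   (\<forall>\<^sub>F n in sequentially. \<forall>z\<in>ball p (s/2). Bn n z = 0)"
  proof (intro allI impI)
   fix p and s :: real assume s: "s > 0" and Q0: "AE z in lborel. z : ball p s --> Q z = 0"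
   have "s/2 > 0" using s by simp
   from r0[OF this] show "\<forall>\<^sub>F n in sequentially. \<forall>z\<in>ball p (s/2). Bn n z = 0"
   proof eventually_elim
   case (elim n)
   have "AE z in lborel. z : ball p (s/2 + inverse (real (Suc n))) --> Q z = 0"
   using Q0 by eventually_elim (use elim in auto)
   thus ?case unfolding Bn_def using conv_local_zero[OF W] by blast
   qed
  qed
 qed
qed

text \<open>L1 convergence yields a subsequence converging almost everywhere, and Fatou's lemma
  carries the energy bound of the approximants over to \<open>P\<close>.\<close>

lemma sobolev_energy:
 assumes S: "sobolev F P Q R"
 shows "(energy P) <= (energy Q)"
proof -
 obtain Fn An Bn where "approx_seq F P Q R Fn An Bn" using sobolev_approx[OF S] by blast
 hence
  1: "ALL n. C1_on UNIV (Fn n) (An n) (Bn n)" "ALL n z. cmod z >= R + 1 --> Fn n z = 0"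
  and 2: "(%n. \<integral>z. cmod (An n z - P z) \<partial>lborel) \<longlonglongrightarrow> 0"
  and 3: "ALL n. (energy (An n)) <= (energy Q)"
  unfolding approx_seq_def by blast+
 have cA: "continuous_on UNIV (An n)" for n using 1 by (simp add: C1_on_def)
 have A0: "An n z = 0" if "z ~: cball 0 (R + 1)" for n z
  using C1_on_zero_deriv(1)[OF spec[OF 1(1)] closed_cball _ that, of n] 1(2) by auto
 have [measurable]: "An n : bmeas borel" for n using cA by (rule continuous_bmeas)
 have [measurable]: "P : bmeas borel" using S by (simp add: sobolev_def)
 have "integrable lborel (%z. An n z - P z)" for n
  using integrable_csupp[OF cA compact_cball[of 0 "R+1"]] A0 sobolev_integrable[OF S] by auto
 from tendsto_L1_AE_subseq[OF this 2] obtain r where r: "strict_mono r"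
  "AE z in lborel. (%n. An (r n) z - P z) \<longlonglongrightarrow> 0" by blast
 have "(energy P) = (\<integral>\<^sup>+z. liminf (%n. ennreal ((cmod (An (r n) z))^2)) \<partial>lborel)"
 proof (rule nn_integral_cong_AE)
  show "AE z in lborel. ennreal ((cmod (P z))^2) = liminf (%n. ennreal ((cmod (An (r n) z))^2))"
   using r(2)
  proof eventually_elim
   case (elim z)
   hence "(%n. An (r n) z) \<longlonglongrightarrow> P z" by (rule LIM_zero_cancel)
   hence "(%n. ennreal ((cmod (An (r n) z))^2)) \<longlonglongrightarrow> ennreal ((cmod (P z))^2)"
   by (intro tendsto_ennrealI tendsto_intros)
   from lim_imp_Liminf[OF _ this] show ?case by simp
  qed
 qed
 also have "... <= liminf (%n. energy (%z. An (r n) z))"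
  by (rule nn_integral_liminf) measurable
 also have "... <= (energy Q)"
  by (rule Liminf_le) (use 3 in auto)
 finally show ?thesis .
qed

subsection \<open>Localisation\<close>

definition weak_on :: "complex set => cfun => cfun => cfun => bool" where
 "weak_on Om f p q \<longleftrightarrow> open Om & continuous_on Om f & locally_L2 Om p & locally_L2 Om q \<and>
  weak_d_z Om f p & weak_d_zbar Om f q"

lemma continuous_on_extend_zero:
 fixes g f :: cfun
 assumes "open U" "continuous_on U f" "continuous_on UNIV g" "compact K" "K \<subseteq> U" "ALL z. z ~: K --> g z = 0"
 shows "continuous_on UNIV (%z. if z : U then g z * f z else 0)"
proof -
 have "continuous_on U (%z. g z * f z)"
  by (intro continuous_intros assms continuous_on_subset[OF assms(3)]) auto
 hence 1: "continuous_on U (%z. if z : U then g z * f z else 0)"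
  by (subst continuous_on_cong[OF refl, of _ _ "%z. g z * f z"]) auto
 have 2: "continuous_on (-K) (%z. if z : U then g z * f z else 0)"
  by (subst continuous_on_cong[OF refl, of _ _ "%_. 0"]) (use assms in auto)
 have "continuous_on (U \<union> - K) (%z. if z : U then g z * f z else 0)"
  using 1 2 assms(1,4) by (intro continuous_on_open_Un) (auto simp: compact_imp_closed open_Compl)
 moreover have "U \<union> - K = UNIV" using assms by auto
 ultimately show ?thesis by simp
qed

lemma completion_ex_borel_measurable_complex:
 fixes g :: "'a => complex"
 assumes g: "g : bmeas (completion M)"
 shows "\<exists>g'\<in>bmeas M. AE x in M. g x = g' x"
proof -
 have "(%x. Re (g x)) : bmeas (completion M)" "(%x. Im (g x)) : bmeas (completion M)"
  using g by measurable
 then obtain u v where uv: "u : bmeas M" "AE x in M. Re (g x) = u x" "v : bmeas M" "AE x in M. Im (g x) = v x"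
  using completion_ex_borel_measurable_real by metis
 show ?thesis
 proof
  show "(%x. Complex (u x) (v x)) : bmeas M"
   using uv by (simp add: borel_measurable_complex_iff)
  show "AE x in M. g x = Complex (u x) (v x)"
   using uv(2,4) by eventually_elim (simp add: complex_eq_iff)
 qed
qed

text \<open>The bridge from the completed measure on \<open>Om\<close> to Borel functions on the
  plane. Multiplication by a compactly supported \<open>g\<close> makes the representative globally
  square integrable.\<close>

lemma locally_L2_borel_rep:
 assumes p: "locally_L2 Om p" and K: "compact K" "K \<subseteq> Om" and g: "continuous_on UNIV g" "ALL z. z ~: K --> g z = 0"
 obtains P where "P : bmeas borel" "AE z in lborel. P z = (if z : Om then g z * p z else 0)"
  "ALL z. z ~: K --> P z = 0" "integrable lborel (%z. (cmod (P z))^2)"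
proof -
 have Ks: "K : sets lebesgue" using K by (simp add: borel_compact)
 define p0 where "p0 z = (if z : K then p z else 0)" for z
 have "p : bmeas (leb K)"
  using p K by (auto simp: locally_L2_def intro: measurable_restrict_mono)
 hence p0m: "p0 : bmeas (completion lborel)"
  unfolding p0_def using borel_measurable_if[OF Ks] by blast
 from completion_ex_borel_measurable_complex[OF this] obtain p1 where p1: "p1 : bmeas lborel" "AE z in lborel. p0 z = p1 z"
  by auto
 have p1m[measurable]: "p1 : bmeas borel" using p1(1) by simp
 have gm[measurable]: "g : bmeas borel" using g(1) by (rule continuous_bmeas)
 obtain B where B: "B >= 0" "\<And>z. cmod (g z) <= B" using bounded_compact_support[OF g(1) K(1)] g(2) by blast
 have "integrable (leb K) (%z. (cmod (p z))^2)" using p K by (auto simp: locally_L2_def)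
 hence "integrable lebesgue (%z. if z : K then (cmod (p z))^2 else 0)"
  by (simp only: Lebesgue_Measure.integrable_restrict_UNIV[OF Ks])
 also have "(%z. if z : K then (cmod (p z))^2 else 0) = (%z. (cmod (p0 z))^2)" by (auto simp: p0_def)
 finally have "integrable lebesgue (%z. (cmod (p0 z))^2)" .
 hence "integrable lebesgue (%z. (cmod (p1 z))^2)"
 proof (rule integrable_cong_AE_imp)
  show "(%z. (cmod (p1 z))^2) : bmeas lebesgue" by (rule measurable_completion) measurable
  have "AE z in lebesgue. p0 z = p1 z" using p1(2) by (simp add: AE_completion_iff)
  thus "AE z in lebesgue. (cmod (p0 z))^2 = (cmod (p1 z))^2" by eventually_elim simp
 qed
 hence i1: "integrable lborel (%z. (cmod (p1 z))^2)" by (subst (asm) integrable_completion) auto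
 show ?thesis
 proof (rule that[of "%z. g z * p1 z"])
  show "AE z in lborel. g z * p1 z = (if z : Om then g z * p z else 0)"
   using p1(2)
  proof eventually_elim
   case (elim z)
   thus ?case using g(2) K(2) by (cases "z : K") (auto simp: p0_def)
  qed
  show "ALL z. z ~: K --> g z * p1 z = 0" using g by simp
  show "integrable lborel (%z. (cmod (g z * p1 z))^2)"
  proof (rule integrable_dom[OF integrable_mult_right[OF i1, of "B^2"]])
   show "AE z in lborel. norm ((cmod (g z * p1 z))^2) <= norm (B^2 * (cmod (p1 z))^2)"
   using B by (auto simp: norm_mult power_mult_distrib abs_mult intro!: mult_right_mono power_mono)
  qed measurable
 qed measurable
qed

lemma lebesgue_on_integral_borel:
 fixes h H :: cfun
 assumes Om: "Om : sets lebesgue" and h: "h : bmeas (leb Om)" and H: "H : bmeas borel"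
  and eq: "AE z in lborel. H z = (if z : Om then h z else 0)"
 shows "integral\<^sup>L (leb Om) h = integral\<^sup>L lborel H"
proof -
 have "integral\<^sup>L (leb Om) h = (\<integral>z. indicator Om z *\<^sub>R h z \<partial>lebesgue)"
  by (rule integral_restrict_space) (use Om in simp)
 also have "... = (\<integral>z. (if z : Om then h z else 0) \<partial>lebesgue)"
  by (rule Bochner_Integration.integral_cong) (auto simp: indicator_def)
 also have "... = (\<integral>z. H z \<partial>lebesgue)"
 proof (rule integral_cong_AE)
  show "(%z. if z : Om then h z else 0) : bmeas lebesgue"
   using h borel_measurable_if[OF Om] by blast
  show "H : bmeas lebesgue" by (rule measurable_completion) (use H in simp)
  have "AE z in lebesgue. H z = (if z : Om then h z else 0)" using eq by (simp add: AE_completion_iff)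
  thus "AE z in lebesgue. (if z : Om then h z else 0) = H z" by eventually_elim simp
 qed
 also have "... = integral\<^sup>L lborel H" by (rule integral_completion) (use H in simp)
 finally show ?thesis .
qed

text \<open>The product rule, obtained by testing the weak equation with
  \<open>\<eta> z * \<tau> z\<close>. The result is a compactly supported function on the plane, to
  which mollification applies.\<close>

lemma weak_on_localize:
 assumes W: "weak_on Om f p q" and \<eta>: "C1_on UNIV \<eta> \<eta>a \<eta>b" and K: "compact K" "K \<subseteq> Om" "ALL z. z ~: K --> \<eta> z = 0"
 obtains P Q R where "sobolev (%z. if z : Om then \<eta> z * f z else 0) P Q R"
  "AE z in lborel. P z = (if z : Om then \<eta> z * p z + \<eta>a z * f z else 0)"
  "AE z in lborel. Q z = (if z : Om then \<eta> z * q z + \<eta>b z * f z else 0)"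
proof -
 have Om: "open Om" "Om : sets lebesgue" and f: "continuous_on Om f" and p: "locally_L2 Om p" and q: "locally_L2 Om q"
  and wd: "weak_d_z Om f p" "weak_d_zbar Om f q"
  using W by (auto simp: weak_on_def)
 have cl: "closed K" using K compact_imp_closed by blast
 have \<eta>0: "\<eta>a z = 0" "\<eta>b z = 0" if "z ~: K" for z
  using C1_on_zero_deriv[OF \<eta> cl _ that] K by auto
 have c\<eta>: "continuous_on UNIV \<eta>" "continuous_on UNIV \<eta>a" "continuous_on UNIV \<eta>b"
  using \<eta> C1_on_imp_continuous[OF \<eta>] by (auto simp: C1_on_def)
 obtain R where R: "K \<subseteq> ball 0 R" using K compact_imp_bounded bounded_subset_ballD by blast
 \<comment> \<open>Both derivatives obey the same rule, so one argument serves for \<open>p\<close>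
   with \<open>\<eta>a\<close> and for \<open>q\<close> with \<open>\<eta>b\<close>; the weak
   equation for the product test function is kept as a premise.\<close>
 have side: "EX P. P : bmeas borel & integrable lborel (%z. (cmod (P z))^2) & (ALL z. cmod z >= R --> P z = 0) \<and>
  (AE z in lborel. P z = (if z : Om then \<eta> z * p z + \<eta>' z * f z else 0)) \<and>
  (ALL \<tau> \<tau>' L. continuous_on UNIV \<tau> & continuous_on UNIV \<tau>' & compact L & (ALL z. z ~: L --> \<tau> z = 0) \<and>
   (LINT z|leb Om. f z * (\<eta>' z * \<tau> z + \<eta> z * \<tau>' z)) = - (LINT z|leb Om. p z * (\<eta> z * \<tau> z)) -->
   (LINT z|lborel. (if z : Om then \<eta> z * f z else 0) * \<tau>' z) = - (LINT z|lborel. P z * \<tau> z))"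
  if p: "locally_L2 Om p" and c: "continuous_on UNIV \<eta>'" "ALL z. z ~: K --> \<eta>' z = 0" for p \<eta>'
 proof -
  obtain P1 where P1: "P1 : bmeas borel" "AE z in lborel. P1 z = (if z : Om then \<eta> z * p z else 0)"
   "ALL z. z ~: K --> P1 z = 0" "integrable lborel (%z. (cmod (P1 z))^2)"
   using locally_L2_borel_rep[OF p K(1,2) c\<eta>(1) K(3)] by blast
  define G where "G z = (if z : Om then \<eta>' z * f z else 0)" for z
  define F where "F z = (if z : Om then \<eta> z * f z else 0)" for z
  have cG: "continuous_on UNIV G" and cF: "continuous_on UNIV F" unfolding G_def F_def
   using continuous_on_extend_zero[OF Om(1) f c(1) K(1,2) c(2)] continuous_on_extend_zero[OF Om(1) f c\<eta>(1) K] by auto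
  have G0: "G z = 0" and F0: "F z = 0" if "z ~: K" for z using that c K by (auto simp: G_def F_def)
  note [measurable] = P1(1) continuous_bmeas[OF cG] continuous_bmeas[OF cF]
  have iG: "integrable lborel (%z. (cmod (G z))^2)"
   by (rule integrable_csupp[OF _ K(1)]) (use G0 in \<open>auto intro!: continuous_intros cG\<close>)
  have P1i: "integrable lborel P1"
   by (rule L2_compact_imp_L1[OF P1(1,4), of R]) (use P1(3) R in \<open>auto simp: subset_iff\<close>)
  show ?thesis
  proof (intro exI[of _ "%z. P1 z + G z"] conjI allI impI)
   show "integrable lborel (%z. (cmod (P1 z + G z))^2)"
   proof (rule integrable_dom)
   show "integrable lborel (%z. 2 * (cmod (P1 z))^2 + 2 * (cmod (G z))^2)" using P1(4) iG by simp
   show "AE z in lborel. norm ((cmod (P1 z + G z))^2) <= norm (2 * (cmod (P1 z))^2 + 2 * (cmod (G z))^2)"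
   proof (rule AE_I2)
   fix z
   have "(cmod (P1 z + G z))^2 <= (cmod (P1 z) + cmod (G z))^2" by (intro power_mono norm_triangle_ineq) auto
   also have "... <= 2 * (cmod (P1 z))^2 + 2 * (cmod (G z))^2"
   using zero_le_power2[of "cmod (P1 z) - cmod (G z)"] by (simp add: power2_sum power2_diff)
   finally show "norm ((cmod (P1 z + G z))^2) <= norm (2 * (cmod (P1 z))^2 + 2 * (cmod (G z))^2)" by simp
   qed
   qed measurable
   show "P1 z + G z = 0" if "cmod z >= R" for z
   proof -
   have "z ~: K" using R that by auto
   thus ?thesis using P1(3) G0 by simp
   qed
   show "AE z in lborel. P1 z + G z = (if z : Om then \<eta> z * p z + \<eta>' z * f z else 0)"
   using P1(2) by eventually_elim (simp add: G_def)
   fix \<tau> \<tau>' L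
   assume "continuous_on UNIV \<tau> & continuous_on UNIV \<tau>' & compact L & (ALL z. z ~: L --> \<tau> z = 0) \<and>
   (LINT z|leb Om. f z * (\<eta>' z * \<tau> z + \<eta> z * \<tau>' z)) = - (LINT z|leb Om. p z * (\<eta> z * \<tau> z))"
   hence t: "continuous_on UNIV \<tau>" "continuous_on UNIV \<tau>'" "compact L" "ALL z. z ~: L --> \<tau> z = 0"
   and eq: "(LINT z|leb Om. f z * (\<eta>' z * \<tau> z + \<eta> z * \<tau>' z)) = - (LINT z|leb Om. p z * (\<eta> z * \<tau> z))" by auto
   note [measurable] = continuous_bmeas[OF t(1)] continuous_bmeas[OF t(2)]
   have on: "h : bmeas (leb Om)" if "continuous_on Om h" for h :: cfun
   by (rule continuous_measurable_leb[OF that Om(2)])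
   have sub: "continuous_on Om h" if "continuous_on UNIV h" for h :: cfun
   using continuous_on_subset[OF that] by auto
   have e1: "(LINT z|leb Om. f z * (\<eta>' z * \<tau> z + \<eta> z * \<tau>' z)) = (LINT z|lborel. G z * \<tau> z + F z * \<tau>' z)"
   proof (rule lebesgue_on_integral_borel[OF Om(2)])
   show "(%z. f z * (\<eta>' z * \<tau> z + \<eta> z * \<tau>' z)) : bmeas (leb Om)"
   by (intro on continuous_intros f sub c c\<eta> t)
   show "AE z in lborel. G z * \<tau> z + F z * \<tau>' z = (if z : Om then f z * (\<eta>' z * \<tau> z + \<eta> z * \<tau>' z) else 0)"
   by (rule AE_I2) (simp add: G_def F_def algebra_simps)
   qed measurable
   have e2: "(LINT z|leb Om. p z * (\<eta> z * \<tau> z)) = (LINT z|lborel. P1 z * \<tau> z)"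
   proof (rule lebesgue_on_integral_borel[OF Om(2)])
   have "(%z. \<eta> z * \<tau> z) : bmeas (leb Om)" by (intro on continuous_intros sub c\<eta> t)
   thus "(%z. p z * (\<eta> z * \<tau> z)) : bmeas (leb Om)"
   using p by (auto simp: locally_L2_def)
   show "AE z in lborel. P1 z * \<tau> z = (if z : Om then p z * (\<eta> z * \<tau> z) else 0)"
   using P1(2) by eventually_elim (simp add: algebra_simps)
   qed measurable
   have i1: "integrable lborel (%z. G z * \<tau> z)" "integrable lborel (%z. F z * \<tau>' z)"
   by (rule integrable_csupp[OF _ K(1)]; use G0 F0 in \<open>auto intro!: continuous_intros cG cF t\<close>)+
   have i2: "integrable lborel (%z. P1 z * \<tau> z)"
   proof -
   obtain B where B: "B >= 0" "\<And>z. cmod (\<tau> z) <= B" using bounded_compact_support[OF t(1,3)] t(4) by blast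
   show ?thesis
   by (rule integrable_dom[OF integrable_mult_left[OF integrable_norm[OF P1i], of B]])
   (auto simp: norm_mult abs_mult B intro!: mult_left_mono order_trans[OF B(2)])
   qed
   show "(LINT z|lborel. (if z : Om then \<eta> z * f z else 0) * \<tau>' z) = - (LINT z|lborel. (P1 z + G z) * \<tau> z)"
   using eq i1 i2 unfolding e1 e2 F_def[symmetric] by (simp add: distrib_right eq_neg_iff_add_eq_0 algebra_simps)
  qed measurable
 qed
 obtain P where P: "P : bmeas borel" "integrable lborel (%z. (cmod (P z))^2)" "ALL z. cmod z >= R --> P z = 0"
  "AE z in lborel. P z = (if z : Om then \<eta> z * p z + \<eta>a z * f z else 0)"
  "\<And>\<tau> \<tau>' L. continuous_on UNIV \<tau> & continuous_on UNIV \<tau>' & compact L & (ALL z. z ~: L --> \<tau> z = 0) \<and>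
   (LINT z|leb Om. f z * (\<eta>a z * \<tau> z + \<eta> z * \<tau>' z)) = - (LINT z|leb Om. p z * (\<eta> z * \<tau> z)) ==>
   (LINT z|lborel. (if z : Om then \<eta> z * f z else 0) * \<tau>' z) = - (LINT z|lborel. P z * \<tau> z)"
  using side[OF p c\<eta>(2)] \<eta>0(1) by blast
 obtain Q where Q: "Q : bmeas borel" "integrable lborel (%z. (cmod (Q z))^2)" "ALL z. cmod z >= R --> Q z = 0"
  "AE z in lborel. Q z = (if z : Om then \<eta> z * q z + \<eta>b z * f z else 0)"
  "\<And>\<tau> \<tau>' L. continuous_on UNIV \<tau> & continuous_on UNIV \<tau>' & compact L & (ALL z. z ~: L --> \<tau> z = 0) \<and>
   (LINT z|leb Om. f z * (\<eta>b z * \<tau> z + \<eta> z * \<tau>' z)) = - (LINT z|leb Om. q z * (\<eta> z * \<tau> z)) ==>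
   (LINT z|lborel. (if z : Om then \<eta> z * f z else 0) * \<tau>' z) = - (LINT z|lborel. Q z * \<tau> z)"
  using side[OF q c\<eta>(3)] \<eta>0(2) by blast
 have "sobolev (%z. if z : Om then \<eta> z * f z else 0) P Q R"
  unfolding sobolev_def
 proof (intro conjI)
  show "continuous_on UNIV (%z. if z : Om then \<eta> z * f z else 0)"
   by (rule continuous_on_extend_zero[OF Om(1) f c\<eta>(1) K])
  show "ALL z. R <= cmod z --> (if z : Om then \<eta> z * f z else 0) = 0 & P z = 0 & Q z = 0"
  proof (intro allI impI)
   fix z assume z: "R <= cmod z"
   hence "z ~: K" using R by auto
   thus "(if z : Om then \<eta> z * f z else 0) = 0 & P z = 0 & Q z = 0"
   using P(3) Q(3) K(3) z by simp
  qed
  show "ALL \<tau> a b. C1_on UNIV \<tau> a b & (EX K. compact K & (ALL z. z ~: K --> \<tau> z = 0)) -->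
   (LINT z|lborel. (if z : Om then \<eta> z * f z else 0) * a z) = - (LINT z|lborel. P z * \<tau> z) \<and>
   (LINT z|lborel. (if z : Om then \<eta> z * f z else 0) * b z) = - (LINT z|lborel. Q z * \<tau> z)"
  proof (intro allI impI)
   fix \<tau> a b assume "C1_on UNIV \<tau> a b & (EX K. compact K & (ALL z. z ~: K --> \<tau> z = 0))"
   then obtain L where t: "C1_on UNIV \<tau> a b" "compact L" "ALL z. z ~: L --> \<tau> z = 0" by blast
   have ct: "continuous_on UNIV \<tau>" "continuous_on UNIV a" "continuous_on UNIV b"
   using t(1) C1_on_imp_continuous[OF t(1)] by (auto simp: C1_on_def)
   note pr = C1_on_mult[OF \<eta> t(1)]
   have "z ~: K ==> \<eta> z * \<tau> z = 0" for z using K(3) by simp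
   note T = test_functionsI[OF pr K(1,2) this]
   have "(LINT z|leb Om. f z * (\<eta>a z * \<tau> z + \<eta> z * a z)) = - (LINT z|leb Om. p z * (\<eta> z * \<tau> z))"
   using wd(1) T unfolding weak_d_z_def by fastforce
   moreover have "(LINT z|leb Om. f z * (\<eta>b z * \<tau> z + \<eta> z * b z)) = - (LINT z|leb Om. q z * (\<eta> z * \<tau> z))"
   using wd(2) T unfolding weak_d_zbar_def by fastforce
   ultimately show "(LINT z|lborel. (if z : Om then \<eta> z * f z else 0) * a z) = - (LINT z|lborel. P z * \<tau> z) \<and>
   (LINT z|lborel. (if z : Om then \<eta> z * f z else 0) * b z) = - (LINT z|lborel. Q z * \<tau> z)"
   using P(5)[of \<tau> a L] Q(5)[of \<tau> b L] ct t by blast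
  qed
 qed (use P Q in auto)
 thus ?thesis using that P(4) Q(4) by blast
qed

section \<open>Radial bumps and logarithmic cutoffs\<close>

text \<open>Between the two circles this is the cubic smoothstep 3 x^2 - 2 x^3 in x = u / L. The
  terms in \<open>v\<close> vanish there; inside the smaller circle they cancel the growth of the
  cubic, so one formula without case distinction is C1 and equal to 1 there.\<close>

definition bump :: "complex => real => real => complex => real" where
 "bump p r1 r2 z = (let L = r2^2 - r1^2; u = max 0 (r2^2 - (cmod (z - p))^2); v = max 0 (r1^2 - (cmod (z - p))^2)
  in (3 / L^2) * u^2 - (2 / L^3) * u^3 + (3 / L^2) * v^2 + (2 / L^3) * v^3)"

text \<open>The derivative of the profile with respect to the squared distance, not the radius:
  multiplied by \<open>cnj (z - p)\<close> or \<open>z - p\<close> it gives the Wirtinger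
  derivatives of \<open>bump\<close>.\<close>

definition dbump :: "complex => real => real => complex => real" where
 "dbump p r1 r2 z = (let L = r2^2 - r1^2; u = max 0 (r2^2 - (cmod (z - p))^2); v = max 0 (r1^2 - (cmod (z - p))^2)
  in - ((3 / L^2) * (2 * u) - (2 / L^3) * (3 * u^2) + (3 / L^2) * (2 * v) + (2 / L^3) * (3 * v^2)))"

lemma bump_C1:
 "C1_on UNIV (%z. of_real (bump p r1 r2 z)) (%z. of_real (dbump p r1 r2 z) * cnj (z - p)) (%z. of_real (dbump p r1 r2 z) * (z - p))"
 unfolding C1_on_def
proof (intro conjI ballI)
 define L where "L = r2^2 - r1^2"
 define s where "s t = (3 / L^2) * (max 0 (r2^2 - t))^2 - (2 / L^3) * (max 0 (r2^2 - t))^3 + (3 / L^2) * (max 0 (r1^2 - t))^2 + (2 / L^3) * (max 0 (r1^2 - t))^3" for t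
 fix z
 have d2: "((%t::real. (max 0 (r - t))^2) has_real_derivative (- (2 * max 0 (r - t)))) (at t)"
  and d3: "((%t::real. (max 0 (r - t))^3) has_real_derivative (- (3 * (max 0 (r - t))^2))) (at t)" for r t
  using has_real_derivative_max_power[of 2 r t] has_real_derivative_max_power[of 3 r t] by auto
 have "(s has_real_derivative ((3 / L^2) * (- (2 * max 0 (r2^2 - t))) - (2 / L^3) * (- (3 * (max 0 (r2^2 - t))^2))
   + (3 / L^2) * (- (2 * max 0 (r1^2 - t))) + (2 / L^3) * (- (3 * (max 0 (r1^2 - t))^2)))) (at t)" for t
  unfolding s_def by (intro DERIV_add DERIV_diff DERIV_cmult d2 d3)
 from wirt_radial[OF this[of "(cmod (z - p))^2"]]
 have "wirt (%z. of_real (s ((cmod (z - p))^2))) (of_real (dbump p r1 r2 z) * cnj (z - p)) (of_real (dbump p r1 r2 z) * (z - p)) z"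
  by (rule back_subst[of "%d. wirt _ (of_real d * _) (of_real d * _) z"]) (simp add: dbump_def L_def Let_def algebra_simps)
 thus "wirt (%z. of_real (bump p r1 r2 z)) (of_real (dbump p r1 r2 z) * cnj (z - p)) (of_real (dbump p r1 r2 z) * (z - p)) z"
  by (simp add: s_def bump_def L_def Let_def)
qed (unfold dbump_def Let_def, (intro continuous_intros)+)

lemma bump_outer:
 assumes "0 < r1" "r1 < r2" "r2 <= cmod (z - p)"
 shows "bump p r1 r2 z = 0" "dbump p r1 r2 z = 0"
proof -
 have "r2^2 <= (cmod (z - p))^2" "r1^2 <= (cmod (z - p))^2" using assms by (auto intro!: power_mono)
 thus "bump p r1 r2 z = 0" "dbump p r1 r2 z = 0" by (simp_all add: bump_def dbump_def)
qed

lemma bump_inner: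
 assumes "0 < r1" "r1 < r2" "cmod (z - p) <= r1"
 shows "bump p r1 r2 z = 1" "dbump p r1 r2 z = 0"
proof -
 define L where "L = r2^2 - r1^2"
 have L: "L > 0" unfolding L_def using assms power_strict_mono[of r1 r2 2] by simp
 define v where "v = r1^2 - (cmod (z - p))^2"
 have "(cmod (z - p))^2 <= r1^2" using assms by (auto intro!: power_mono)
 hence v: "v >= 0" by (simp add: v_def)
 have u: "r2^2 - (cmod (z - p))^2 = L + v" by (simp add: L_def v_def)
 \<comment> \<open>In units of \<open>L\<close> the two truncated variables are \<open>1 + w\<close>
   and \<open>w\<close>, so both claims become polynomial identities in \<open>w\<close>.\<close>
 define w where "w = v / L"
 have Lw: "L + v = L * (1 + w)" "v = L * w" using L by (simp_all add: w_def distrib_left)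
 have w: "w >= 0" using v L by (simp add: w_def)
 have m: "max 0 (L * (1 + w)) = L * (1 + w)" "max 0 (L * w) = L * w" using L w by auto
 have e: "r2^2 - (cmod (z - p))^2 = L * (1 + w)" "r1^2 - (cmod (z - p))^2 = L * w"
  using u Lw v_def by auto
 have "bump p r1 r2 z = 3 * (1 + w)^2 - 2 * (1 + w)^3 + 3 * w^2 + 2 * w^3"
  unfolding bump_def Let_def e m L_def[symmetric] using L by (simp add: power_mult_distrib)
 also have "... = 1" by (simp add: power2_eq_square power3_eq_cube algebra_simps)
 finally show "bump p r1 r2 z = 1" .
 have "dbump p r1 r2 z = - ((6 * (1 + w) - 6 * (1 + w)^2 + 6 * w + 6 * w^2) / L)"
  unfolding dbump_def Let_def e m L_def[symmetric] using L by (simp add: field_simps power2_eq_square power3_eq_cube)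
 also have "... = 0" by (simp add: power2_eq_square algebra_simps)
 finally show "dbump p r1 r2 z = 0" .
qed

lemma bump_middle:
 assumes "0 < r1" "r1 < r2" "r1 <= cmod (z - p)" "cmod (z - p) <= r2"
 shows "0 <= bump p r1 r2 z" "bump p r1 r2 z <= 1" "dbump p r1 r2 z <= 0" "\<bar>dbump p r1 r2 z\<bar> <= 3 / (2 * (r2^2 - r1^2))"
  "r1 < cmod (z - p) ==> cmod (z - p) < r2 ==> dbump p r1 r2 z < 0"
proof -
 define L where "L = r2^2 - r1^2"
 have L: "L > 0" unfolding L_def using assms power_strict_mono[of r1 r2 2] by simp
 define u where "u = (r2^2 - (cmod (z - p))^2) / L"
 have "r1^2 <= (cmod (z - p))^2" "(cmod (z - p))^2 <= r2^2" using assms by (auto intro!: power_mono)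
 hence u: "0 <= u" "u <= 1" and e: "max 0 (r2^2 - (cmod (z - p))^2) = L * u" "max 0 (r1^2 - (cmod (z - p))^2) = 0"
  using L by (simp_all add: u_def divide_le_eq, simp_all add: L_def)
 have b: "bump p r1 r2 z = 3 * u^2 - 2 * u^3"
  using L unfolding bump_def Let_def e L_def[symmetric] by (simp add: power_mult_distrib)
 have d: "dbump p r1 r2 z = - (6 * u * (1 - u) / L)"
  using L unfolding dbump_def Let_def e L_def[symmetric] by (simp add: field_simps power2_eq_square power3_eq_cube)
 have "3 * u^2 - 2 * u^3 = u^2 * (3 - 2 * u)" by (simp add: power2_eq_square power3_eq_cube algebra_simps)
 thus "0 <= bump p r1 r2 z" using u b by simp
 have "1 - (3 * u^2 - 2 * u^3) = (1 - u)^2 * (1 + 2 * u)" by (simp add: power2_eq_square power3_eq_cube algebra_simps)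
 moreover have "(1 - u)^2 * (1 + 2 * u) >= 0" using u by simp
 ultimately show "bump p r1 r2 z <= 1" using b by linarith
 show "dbump p r1 r2 z <= 0" using d u L by simp
 have "4 * (u * (1 - u)) <= 1" using zero_le_power2[of "2 * u - 1"] by (simp add: power2_eq_square algebra_simps)
 hence "6 * u * (1 - u) / L <= (3/2) / L" using L by (intro divide_right_mono) auto
 thus "\<bar>dbump p r1 r2 z\<bar> <= 3 / (2 * (r2^2 - r1^2))" using d u L by (simp add: L_def[symmetric])
 assume "r1 < cmod (z - p)" "cmod (z - p) < r2"
 hence "r1^2 < (cmod (z - p))^2" "(cmod (z - p))^2 < r2^2" using assms by (auto intro!: power_strict_mono)
 hence "0 < u" "u < 1" using L by (simp_all add: u_def divide_less_eq, simp_all add: L_def)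
 thus "dbump p r1 r2 z < 0" using d L by simp
qed

lemma bump_range: "0 < r1 ==> r1 < r2 ==> 0 <= bump p r1 r2 z & bump p r1 r2 z <= 1"
 using bump_outer(1)[of r1 r2 z p] bump_inner(1)[of r1 r2 z p] bump_middle(1,2)[of r1 r2 z p] by (cases "cmod (z - p) <= r1"; cases "r2 <= cmod (z - p)") auto

text \<open>The logarithmic cutoff: averaging \<open>N\<close> dyadic bumps, whose gradients have disjoint supports and equal
 Dirichlet energy, makes the energy of order \<open>1/N\<close>.\<close>

definition ladder :: "complex => real => nat => complex => real" where
 "ladder p R N z = (\<Sum>j<N. bump p (R * 2^j) (R * 2^(Suc j)) z) / real N"

definition dladder :: "complex => real => nat => complex => real" where
 "dladder p R N z = (\<Sum>j<N. dbump p (R * 2^j) (R * 2^(Suc j)) z) / real N"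

lemma C1_on_sum:
 assumes "finite I" "\<And>i. i : I ==> C1_on U (f i) (a i) (b i)"
 shows "C1_on U (%z. \<Sum>i\<in>I. f i z) (%z. \<Sum>i\<in>I. a i z) (%z. \<Sum>i\<in>I. b i z)"
 using assms
proof (induction I rule: finite_induct)
 case empty thus ?case using C1_on_const[of U 0] by simp
next
 case (insert i I)
 hence "C1_on U (%z. f i z + (\<Sum>i\<in>I. f i z)) (%z. a i z + (\<Sum>i\<in>I. a i z)) (%z. b i z + (\<Sum>i\<in>I. b i z))"
  by (intro C1_on_add) auto
 thus ?case using insert by simp
qed

lemma ladder_C1:
 "C1_on UNIV (%z. of_real (ladder p R N z)) (%z. of_real (dladder p R N z) * cnj (z - p)) (%z. of_real (dladder p R N z) * (z - p))"
proof -
 have "C1_on UNIV (%z. \<Sum>j<N. complex_of_real (bump p (R * 2^j) (R * 2^(Suc j)) z))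
  (%z. \<Sum>j<N. of_real (dbump p (R * 2^j) (R * 2^(Suc j)) z) * cnj (z - p))
  (%z. \<Sum>j<N. of_real (dbump p (R * 2^j) (R * 2^(Suc j)) z) * (z - p))"
  by (intro C1_on_sum bump_C1) auto
 from C1_on_mult[OF C1_on_const[of UNIV "1 / of_nat N"] this]
 have C: "C1_on UNIV (%z. 1 / of_nat N * (\<Sum>j<N. complex_of_real (bump p (R * 2^j) (R * 2^(Suc j)) z)))
  (%z. of_real (dladder p R N z) * cnj (z - p)) (%z. of_real (dladder p R N z) * (z - p))"
  by (rule C1_on_cong) (simp_all add: dladder_def sum_distrib_right)
 have "(%z. 1 / of_nat N * (\<Sum>j<N. complex_of_real (bump p (R * 2^j) (R * 2^(Suc j)) z))) = (%z. of_real (ladder p R N z))"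
  by (simp add: ladder_def fun_eq_iff)
 with C show ?thesis by simp
qed

lemma ladder_props:
 assumes R: "R > 0" and N: "N > 0"
 shows "0 <= ladder p R N z" "ladder p R N z <= 1"
  "cmod (z - p) <= R ==> ladder p R N z = 1" "cmod (z - p) >= R * 2^N ==> ladder p R N z = 0"
  "cmod (z - p) >= R * 2^N ==> dladder p R N z = 0" "cmod (z - p) <= R ==> dladder p R N z = 0"
proof -
 have r: "0 < R * 2^j" "R * 2^j < R * 2^(Suc j)" for j using R by auto
 show "0 <= ladder p R N z" unfolding ladder_def using bump_range[OF r] by (intro divide_nonneg_nonneg sum_nonneg) auto
 have "(\<Sum>j<N. bump p (R * 2^j) (R * 2^(Suc j)) z) <= (\<Sum>j<N. 1)" using bump_range[OF r] by (intro sum_mono) auto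
 thus "ladder p R N z <= 1" using N by (simp add: ladder_def)
 have "cmod (z - p) <= R * 2^j" if "cmod (z - p) <= R" for j
  using that R order_trans[OF that, of "R * 2^j"] by simp
 thus "cmod (z - p) <= R ==> ladder p R N z = 1" "cmod (z - p) <= R ==> dladder p R N z = 0"
  using bump_inner[OF r] N by (simp_all add: ladder_def dladder_def del: power_Suc)
 have "R * 2^(Suc j) <= cmod (z - p)" if "cmod (z - p) >= R * 2^N" "j < N" for j
 proof -
  have "(2::real)^(Suc j) <= 2^N" using that by (intro power_increasing) auto
  hence "R * 2^(Suc j) <= R * 2^N" using R by (intro mult_left_mono) auto
  thus ?thesis using that by linarith
 qed
 thus "cmod (z - p) >= R * 2^N ==> ladder p R N z = 0" "cmod (z - p) >= R * 2^N ==> dladder p R N z = 0"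
  using bump_outer[OF r] by (simp_all add: ladder_def dladder_def del: power_Suc)
qed

text \<open>A scale-free energy bound for one dyadic bump: its derivative is at most 1 / r and lives
  in the disc of radius 2 r, whose area is 4 r^2 times that of the unit disc.\<close>

definition ladder_const :: real where "ladder_const = 4 * unit_ball_vol 2"

lemma ladder_energy:
 assumes R: "R > 0" and N: "N > 0"
 shows "(energy (%z. of_real (dladder p R N z) * (z - p))) <= ennreal (ladder_const / real N)"
proof -
 define r where "r j = R * 2^j" for j :: nat
 have r: "0 < r j" "r j < 2 * r j" "R * 2^(Suc j) = 2 * r j" for j using R by (auto simp: r_def)
 define g where "g j z = complex_of_real (dbump p (r j) (2 * r j) z) * (z - p)" for j z
 have g0: "g j z = 0" if "~ (r j < cmod (z - p) & cmod (z - p) < 2 * r j)" for j z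
  using that bump_inner(2)[OF r(1,2), of z p] bump_outer(2)[OF r(1,2), of j z p] by (auto simp: g_def not_less)
 have gb: "(cmod (g j z))^2 <= (1 / (r j)^2) * indicator (cball p (2 * r j)) z" for j z
 proof (cases "r j < cmod (z - p) & cmod (z - p) < 2 * r j")
  case False
  thus ?thesis using g0[OF False] by simp
 next
  case True
  have "\<bar>dbump p (r j) (2 * r j) z\<bar> <= 3 / (2 * ((2 * r j)^2 - (r j)^2))"
   using bump_middle(4)[OF r(1,2), of j z p] True by simp
  also have "... = 1 / (2 * (r j)^2)" using r(1)[of j] by (simp add: power2_eq_square field_simps)
  finally have "cmod (g j z) <= 1 / (2 * (r j)^2) * (2 * r j)"
   unfolding g_def norm_mult using True by (intro mult_mono) auto
  also have "... = 1 / r j" using r(1)[of j] by (simp add: power2_eq_square)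
  finally have "(cmod (g j z))^2 <= (1 / r j)^2" by (intro power_mono) auto
  thus ?thesis using True by (simp add: power_divide dist_norm norm_minus_commute)
 qed
 \<comment> \<open>At most one of the dyadic annuli contains \<open>z\<close>, so there is no factor
   \<open>N\<close> as Cauchy-Schwarz would give. After division by \<open>N^2\<close> the
   \<open>N\<close> equal energies leave 1 / N.\<close>
 have pw: "(cmod (\<Sum>j<N. g j z))^2 <= (\<Sum>j<N. (cmod (g j z))^2)" for z
 proof (cases "\<exists>i<N. g i z ~= 0")
  case True
  then obtain i where i: "i < N" "g i z ~= 0" by blast
  have uniq: "g j z = 0" if "j ~= i" for j
  proof (rule ccontr)
   assume gj: "g j z ~= 0"
   have ii: "r i < cmod (z - p)" "cmod (z - p) < 2 * r i" using g0[of i z] i by blast+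
   have jj: "r j < cmod (z - p)" "cmod (z - p) < 2 * r j" using g0[of j z] gj by blast+
   consider "j < i" | "i < j" using \<open>j ~= i\<close> by linarith
   thus False
   proof cases
   case 1
   hence "(2::real)^(Suc j) <= 2^i" by (intro power_increasing) auto
   hence "2 * r j <= r i" using R by (simp add: r_def)
   thus False using ii jj by linarith
   next
   case 2
   hence "(2::real)^(Suc i) <= 2^j" by (intro power_increasing) auto
   hence "2 * r i <= r j" using R by (simp add: r_def)
   thus False using ii jj by linarith
   qed
  qed
  have "(\<Sum>j<N. g j z) = g i z" using i uniq sum.remove[of "{..<N}" i "%j. g j z"] by (simp add: sum.neutral)
  moreover have "(cmod (g i z))^2 <= (\<Sum>j<N. (cmod (g j z))^2)" using i by (intro member_le_sum) auto
  ultimately show ?thesis by simp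
 next
  case False
  hence "(\<Sum>j<N. g j z) = 0" by (intro sum.neutral) auto
  thus ?thesis by (simp add: sum_nonneg)
 qed
 have "(energy (%z. of_real (dladder p R N z) * (z - p)))
  <= (\<integral>\<^sup>+z. (\<Sum>j<N. ennreal (1 / (real N)^2 * (1 / (r j)^2)) * indicator (cball p (2 * r j)) z) \<partial>lborel)"
 proof (rule nn_integral_mono)
  fix z
  have "of_real (dladder p R N z) * (z - p) = (\<Sum>j<N. g j z) / of_nat N"
   by (simp add: dladder_def g_def r_def sum_distrib_right mult.left_commute)
  hence "(cmod (of_real (dladder p R N z) * (z - p)))^2 = 1 / (real N)^2 * (cmod (\<Sum>j<N. g j z))^2"
   by (simp add: norm_divide power_divide)
  also have "... <= 1 / (real N)^2 * (\<Sum>j<N. (1 / (r j)^2) * indicator (cball p (2 * r j)) z)"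
   by (intro mult_left_mono order_trans[OF pw] sum_mono gb) auto
  also have "... = (\<Sum>j<N. 1 / (real N)^2 * (1 / (r j)^2) * indicator (cball p (2 * r j)) z)"
   by (simp add: sum_distrib_left mult.assoc)
  finally have "ennreal ((cmod (of_real (dladder p R N z) * (z - p)))^2) <= ennreal (\<Sum>j<N. 1 / (real N)^2 * (1 / (r j)^2) * indicator (cball p (2 * r j)) z)"
   by (rule ennreal_leI)
  also have "... = (\<Sum>j<N. ennreal (1 / (real N)^2 * (1 / (r j)^2)) * indicator (cball p (2 * r j)) z)"
  proof -
   have "ennreal (\<Sum>j<N. 1 / (real N)^2 * (1 / (r j)^2) * indicator (cball p (2 * r j)) z)
   = (\<Sum>j<N. ennreal (1 / (real N)^2 * (1 / (r j)^2) * indicator (cball p (2 * r j)) z))"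
   by (rule sum_ennreal[symmetric]) simp
   also have "... = (\<Sum>j<N. ennreal (1 / (real N)^2 * (1 / (r j)^2)) * indicator (cball p (2 * r j)) z)"
   proof (rule sum.cong[OF refl])
   fix j
   show "ennreal (1 / (real N)^2 * (1 / (r j)^2) * indicator (cball p (2 * r j)) z) = ennreal (1 / (real N)^2 * (1 / (r j)^2)) * indicator (cball p (2 * r j)) z"
   by (cases "z : cball p (2 * r j)") simp_all
   qed
   finally show ?thesis .
  qed
  finally show "ennreal ((cmod (of_real (dladder p R N z) * (z - p)))^2) <= (\<Sum>j<N. ennreal (1 / (real N)^2 * (1 / (r j)^2)) * indicator (cball p (2 * r j)) z)" .
 qed
 also have "... = (\<Sum>j<N. \<integral>\<^sup>+z. ennreal (1 / (real N)^2 * (1 / (r j)^2)) * indicator (cball p (2 * r j)) z \<partial>lborel)"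
  by (rule nn_integral_sum) (auto intro!: borel_measurable_times_ennreal borel_measurable_indicator)
 also have "... = (\<Sum>j<N. ennreal (1 / (real N)^2 * (1 / (r j)^2)) * emeasure lborel (cball p (2 * r j)))"
  by (intro sum.cong refl nn_integral_cmult_indicator) auto
 also have "... = (\<Sum>j<N. ennreal (1 / (real N)^2 * ladder_const))"
 proof (rule sum.cong[OF refl])
  fix j
  have "emeasure lborel (cball p (2 * r j)) = ennreal (unit_ball_vol 2 * (2 * r j)^2)"
   using emeasure_cball[of "2 * r j" p] r(1)[of j] by simp
  hence "ennreal (1 / (real N)^2 * (1 / (r j)^2)) * emeasure lborel (cball p (2 * r j))
   = ennreal (1 / (real N)^2 * (1 / (r j)^2) * (unit_ball_vol 2 * (2 * r j)^2))"
   by (simp add: ennreal_mult[symmetric])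
  also have "1 / (real N)^2 * (1 / (r j)^2) * (unit_ball_vol 2 * (2 * r j)^2) = 1 / (real N)^2 * ladder_const"
   using r(1)[of j] by (simp add: ladder_const_def power_mult_distrib)
  finally show "ennreal (1 / (real N)^2 * (1 / (r j)^2)) * emeasure lborel (cball p (2 * r j)) = ennreal (1 / (real N)^2 * ladder_const)" .
 qed
 also have "... = ennreal (real N * (1 / (real N)^2 * ladder_const))"
  by (subst ennreal_mult) (auto simp: ennreal_of_nat_eq_real_of_nat ladder_const_def)
 also have "real N * (1 / (real N)^2 * ladder_const) = ladder_const / real N"
  using N by (simp add: power2_eq_square)
 finally show ?thesis .
qed

section \<open>Test functions and plateau functions\<close>

text \<open>A real-linear map of the plane is determined by its values at 1 and \<open>\<i>\<close>,
  the two values from which \<open>d_z\<close> and \<open>d_zbar\<close> are built.\<close>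

lemma test_functionsD:
 assumes "\<phi> : test_functions Om"
 shows "C1_on UNIV \<phi> (d_z \<phi>) (d_zbar \<phi>)" "compact (closure {z. \<phi> z ~= 0})" "closure {z. \<phi> z ~= 0} \<subseteq> Om"
  "ALL z. z ~: closure {z. \<phi> z ~= 0} --> \<phi> z = 0"
proof -
 show "compact (closure {z. \<phi> z ~= 0})" "closure {z. \<phi> z ~= 0} \<subseteq> Om" using assms by (auto simp: test_functions_def)
 show "ALL z. z ~: closure {z. \<phi> z ~= 0} --> \<phi> z = 0" using closure_subset[of "{z. \<phi> z ~= 0}"] by auto
 have c: "continuous_on UNIV (%z. frechet_derivative \<phi> (at z) v)" for v using assms by (auto simp: test_functions_def)
 have w: "wirt \<phi> (d_z \<phi> z) (d_zbar \<phi> z) z" for z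
 proof -
  define D where "D = frechet_derivative \<phi> (at z)"
  have "\<phi> differentiable (at z)" using assms by (auto simp: test_functions_def differentiable_on_def)
  hence D: "(\<phi> has_derivative D) (at z)" by (simp add: D_def frechet_derivative_works)
  hence lin: "linear D" by (simp add: has_derivative_linear)
  have "D h = d_z \<phi> z * h + d_zbar \<phi> z * cnj h" for h
  proof -
   have "h = Re h *\<^sub>R 1 + Im h *\<^sub>R \<i>" by (simp add: complex_eq_iff)
   hence "D h = D (Re h *\<^sub>R 1 + Im h *\<^sub>R \<i>)" by simp
   also have "... = Re h *\<^sub>R D 1 + Im h *\<^sub>R D \<i>" by (simp add: linear_add[OF lin] linear_scale[OF lin])
   also have "... = d_z \<phi> z * h + d_zbar \<phi> z * cnj h"
   proof -
   define A B where "A = D 1" and "B = D \<i>"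
   have "h = of_real (Re h) + \<i> * of_real (Im h)" "cnj h = of_real (Re h) - \<i> * of_real (Im h)"
   by (simp_all add: complex_eq_iff)
   hence "(A - \<i> * B) / 2 * h + (A + \<i> * B) / 2 * cnj h
   = (A - \<i> * B) / 2 * (of_real (Re h) + \<i> * of_real (Im h)) + (A + \<i> * B) / 2 * (of_real (Re h) - \<i> * of_real (Im h))" by simp
   also have "... = of_real (Re h) * A + of_real (Im h) * B" by (simp add: field_simps)
   finally show ?thesis unfolding d_z_def d_zbar_def D_def[symmetric] A_def B_def by (simp add: scaleR_conv_of_real)
   qed
   finally show ?thesis .
  qed
  hence "D = (%h. d_z \<phi> z * h + d_zbar \<phi> z * cnj h)" by (rule ext)
  thus ?thesis using D unfolding wirt_def by simp
 qed
 show "C1_on UNIV \<phi> (d_z \<phi>) (d_zbar \<phi>)"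
  unfolding C1_on_def
 proof (intro conjI ballI w)
  show "continuous_on UNIV (d_z \<phi>)" unfolding d_z_def[abs_def] by (intro continuous_intros c) auto
  show "continuous_on UNIV (d_zbar \<phi>)" unfolding d_zbar_def[abs_def] by (intro continuous_intros c) auto
 qed
qed

text \<open>A Lipschitz function of the distance to \<open>K\<close>, equal to 1 up to distance
  \<open>d\<close> and to 0 from \<open>2 * d\<close> on, is mollified at scale
  \<open>d / 2\<close>. The plateau survives within distance \<open>d / 2\<close>, and the support
  stays within \<open>3 * d\<close>, which is inside \<open>Om\<close> because the margin is
  \<open>4 * d\<close>.\<close>

lemma plateau_exists:
 assumes Om: "open Om" and K: "compact K" "K \<subseteq> Om"
 shows "EX \<eta> \<eta>a \<eta>b L V. C1_on UNIV \<eta> \<eta>a \<eta>b & compact L & L \<subseteq> Om & (ALL z. z ~: L --> \<eta> z = 0) & open V & K \<subseteq> V & (\<forall>z\<in>V. \<eta> z = 1)"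
proof (cases "K = {}")
 case True
 thus ?thesis using C1_on_const[of UNIV 0] by (intro exI[of _ "%_. 0"] exI[of _ "{}"]) auto
next
 case False
 obtain d0 where d0: "d0 > 0" "\<And>z x. x : K ==> dist x z < d0 ==> z : Om"
 proof -
  obtain e where "e > 0" "(\<Union>x\<in>K. ball x e) \<subseteq> Om" using compact_subset_open_imp_ball_epsilon_subset[OF K(1) Om K(2)] by blast
  thus ?thesis using that[of e] by (auto simp: subset_iff)
 qed
 define d where "d = d0 / 4"
 have d: "d > 0" using d0 by (simp add: d_def)
 define g where "g z = complex_of_real (max 0 (min 1 (2 - infdist z K / d)))" for z
 have cg: "continuous_on UNIV g" unfolding g_def by (intro continuous_intros) (use d in auto)
 have bd: "bounded {z. infdist z K <= c}" for c
 proof -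
  obtain B where B: "\<And>x. x : K ==> cmod x <= B" using compact_imp_bounded[OF K(1)] bounded_iff by metis
  have "cmod z <= B + c" if "infdist z K <= c" for z
  proof -
   obtain x where x: "x : K" "infdist z K = dist z x" using infdist_attains_inf[OF compact_imp_closed[OF K(1)] False] by blast
   thus ?thesis using that B[of x] norm_triangle_ineq2[of z x] by (simp add: dist_norm)
  qed
  thus ?thesis unfolding bounded_iff by blast
 qed
 have cp: "compact {z. infdist z K <= c}" for c
 proof -
  have "closed {z. infdist z K <= c}" by (intro closed_Collect_le continuous_intros)
  thus ?thesis using bd compact_eq_bounded_closed by blast
 qed
 have gi: "integrable lborel g"
 proof (rule integrable_csupp[OF cg cp[of "2*d"]])
  fix z assume "z ~: {z. infdist z K <= 2 * d}"
  hence "2 * d < infdist z K" by simp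
  hence "2 < infdist z K / d" using d by (simp add: less_divide_eq)
  thus "g z = 0" by (simp add: g_def)
 qed
 have "d/2 > 0" using d by simp
 then obtain k a b aa c bb where M: "mollifier (d/2) k a b aa c bb" using mollifier_exists by blast
 have W: "weight k (d/2)" by (rule mollifier_weight[OF M])
 have kC: "C1_on UNIV k a b" using M by (simp add: mollifier_def)
 have k0: "k z = 0" if "z ~: cball 0 (d/2)" for z using W that by (simp add: weight_def)
 show ?thesis
 proof (intro exI conjI)
  show "C1_on UNIV (conv g k) (conv g a) (conv g b)"
   by (rule conv_C1[OF gi kC compact_cball[of 0 "d/2"]]) (rule k0)
  show "compact {z. infdist z K <= 3 * d}" by (rule cp)
  show "{z. infdist z K <= 3 * d} \<subseteq> Om"
  proof
   fix z assume "z : {z. infdist z K <= 3 * d}"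
   moreover obtain x where "x : K" "infdist z K = dist z x" using infdist_attains_inf[OF compact_imp_closed[OF K(1)] False] by blast
   ultimately show "z : Om" using d0(2)[of x z] d by (simp add: d_def dist_commute)
  qed
  show "ALL z. z ~: {z. infdist z K <= 3 * d} --> conv g k z = 0"
  proof (intro allI impI)
   fix z assume z: "z ~: {z. infdist z K <= 3 * d}"
   have "g \<zeta> * k (z - \<zeta>) = 0" for \<zeta>
   proof (cases "cmod (z - \<zeta>) >= d/2")
   case True thus ?thesis using W by (simp add: weight_def)
   next
   case False
   hence "infdist \<zeta> K >= 2 * d" using z d infdist_triangle[of z K \<zeta>] by (simp add: dist_norm)
   hence "2 <= infdist \<zeta> K / d" using d by (simp add: le_divide_eq)
   thus ?thesis by (simp add: g_def)
   qed
   thus "conv g k z = 0" unfolding conv_def by (simp only:) simp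
  qed
  show "open {z. infdist z K < d/2}" by (intro open_Collect_less continuous_intros)
  show "K \<subseteq> {z. infdist z K < d/2}" using d by auto
  show "\<forall>z\<in>{z. infdist z K < d/2}. conv g k z = 1"
  proof
   fix z assume z: "z : {z. infdist z K < d/2}"
   have "g \<zeta> * k (z - \<zeta>) = k (z - \<zeta>)" for \<zeta>
   proof (cases "cmod (z - \<zeta>) >= d/2")
   case True thus ?thesis using W by (simp add: weight_def)
   next
   case False
   hence "infdist \<zeta> K <= d" using z infdist_triangle[of \<zeta> K z] by (simp add: dist_norm norm_minus_commute)
   hence "infdist \<zeta> K / d <= 1" using d by simp
   thus ?thesis by (simp add: g_def)
   qed
   thus "conv g k z = 1" unfolding conv_def using weight_reflect(2)[OF W, of z] by (simp only:)
  qed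
 qed
qed

section \<open>Weyl's lemma and calculus of weak derivatives\<close>

text \<open>Where the weak dbar derivative of the localised function vanishes, its mollifications
  satisfy the Cauchy-Riemann equations, and they converge uniformly. The radius drops to
  \<open>s / 2\<close> through the bump, to \<open>s / 4\<close> through mollification, and to
  \<open>s / 5\<close> so that a closed disc fits inside.\<close>

lemma weyl_local:
 assumes W: "weak_on Om f p q" and s: "s > 0" "ball z0 s \<subseteq> Om" and q0: "AE z in lborel. z : ball z0 s --> q z = 0"
 shows "f holomorphic_on ball z0 (s/5)"
proof -
 have r: "0 < s/2" "s/2 < 3 * s / 4" using s by auto
 have b0: "z ~: cball z0 (3 * s / 4) ==> complex_of_real (bump z0 (s/2) (3 * s / 4) z) = 0" for z
  using bump_outer(1)[OF r, of z z0] by (simp add: dist_norm norm_minus_commute)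
 have sub: "cball z0 (3 * s / 4) \<subseteq> Om" using s by (auto simp: subset_iff)
 have b0': "ALL z. z ~: cball z0 (3 * s / 4) --> complex_of_real (bump z0 (s/2) (3 * s / 4) z) = 0" using b0 by blast
 obtain P Q R where S: "sobolev (%z. if z : Om then of_real (bump z0 (s/2) (3 * s / 4) z) * f z else 0) P Q R"
  and Q: "AE z in lborel. Q z = (if z : Om then of_real (bump z0 (s/2) (3 * s / 4) z) * q z + of_real (dbump z0 (s/2) (3 * s / 4) z) * (z - z0) * f z else 0)"
  using weak_on_localize[OF W bump_C1 compact_cball sub b0'] by blast
 obtain Fn An Bn where "approx_seq (%z. if z : Om then of_real (bump z0 (s/2) (3 * s / 4) z) * f z else 0) P Q R Fn An Bn"
  using sobolev_approx[OF S] by blast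
 hence C: "\<And>n. C1_on UNIV (Fn n) (An n) (Bn n)"
  and U: "\<forall>e>0. \<forall>\<^sub>F n in sequentially. ALL z. cmod (Fn n z - (if z : Om then of_real (bump z0 (s/2) (3 * s / 4) z) * f z else 0)) <= e"
  and B: "ALL p s. s > 0 --> (AE z in lborel. z : ball p s --> Q z = 0) --> (\<forall>\<^sub>F n in sequentially. \<forall>z\<in>ball p (s/2). Bn n z = 0)"
  unfolding approx_seq_def by simp_all
 have "AE z in lborel. z : ball z0 (s/2) --> Q z = 0"
  using Q q0
 proof eventually_elim
  case (elim z)
  show ?case
  proof
   assume z: "z : ball z0 (s/2)"
   hence "cmod (z - z0) <= s/2" "z : ball z0 s" using s by (auto simp: dist_norm norm_minus_commute)
   thus "Q z = 0" using elim bump_inner(2)[OF r, of z z0] by simp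
  qed
 qed
 hence Bz: "\<forall>\<^sub>F n in sequentially. \<forall>z\<in>ball z0 (s/2/2). Bn n z = 0" using B r(1) by blast
 have lim: "uniform_limit (cball z0 (s/5)) Fn f sequentially"
  unfolding uniform_limit_iff
 proof (intro allI impI)
  fix e :: real assume e: "e > 0"
  hence "e/2 > 0" by simp
  hence "\<forall>\<^sub>F n in sequentially. ALL z. cmod (Fn n z - (if z : Om then of_real (bump z0 (s/2) (3 * s / 4) z) * f z else 0)) <= e/2"
   using U by blast
  thus "\<forall>\<^sub>F n in sequentially. \<forall>z\<in>cball z0 (s/5). dist (Fn n z) (f z) < e"
  proof eventually_elim
   case (elim n)
   show ?case
   proof
   fix z assume z: "z : cball z0 (s/5)"
   hence "cmod (z - z0) <= s/2" "z : Om" using s by (auto simp: dist_norm norm_minus_commute subset_iff)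
   thus "dist (Fn n z) (f z) < e" using elim[rule_format, of z] bump_inner(1)[OF r, of z z0] e by (simp add: dist_norm)
   qed
  qed
 qed
 have hol: "\<forall>\<^sub>F n in sequentially. continuous_on (cball z0 (s/5)) (Fn n) & Fn n holomorphic_on ball z0 (s/5)"
  using Bz
 proof eventually_elim
  case (elim n)
  have "continuous_on UNIV (Fn n)" using C1_on_imp_continuous[OF C] .
  moreover have "(Fn n has_field_derivative An n z) (at z)" if "z : ball z0 (s/5)" for z
  proof -
   have "z : ball z0 (s/2/2)" using that s by simp
   hence "Bn n z = 0" using elim by blast
   moreover have "wirt (Fn n) (An n z) (Bn n z) z" using C[of n] by (simp add: C1_on_def)
   ultimately show ?thesis by (simp add: wirt_field_iff)
  qed
  ultimately show ?case
   unfolding holomorphic_on_open[OF open_ball] by (blast intro: continuous_on_subset)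
 qed
 show ?thesis using holomorphic_uniform_limit[OF hol lim] by auto
qed

lemma weyl:
 assumes W: "weak_on Om f p q" and U: "open U" "U \<subseteq> Om" and q0: "AE z in lborel. z : U --> q z = 0"
 shows "f holomorphic_on U"
proof -
 have "f field_differentiable at z0" if z0: "z0 : U" for z0
 proof -
  obtain s where s: "s > 0" "ball z0 s \<subseteq> U" using openE[OF U(1) z0] by metis
  have sub: "ball z0 s \<subseteq> Om" using s U by (meson order_trans)
  have "AE z in lborel. z : ball z0 s --> q z = 0" using q0
  proof eventually_elim
   case (elim z)
   thus ?case using s(2) by (meson subsetD)
  qed
  hence "f holomorphic_on ball z0 (s/5)" by (rule weyl_local[OF W s(1) sub])
  thus ?thesis using s(1) by (intro holomorphic_on_imp_differentiable_at[OF _ open_ball]) auto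
 qed
 thus ?thesis by (simp add: holomorphic_on_def field_differentiable_at_within)
qed

lemma locally_L2_mult:
 assumes p: "locally_L2 Om p" and h: "continuous_on Om h" and Om: "open Om"
 shows "locally_L2 Om (%z. h z * p z)"
 unfolding locally_L2_def
proof (intro conjI allI impI)
 have hm: "h : bmeas (leb Om)"
  using continuous_measurable_leb[OF h] Om by simp
 have pm: "p : bmeas (leb Om)" using p by (simp add: locally_L2_def)
 show m: "(%z. h z * p z) : bmeas (leb Om)" using hm pm by measurable
 fix K assume K: "compact K & K \<subseteq> Om"
 have i: "integrable (leb K) (%z. (cmod (p z))^2)" using p K by (simp add: locally_L2_def)
 have "compact (h ` K)" using K h by (meson compact_continuous_image continuous_on_subset)
 then obtain B where B: "\<And>z. z : K ==> cmod (h z) <= B" using compact_imp_bounded bounded_iff by (metis image_eqI)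
 have mK: "(%z. h z * p z) : bmeas (leb K)" by (rule measurable_restrict_mono[OF m]) (use K in simp)
 show "integrable (leb K) (%z. (cmod (h z * p z))^2)"
 proof (rule integrable_dom[OF integrable_mult_right[OF i, of "B^2"]])
  show "(%z. (cmod (h z * p z))^2) : bmeas (leb K)" using mK by measurable
  show "AE z in leb K. norm ((cmod (h z * p z))^2) <= norm (B^2 * (cmod (p z))^2)"
  proof (rule AE_I2)
   fix z assume "z : space (leb K)"
   hence "cmod (h z) <= B" using B by simp
   hence "(cmod (h z))^2 * (cmod (p z))^2 <= B^2 * (cmod (p z))^2" by (intro mult_right_mono power_mono) auto
   thus "norm ((cmod (h z * p z))^2) <= norm (B^2 * (cmod (p z))^2)" by (simp add: norm_mult power_mult_distrib)
  qed
 qed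
qed

lemma locally_L2_const: assumes "open Om" shows "locally_L2 Om (%z. c)"
 unfolding locally_L2_def
proof (intro conjI allI impI)
 fix K assume K: "compact K & K \<subseteq> Om"
 hence "K : lmeasurable" by (simp add: lmeasurable_compact)
 hence "finite_measure (leb K)" by (rule finite_measure_lebesgue_on)
 thus "integrable (leb K) (%z. (cmod c)^2)" by (rule finite_measure.integrable_const)
qed simp

lemma locally_L2_continuous:
 assumes "open Om" "continuous_on Om h" shows "locally_L2 Om h"
 using locally_L2_mult[OF locally_L2_const[OF assms(1), of 1] assms(2,1)] by simp

lemma locally_L2_diff:
 assumes p: "locally_L2 Om p" and q: "locally_L2 Om q"
 shows "locally_L2 Om (%z. p z - q z)"
 unfolding locally_L2_def
proof (intro conjI allI impI)
 have pm: "p : bmeas (leb Om)" "q : bmeas (leb Om)" using p q by (simp_all add: locally_L2_def)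
 show m: "(%z. p z - q z) : bmeas (leb Om)" using pm by measurable
 fix K assume K: "compact K & K \<subseteq> Om"
 have i: "integrable (leb K) (%z. (cmod (p z))^2)" "integrable (leb K) (%z. (cmod (q z))^2)"
  using p q K by (simp_all add: locally_L2_def)
 have mK: "(%z. p z - q z) : bmeas (leb K)" by (rule measurable_restrict_mono[OF m]) (use K in simp)
 show "integrable (leb K) (%z. (cmod (p z - q z))^2)"
 proof (rule integrable_dom)
  show "integrable (leb K) (%z. 2 * (cmod (p z))^2 + 2 * (cmod (q z))^2)" using i by simp
  show "(%z. (cmod (p z - q z))^2) : bmeas (leb K)" using mK by measurable
  show "AE z in leb K. norm ((cmod (p z - q z))^2) <= norm (2 * (cmod (p z))^2 + 2 * (cmod (q z))^2)"
  proof (rule AE_I2)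
   fix z
   have "(cmod (p z - q z))^2 <= (cmod (p z) + cmod (q z))^2" by (intro power_mono norm_triangle_ineq4) auto
   also have "... <= 2 * (cmod (p z))^2 + 2 * (cmod (q z))^2"
   using zero_le_power2[of "cmod (p z) - cmod (q z)"] by (simp add: power2_sum power2_diff)
   finally show "norm ((cmod (p z - q z))^2) <= norm (2 * (cmod (p z))^2 + 2 * (cmod (q z))^2)" by simp
  qed
 qed
qed

lemma locally_L2_test_integrable:
 assumes p: "locally_L2 Om p" and Om: "open Om" and K: "compact K" "K \<subseteq> Om" and g: "continuous_on UNIV g" "ALL z. z ~: K --> g z = 0"
 shows "integrable (leb Om) (%z. p z * g z)"
proof -
 have Oms: "Om : sets lebesgue" using Om by simp
 obtain P where P: "P : bmeas borel" "AE z in lborel. P z = (if z : Om then g z * p z else 0)"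
  "ALL z. z ~: K --> P z = 0" "integrable lborel (%z. (cmod (P z))^2)"
  using locally_L2_borel_rep[OF p K g] by blast
 obtain R where R: "K \<subseteq> ball 0 R" using K compact_imp_bounded bounded_subset_ballD by blast
 have "ALL z. R <= cmod z --> P z = 0" using R P(3) by auto
 hence "integrable lborel P" by (rule L2_compact_imp_L1[OF P(1,4)])
 hence "integrable lebesgue P" using integrable_completion[of P lborel] P(1) by simp
 hence "integrable lebesgue (%z. if z : Om then p z * g z else 0)"
 proof (rule integrable_cong_AE_imp)
  have "p : bmeas (leb Om)" using p by (simp add: locally_L2_def)
  moreover have "g : bmeas (leb Om)"
   using continuous_measurable_leb[OF continuous_on_subset[OF g(1) subset_UNIV] Oms] .
  ultimately have "(%z. p z * g z) : bmeas (leb Om)" by measurable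
  thus "(%z. if z : Om then p z * g z else 0) : bmeas lebesgue"
   using borel_measurable_if[OF Oms, of "%z. p z * g z"] by simp
  have "AE z in lebesgue. P z = (if z : Om then g z * p z else 0)" using P(2) by (simp add: AE_completion_iff)
  thus "AE z in lebesgue. P z = (if z : Om then p z * g z else 0)" by eventually_elim (simp add: mult.commute)
 qed
 thus ?thesis by (simp only: Lebesgue_Measure.integrable_restrict_UNIV[OF Oms])
qed

lemma weak_on_subset:
 assumes W: "weak_on Om f p q" and U: "open U" "U \<subseteq> Om"
 shows "weak_on U f p q"
proof -
 have Oms: "Om : sets lebesgue" "U : sets lebesgue" using W U by (auto simp: weak_on_def)
 have mono: "locally_L2 U r" if "locally_L2 Om r" for r
  using that U unfolding locally_L2_def by (auto intro: measurable_restrict_mono)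
 have eq: "(LINT z|leb U. h z * g z) = (LINT z|leb Om. h z * g z)" if "ALL z. z ~: U --> g z = 0" for h g :: cfun
 proof -
  have "(LINT z|leb U. h z * g z) = (\<integral>z. indicator U z *\<^sub>R (h z * g z) \<partial>lebesgue)"
   by (rule integral_restrict_space) (use Oms in simp)
  also have "... = (\<integral>z. indicator Om z *\<^sub>R (h z * g z) \<partial>lebesgue)"
   by (rule Bochner_Integration.integral_cong) (use that U in \<open>auto simp: indicator_def\<close>)
  also have "... = (LINT z|leb Om. h z * g z)"
   by (rule integral_restrict_space[symmetric]) (use Oms in simp)
  finally show ?thesis .
 qed
 have T: "\<phi> : test_functions Om & (ALL z. z ~: U --> \<phi> z = 0 & d_z \<phi> z = 0 & d_zbar \<phi> z = 0)" if "\<phi> : test_functions U" for \<phi>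
 proof -
  note D = test_functionsD[OF that]
  have "z ~: U ==> z ~: closure {z. \<phi> z ~= 0}" for z using D(3) by auto
  moreover have "\<And>z. z ~: closure {z. \<phi> z ~= 0} ==> \<phi> z = 0" using D(4) by blast
  ultimately have "ALL z. z ~: U --> \<phi> z = 0 & d_z \<phi> z = 0 & d_zbar \<phi> z = 0"
   using C1_on_zero_deriv[OF D(1) closed_closure[of "{z. \<phi> z ~= 0}"]] by blast
  thus ?thesis using that U by (auto simp: test_functions_def)
 qed
 show ?thesis
  unfolding weak_on_def weak_d_z_def weak_d_zbar_def
 proof (intro conjI ballI)
  show "continuous_on U f" using W U by (auto simp: weak_on_def intro: continuous_on_subset)
  fix \<phi> assume \<phi>: "\<phi> : test_functions U"
  have "(LINT z|leb Om. f z * d_z \<phi> z) = - (LINT z|leb Om. p z * \<phi> z)"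
   "(LINT z|leb Om. f z * d_zbar \<phi> z) = - (LINT z|leb Om. q z * \<phi> z)"
   using W T[OF \<phi>] by (auto simp: weak_on_def weak_d_z_def weak_d_zbar_def)
  thus "(LINT z|leb U. f z * d_z \<phi> z) = - (LINT z|leb U. p z * \<phi> z)"
   "(LINT z|leb U. f z * d_zbar \<phi> z) = - (LINT z|leb U. q z * \<phi> z)"
   using T[OF \<phi>] by (simp_all add: eq)
 qed (use W U mono in \<open>auto simp: weak_on_def\<close>)
qed

lemma weak_on_diff:
 assumes f: "weak_on Om f p q" and g: "weak_on Om g r s"
 shows "weak_on Om (%z. f z - g z) (%z. p z - r z) (%z. q z - s z)"
proof -
 have Om: "open Om" using f by (simp add: weak_on_def)
 have L: "locally_L2 Om f" "locally_L2 Om g" "locally_L2 Om p" "locally_L2 Om q" "locally_L2 Om r" "locally_L2 Om s"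
  using f g locally_L2_continuous by (auto simp: weak_on_def)
 have main: "(LINT z|leb Om. (f z - g z) * d_z \<phi> z) = - (LINT z|leb Om. (p z - r z) * \<phi> z) \<and>
  (LINT z|leb Om. (f z - g z) * d_zbar \<phi> z) = - (LINT z|leb Om. (q z - s z) * \<phi> z)" if \<phi>: "\<phi> : test_functions Om" for \<phi>
 proof -
  define K where "K = closure {z. \<phi> z ~= 0}"
  have D: "C1_on UNIV \<phi> (d_z \<phi>) (d_zbar \<phi>)" "compact K" "K \<subseteq> Om" "ALL z. z ~: K --> \<phi> z = 0"
   using test_functionsD[OF \<phi>] unfolding K_def by blast+
  have clK: "closed K" by (simp add: K_def)
  have z: "\<And>z. z ~: K ==> \<phi> z = 0" using D(4) by blast
  have z2: "ALL z. z ~: K --> d_z \<phi> z = 0" "ALL z. z ~: K --> d_zbar \<phi> z = 0"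
   using C1_on_zero_deriv[OF D(1) clK z] by blast+
  have c: "continuous_on UNIV \<phi>" "continuous_on UNIV (d_z \<phi>)" "continuous_on UNIV (d_zbar \<phi>)"
   using D(1) C1_on_imp_continuous[OF D(1)] by (auto simp: C1_on_def)
  have i: "integrable (leb Om) (%z. u z * v z)"
   if "locally_L2 Om u" "v = \<phi> \<or> v = d_z \<phi> \<or> v = d_zbar \<phi>" for u v
  proof (rule locally_L2_test_integrable[OF that(1) Om D(2,3)])
   show "continuous_on UNIV v" using that(2) c by (elim disjE) simp_all
   show "ALL z. z ~: K --> v z = 0" using that(2) D(4) z2 by (elim disjE) simp_all
  qed
  have wf: "(LINT z|leb Om. f z * d_z \<phi> z) = - (LINT z|leb Om. p z * \<phi> z)"
   "(LINT z|leb Om. f z * d_zbar \<phi> z) = - (LINT z|leb Om. q z * \<phi> z)"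
   "(LINT z|leb Om. g z * d_z \<phi> z) = - (LINT z|leb Om. r z * \<phi> z)"
   "(LINT z|leb Om. g z * d_zbar \<phi> z) = - (LINT z|leb Om. s z * \<phi> z)"
   using f g \<phi> by (auto simp: weak_on_def weak_d_z_def weak_d_zbar_def)
  show ?thesis using wf by (simp add: left_diff_distrib i L)
 qed
 show ?thesis
  unfolding weak_on_def weak_d_z_def weak_d_zbar_def
  using f g main by (auto simp: weak_on_def intro: continuous_on_diff locally_L2_diff)
qed

text \<open>The product of \<open>f\<close> with a test function, extended by 0, is C1 on the plane,
  and its derivatives have integral 0.\<close>

lemma weak_on_holomorphic:
 assumes Om: "open Om" and f: "f holomorphic_on Om"
 shows "weak_on Om f (deriv f) (%_. 0)"
proof -
 have cf: "continuous_on Om f" using f by (rule holomorphic_on_imp_continuous_on)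
 have cd: "continuous_on Om (deriv f)" using holomorphic_on_imp_continuous_on[OF holomorphic_deriv[OF f Om]] .
 have L: "locally_L2 Om f" "locally_L2 Om (deriv f)" using locally_L2_continuous[OF Om] cf cd by auto
 have main: "(LINT z|leb Om. f z * d_z \<phi> z) = - (LINT z|leb Om. deriv f z * \<phi> z) \<and>
  (LINT z|leb Om. f z * d_zbar \<phi> z) = 0" if \<phi>: "\<phi> : test_functions Om" for \<phi>
 proof -
  define K where "K = closure {z. \<phi> z ~= 0}"
  have D: "C1_on UNIV \<phi> (d_z \<phi>) (d_zbar \<phi>)" "compact K" "K \<subseteq> Om" "ALL z. z ~: K --> \<phi> z = 0"
   using test_functionsD[OF \<phi>] unfolding K_def by blast+
  have clK: "closed K" by (simp add: K_def)
  have z: "\<And>z. z ~: K ==> \<phi> z = 0" using D(4) by blast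
  have z2: "ALL z. z ~: K --> d_z \<phi> z = 0" "ALL z. z ~: K --> d_zbar \<phi> z = 0"
   using C1_on_zero_deriv[OF D(1) clK z] by blast+
  have c: "continuous_on UNIV \<phi>" "continuous_on UNIV (d_z \<phi>)" "continuous_on UNIV (d_zbar \<phi>)"
   using D(1) C1_on_imp_continuous[OF D(1)] by (auto simp: C1_on_def)
  have i: "integrable (leb Om) (%z. u z * v z)"
   if "locally_L2 Om u" "v = \<phi> \<or> v = d_z \<phi> \<or> v = d_zbar \<phi>" for u v
  proof (rule locally_L2_test_integrable[OF that(1) Om D(2,3)])
   show "continuous_on UNIV v" using that(2) c by (elim disjE) simp_all
   show "ALL z. z ~: K --> v z = 0" using that(2) D(4) z2 by (elim disjE) simp_all
  qed
  define U where "U = Om"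
  have pr: "C1_on Om (%z. f z * \<phi> z) (%z. deriv f z * \<phi> z + f z * d_z \<phi> z) (%z. 0 * \<phi> z + f z * d_zbar \<phi> z)"
   by (rule C1_on_mult[OF C1_on_holomorphic[OF f Om] C1_on_subset[OF D(1) subset_UNIV]])
  have "C1_on UNIV (%z. if z : Om then f z * \<phi> z else 0) (%z. if z : Om then deriv f z * \<phi> z + f z * d_z \<phi> z else 0)
   (%z. if z : Om then 0 * \<phi> z + f z * d_zbar \<phi> z else 0)"
   by (rule C1_on_extend[OF pr Om D(2,3)]) (simp add: z)
  note iz = integral_wirt_zero[OF this D(2)]
  have zz: "z ~: K ==> (if z : Om then f z * \<phi> z else 0) = 0" for z by (simp add: z)
  have m: "(%z. if z : Om then h z else 0) : bmeas borel ==>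
   h : bmeas (leb Om) ==> (LINT z|leb Om. h z) = (LINT z|lborel. (if z : Om then h z else 0))" for h :: cfun
   by (rule lebesgue_on_integral_borel) (use Om in auto)
  have bm: "(%z. if z : Om then h z else 0) : bmeas borel & h : bmeas (leb Om)" if "continuous_on Om h" for h :: cfun
  proof
   show "(%z. if z : Om then h z else 0) : bmeas borel"
   using that Om by (intro borel_measurable_continuous_on_if) auto
   show "h : bmeas (leb Om)"
   using continuous_measurable_leb[OF that] Om by simp
  qed
  have cs: "continuous_on Om \<phi>" "continuous_on Om (d_z \<phi>)" "continuous_on Om (d_zbar \<phi>)"
   using c by (auto intro: continuous_on_subset)
  have h1: "continuous_on Om (%z. deriv f z * \<phi> z + f z * d_z \<phi> z)" "continuous_on Om (%z. 0 * \<phi> z + f z * d_zbar \<phi> z)"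
   by (intro continuous_intros cf cd cs)+
  have "(LINT z|leb Om. deriv f z * \<phi> z + f z * d_z \<phi> z) = 0"
   using m[OF conjunct1[OF bm[OF h1(1)]] conjunct2[OF bm[OF h1(1)]]] iz(1) zz by simp
  moreover have "(LINT z|leb Om. f z * d_zbar \<phi> z) = 0"
   using m[OF conjunct1[OF bm[OF h1(2)]] conjunct2[OF bm[OF h1(2)]]] iz(2) zz by simp
  ultimately show ?thesis by (simp add: i L eq_neg_iff_add_eq_0 add.commute)
 qed
 show ?thesis
  unfolding weak_on_def weak_d_z_def weak_d_zbar_def
  using Om cf L main locally_L2_const[OF Om] by auto
qed

section \<open>Reciprocals of weakly differentiable functions\<close>

text \<open>The factor \<open>\<phi> z / (Fn n z - c)^2\<close> converges pointwise and boundedly,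
  while \<open>An\<close> converges in L1; this suffices for the integrals of the products to
  converge.\<close>

lemma inverse_chain_limit:
 fixes F P \<phi> \<alpha> :: cfun
 assumes K: "compact K" and F: "continuous_on UNIV F" and P: "integrable lborel P"
  and \<phi>: "continuous_on UNIV \<phi>" "continuous_on UNIV \<alpha>" "ALL z. z ~: K --> \<phi> z = 0" "ALL z. z ~: K --> \<alpha> z = 0"
  and \<delta>: "\<delta> > 0" and Fn: "\<And>n. continuous_on UNIV (Fn n)" "\<And>n z. z : K ==> cmod (Fn n z - c) >= \<delta>"
  and lim: "\<And>z. (%n. Fn n z) \<longlonglongrightarrow> F z"
  and An: "\<And>n. integrable lborel (An n)" "(%n. \<integral>z. cmod (An n z - P z) \<partial>lborel) \<longlonglongrightarrow> 0"
  and eq: "\<And>n. (LINT z|lborel. \<alpha> z / (Fn n z - c) - An n z * (\<phi> z / (Fn n z - c)^2)) = 0"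
 shows "(LINT z|lborel. \<alpha> z / (F z - c)) = (LINT z|lborel. P z * (\<phi> z / (F z - c)^2))"
proof -
 obtain M1 where M1: "M1 >= 0" "\<And>z. cmod (\<phi> z) <= M1" using bounded_compact_support[OF \<phi>(1) K] \<phi>(3) by blast
 obtain M2 where M2: "M2 >= 0" "\<And>z. cmod (\<alpha> z) <= M2" using bounded_compact_support[OF \<phi>(2) K] \<phi>(4) by blast
 note [measurable] = continuous_bmeas[OF F] continuous_bmeas[OF \<phi>(1)] continuous_bmeas[OF \<phi>(2)]
  continuous_bmeas[OF Fn(1)] borel_measurable_integrable[OF P] borel_measurable_integrable[OF An(1)]
 have Pb[measurable]: "P : bmeas borel" "\<And>n. An n : bmeas borel"
  using borel_measurable_integrable[OF P] borel_measurable_integrable[OF An(1)] by auto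
 have Fc: "cmod (F z - c) >= \<delta>" if "z : K" for z
 proof -
  have "(%n. cmod (Fn n z - c)) \<longlonglongrightarrow> cmod (F z - c)" by (intro tendsto_intros lim)
  thus ?thesis by (rule tendsto_lowerbound) (use Fn(2)[OF that] in auto)
 qed
 have b1: "cmod (\<alpha> z / (Fn n z - c)) <= indicator K z *\<^sub>R (M2 / \<delta>)" for n z
 proof (cases "z : K")
  case True thus ?thesis using Fn(2)[OF True, of n] M2 \<delta> by (simp add: norm_divide frac_le)
 qed (use \<phi> in simp)
 have b2: "cmod (\<phi> z / (Fn n z - c)^2) <= M1 / \<delta>^2" for n z
 proof (cases "z : K")
  case True
  have "\<delta>^2 <= (cmod (Fn n z - c))^2" using Fn(2)[OF True, of n] \<delta> by (intro power_mono) auto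
  thus ?thesis using M1 \<delta> by (simp add: norm_divide norm_power frac_le)
 qed (use \<phi> M1 in simp)
 have l1: "(%n. \<alpha> z / (Fn n z - c)) \<longlonglongrightarrow> \<alpha> z / (F z - c)" for z
 proof (cases "z : K")
  case True thus ?thesis using Fc[OF True] \<delta> by (intro tendsto_intros lim) auto
 qed (use \<phi> in simp)
 have l2: "(%n. \<phi> z / (Fn n z - c)^2) \<longlonglongrightarrow> \<phi> z / (F z - c)^2" for z
 proof (cases "z : K")
  case True thus ?thesis using Fc[OF True] \<delta> by (intro tendsto_intros lim) auto
 qed (use \<phi> in simp)
 have iK: "integrable lborel (%z. indicator K z *\<^sub>R (M2 / \<delta>))"
  by (intro borel_integrable_compact[OF K]) auto
 have L1: "(%n. \<integral>z. \<alpha> z / (Fn n z - c) \<partial>lborel) \<longlonglongrightarrow> (LINT z|lborel. \<alpha> z / (F z - c))"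
  by (rule integral_dominated_convergence[OF _ _ iK]) (use l1 b1 in auto)
 have L2: "(%n. \<integral>z. P z * (\<phi> z / (Fn n z - c)^2) \<partial>lborel) \<longlonglongrightarrow> (LINT z|lborel. P z * (\<phi> z / (F z - c)^2))"
 proof (rule integral_dominated_convergence[where w="%z. cmod (P z) * (M1 / \<delta>^2)"])
  show "integrable lborel (%z. cmod (P z) * (M1 / \<delta>^2))" using P by simp
  show "AE z in lborel. (%n. P z * (\<phi> z / (Fn n z - c)^2)) \<longlonglongrightarrow> P z * (\<phi> z / (F z - c)^2)"
   by (intro AE_I2 tendsto_mult tendsto_const l2)
  show "AE z in lborel. norm (P z * (\<phi> z / (Fn n z - c)^2)) <= cmod (P z) * (M1 / \<delta>^2)" for n
   unfolding norm_mult by (intro AE_I2 mult_left_mono b2) auto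
 qed measurable
 have bi: "integrable lborel (%z. h z * (\<phi> z / (Fn n z - c)^2))" if h: "integrable lborel h" for h :: cfun and n
 proof (rule integrable_dom[OF integrable_mult_left[OF integrable_norm[OF h], of "M1 / \<delta>^2"]])
  have [measurable]: "h : bmeas borel" using borel_measurable_integrable[OF h] by simp
  show "(%z. h z * (\<phi> z / (Fn n z - c)^2)) : bmeas lborel" by measurable
  have "cmod (h z * (\<phi> z / (Fn n z - c)^2)) <= cmod (h z) * (M1 / \<delta>^2)" for z
   unfolding norm_mult[of "h z"] by (intro mult_left_mono b2) auto
  thus "AE z in lborel. norm (h z * (\<phi> z / (Fn n z - c)^2)) <= norm (cmod (h z) * (M1 / \<delta>^2))"
   using M1(1) by (intro AE_I2) (simp add: abs_mult)
 qed
 have ai: "integrable lborel (%z. \<alpha> z / (Fn n z - c))" for n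
  by (rule integrable_dom[OF iK]) (use b1[of _ n] M2 \<delta> in \<open>auto intro!: AE_I2 order_trans[OF b1]\<close>)
 have "(%n. \<integral>z. (An n z - P z) * (\<phi> z / (Fn n z - c)^2) \<partial>lborel) \<longlonglongrightarrow> 0"
 proof (rule Lim_null_comparison[where g="%n. (M1 / \<delta>^2) * (LINT z|lborel. cmod (An n z - P z))"])
  show "(%n. (M1 / \<delta>^2) * (LINT z|lborel. cmod (An n z - P z))) \<longlonglongrightarrow> 0"
   using tendsto_mult[OF tendsto_const An(2), of "M1 / \<delta>^2"] by simp
  have "norm (LINT z|lborel. (An n z - P z) * (\<phi> z / (Fn n z - c)^2)) <= (LINT z|lborel. (M1 / \<delta>^2) * cmod (An n z - P z))" for n
  proof (rule Bochner_Integration.integral_norm_bound_integral)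
   show "norm ((An n z - P z) * (\<phi> z / (Fn n z - c)^2)) <= (M1 / \<delta>^2) * cmod (An n z - P z)" for z
   unfolding norm_mult[of "An n z - P z"] by (subst mult.commute) (intro mult_right_mono b2, simp)
  qed (use bi[of "%z. An n z - P z" n] An P in auto)
  thus "\<forall>\<^sub>F n in sequentially. norm (LINT z|lborel. (An n z - P z) * (\<phi> z / (Fn n z - c)^2)) <= (M1 / \<delta>^2) * (LINT z|lborel. cmod (An n z - P z))"
   by simp
 qed
 from tendsto_add[OF this L2]
 have L3: "(%n. (LINT z|lborel. (An n z - P z) * (\<phi> z / (Fn n z - c)^2)) + (LINT z|lborel. P z * (\<phi> z / (Fn n z - c)^2))) \<longlonglongrightarrow> (LINT z|lborel. P z * (\<phi> z / (F z - c)^2))"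
  by simp
 have "(LINT z|lborel. (An n z - P z) * (\<phi> z / (Fn n z - c)^2)) + (LINT z|lborel. P z * (\<phi> z / (Fn n z - c)^2)) = (LINT z|lborel. \<alpha> z / (Fn n z - c))" for n
 proof -
  have "(LINT z|lborel. \<alpha> z / (Fn n z - c)) = (LINT z|lborel. An n z * (\<phi> z / (Fn n z - c)^2))"
   using eq[of n] ai[of n] bi[OF An(1), of n n] by simp
  also have "... = (LINT z|lborel. (An n z - P z) * (\<phi> z / (Fn n z - c)^2) + P z * (\<phi> z / (Fn n z - c)^2))"
   by (simp only: distrib_right[symmetric] diff_add_cancel)
  also have "... = (LINT z|lborel. (An n z - P z) * (\<phi> z / (Fn n z - c)^2)) + (LINT z|lborel. P z * (\<phi> z / (Fn n z - c)^2))"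
   by (rule Bochner_Integration.integral_add) (use bi[of "%z. An n z - P z" n] bi[OF P] An P in auto)
  finally show ?thesis by simp
 qed
 thus ?thesis using LIMSEQ_unique[OF L1] L3 by simp
qed

text \<open>The chain rule for a function whose derivatives exist only weakly: it holds for the
  mollified functions, and both sides pass to the limit. Applied with \<open>c = f z0\<close>, it
  transfers the Beltrami equation of \<open>f\<close> to \<open>1 / (f z - f z0)\<close>.\<close>

lemma weak_on_inverse:
 assumes W: "weak_on Om f p q" and ne: "\<forall>z\<in>Om. f z ~= c"
 shows "weak_on Om (%z. 1 / (f z - c)) (%z. (- 1 / (f z - c)^2) * p z) (%z. (- 1 / (f z - c)^2) * q z)"
proof -
 have Om: "open Om" "Om : sets lebesgue" and f: "continuous_on Om f" and L: "locally_L2 Om p" "locally_L2 Om q"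
  using W by (auto simp: weak_on_def)
 have cf: "continuous_on Om (%z. 1 / (f z - c))" "continuous_on Om (%z. - 1 / (f z - c)^2)"
  by (intro continuous_intros f; use ne in simp)+
 have main: "(LINT z|leb Om. 1 / (f z - c) * d_z \<phi> z) = - (LINT z|leb Om. (- 1 / (f z - c)^2) * p z * \<phi> z) \<and>
  (LINT z|leb Om. 1 / (f z - c) * d_zbar \<phi> z) = - (LINT z|leb Om. (- 1 / (f z - c)^2) * q z * \<phi> z)"
  if \<phi>: "\<phi> : test_functions Om" for \<phi>
 proof -
  define K where "K = closure {z. \<phi> z ~= 0}"
  have D: "C1_on UNIV \<phi> (d_z \<phi>) (d_zbar \<phi>)" "compact K" "K \<subseteq> Om" "ALL z. z ~: K --> \<phi> z = 0"
   using test_functionsD[OF \<phi>] unfolding K_def by blast+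
  have clK: "closed K" by (simp add: K_def)
  have z: "\<And>z. z ~: K ==> \<phi> z = 0" using D(4) by blast
  have z2': "ALL z. z ~: K --> d_z \<phi> z = 0" "ALL z. z ~: K --> d_zbar \<phi> z = 0"
   using C1_on_zero_deriv[OF D(1) clK z] by blast+
  have c: "continuous_on UNIV \<phi>" "continuous_on UNIV (d_z \<phi>)" "continuous_on UNIV (d_zbar \<phi>)"
   using D(1) C1_on_imp_continuous[OF D(1)] by (auto simp: C1_on_def)
  \<comment> \<open>With a plateau equal to 1 near the support of \<open>\<phi>\<close>, the
    localised function agrees there with \<open>f\<close> and its weak derivatives agree with
    \<open>p\<close> and \<open>q\<close>.\<close>
  obtain \<eta> \<eta>a \<eta>b L V where \<eta>: "C1_on UNIV \<eta> \<eta>a \<eta>b" "compact L" "L \<subseteq> Om" "ALL z. z ~: L --> \<eta> z = 0" "open V" "K \<subseteq> V" "\<forall>z\<in>V. \<eta> z = 1"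
   using plateau_exists[OF Om(1) D(2,3)] by blast
  have \<eta>K: "\<eta> z = 1" "\<eta>a z = 0" "\<eta>b z = 0" if "z : K" for z
  proof -
   have zV: "z : V" using that \<eta> by blast
   have "wirt \<eta> 0 0 z"
   by (rule wirt_transform[OF wirt_const[of 1] \<eta>(5) zV]) (use \<eta>(7) in simp)
   moreover have "wirt \<eta> (\<eta>a z) (\<eta>b z) z" using \<eta>(1) by (simp add: C1_on_def)
   ultimately show "\<eta>a z = 0" "\<eta>b z = 0" using wirt_unique by blast+
   show "\<eta> z = 1" using \<eta>(7) zV by blast
  qed
  define F where "F z = (if z : Om then \<eta> z * f z else 0)" for z
  obtain P Q R where S: "sobolev F P Q R"
   and PQ: "AE z in lborel. P z = (if z : Om then \<eta> z * p z + \<eta>a z * f z else 0)"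
   "AE z in lborel. Q z = (if z : Om then \<eta> z * q z + \<eta>b z * f z else 0)"
   unfolding F_def using weak_on_localize[OF W \<eta>(1-4)] by blast
  have cF: "continuous_on UNIV F" using S by (simp add: sobolev_def)
  have FK: "F z = f z" if "z : K" for z using that D \<eta>K by (auto simp: F_def)
  obtain Fn An Bn where "approx_seq F P Q R Fn An Bn" using sobolev_approx[OF S] by blast
  hence C: "\<And>n. C1_on UNIV (Fn n) (An n) (Bn n)" and F0: "\<And>n z. cmod z >= R + 1 ==> Fn n z = 0"
   and U: "\<forall>e>0. \<forall>\<^sub>F n in sequentially. ALL z. cmod (Fn n z - F z) <= e"
   and A: "(%n. \<integral>z. cmod (An n z - P z) \<partial>lborel) \<longlonglongrightarrow> 0" "(%n. \<integral>z. cmod (Bn n z - Q z) \<partial>lborel) \<longlonglongrightarrow> 0"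
   unfolding approx_seq_def by simp_all
  have cn: "continuous_on UNIV (Fn n)" "continuous_on UNIV (An n)" "continuous_on UNIV (Bn n)" for n
   using C[of n] C1_on_imp_continuous[OF C[of n]] by (auto simp: C1_on_def)
  have AB0: "An n z = 0" "Bn n z = 0" if z: "z ~: cball 0 (R + 1)" for n z
   using C1_on_zero_deriv[OF C[of n] closed_cball[of 0 "R+1"] _ z] F0 by auto
  have iAB: "integrable lborel (An n)" "integrable lborel (Bn n)" for n
   by (rule integrable_csupp[of _ "cball 0 (R+1)"]; use AB0 cn in auto)+
  have "compact ((%z. 1 / (f z - c)) ` K)"
   by (rule compact_continuous_image[OF continuous_on_subset[OF cf(1) D(3)] D(2)])
  from compact_imp_bounded[OF this] obtain B where B0: "\<forall>x\<in>(%z. 1 / (f z - c)) ` K. cmod x <= B"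
   unfolding bounded_iff by blast
  have B: "cmod (1 / (f z - c)) <= B" if "z : K" for z using bspec[OF B0 imageI[OF that]] .
  \<comment> \<open>Half of a lower bound for \<open>cmod (f z - c)\<close> on \<open>K\<close>:
    approximants within \<open>\<delta>\<close> of \<open>F\<close> still avoid \<open>c\<close>
    there.\<close>
  define \<delta> where "\<delta> = (1 / (\<bar>B\<bar> + 1)) / 2"
  have \<delta>: "\<delta> > 0" by (simp add: \<delta>_def)
  have f\<delta>: "cmod (f z - c) >= 2 * \<delta>" if z: "z : K" for z
  proof -
   have pos: "cmod (f z - c) > 0" using ne z D(3) by auto
   have "1 / cmod (f z - c) <= \<bar>B\<bar> + 1" using B[OF z] by (simp add: norm_divide)
   hence "1 <= (\<bar>B\<bar> + 1) * cmod (f z - c)" using pos by (simp add: divide_le_eq)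
   hence "1 / (\<bar>B\<bar> + 1) <= cmod (f z - c)" by (simp add: divide_le_eq mult.commute)
   moreover have "2 * (x / 2) = x" for x :: real by simp
   hence "2 * \<delta> = 1 / (\<bar>B\<bar> + 1)" unfolding \<delta>_def .
   ultimately show ?thesis by linarith
  qed
  obtain N where N: "\<And>n z. n >= N ==> cmod (Fn n z - F z) <= \<delta>"
   using U \<delta> unfolding eventually_sequentially by blast
  have Fn\<delta>: "cmod (Fn (n + N) z - c) >= \<delta>" if z: "z : K" for n z
   using N[of "n + N" z] f\<delta>[OF z] FK[OF z] norm_triangle_ineq2[of "f z - c" "f z - Fn (n + N) z"]
   by (simp add: norm_minus_commute)
  have lim: "(%n. Fn (n + N) z) \<longlonglongrightarrow> F z" for z
  proof (rule LIMSEQ_ignore_initial_segment)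
   show "(%n. Fn n z) \<longlonglongrightarrow> F z"
   unfolding tendsto_iff
   proof (intro allI impI)
   fix e :: real assume "e > 0"
   hence "e/2 > 0" by simp
   hence "\<forall>\<^sub>F n in sequentially. ALL z. cmod (Fn n z - F z) <= e/2" using U by blast
   thus "\<forall>\<^sub>F n in sequentially. dist (Fn n z) (F z) < e"
   proof eventually_elim
   case (elim n)
   hence "cmod (Fn n z - F z) <= e/2" by blast
   thus ?case using \<open>e > 0\<close> by (simp add: dist_norm)
   qed
   qed
  qed
  have zero: "(LINT z|lborel. d_z \<phi> z / (Fn (n + N) z - c) - An (n + N) z * (\<phi> z / (Fn (n + N) z - c)^2)) = 0 \<and>
   (LINT z|lborel. d_zbar \<phi> z / (Fn (n + N) z - c) - Bn (n + N) z * (\<phi> z / (Fn (n + N) z - c)^2)) = 0" for n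
  proof -
   define m where "m = n + N"
   \<comment> \<open>Away from \<open>K\<close> the approximant may take the value \<open>c\<close>.
     The quotient is therefore differentiated on this open neighbourhood of \<open>K\<close> only
     and then extended by 0.\<close>
   define Uo where "Uo = {z. \<delta> / 2 < cmod (Fn m z - c)}"
   have oU: "open Uo" unfolding Uo_def by (intro open_Collect_less continuous_intros cn)
   have KU: "K \<subseteq> Uo" using Fn\<delta>[of _ n] \<delta> by (force simp: Uo_def m_def)
   have neU: "Fn m z - c ~= 0" if "z : Uo" for z using that \<delta> by (auto simp: Uo_def)
   have inv: "C1_on Uo (%z. inverse (Fn m z - c)) (%z. - An m z / (Fn m z - c)^2) (%z. - Bn m z / (Fn m z - c)^2)"
   unfolding C1_on_def
   proof (intro conjI ballI)
   fix z assume zU: "z : Uo"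
   have "((%w. inverse (w - c)) has_field_derivative - (1 / (Fn m z - c)^2)) (at (Fn m z))"
   using neU[OF zU] by (auto intro!: derivative_eq_intros simp: power2_eq_square divide_simps)
   moreover have "wirt (Fn m) (An m z) (Bn m z) z" using C[of m] by (simp add: C1_on_def)
   ultimately show "wirt (%z. inverse (Fn m z - c)) (- An m z / (Fn m z - c)^2) (- Bn m z / (Fn m z - c)^2) z"
   using wirt_compose_field[of "Fn m" "An m z" "Bn m z" z "%w. inverse (w - c)"] by fastforce
   next
   show "continuous_on Uo (%z. - An m z / (Fn m z - c)^2)" "continuous_on Uo (%z. - Bn m z / (Fn m z - c)^2)"
   by (intro continuous_intros continuous_on_subset[OF cn(1) subset_UNIV] continuous_on_subset[OF cn(2) subset_UNIV] continuous_on_subset[OF cn(3) subset_UNIV]; use neU in simp)+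
   qed
   have pr: "C1_on Uo (%z. \<phi> z * inverse (Fn m z - c))
   (%z. d_z \<phi> z / (Fn m z - c) - An m z * (\<phi> z / (Fn m z - c)^2))
   (%z. d_zbar \<phi> z / (Fn m z - c) - Bn m z * (\<phi> z / (Fn m z - c)^2))"
   by (rule C1_on_cong[OF C1_on_mult[OF C1_on_subset[OF D(1) subset_UNIV] inv]]) (auto simp: divide_inverse)
   have "C1_on UNIV (%z. if z : Uo then \<phi> z * inverse (Fn m z - c) else 0)
   (%z. if z : Uo then d_z \<phi> z / (Fn m z - c) - An m z * (\<phi> z / (Fn m z - c)^2) else 0)
   (%z. if z : Uo then d_zbar \<phi> z / (Fn m z - c) - Bn m z * (\<phi> z / (Fn m z - c)^2) else 0)"
   by (rule C1_on_extend[OF pr oU D(2) KU]) (simp add: z)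
   note iz = integral_wirt_zero[OF this D(2)]
   have zz: "z ~: K ==> (if z : Uo then \<phi> z * inverse (Fn m z - c) else 0) = 0" for z by (simp add: z)
   have off: "\<phi> z = 0 & d_z \<phi> z = 0 & d_zbar \<phi> z = 0" if "z ~: Uo" for z using that KU D(4) z2' by blast
   have "(%z. if z : Uo then d_z \<phi> z / (Fn m z - c) - An m z * (\<phi> z / (Fn m z - c)^2) else 0) = (%z. d_z \<phi> z / (Fn m z - c) - An m z * (\<phi> z / (Fn m z - c)^2))"
   "(%z. if z : Uo then d_zbar \<phi> z / (Fn m z - c) - Bn m z * (\<phi> z / (Fn m z - c)^2) else 0) = (%z. d_zbar \<phi> z / (Fn m z - c) - Bn m z * (\<phi> z / (Fn m z - c)^2))"
   using off by (auto simp: fun_eq_iff)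
   thus ?thesis using iz zz unfolding m_def[symmetric] by simp
  qed
  have int: "integrable lborel P" "integrable lborel Q" using sobolev_integrable[OF S] by auto
  have L1: "(LINT z|lborel. d_z \<phi> z / (F z - c)) = (LINT z|lborel. P z * (\<phi> z / (F z - c)^2))"
   by (rule inverse_chain_limit[OF D(2) cF int(1) c(1,2) D(4) z2'(1) \<delta>, of "%n. Fn (n + N)" c "%n. An (n + N)"])
   (use cn Fn\<delta> lim iAB zero LIMSEQ_ignore_initial_segment[OF A(1)] in auto)
  have L2: "(LINT z|lborel. d_zbar \<phi> z / (F z - c)) = (LINT z|lborel. Q z * (\<phi> z / (F z - c)^2))"
   by (rule inverse_chain_limit[OF D(2) cF int(2) c(1,3) D(4) z2'(2) \<delta>, of "%n. Fn (n + N)" c "%n. Bn (n + N)"])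
   (use cn Fn\<delta> lim iAB zero LIMSEQ_ignore_initial_segment[OF A(2)] in auto)
  note [measurable] = continuous_bmeas[OF cF] continuous_bmeas[OF c(1)]
   continuous_bmeas[OF c(2)] continuous_bmeas[OF c(3)]
  have Pm[measurable]: "P : bmeas borel" "Q : bmeas borel" using S by (auto simp: sobolev_def)
  have on: "h : bmeas (leb Om)" if "continuous_on Om h" for h :: cfun
   by (rule continuous_measurable_leb[OF that Om(2)])
  have lhs: "(LINT z|leb Om. 1 / (f z - c) * \<alpha> z) = (LINT z|lborel. \<alpha> z / (F z - c))"
   if \<alpha>: "continuous_on UNIV \<alpha>" "ALL z. z ~: K --> \<alpha> z = 0" for \<alpha>
  proof (rule lebesgue_on_integral_borel[OF Om(2)])
   show "(%z. 1 / (f z - c) * \<alpha> z) : bmeas (leb Om)"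
   by (intro on continuous_on_mult cf continuous_on_subset[OF \<alpha>(1) subset_UNIV])
   note [measurable] = continuous_bmeas[OF \<alpha>(1)]
   show "(%z. \<alpha> z / (F z - c)) : bmeas borel" by measurable
   show "AE z in lborel. \<alpha> z / (F z - c) = (if z : Om then 1 / (f z - c) * \<alpha> z else 0)"
   proof (rule AE_I2)
   fix z show "\<alpha> z / (F z - c) = (if z : Om then 1 / (f z - c) * \<alpha> z else 0)"
   using \<alpha>(2) FK D(3) by (cases "z : K") auto
   qed
  qed
  have rhs: "(LINT z|leb Om. - 1 / (f z - c)^2 * p z * \<phi> z) = (LINT z|lborel. - (P z * (\<phi> z / (F z - c)^2)))"
   if p: "locally_L2 Om p" and Pm: "P : bmeas borel" and PQ: "AE z in lborel. P z = (if z : Om then \<eta> z * p z + \<eta>a z * f z else 0)" and \<eta>K: "\<forall>z\<in>K. \<eta> z = 1 & \<eta>a z = 0" for p P \<eta>a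
  proof (rule lebesgue_on_integral_borel[OF Om(2)])
   have "p : bmeas (leb Om)" using p by (simp add: locally_L2_def)
   thus "(%z. - 1 / (f z - c)^2 * p z * \<phi> z) : bmeas (leb Om)"
   using on[OF cf(2)] on[OF continuous_on_subset[OF c(1) subset_UNIV]]
   by (intro borel_measurable_times)
   note [measurable] = Pm
   show "(%z. - (P z * (\<phi> z / (F z - c)^2))) : bmeas borel" by measurable
   show "AE z in lborel. - (P z * (\<phi> z / (F z - c)^2)) = (if z : Om then - 1 / (f z - c)^2 * p z * \<phi> z else 0)"
   using PQ
   proof eventually_elim
   case (elim z)
   show ?case using elim \<eta>K D(3,4) FK by (cases "z : K") auto
   qed
  qed
  show ?thesis
   using lhs[OF c(2) z2'(1)] lhs[OF c(3) z2'(2)] rhs[OF L(1) Pm(1) PQ(1)] rhs[OF L(2) Pm(2) PQ(2)] \<eta>K L1 L2 by simp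
 qed
 show ?thesis
  unfolding weak_on_def weak_d_z_def weak_d_zbar_def
  using Om cf main locally_L2_mult[OF L(1) cf(2) Om(1)] locally_L2_mult[OF L(2) cf(2) Om(1)] by auto
qed

section \<open>Tail integrals and an area form of Cauchy's formula\<close>

text \<open>A geometric series over dyadic annuli: the annulus number j contributes at most 4
  (1/4)^j / r^2 times the area of the unit disc, and 4 / (1 - 1/4) = 16 / 3. It is the scaling 1 /
  r^2 that matters, not the sharpness of the constant.\<close>

definition tail_const :: real where "tail_const = 16 / 3 * unit_ball_vol 2"

lemma tail_const_nonneg: "tail_const >= 0" by (simp add: tail_const_def)

lemma tail_integral:
 assumes r: "r > 0"
 shows "(\<integral>\<^sup>+z. ennreal (if r <= cmod (z - p) then 1 / (cmod (z - p))^4 else 0) \<partial>lborel) <= ennreal (tail_const / r^2)"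
proof -
 define t where "t j = 1 / (r * 2^j)^4" for j :: nat
 have pw: "ennreal (if r <= cmod (z - p) then 1 / (cmod (z - p))^4 else 0) <= (\<Sum>j. ennreal (t j) * indicator (cball p (r * 2^(Suc j))) z)" for z
 proof (cases "r <= cmod (z - p)")
  case True
  define x where "x = cmod (z - p) / r"
  have x: "x >= 1" using True r by (simp add: x_def)
  define j where "j = (LEAST n. x < 2^(Suc n))"
  have "EX n. x < 2^n" by (rule real_arch_pow) simp
  then obtain n where "x < 2^n" by blast
  moreover have "(2::real)^n <= 2^(Suc n)" by (rule power_increasing) auto
  ultimately have "x < 2^(Suc n)" by linarith
  hence j1: "x < 2^(Suc j)" unfolding j_def by (rule LeastI)
  have j2: "2^j <= x"
  proof (cases j)
   case (Suc i)
   hence "~ x < 2^(Suc i)" using not_less_Least[of i "%n. x < 2^(Suc n)"] j_def by simp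
   thus ?thesis using Suc by simp
  qed (use x in simp)
  have a: "r * 2^j <= cmod (z - p)" "cmod (z - p) <= r * 2^(Suc j)"
   using j1 j2 r by (simp_all add: x_def field_simps)
  have p1: "0 < r * 2^j" using r by simp
  hence p2: "0 < cmod (z - p)" using a(1) by linarith
  have "1 / (cmod (z - p))^4 <= t j"
   unfolding t_def by (rule frac_le) (use zero_less_power[OF p1, of 4] power_mono[OF a(1), of 4] p1 in auto)
  hence "ennreal (1 / (cmod (z - p))^4) <= ennreal (t j) * indicator (cball p (r * 2^(Suc j))) z"
   using a(2) by (simp add: dist_norm norm_minus_commute ennreal_leI)
  also have "... = (\<Sum>i\<in>{j}. ennreal (t i) * indicator (cball p (r * 2^(Suc i))) z)"
   by (simp only: sum.insert finite.emptyI empty_iff not_False_eq_True sum.empty add_0_right)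
  also have "... <= (\<Sum>j. ennreal (t j) * indicator (cball p (r * 2^(Suc j))) z)"
   by (rule sum_le_suminf) auto
  finally show ?thesis using True by simp
 qed simp
 have "(\<integral>\<^sup>+z. ennreal (if r <= cmod (z - p) then 1 / (cmod (z - p))^4 else 0) \<partial>lborel)
   <= (\<integral>\<^sup>+z. (\<Sum>j. ennreal (t j) * indicator (cball p (r * 2^(Suc j))) z) \<partial>lborel)"
  by (intro nn_integral_mono pw)
 also have "... = (\<Sum>j. \<integral>\<^sup>+z. ennreal (t j) * indicator (cball p (r * 2^(Suc j))) z \<partial>lborel)"
  by (rule nn_integral_suminf) (auto intro!: borel_measurable_times_ennreal borel_measurable_indicator)
 also have "... = (\<Sum>j. ennreal (t j) * emeasure lborel (cball p (r * 2^(Suc j))))"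
  by (intro suminf_cong nn_integral_cmult_indicator) auto
 also have "... = (\<Sum>j. ennreal (4 * unit_ball_vol 2 / r^2 * (1/4)^j))"
 proof (rule suminf_cong)
  fix j
  have "emeasure lborel (cball p (r * 2^(Suc j))) = ennreal (unit_ball_vol 2 * (r * 2^(Suc j))^2)"
   using emeasure_cball[of "r * 2^(Suc j)" p] r by simp
  hence "ennreal (t j) * emeasure lborel (cball p (r * 2^(Suc j))) = ennreal (t j * (unit_ball_vol 2 * (r * 2^(Suc j))^2))"
   using r by (subst ennreal_mult) (auto simp: t_def)
  also have "t j * (unit_ball_vol 2 * (r * 2^(Suc j))^2) = 4 * unit_ball_vol 2 / r^2 * (1/4)^j"
  proof -
   have "(2::real)^j * 2^j = 4^j" by (simp add: power_mult_distrib[symmetric])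
   thus ?thesis using r unfolding t_def
   by (simp add: field_simps power2_eq_square power4_eq_xxxx power_divide)
  qed
  finally show "ennreal (t j) * emeasure lborel (cball p (r * 2^(Suc j))) = ennreal (4 * unit_ball_vol 2 / r^2 * (1/4)^j)" .
 qed
 also have "... = ennreal (\<Sum>j. 4 * unit_ball_vol 2 / r^2 * (1/4)^j)"
  by (rule suminf_ennreal2) (auto intro!: summable_mult summable_geometric)
 also have "(\<Sum>j. 4 * unit_ball_vol 2 / r^2 * (1/4)^j) = tail_const / r^2"
  by (subst suminf_mult) (auto intro!: summable_geometric simp: suminf_geometric tail_const_def)
 finally show ?thesis .
qed

lemma integral_affine_complex:
 fixes f :: cfun
 assumes r: "r > 0" and f[measurable]: "f : bmeas borel"
 shows "integral\<^sup>L lborel f = of_real (r^2) * (LINT w|lborel. f (p + of_real r * w))"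
proof -
 have l: "lborel = density (distr lborel borel (%x::complex. p + r *\<^sub>R x)) (%_. ennreal (\<bar>r\<bar> ^ DIM(complex)))"
  by (rule lborel_affine) (use r in simp)
 have "integral\<^sup>L lborel f = integral\<^sup>L (density (distr lborel borel (%x::complex. p + r *\<^sub>R x)) (%_. ennreal (\<bar>r\<bar> ^ DIM(complex)))) f"
  using l by simp
 also have "... = (\<integral>x. (\<bar>r\<bar> ^ DIM(complex)) *\<^sub>R f x \<partial>distr lborel borel (%x::complex. p + r *\<^sub>R x))"
  by (rule integral_density) auto
 also have "... = (LINT x|lborel. (\<bar>r\<bar> ^ DIM(complex)) *\<^sub>R f (p + r *\<^sub>R x))"
  by (rule integral_distr) auto
 also have "... = of_real (r^2) * (LINT w|lborel. f (p + of_real r * w))"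
  using r by (simp add: scaleR_conv_of_real)
 finally show ?thesis .
qed

lemma dbump_continuous: "continuous_on UNIV (dbump p r1 r2)"
 unfolding dbump_def[abs_def] Let_def by (intro continuous_intros)

lemma dbump_integrable:
 assumes "0 < r1" "r1 < r2" shows "integrable lborel (dbump p r1 r2)"
proof (rule integrable_csupp[OF dbump_continuous compact_cball[of p r2]])
 fix z assume "z ~: cball p r2"
 thus "dbump p r1 r2 z = 0" by (intro bump_outer(2) assms) (auto simp: dist_norm norm_minus_commute)
qed

text \<open>In polar coordinates the value is pi times the drop of the bump from 1 to 0, that is pi;
  positivity is all that later arguments need, since the constant cancels into
  \<open>kap\<close>.\<close>

definition annulus_const :: real where "annulus_const = - (LINT z|lborel. dbump 0 1 2 z)"

lemma dbump_scale:
 assumes r: "r > 0"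
 shows "dbump p r (2 * r) (p + of_real r * w) = dbump 0 1 2 w / r^2"
proof -
 have c: "(cmod (p + of_real r * w - p))^2 = r^2 * (cmod w)^2" using r by (simp add: norm_mult power_mult_distrib)
 have m1: "max 0 ((2 * r)^2 - r^2 * (cmod w)^2) = r^2 * max 0 (2^2 - (cmod w)^2)"
  using r by (subst max_mult_distrib_left) (simp add: power_mult_distrib algebra_simps)
 have m2: "max 0 (r^2 - r^2 * (cmod w)^2) = r^2 * max 0 (1^2 - (cmod w)^2)"
  using r by (subst max_mult_distrib_left) (simp add: algebra_simps)
 have L: "(2 * r)^2 - r^2 = r^2 * 3" by (simp add: power_mult_distrib)
 define u v R where "u = max 0 (2^2 - (cmod w)^2)" and "v = max 0 (1^2 - (cmod w)^2)" and "R = r^2"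
 have R: "R > 0" using r by (simp add: R_def)
 show ?thesis
  unfolding dbump_def Let_def diff_0_right c
  unfolding m1 m2 L
  unfolding u_def[symmetric] v_def[symmetric] R_def[symmetric]
  using R by (simp add: field_simps power2_eq_square power3_eq_cube)
qed

lemma dbump_integral:
 assumes r: "r > 0"
 shows "(LINT z|lborel. complex_of_real (dbump p r (2 * r) z)) = - of_real annulus_const"
proof -
 have "(LINT z|lborel. complex_of_real (dbump p r (2 * r) z)) = of_real (r^2) * (LINT w|lborel. complex_of_real (dbump p r (2 * r) (p + of_real r * w)))"
  by (rule integral_affine_complex[OF r]) (intro continuous_bmeas continuous_intros dbump_continuous)
 also have "... = of_real (r^2) * (LINT w|lborel. complex_of_real (dbump 0 1 2 w / r^2))"
  by (simp only: dbump_scale[OF r])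
 also have "... = (LINT w|lborel. complex_of_real (dbump 0 1 2 w))"
  using r by (simp add: of_real_divide)
 also have "... = - of_real annulus_const" by (simp only: integral_complex_of_real annulus_const_def) simp
 finally show ?thesis .
qed

lemma annulus_const_pos: "annulus_const > 0"
proof -
 have i: "integrable lborel (%z. - dbump 0 1 2 z)" using dbump_integrable[of 1 2 0] by simp
 have le: "dbump 0 1 2 z <= 0" for z
  using bump_inner(2)[of 1 2 z 0] bump_outer(2)[of 1 2 z 0] bump_middle(3)[of 1 2 z 0]
  by (cases "cmod z <= 1"; cases "2 <= cmod z") auto
 have eq: "annulus_const = (LINT z|lborel. - dbump 0 1 2 z)" by (simp add: annulus_const_def)
 have "annulus_const >= 0" unfolding eq by (rule integral_nonneg_AE) (use le in auto)
 moreover have "annulus_const ~= 0"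
 proof
  assume "annulus_const = 0"
  hence "AE z in lborel. - dbump 0 1 2 z = 0"
   unfolding eq using integral_nonneg_eq_0_iff_AE[OF i] le by auto
  \<comment> \<open>This disc lies in the open annulus between the radii 1 and 2, where
    \<open>dbump 0 1 2\<close> is strictly negative.\<close>
  hence "AE z in lborel. z ~: ball (3/2::complex) (1/2)"
  proof eventually_elim
   case (elim z)
   show ?case
   proof
   assume "z : ball (3/2::complex) (1/2)"
   hence d: "cmod (z - 3/2) < 1/2" by (simp add: dist_norm norm_minus_commute)
   have "cmod z <= cmod (z - 3/2) + cmod (3/2)" using norm_triangle_ineq[of "z - 3/2" "3/2"] by simp
   moreover have "cmod (3/2) - cmod (z - 3/2) <= cmod z" using norm_triangle_ineq2[of "3/2" "3/2 - z"] by (simp add: norm_minus_commute)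
   moreover have "cmod (3/2) = 3/2" by (simp add: norm_divide)
   ultimately have "1 < cmod z" "cmod z < 2" using d by linarith+
   thus False using bump_middle(5)[of 1 2 z 0] elim by simp
   qed
  qed
  hence "ball (3/2::complex) (1/2) : null_sets lborel" by (simp add: AE_iff_null_sets)
  thus False using open_not_negligible[of "ball (3/2::complex) (1/2)"] by (simp add: negligible_iff_emeasure0 null_sets_def)
 qed
 ultimately show ?thesis by simp
qed

text \<open>Cauchy's formula for the derivative, averaged over an annulus: the integrand is
  \<open>g z / (z - p)^2\<close> times the dbar derivative of the bump. Expand \<open>g\<close> to
  second order at \<open>p\<close>. The constant term integrates to 0 by symmetry, the linear one
  gives the derivative, and the remainder is an exact dbar derivative.\<close>

lemma annulus_formula:
 assumes r: "r > 0" and g: "g holomorphic_on ball p (3 * r)"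
 shows "integrable lborel (%z. if z : ball p (3 * r) then of_real (dbump p r (2 * r) z) / (z - p) * g z else 0)"
  "(LINT z|lborel. (if z : ball p (3 * r) then of_real (dbump p r (2 * r) z) / (z - p) * g z else 0)) = - of_real annulus_const * deriv g p"
proof -
 define U where "U = ball p (3 * r)"
 have oU: "open U" and pU: "p : U" "p : interior U" using r by (auto simp: U_def)
 have gU: "g holomorphic_on U" using g by (simp add: U_def)
 have rr: "0 < r" "r < 2 * r" using r by auto
 define g1 where "g1 z = (if z = p then deriv g p else (g z - g p) / (z - p))" for z
 have g1h: "g1 holomorphic_on U" unfolding g1_def[abs_def] by (rule pole_lemma[OF gU pU(2)])
 define G where "G z = (if z = p then deriv g1 p else (g1 z - g1 p) / (z - p))" for z
 have Gh: "G holomorphic_on U" unfolding G_def[abs_def] by (rule pole_lemma[OF g1h pU(2)])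
 have exp: "g z = g p + (z - p) * (deriv g p + (z - p) * G z)" for z
  by (cases "z = p") (simp_all add: G_def g1_def)
 define d where "d z = complex_of_real (dbump p r (2 * r) z)" for z
 have di: "integrable lborel d" unfolding d_def[abs_def] using dbump_integrable[OF rr] by simp
 have dm[measurable]: "d : bmeas borel" unfolding d_def[abs_def]
  by (intro continuous_bmeas continuous_intros dbump_continuous)
 have d0: "d z = 0" if "cmod (z - p) <= r \<or> 2 * r <= cmod (z - p)" for z
  using that bump_inner(2)[OF rr, of z p] bump_outer(2)[OF rr, of z p] by (auto simp: d_def)
 have i1: "integrable lborel (%z. d z / (z - p))"
 proof (rule integrable_dom[OF integrable_mult_left[OF integrable_norm[OF di], of "1 / r"]])
  have "cmod (d z / (z - p)) <= cmod (d z) * (1 / r)" for z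
  proof (cases "cmod (z - p) <= r")
   case True thus ?thesis using d0[of z] by simp
  next
   case False
   hence "cmod (d z) / cmod (z - p) <= cmod (d z) / r" using r by (intro divide_left_mono mult_pos_pos) auto
   thus ?thesis by (simp add: norm_divide)
  qed
  thus "AE z in lborel. norm (d z / (z - p)) <= norm (cmod (d z) * (1 / r))" using r by (intro AE_I2) simp
 qed measurable
 \<comment> \<open>Point reflection in \<open>p\<close> preserves the radial factor and changes the
   sign of \<open>z - p\<close>.\<close>
 have z1: "(LINT z|lborel. d z / (z - p)) = 0"
 proof -
  have "(LINT z|lborel. d z / (z - p)) = (LINT z|lborel. d (2 * p - z) / ((2 * p - z) - p))"
   by (rule integral_reflect[symmetric, of "%z. d z / (z - p)"]) measurable
  also have "... = (LINT z|lborel. - (d z / (z - p)))"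
  proof (rule Bochner_Integration.integral_cong[OF refl])
   fix z
   have e: "(2 * p - z) - p = - (z - p)" by simp
   have n: "cmod (2 * p - z - p) = cmod (z - p)" unfolding e by (simp add: norm_minus_commute)
   have dd: "d (2 * p - z) = d z" unfolding d_def dbump_def n ..
   thus "d (2 * p - z) / ((2 * p - z) - p) = - (d z / (z - p))" by (simp only: dd e divide_minus_right)
  qed
  finally show ?thesis by simp
 qed
 \<comment> \<open>The second-order remainder is the dbar derivative of the bump times
   \<open>G\<close>, a compactly supported function, so its integral vanishes.\<close>
 have C: "C1_on U (%z. of_real (bump p r (2 * r) z) * G z) (%z. of_real (dbump p r (2 * r) z) * cnj (z - p) * G z + of_real (bump p r (2 * r) z) * deriv G z)
   (%z. of_real (dbump p r (2 * r) z) * (z - p) * G z + of_real (bump p r (2 * r) z) * 0)"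
  by (rule C1_on_mult[OF C1_on_subset[OF bump_C1 subset_UNIV] C1_on_holomorphic[OF Gh oU]])
 have sub: "cball p (2 * r) \<subseteq> U" using r by (auto simp: U_def)
 have b0: "z ~: cball p (2 * r) ==> of_real (bump p r (2 * r) z) * G z = 0" for z
  using bump_outer(1)[OF rr, of z p] by (simp add: dist_norm norm_minus_commute)
 have CC: "C1_on UNIV (%z. if z : U then of_real (bump p r (2 * r) z) * G z else 0)
   (%z. if z : U then of_real (dbump p r (2 * r) z) * cnj (z - p) * G z + of_real (bump p r (2 * r) z) * deriv G z else 0)
   (%z. if z : U then of_real (dbump p r (2 * r) z) * (z - p) * G z + of_real (bump p r (2 * r) z) * 0 else 0)"
  by (rule C1_on_extend[OF C oU compact_cball sub]) (rule b0)
 have b1: "z ~: cball p (2 * r) ==> (if z : U then of_real (bump p r (2 * r) z) * G z else 0) = 0" for z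
  using b0 by simp
 have z3: "(LINT z|lborel. (if z : U then d z * (z - p) * G z else 0)) = 0"
  using integral_wirt_zero(2)[OF CC compact_cball b1] by (simp add: d_def cong: if_cong)
 have i3: "integrable lborel (%z. if z : U then d z * (z - p) * G z else 0)"
 proof -
  have c: "continuous_on UNIV (%z. if z : U then of_real (dbump p r (2 * r) z) * (z - p) * G z + of_real (bump p r (2 * r) z) * 0 else 0)"
   using CC by (simp add: C1_on_def)
  have "(if z : U then of_real (dbump p r (2 * r) z) * (z - p) * G z + of_real (bump p r (2 * r) z) * 0 else 0) = 0" if "z ~: cball p (2 * r)" for z
   using d0[of z] that by (simp add: d_def dist_norm norm_minus_commute)
  from integrable_csupp[OF c compact_cball this] show ?thesis by (simp add: d_def cong: if_cong)
 qed
 have e: "(%z. if z : U then of_real (dbump p r (2 * r) z) / (z - p) * g z else 0)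
  = (%z. g p * (d z / (z - p)) + (deriv g p * d z + (if z : U then d z * (z - p) * G z else 0)))"
 proof
  fix z
  show "(if z : U then of_real (dbump p r (2 * r) z) / (z - p) * g z else 0) = g p * (d z / (z - p)) + (deriv g p * d z + (if z : U then d z * (z - p) * G z else 0))"
  proof (cases "z : U & z ~= p")
   case True
   have "of_real (dbump p r (2 * r) z) / (z - p) * g z = d z / (z - p) * (g p + (z - p) * (deriv g p + (z - p) * G z))"
   using exp[of z] by (simp add: d_def)
   also have "... = g p * (d z / (z - p)) + (deriv g p * d z + d z * (z - p) * G z)"
   using True by (simp add: field_simps)
   finally show ?thesis using True by simp
  next
   case False
   hence "d z = 0" using d0[of z] r by (auto simp: U_def dist_norm norm_minus_commute)
   thus ?thesis by (simp add: d_def)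
  qed
 qed
 show "integrable lborel (%z. if z : ball p (3 * r) then of_real (dbump p r (2 * r) z) / (z - p) * g z else 0)"
  unfolding U_def[symmetric] e
  by (intro Bochner_Integration.integrable_add integrable_mult_right i1 di i3)
 have dint: "integral\<^sup>L lborel d = - of_real annulus_const" unfolding d_def[abs_def] by (rule dbump_integral[OF r])
 show "(LINT z|lborel. (if z : ball p (3 * r) then of_real (dbump p r (2 * r) z) / (z - p) * g z else 0)) = - of_real annulus_const * deriv g p"
 proof -
  have "(LINT z|lborel. g p * (d z / (z - p)) + (deriv g p * d z + (if z : U then d z * (z - p) * G z else 0)))
   = (LINT z|lborel. g p * (d z / (z - p))) + ((LINT z|lborel. deriv g p * d z) + (LINT z|lborel. (if z : U then d z * (z - p) * G z else 0)))"
   by (subst Bochner_Integration.integral_add Bochner_Integration.integral_add;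
   (intro Bochner_Integration.integrable_add integrable_mult_right i1 di i3)?)+ simp
  also have "... = g p * 0 + (deriv g p * (- of_real annulus_const) + 0)"
   by (simp only: integral_mult_right_zero z1 z3 dint)
  finally show ?thesis unfolding U_def[symmetric] e by simp
 qed
qed

section \<open>Cutoffs at two points and at infinity, and the energy estimate\<close>

lemma norm_add_sq: "(cmod (x + y))^2 <= 2 * (cmod x)^2 + 2 * (cmod y)^2"
proof -
 have "(cmod (x + y))^2 <= (cmod x + cmod y)^2" by (intro power_mono norm_triangle_ineq) auto
 also have "... <= 2 * (cmod x)^2 + 2 * (cmod y)^2"
  using zero_le_power2[of "cmod x - cmod y"] by (simp add: power2_sum power2_diff)
 finally show ?thesis .
qed

lemma norm_add3_sq: "(cmod (x + y + w))^2 <= 3 * ((cmod x)^2 + (cmod y)^2 + (cmod w)^2)"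
proof -
 have "(cmod (x + y + w))^2 <= (cmod x + cmod y + cmod w)^2"
  by (intro power_mono order_trans[OF norm_triangle_ineq] add_right_mono norm_triangle_ineq) auto
 also have "... <= 3 * ((cmod x)^2 + (cmod y)^2 + (cmod w)^2)"
  using zero_le_power2[of "cmod x - cmod y"] zero_le_power2[of "cmod x - cmod w"] zero_le_power2[of "cmod y - cmod w"]
  by (simp add: power2_eq_square algebra_simps)
 finally show ?thesis .
qed

text \<open>The intended \<open>p\<close> and \<open>q\<close> are the point of evaluation and the
  pole; infinity is the third end. The 9 in the energy bounds is three ladders times the factor 3
  from squaring a sum of three terms.\<close>

definition cutoff :: "complex => complex => nat => (complex => real) => cfun => cfun => complex set => bool" where
 "cutoff p q N \<eta> a b K \<longleftrightarrow> C1_on UNIV (%z. of_real (\<eta> z)) a b & (ALL z. 0 <= \<eta> z & \<eta> z <= 1) \<and>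
  compact K & K \<subseteq> - {p, q} & (ALL z. z ~: K --> \<eta> z = 0) \<and>
  (energy a) <= ennreal (9 * ladder_const / real N) \<and>
  (energy b) <= ennreal (9 * ladder_const / real N) \<and>
  (ALL z. cmod z <= real N & 1 / real N <= cmod (z - p) & 1 / real N <= cmod (z - q) --> \<eta> z = 1)"

lemma cutoff_exists:
 assumes N: "N > 0"
 shows "EX \<eta> a b K. cutoff p q N \<eta> a b K"
proof -
 \<comment> \<open>The ladders at \<open>p\<close> and \<open>q\<close> run from radius
   \<open>\<epsilon>\<close> to \<open>\<epsilon> * 2^N = 1 / real N\<close>, the one at 0 starts at
   radius \<open>real N\<close>; so the region where the cutoff is 1 exhausts the punctured
   plane.\<close>
 define \<epsilon> where "\<epsilon> = 1 / (real N * 2^N)"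
 have e: "\<epsilon> > 0" "\<epsilon> * 2^N = 1 / real N" using N by (auto simp: \<epsilon>_def)
 have RN: "real N > 0" using N by simp
 define l1 l2 l3 where "l1 = ladder p \<epsilon> N" and "l2 = ladder q \<epsilon> N" and "l3 = ladder 0 (real N) N"
 define d1 d2 d3 where "d1 = dladder p \<epsilon> N" and "d2 = dladder q \<epsilon> N" and "d3 = dladder 0 (real N) N"
 note p1 = ladder_props[OF e(1) N, where p=p, folded l1_def d1_def] and p2 = ladder_props[OF e(1) N, where p=q, folded l2_def d2_def]
  and p3 = ladder_props[OF RN N, where p=0, folded l3_def d3_def]
 define \<eta> where "\<eta> z = (1 - l1 z) * (1 - l2 z) * l3 z" for z
 define g where "g c1 c2 c3 z = - (c1 z * complex_of_real ((1 - l2 z) * l3 z)) + - (c2 z * of_real ((1 - l1 z) * l3 z)) + c3 z * of_real ((1 - l1 z) * (1 - l2 z))" for c1 c2 c3 z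
 define a where "a = g (%z. of_real (d1 z) * cnj (z - p)) (%z. of_real (d2 z) * cnj (z - q)) (%z. of_real (d3 z) * cnj (z - 0))"
 define b where "b = g (%z. of_real (d1 z) * (z - p)) (%z. of_real (d2 z) * (z - q)) (%z. of_real (d3 z) * (z - 0))"
 define K where "K = cball 0 (real N * 2^N) - ball p \<epsilon> - ball q \<epsilon>"
 have C1: "C1_on UNIV (%z. of_real (\<eta> z)) a b"
 proof -
  note L1 = C1_on_diff[OF C1_on_const[of UNIV 1] ladder_C1[of p \<epsilon> N], folded l1_def d1_def]
  note L2 = C1_on_diff[OF C1_on_const[of UNIV 1] ladder_C1[of q \<epsilon> N], folded l2_def d2_def]
  note L3 = ladder_C1[of 0 "real N" N, folded l3_def d3_def]
  have "C1_on UNIV (%z. (1 - of_real (l1 z)) * (1 - of_real (l2 z)) * of_real (l3 z)) a b"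
   by (rule C1_on_cong[OF C1_on_mult[OF C1_on_mult[OF L1 L2] L3]]) (auto simp: a_def b_def g_def algebra_simps)
  thus ?thesis by (simp add: \<eta>_def)
 qed
 have r: "0 <= \<eta> z & \<eta> z <= 1" for z
 proof -
  have "(1 - l1 z) * (1 - l2 z) * l3 z <= 1 * 1 * 1" using p1[of z] p2[of z] p3[of z] by (intro mult_mono) auto
  thus ?thesis using p1[of z] p2[of z] p3[of z] by (simp add: \<eta>_def)
 qed
 have en: "(energy (%z. g (%z. of_real (d1 z) * s (z - p)) (%z. of_real (d2 z) * s (z - q)) (%z. of_real (d3 z) * s (z - 0)) z)) <= ennreal (9 * ladder_const / real N)"
  if s: "\<And>w. cmod (s w) = cmod w" for s :: cfun
 proof -
  have dm: "continuous_on UNIV d1" "continuous_on UNIV d2" "continuous_on UNIV d3"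
   unfolding d1_def d2_def d3_def dladder_def[abs_def] divide_inverse by (intro continuous_intros dbump_continuous)+
  note [measurable] = continuous_bmeas[OF dm(1)] continuous_bmeas[OF dm(2)] continuous_bmeas[OF dm(3)]
  define e1 e2 e3 where "e1 z = ennreal ((cmod (of_real (d1 z) * (z - p)))^2)" and "e2 z = ennreal ((cmod (of_real (d2 z) * (z - q)))^2)" and "e3 z = ennreal ((cmod (of_real (d3 z) * (z - 0)))^2)" for z
  have [measurable]: "e1 : bmeas borel" "e2 : bmeas borel" "e3 : bmeas borel"
   unfolding e1_def[abs_def] e2_def[abs_def] e3_def[abs_def] by measurable
  have pw: "ennreal ((cmod (g (%z. of_real (d1 z) * s (z - p)) (%z. of_real (d2 z) * s (z - q)) (%z. of_real (d3 z) * s (z - 0)) z))^2) <= 3 * (e1 z + e2 z + e3 z)" for z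
  proof -
   have m: "(cmod (x * of_real t))^2 <= (cmod x)^2" if "0 <= t" "t <= 1" for x t
   using that by (simp add: norm_mult power_mult_distrib mult_left_le power_le_one)
   have t: "0 <= (1 - l2 z) * l3 z" "(1 - l2 z) * l3 z <= 1" "0 <= (1 - l1 z) * l3 z" "(1 - l1 z) * l3 z <= 1"
   "0 <= (1 - l1 z) * (1 - l2 z)" "(1 - l1 z) * (1 - l2 z) <= 1"
   using p1(1,2)[of z] p2(1,2)[of z] p3(1,2)[of z] by (auto intro!: mult_le_one)
   have "(cmod (g (%z. of_real (d1 z) * s (z - p)) (%z. of_real (d2 z) * s (z - q)) (%z. of_real (d3 z) * s (z - 0)) z))^2
   <= 3 * ((cmod (of_real (d1 z) * s (z - p)))^2 + (cmod (of_real (d2 z) * s (z - q)))^2 + (cmod (of_real (d3 z) * s (z - 0)))^2)"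
   unfolding g_def by (intro order_trans[OF norm_add3_sq] mult_left_mono add_mono) (use m t in \<open>auto simp only: norm_minus_cancel\<close>)
   also have "... = 3 * ((cmod (of_real (d1 z) * (z - p)))^2 + (cmod (of_real (d2 z) * (z - q)))^2 + (cmod (of_real (d3 z) * (z - 0)))^2)"
   by (simp only: norm_mult s)
   finally have "ennreal ((cmod (g (%z. of_real (d1 z) * s (z - p)) (%z. of_real (d2 z) * s (z - q)) (%z. of_real (d3 z) * s (z - 0)) z))^2)
   <= ennreal (3 * ((cmod (of_real (d1 z) * (z - p)))^2 + (cmod (of_real (d2 z) * (z - q)))^2 + (cmod (of_real (d3 z) * (z - 0)))^2))"
   by (rule ennreal_leI)
   also have "... = 3 * (e1 z + e2 z + e3 z)"
   unfolding e1_def e2_def e3_def by (subst ennreal_mult) (auto simp: ennreal_plus[symmetric] simp del: ennreal_plus)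
   finally show ?thesis .
  qed
  have "(energy (%z. g (%z. of_real (d1 z) * s (z - p)) (%z. of_real (d2 z) * s (z - q)) (%z. of_real (d3 z) * s (z - 0)) z))
   <= (\<integral>\<^sup>+z. 3 * (e1 z + e2 z + e3 z) \<partial>lborel)" by (intro nn_integral_mono pw)
  also have "... = 3 * ((\<integral>\<^sup>+z. e1 z \<partial>lborel) + (\<integral>\<^sup>+z. e2 z \<partial>lborel) + (\<integral>\<^sup>+z. e3 z \<partial>lborel))"
   by (simp add: nn_integral_cmult nn_integral_add)
  also have "... <= 3 * (ennreal (ladder_const / real N) + ennreal (ladder_const / real N) + ennreal (ladder_const / real N))"
   unfolding e1_def e2_def e3_def d1_def d2_def d3_def
   by (intro mult_left_mono add_mono ladder_energy e N RN) auto
  also have "... = ennreal (3 * (ladder_const / real N + ladder_const / real N + ladder_const / real N))"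
   by (subst ennreal_mult) (auto simp: ladder_const_def ennreal_plus[symmetric] simp del: ennreal_plus)
  also have "3 * (ladder_const / real N + ladder_const / real N + ladder_const / real N) = 9 * ladder_const / real N" by simp
  finally show ?thesis .
 qed
 have f2: "compact K" unfolding K_def by (intro compact_diff compact_cball open_ball)
 have f3: "K \<subseteq> - {p, q}" using e by (auto simp: K_def)
 have f4: "(energy a) <= ennreal (9 * ladder_const / real N)"
  unfolding a_def by (rule en) (rule complex_mod_cnj)
 have f5: "(energy b) <= ennreal (9 * ladder_const / real N)"
  unfolding b_def by (rule en[of "%w. w"]) (rule refl)
 have f6: "\<eta> z = 0" if "z ~: K" for z
 proof -
  have "cmod (z - 0) >= real N * 2^N \<or> cmod (z - p) <= \<epsilon> \<or> cmod (z - q) <= \<epsilon>"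
   using that by (auto simp: K_def dist_norm norm_minus_commute)
  thus ?thesis using p1(3)[of z] p2(3)[of z] p3(4)[of z] unfolding \<eta>_def by (elim disjE) simp_all
 qed
 have f7: "\<eta> z = 1" if "cmod z <= real N & 1 / real N <= cmod (z - p) & 1 / real N <= cmod (z - q)" for z
 proof -
  have "l1 z = 0" "l2 z = 0" "l3 z = 1" using that p1(4)[of z] p2(4)[of z] p3(3)[of z] e by auto
  thus "\<eta> z = 1" by (simp add: \<eta>_def)
 qed
 have "cutoff p q N \<eta> a b K"
  unfolding cutoff_def using C1 r f2 f3 f4 f5 f6 f7 by (intro conjI allI impI) simp_all
 thus ?thesis by blast
qed

lemma cutoff_eventually_one:
 assumes "\<And>N. cutoff p q (Suc N) (\<eta> N) (a N) (b N) (K N)" "z ~= p" "z ~= q"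
 shows "\<forall>\<^sub>F N in sequentially. \<eta> N z = 1"
proof -
 have d: "cmod (z - p) > 0" "cmod (z - q) > 0" using assms by auto
 have 1: "\<forall>\<^sub>F N in sequentially. inverse (real (Suc N)) < cmod (z - p)" "\<forall>\<^sub>F N in sequentially. inverse (real (Suc N)) < cmod (z - q)"
  using order_tendstoD(2)[OF LIMSEQ_inverse_real_of_nat] d by auto
 have 2: "\<forall>\<^sub>F N in sequentially. cmod z <= real N" using eventually_ge_at_top[of "nat \<lceil>cmod z\<rceil>"] by eventually_elim linarith
 show ?thesis using 1(1) 1(2) 2
  by eventually_elim (use assms(1) in \<open>auto simp: cutoff_def inverse_eq_divide\<close>)
qed

lemma AE_lborel_neq: "AE z in lborel. z ~= (c::complex)"
 using AE_not_in[OF finite_imp_null_set_lborel[of "{c}"]] by simp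

text \<open>Cut off, apply \<open>sobolev_energy\<close>, and absorb: the equation bounds the dbar
  energy by a multiple of \<open>k^2\<close> times the d energy, plus the source, plus cutoff terms
  that vanish in the limit because \<open>\<phi>\<close> is bounded. \<open>H\<close> replaces
  \<open>h\<close>, which is not square integrable at its pole in the application; it only has to
  dominate where \<open>\<mu>\<close> lives.\<close>

lemma core_energy:
 fixes \<phi> P Q P' \<mu> h :: cfun and H :: "complex => real"
 assumes W: "weak_on (- {z0, z1}) \<phi> P Q" and M: "\<forall>z\<in>- {z0, z1}. cmod (\<phi> z) <= M"
  and Q: "AE z in lborel. z : - {z0, z1} --> Q z = \<mu> z * (P z - h z)"
  and \<mu>: "AE z in lborel. cmod (\<mu> z) <= k" "AE z in lborel. cmod (\<mu> z * h z) <= k * H z"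
  and H: "H : bmeas borel" "\<And>z. 0 <= H z" "(\<integral>\<^sup>+z. ennreal ((H z)^2) \<partial>lborel) <= ennreal A2" "A2 >= 0"
  and k: "0 <= k" "k <= 1/4"
  and P': "P' : bmeas borel" "AE z in lborel. P' z = (if z : - {z0, z1} then P z else 0)"
 shows "(energy P') <= ennreal (16 * k^2 * A2)"
proof -
 define Om where "Om = - {z0, z1}"
 note [measurable] = P'(1) H(1)
 have "\<bar>M\<bar> >= 0" by simp
 have M': "cmod (\<phi> z) <= \<bar>M\<bar>" if "z : Om" for z 
 proof -
  have "cmod (\<phi> z) <= M" using M that unfolding Om_def by blast
  thus ?thesis by linarith
 qed
 have AEOm: "AE z in lborel. z : Om" using AE_lborel_neq[of z0] AE_lborel_neq[of z1] by eventually_elim (simp add: Om_def)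
 have bound: "(energy (%z. of_real (\<eta> z) * P' z)) <= ennreal (16 * k^2 * A2 + 12 * M^2 * (9 * ladder_const / real N))"
  if N: "N > 0" and c: "cutoff z0 z1 N \<eta> a b K" for N \<eta> a b K
 proof -
  define \<tau> where "\<tau> = 9 * ladder_const / real N"
  have \<tau>: "\<tau> >= 0" by (simp add: \<tau>_def ladder_const_def)
  have C: "C1_on UNIV (%z. of_real (\<eta> z)) a b" and e01: "\<And>z. 0 <= \<eta> z & \<eta> z <= 1" and K: "compact K" "K \<subseteq> Om" "ALL z. z ~: K --> complex_of_real (\<eta> z) = 0"
   and en: "(energy a) <= ennreal \<tau>" "(energy b) <= ennreal \<tau>"
   using c by (auto simp: cutoff_def Om_def \<tau>_def)
  have cc: "continuous_on UNIV (%z. complex_of_real (\<eta> z))" "continuous_on UNIV a" "continuous_on UNIV b"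
   using C C1_on_imp_continuous[OF C] by (auto simp: C1_on_def)
  note [measurable] = continuous_bmeas[OF cc(1)] continuous_bmeas[OF cc(2)] continuous_bmeas[OF cc(3)]
  obtain PN QN R where S: "sobolev (%z. if z : Om then of_real (\<eta> z) * \<phi> z else 0) PN QN R"
   and PN: "AE z in lborel. PN z = (if z : Om then of_real (\<eta> z) * P z + a z * \<phi> z else 0)"
   and QN: "AE z in lborel. QN z = (if z : Om then of_real (\<eta> z) * Q z + b z * \<phi> z else 0)"
   using weak_on_localize[OF W[folded Om_def] C K] by blast
  have [measurable]: "PN : bmeas borel" "QN : bmeas borel" using S by (auto simp: sobolev_def)
  define X where "X z = of_real (\<eta> z) * P' z" for z
  have [measurable]: "X : bmeas borel" unfolding X_def[abs_def] by measurable
  have 1: "(energy X) <= (\<integral>\<^sup>+z. ennreal 2 * ennreal ((cmod (PN z))^2) + ennreal (2 * M^2) * ennreal ((cmod (a z))^2) \<partial>lborel)"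
  proof (rule nn_integral_mono_AE)
   show "AE z in lborel. ennreal ((cmod (X z))^2) <= ennreal 2 * ennreal ((cmod (PN z))^2) + ennreal (2 * M^2) * ennreal ((cmod (a z))^2)"
   using PN P'(2) AEOm
   proof eventually_elim
   case (elim z)
   have "X z = PN z + (- (a z * \<phi> z))" using elim by (simp add: X_def Om_def)
   hence "(cmod (X z))^2 <= 2 * (cmod (PN z))^2 + 2 * (cmod (a z * \<phi> z))^2" using norm_add_sq[of "PN z" "- (a z * \<phi> z)"] by simp
   also have "(cmod (a z * \<phi> z))^2 <= (cmod (a z))^2 * M^2"
   using power_mono[OF M'[OF elim(3)], of 2] by (simp add: norm_mult power_mult_distrib mult_left_mono)
   finally have "(cmod (X z))^2 <= 2 * (cmod (PN z))^2 + 2 * M^2 * (cmod (a z))^2" by (simp add: algebra_simps)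
   hence "ennreal ((cmod (X z))^2) <= ennreal (2 * (cmod (PN z))^2 + 2 * M^2 * (cmod (a z))^2)" by (rule ennreal_leI)
   also have "... = ennreal 2 * ennreal ((cmod (PN z))^2) + ennreal (2 * M^2) * ennreal ((cmod (a z))^2)"
   by (simp add: ennreal_mult)
   finally show ?case .
   qed
  qed
  have 3: "(energy QN) <= (\<integral>\<^sup>+z. ennreal (4 * k^2) * ennreal ((cmod (X z))^2) + ennreal (4 * k^2) * ennreal ((H z)^2) + ennreal (2 * M^2) * ennreal ((cmod (b z))^2) \<partial>lborel)"
  proof (rule nn_integral_mono_AE)
   show "AE z in lborel. ennreal ((cmod (QN z))^2) <= ennreal (4 * k^2) * ennreal ((cmod (X z))^2) + ennreal (4 * k^2) * ennreal ((H z)^2) + ennreal (2 * M^2) * ennreal ((cmod (b z))^2)"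
   using QN P'(2) AEOm Q \<mu>(1) \<mu>(2)
   proof eventually_elim
   case (elim z)
   have "Q z = \<mu> z * (P' z - h z)" using elim by (simp add: Om_def)
   moreover have "QN z = of_real (\<eta> z) * Q z + b z * \<phi> z" using elim(1,3) by simp
   ultimately have q: "QN z = (\<mu> z * X z + - (of_real (\<eta> z) * (\<mu> z * h z))) + b z * \<phi> z"
   unfolding X_def by (simp add: right_diff_distrib mult.left_commute)
   have m1: "(cmod (\<mu> z * X z))^2 <= k^2 * (cmod (X z))^2"
   using power_mono[OF elim(5), of 2] by (simp add: norm_mult power_mult_distrib mult_right_mono)
   have "cmod (of_real (\<eta> z) * (\<mu> z * h z)) <= 1 * (k * H z)"
   using e01[of z] elim(6) unfolding norm_mult[of "of_real (\<eta> z)"] by (intro mult_mono) auto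
   hence m2: "(cmod (of_real (\<eta> z) * (\<mu> z * h z)))^2 <= k^2 * (H z)^2"
   using power_mono[of _ "k * H z" 2] by (simp add: power_mult_distrib)
   have m3: "(cmod (b z * \<phi> z))^2 <= M^2 * (cmod (b z))^2"
   using power_mono[OF M'[OF elim(3)], of 2] by (simp add: norm_mult power_mult_distrib mult_left_mono mult.commute[of "M^2"])
   have "(cmod (QN z))^2 <= 2 * (cmod (\<mu> z * X z + - (of_real (\<eta> z) * (\<mu> z * h z))))^2 + 2 * (cmod (b z * \<phi> z))^2"
   unfolding q by (rule norm_add_sq)
   also have "... <= 2 * (2 * (cmod (\<mu> z * X z))^2 + 2 * (cmod (- (of_real (\<eta> z) * (\<mu> z * h z))))^2) + 2 * (cmod (b z * \<phi> z))^2"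
   by (intro add_right_mono mult_left_mono norm_add_sq) auto
   also have "... <= 4 * k^2 * (cmod (X z))^2 + 4 * k^2 * (H z)^2 + 2 * M^2 * (cmod (b z))^2"
   using m1 m2 m3 by simp
   finally have "ennreal ((cmod (QN z))^2) <= ennreal (4 * k^2 * (cmod (X z))^2 + 4 * k^2 * (H z)^2 + 2 * M^2 * (cmod (b z))^2)" by (rule ennreal_leI)
   also have "... = ennreal (4 * k^2) * ennreal ((cmod (X z))^2) + ennreal (4 * k^2) * ennreal ((H z)^2) + ennreal (2 * M^2) * ennreal ((cmod (b z))^2)"
   by (simp add: ennreal_mult[symmetric])
   finally show ?case .
   qed
  qed
  have iP: "integrable lborel (%z. (cmod (PN z))^2)" "integrable lborel (%z. (cmod (QN z))^2)" using S by (auto simp: sobolev_def)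
  define pn qn where "pn = (LINT z|lborel. (cmod (PN z))^2)" and "qn = (LINT z|lborel. (cmod (QN z))^2)"
  have pq: "(energy PN) = ennreal pn" "(energy QN) = ennreal qn" "pn >= 0" "qn >= 0"
   unfolding pn_def qn_def using iP by (auto simp: nn_integral_eq_integral)
  have 2: "pn <= qn" using sobolev_energy[OF S] pq by (simp add: ennreal_le_iff)
  have "(energy X) <= ennreal 2 * ennreal pn + ennreal (2 * M^2) * (energy a)"
   using 1 by (simp add: nn_integral_add nn_integral_cmult pq)
  also have "... <= ennreal 2 * ennreal pn + ennreal (2 * M^2) * ennreal \<tau>" by (intro add_left_mono mult_left_mono en) auto
  also have "... = ennreal (2 * pn + 2 * M^2 * \<tau>)" using pq \<tau> by (simp add: ennreal_mult)
  finally have X1: "(energy X) <= ennreal (2 * pn + 2 * M^2 * \<tau>)" .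
  \<comment> \<open>Finiteness must be known before \<open>x\<close> can be absorbed into the left
    side; it comes from the square integrability of \<open>PN\<close> and of the cutoff
    derivative.\<close>
  hence "(energy X) < \<infinity>" using le_less_trans ennreal_less_top by (metis infinity_ennreal_def)
  then obtain x where x: "(energy X) = ennreal x" "x >= 0"
   by (metis ennreal_cases infinity_ennreal_def less_irrefl)
  have x1: "x <= 2 * pn + 2 * M^2 * \<tau>" using X1 pq \<tau> unfolding x(1) by (subst (asm) ennreal_le_iff) auto
  have "ennreal qn <= ennreal (4 * k^2) * ennreal x + ennreal (4 * k^2) * (\<integral>\<^sup>+z. ennreal ((H z)^2) \<partial>lborel) + ennreal (2 * M^2) * (energy b)"
   using 3 unfolding pq(2) x(1)[symmetric] by (simp add: nn_integral_add nn_integral_cmult)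
  also have "... <= ennreal (4 * k^2) * ennreal x + ennreal (4 * k^2) * ennreal A2 + ennreal (2 * M^2) * ennreal \<tau>"
   by (intro add_mono mult_left_mono en H) auto
  also have "... = ennreal (4 * k^2 * x + 4 * k^2 * A2 + 2 * M^2 * \<tau>)" using x \<tau> H by (simp add: ennreal_mult[symmetric])
  finally have q1: "qn <= 4 * k^2 * x + 4 * k^2 * A2 + 2 * M^2 * \<tau>" using x \<tau> H by (subst (asm) ennreal_le_iff) auto
  \<comment> \<open>The three inequalities combine to x <= 8 k^2 x + 8 k^2 A2 + 6 M^2 tau. The bound
    1/4 on \<open>k\<close> makes the coefficient 8 k^2 at most 1/2, and doubling the rest gives 16
    and 12.\<close>
  have "k^2 <= (1/4)^2" using k by (intro power_mono) auto
  hence "k^2 * x <= 1/16 * x" using x by (intro mult_right_mono) (auto simp: power2_eq_square)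
  hence "x <= 16 * k^2 * A2 + 12 * M^2 * \<tau>" using x1 2 q1 by simp
  thus ?thesis unfolding X_def[symmetric] x(1) \<tau>_def[symmetric] by (rule ennreal_leI)
 qed
 have "EX \<eta> a b K. cutoff z0 z1 (Suc N) \<eta> a b K" for N by (rule cutoff_exists) simp
 then obtain \<eta> a b K where c: "\<And>N. cutoff z0 z1 (Suc N) (\<eta> N) (a N) (b N) (K N)" by metis
 have [measurable]: "(%z. complex_of_real (\<eta> N z)) : bmeas borel" for N
 proof -
  have "C1_on UNIV (%z. complex_of_real (\<eta> N z)) (a N) (b N)" using c[of N] by (simp add: cutoff_def)
  from C1_on_imp_continuous[OF this] show ?thesis by (rule continuous_bmeas)
 qed
 have "(energy P') = (\<integral>\<^sup>+z. liminf (%N. ennreal ((cmod (of_real (\<eta> N z) * P' z))^2)) \<partial>lborel)"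
 proof (rule nn_integral_cong_AE)
  show "AE z in lborel. ennreal ((cmod (P' z))^2) = liminf (%N. ennreal ((cmod (of_real (\<eta> N z) * P' z))^2))"
   using AEOm
  proof eventually_elim
   case (elim z)
   have "\<forall>\<^sub>F N in sequentially. \<eta> N z = 1"
   using cutoff_eventually_one[OF c] elim by (auto simp: Om_def)
   hence "\<forall>\<^sub>F N in sequentially. ennreal ((cmod (of_real (\<eta> N z) * P' z))^2) = ennreal ((cmod (P' z))^2)"
   by eventually_elim simp
   hence "(%N. ennreal ((cmod (of_real (\<eta> N z) * P' z))^2)) \<longlonglongrightarrow> ennreal ((cmod (P' z))^2)" by (rule tendsto_eventually)
   from lim_imp_Liminf[OF _ this] show ?case by simp
  qed
 qed
 also have "... <= liminf (%N. energy (%z. of_real (\<eta> N z) * P' z))"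
  by (rule nn_integral_liminf) measurable
 also have "... <= liminf (%N. ennreal (16 * k^2 * A2 + 12 * M^2 * (9 * ladder_const / real (Suc N))))"
  by (intro Liminf_mono always_eventually allI bound[OF _ c]) simp
 also have "... = ennreal (16 * k^2 * A2)"
 proof -
  have "(%N. 16 * k^2 * A2 + 12 * M^2 * (9 * ladder_const * inverse (real (Suc N)))) \<longlonglongrightarrow> 16 * k^2 * A2 + 12 * M^2 * (9 * ladder_const * 0)"
   by (intro tendsto_intros LIMSEQ_inverse_real_of_nat)
  hence "(%N. ennreal (16 * k^2 * A2 + 12 * M^2 * (9 * ladder_const / real (Suc N)))) \<longlonglongrightarrow> ennreal (16 * k^2 * A2)"
   by (intro tendsto_ennrealI) (simp add: divide_inverse)
  from lim_imp_Liminf[OF _ this] show ?thesis by simp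
 qed
 finally show ?thesis .
qed

section \<open>First-order asymptotics of the Schwarzian\<close>

lemma lebesgue_on_borel_rep:
 fixes P :: cfun
 assumes "P : bmeas (leb Om)" "Om : sets lebesgue"
 shows "\<exists>P'\<in>bmeas borel. AE z in lborel. P' z = (if z : Om then P z else 0)"
proof -
 have "(%z. if z : Om then P z else 0) : bmeas lebesgue"
  using borel_measurable_if[OF assms(2), of P] assms(1) by blast
 from completion_ex_borel_measurable_complex[OF this]
 obtain P' where "P' : bmeas lborel" "AE z in lborel. (if z : Om then P z else 0) = P' z" by blast
 thus ?thesis by (intro bexI[of _ P']) (auto elim: eventually_mono)
qed

lemma integrable_of_nn_integral:
 fixes f :: "complex => real"
 assumes "f : bmeas borel" "\<And>z. f z >= 0" "(\<integral>\<^sup>+z. ennreal (f z) \<partial>lborel) <= ennreal B" "B >= 0"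
 shows "integrable lborel f" "integral\<^sup>L lborel f <= B"
proof -
 have "(\<integral>\<^sup>+z. ennreal (f z) \<partial>lborel) < \<infinity>" using assms(3) le_less_trans ennreal_less_top by (metis infinity_ennreal_def)
 thus i: "integrable lborel f" using assms(1,2) by (intro integrableI_nonneg) auto
 have "ennreal (integral\<^sup>L lborel f) <= ennreal B" using nn_integral_eq_integral[OF i] assms(2,3) by simp
 thus "integral\<^sup>L lborel f <= B" using assms(4) by (simp add: ennreal_le_iff)
qed

text \<open>The equation dbar phi = mu (P - h) is tested with eta psi h, where \<open>\<psi>\<close>
  removes the pole of \<open>h\<close> at \<open>z0\<close> and \<open>\<eta>\<close> cuts off at
  \<open>z1\<close> and infinity. The derivative of \<open>\<psi>\<close> lives on an annulus around
  \<open>z0\<close> and yields \<open>deriv \<phi>0 z0\<close> through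
  \<open>annulus_formula\<close>. On the other side mu h^2 is the main term, and mu P h is of second
  order because mu h and P are both of size \<open>k\<close> in L2.\<close>

lemma core_representation:
 fixes \<phi> P Q \<mu> \<phi>0 :: cfun
 assumes W: "weak_on (- {z0, z1}) \<phi> P Q" and M: "\<forall>z\<in>- {z0, z1}. cmod (\<phi> z) <= M"
  and Q: "AE z in lborel. z : - {z0, z1} --> Q z = \<mu> z * (P z - 1 / (z - z0)^2)"
  and \<mu>m: "\<mu> : bmeas borel" and \<mu>k: "AE z in lborel. cmod (\<mu> z) <= k"
  and \<mu>0: "AE z in lborel. z : ball 0 1 --> \<mu> z = 0" and k: "0 <= k" "k <= 1/4"
  and z0: "cmod z0 < 1" and r: "r > 0" "ball z0 (3 * r) \<subseteq> ball 0 1" "z1 ~: ball z0 (3 * r)"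
  and \<phi>0: "\<phi>0 holomorphic_on ball z0 (3 * r)" "\<forall>z\<in>ball z0 (3 * r) - {z0}. \<phi> z = \<phi>0 z"
 shows "cmod (of_real annulus_const * deriv \<phi>0 z0 - (LINT z|lborel. \<mu> z * (1 / (z - z0) ^ 4))) <= 9 * k^2 * (tail_const / (1 - cmod z0)^2)"
proof -
 define Om where "Om = - {z0, z1}"
 define h where "h z = 1 / (z - z0)^2" for z
 define H where "H z = (if 1 <= cmod z then cmod (h z) else 0)" for z
 define A2 where "A2 = tail_const / (1 - cmod z0)^2"
 have A2: "A2 >= 0" using tail_const_nonneg by (simp add: A2_def)
 have [measurable]: "h : bmeas borel" unfolding h_def[abs_def] by measurable
 have [measurable]: "H : bmeas borel" unfolding H_def[abs_def] by measurable
 have H0: "0 <= H z" for z by (simp add: H_def)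
 have OOm: "open Om" and \<phi>c: "continuous_on Om \<phi>" and LP: "locally_L2 Om P" and LQ: "locally_L2 Om Q" and wz: "weak_d_zbar Om \<phi> Q"
  using W unfolding weak_on_def Om_def by auto
 have Oms: "Om : sets lebesgue" using OOm by simp
 have AEOm: "AE z in lborel. z : Om" using AE_lborel_neq[of z0] AE_lborel_neq[of z1] by eventually_elim (simp add: Om_def)
 have H2: "(\<integral>\<^sup>+z. ennreal ((H z)^2) \<partial>lborel) <= ennreal A2"
 proof -
  have "(H z)^2 <= (if 1 - cmod z0 <= cmod (z - z0) then 1 / (cmod (z - z0))^4 else 0)" for z
  proof (cases "1 <= cmod z")
   case True
   hence "1 - cmod z0 <= cmod (z - z0)" using norm_triangle_ineq2[of z z0] by linarith
   thus ?thesis using True by (simp add: H_def h_def norm_divide norm_power power_divide flip: power_mult)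
  qed (simp add: H_def)
  hence "(\<integral>\<^sup>+z. ennreal ((H z)^2) \<partial>lborel) <= (\<integral>\<^sup>+z. ennreal (if 1 - cmod z0 <= cmod (z - z0) then 1 / (cmod (z - z0))^4 else 0) \<partial>lborel)"
   by (intro nn_integral_mono ennreal_leI)
  also have "... <= ennreal A2" unfolding A2_def by (rule tail_integral) (use z0 in simp)
  finally show ?thesis .
 qed
 note iH = integrable_of_nn_integral[OF _ _ H2 A2]
 have iH2: "integrable lborel (%z. (H z)^2)" "(LINT z|lborel. (H z)^2) <= A2" by (rule iH; simp)+
 have \<mu>h: "AE z in lborel. cmod (\<mu> z * h z) <= k * H z"
  using \<mu>k \<mu>0
 proof eventually_elim
  case (elim z)
  show ?case
  proof (cases "1 <= cmod z")
   case True thus ?thesis using elim(1) by (simp add: H_def norm_mult mult_right_mono)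
  next
   case False thus ?thesis using elim(2) k by (simp add: H_def)
  qed
 qed
 obtain P' where P'm[measurable]: "P' : bmeas borel" and P': "AE z in lborel. P' z = (if z : Om then P z else 0)"
  using lebesgue_on_borel_rep[OF _ Oms, of P] LP by (auto simp: locally_L2_def)
 have Q2: "AE z in lborel. z : - {z0, z1} --> Q z = \<mu> z * (P z - h z)" using Q unfolding h_def .
 have "(energy P') <= ennreal (16 * k^2 * A2)"
  by (rule core_energy[OF W M Q2 \<mu>k \<mu>h _ H0 H2 A2 k P'm P'[unfolded Om_def]]) simp
 note iP = integrable_of_nn_integral[OF _ _ this]
 have iP2: "integrable lborel (%z. (cmod (P' z))^2)" "(LINT z|lborel. (cmod (P' z))^2) <= 16 * k^2 * A2"
  by (rule iP; use A2 in simp)+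
 note [measurable] = \<mu>m
 have X: "AE z in lborel. cmod (\<mu> z * P' z * h z) <= ((cmod (P' z))^2 + k^2 * (H z)^2) / 2"
  using \<mu>h
 proof eventually_elim
  case (elim z)
  have "cmod (\<mu> z * P' z * h z) = cmod (P' z) * cmod (\<mu> z * h z)" by (simp add: norm_mult ac_simps)
  also have "... <= cmod (P' z) * (k * H z)" using elim by (intro mult_left_mono) auto
  also have "... <= ((cmod (P' z))^2 + (k * H z)^2) / 2" using sum_squares_bound[of "cmod (P' z)" "k * H z"] by simp
  finally show ?case by (simp add: power_mult_distrib)
 qed
 have Y: "AE z in lborel. cmod (\<mu> z * h z * h z) <= k * (H z)^2"
  using \<mu>h \<mu>0
 proof eventually_elim
  case (elim z)
  show ?case
  proof (cases "1 <= cmod z")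
   case True
   hence "cmod (h z) = H z" by (simp add: H_def)
   thus ?thesis using mult_right_mono[OF elim(1) H0[of z]] by (simp only: norm_mult[of "\<mu> z * h z"]) (simp add: power2_eq_square)
  next
   case False thus ?thesis using elim(2) by (simp add: H_def)
  qed
 qed
 have iX0: "integrable lborel (%z. ((cmod (P' z))^2 + k^2 * (H z)^2) / 2)" using iP2(1) iH2(1) by simp
 have iX: "integrable lborel (%z. \<mu> z * P' z * h z)"
  by (rule integrable_dom[OF iX0]) (use X in \<open>auto elim!: eventually_mono\<close>)
 have iY: "integrable lborel (%z. \<mu> z * h z * h z)"
  by (rule integrable_dom[OF integrable_mult_right[OF iH2(1), of k]]) (use Y k in \<open>auto elim!: eventually_mono simp: abs_mult\<close>)
 have bX: "cmod (LINT z|lborel. \<mu> z * P' z * h z) <= 9 * k^2 * A2"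
 proof -
  have "cmod (LINT z|lborel. \<mu> z * P' z * h z) <= (LINT z|lborel. ((cmod (P' z))^2 + k^2 * (H z)^2) / 2)"
   by (rule order_trans[OF integral_norm_bound integral_mono_AE[OF integrable_norm[OF iX] iX0 X]])
  also have "... = ((LINT z|lborel. (cmod (P' z))^2) + k^2 * (LINT z|lborel. (H z)^2)) / 2" using iP2(1) iH2(1) by simp
  \<comment> \<open>The energy constant 16 and the 1 belonging to \<open>H\<close> average to 17/2,
    which is rounded up to 9.\<close>
  also have "... <= (16 * k^2 * A2 + k^2 * A2) / 2" using iP2(2) mult_left_mono[OF iH2(2), of "k^2"] by (simp add: ac_simps)
  also have "... <= 9 * k^2 * A2" using A2 by simp
  finally show ?thesis .
 qed
 define c0 where "c0 = complex_of_real annulus_const * deriv \<phi>0 z0"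
 define \<phi>e where "\<phi>e z = (if z : Om then \<phi> z else 0)" for z
 have [measurable]: "\<phi>e : bmeas borel"
  unfolding \<phi>e_def[abs_def] using \<phi>c OOm by (intro borel_measurable_continuous_on_if) auto
 have \<phi>M: "cmod (\<phi>e z) <= \<bar>M\<bar>" for z using M abs_ge_self[of M] abs_ge_zero[of M] unfolding \<phi>e_def Om_def by (smt (verit) norm_zero)
 define \<psi> where "\<psi> z = 1 - complex_of_real (bump z0 r (2 * r) z)" for z
 define D where "D = dbump z0 r (2 * r)"
 have bmp: "C1_on UNIV (%z. of_real (bump z0 r (2 * r) z)) (%z. of_real (D z) * cnj (z - z0)) (%z. of_real (D z) * (z - z0))"
  unfolding D_def by (rule bump_C1)
 have \<psi>C: "C1_on UNIV \<psi> (%z. 0 - of_real (D z) * cnj (z - z0)) (%z. 0 - of_real (D z) * (z - z0))"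
  unfolding \<psi>_def[abs_def] by (rule C1_on_diff[OF C1_on_const bmp])
 have [measurable]: "\<psi> : bmeas borel" by (rule continuous_bmeas[OF C1_on_imp_continuous[OF \<psi>C]])
 have [measurable]: "D : bmeas borel" unfolding D_def by (rule continuous_bmeas[OF dbump_continuous])
 have \<psi>0: "\<psi> z = 0" if "cmod (z - z0) <= r" for z using bump_inner(1)[of r "2 * r" z z0] that r by (simp add: \<psi>_def)
 have \<psi>1: "\<psi> z = 1" if "cmod (z - z0) >= 2 * r" for z using bump_outer(1)[of r "2 * r" z z0] that r by (simp add: \<psi>_def)
 have \<psi>le: "cmod (\<psi> z) <= 1" for z
 proof -
  have "\<psi> z = complex_of_real (1 - bump z0 r (2 * r) z)" by (simp add: \<psi>_def)
  thus ?thesis using bump_range[of r "2 * r" z0 z] r by (simp only: norm_of_real) simp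
 qed
 define T where "T = tail_const / r^2"
 have T0: "T >= 0" using tail_const_nonneg by (simp add: T_def)
 have sq: "(cmod (\<psi> z * h z))^2 <= (if r <= cmod (z - z0) then 1 / (cmod (z - z0))^4 else 0)" for z
 proof (cases "r <= cmod (z - z0)")
  case True
  have "cmod (\<psi> z * h z) <= 1 * cmod (h z)" unfolding norm_mult by (intro mult_right_mono \<psi>le) auto
  hence "(cmod (\<psi> z * h z))^2 <= (cmod (h z))^2" by (intro power_mono) auto
  thus ?thesis using True by (simp add: h_def norm_divide norm_power power_divide flip: power_mult)
 qed (simp add: \<psi>0)
 have nT: "(energy (%z. \<psi> z * h z)) <= ennreal T"
 proof -
  have "(energy (%z. \<psi> z * h z)) <= (\<integral>\<^sup>+z. ennreal (if r <= cmod (z - z0) then 1 / (cmod (z - z0))^4 else 0) \<partial>lborel)"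
   by (intro nn_integral_mono ennreal_leI sq)
  also have "... <= ennreal T" unfolding T_def by (rule tail_integral[OF r(1)])
  finally show ?thesis .
 qed
 have iT: "integrable lborel (%z. (cmod (\<psi> z * h z))^2)" "(LINT z|lborel. (cmod (\<psi> z * h z))^2) <= T"
  by (rule integrable_of_nn_integral[OF _ _ nT T0]; simp)+
 \<comment> \<open>Both exceptional points are set to \<open>z1\<close>, since at \<open>z0\<close>
   the factor \<open>\<psi>\<close> already cuts off.\<close>
 have "EX \<eta> a b K. cutoff z1 z1 (Suc N) \<eta> a b K" for N by (rule cutoff_exists) simp
 then obtain \<eta> a b K where c: "\<And>N. cutoff z1 z1 (Suc N) (\<eta> N) (a N) (b N) (K N)" by metis
 have C: "C1_on UNIV (%z. of_real (\<eta> N z)) (a N) (b N)" and e01: "0 <= \<eta> N z" "\<eta> N z <= 1"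
  and K: "compact (K N)" "K N \<subseteq> - {z1}" "z ~: K N ==> \<eta> N z = 0"
  and en: "(energy (b N)) <= ennreal (9 * ladder_const / real (Suc N))"
  and one: "cmod z <= real (Suc N) ==> 1 / real (Suc N) <= cmod (z - z1) ==> \<eta> N z = 1" for N z
  using c[of N] by (auto simp: cutoff_def)
 have [measurable]: "(%z. complex_of_real (\<eta> N z)) : bmeas borel" "b N : bmeas borel" for N
  using C1_on_imp_continuous[OF C[of N]] C[of N] continuous_bmeas unfolding C1_on_def by blast+
 define U where "U = - {z0}"
 have U: "open U" unfolding U_def by auto
 have hC: "C1_on U h (deriv h) (%z. 0)"
  unfolding h_def[abs_def] U_def by (rule C1_on_holomorphic) (auto intro!: holomorphic_intros)
 define bt where "bt N z = (b N z * \<psi> z + of_real (\<eta> N z) * (0 - of_real (D z) * (z - z0))) * h z + of_real (\<eta> N z) * \<psi> z * 0" for N z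
 define t where "t N z = (if z : U then of_real (\<eta> N z) * \<psi> z * h z else 0)" for N z
 have tC: "EX ta. C1_on UNIV (t N) ta (%z. if z : U then bt N z else 0)"
  and K': "compact (K N - ball z0 r)" "K N - ball z0 r \<subseteq> Om" and t0: "z ~: K N - ball z0 r ==> t N z = 0" for N z
 proof -
  show 1: "compact (K N - ball z0 r)" by (intro compact_diff K) auto
  have 2: "K N - ball z0 r \<subseteq> U" using r by (auto simp: U_def)
  show "K N - ball z0 r \<subseteq> Om" using r K(2)[of N] by (auto simp: Om_def)
  have 3: "complex_of_real (\<eta> N z) * \<psi> z * h z = 0" if "z ~: K N - ball z0 r" for z
   using that K(3)[of z N] \<psi>0[of z] by (auto simp: dist_norm norm_minus_commute)
  thus "z ~: K N - ball z0 r ==> t N z = 0" by (simp add: t_def)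
  show "EX ta. C1_on UNIV (t N) ta (%z. if z : U then bt N z else 0)"
   unfolding t_def[abs_def] bt_def
   using C1_on_extend[OF C1_on_mult[OF C1_on_mult[OF C1_on_subset[OF C[of N]] C1_on_subset[OF \<psi>C]] hC] U 1 2] 3 by auto
 qed
 have tm[measurable]: "t N : bmeas borel" for N
  using tC[of N] C1_on_imp_continuous continuous_bmeas by blast
 have AEt: "AE z in lborel. t N z = of_real (\<eta> N z) * \<psi> z * h z" for N using AE_lborel_neq[of z0] by eventually_elim (simp add: t_def U_def)
 have EQ: "(LINT z|lborel. \<phi>e z * bt N z) = - (LINT z|lborel. of_real (\<eta> N z) * (\<mu> z * P' z * h z - \<mu> z * h z * h z))" for N
 proof -
  obtain ta where ta: "C1_on UNIV (t N) ta (%z. if z : U then bt N z else 0)" using tC by blast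
  note tt = test_functionsI[OF ta K' t0]
  have w: "(LINT z|leb Om. \<phi> z * d_zbar (t N) z) = - (LINT z|leb Om. Q z * t N z)"
   using wz tt(1) unfolding weak_d_zbar_def by blast
  have m1: "(%z. if z : U then bt N z else 0) : bmeas borel" using ta continuous_bmeas unfolding C1_on_def by blast
  have 0: "(LINT z|leb Om. \<phi> z * (if z : U then bt N z else 0)) = (LINT z|lborel. \<phi>e z * bt N z)"
  proof (rule lebesgue_on_integral_borel[OF Oms])
   have "(%z. if z : U then bt N z else 0) : bmeas (leb Om)" 
   using ta unfolding C1_on_def by (meson continuous_measurable_leb continuous_on_subset top_greatest Oms)
   moreover have "\<phi> : bmeas (leb Om)" by (rule continuous_measurable_leb[OF \<phi>c Oms])
   ultimately show "(%z. \<phi> z * (if z : U then bt N z else 0)) : bmeas (leb Om)" by measurable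
   show "(%z. \<phi>e z * bt N z) : bmeas borel" unfolding bt_def by measurable
   show "AE z in lborel. \<phi>e z * bt N z = (if z : Om then \<phi> z * (if z : U then bt N z else 0) else 0)"
   using AE_lborel_neq[of z0] by eventually_elim (simp add: \<phi>e_def U_def)
  qed
  have 1: "(LINT z|leb Om. \<phi> z * d_zbar (t N) z) = (LINT z|lborel. \<phi>e z * bt N z)"
   using 0 by (simp only: tt(3))
  have 2: "(LINT z|leb Om. Q z * t N z) = (LINT z|lborel. of_real (\<eta> N z) * (\<mu> z * P' z * h z - \<mu> z * h z * h z))"
  proof (rule lebesgue_on_integral_borel[OF Oms])
   have "integrable (leb Om) (%z. Q z * t N z)"
   by (rule locally_L2_test_integrable[OF LQ OOm K']) (use C1_on_imp_continuous[OF ta] t0 in auto)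
   thus "(%z. Q z * t N z) : bmeas (leb Om)" by auto
   show "AE z in lborel. of_real (\<eta> N z) * (\<mu> z * P' z * h z - \<mu> z * h z * h z) = (if z : Om then Q z * t N z else 0)"
   using AEt[of N] Q2[folded Om_def] P' AEOm \<mu>0
   proof eventually_elim
   case (elim z)
   \<comment> \<open>\<open>\<psi>\<close> differs from 1 only within \<open>2 * r\<close> of
     \<open>z0\<close>, inside the unit disc, where \<open>\<mu>\<close> vanishes.\<close>
   have mx: "\<mu> z * \<psi> z = \<mu> z"
   proof (cases "cmod (z - z0) >= 2 * r")
   case False
   hence "z : ball z0 (3 * r)" using r(1) by (simp add: dist_norm norm_minus_commute)
   hence "z : ball 0 1" using r(2) by blast
   thus ?thesis using elim(5) by simp
   qed (simp add: \<psi>1)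
   have "Q z * t N z = of_real (\<eta> N z) * ((\<mu> z * \<psi> z) * (P z - h z) * h z)"
   using elim by (simp add: ac_simps)
   thus ?case using elim(3,4) unfolding mx by (simp add: algebra_simps)
   qed
  qed measurable
  show ?thesis using w unfolding 1 2 .
 qed
 define E where "E N = (LINT z|lborel. \<phi>e z * (b N z * (\<psi> z * h z)))" for N
 define L where "L = ladder_const"
 have L0: "L >= 0" by (simp add: L_def ladder_const_def)
 have iE: "integrable lborel (%z. \<phi>e z * (b N z * (\<psi> z * h z)))" and bE: "cmod (E N) <= \<bar>M\<bar> / 2 * (9 * L + T) * inverse (sqrt (real (Suc N)))" for N
 proof -
  \<comment> \<open>The weight in Young's inequality: the cutoff energy is of order 1 / N and
    \<open>T\<close> is fixed, so this choice makes both terms of order 1 / s.\<close>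
  define s where "s = sqrt (real (Suc N))"
  have s: "s > 0" "s * s = real (Suc N)" by (simp_all add: s_def)
  have B0: "9 * ladder_const / real (Suc N) >= 0" by (simp add: ladder_const_def)
  have ib: "integrable lborel (%z. (cmod (b N z))^2)" "(LINT z|lborel. (cmod (b N z))^2) <= 9 * ladder_const / real (Suc N)"
   by (rule integrable_of_nn_integral[OF _ _ en B0]; simp)+
  have le: "cmod (\<phi>e z * (b N z * (\<psi> z * h z))) <= \<bar>M\<bar> / 2 * (s * (cmod (b N z))^2 + (cmod (\<psi> z * h z))^2 / s)" for z
  proof -
   define x y where "x = cmod (b N z)" and "y = cmod (\<psi> z * h z)"
   have "0 <= (s * x - y)^2 / s" using s by simp
   also have "... = s * x^2 + y^2 / s - 2 * (x * y)" using s by (simp add: power2_diff power_mult_distrib power2_eq_square field_simps)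
   finally have "x * y <= (s * x^2 + y^2 / s) / 2" by simp
   hence "\<bar>M\<bar> * (x * y) <= \<bar>M\<bar> * ((s * x^2 + y^2 / s) / 2)" by (intro mult_left_mono) auto
   moreover have "cmod (\<phi>e z * (b N z * (\<psi> z * h z))) <= \<bar>M\<bar> * (x * y)" unfolding norm_mult[of "\<phi>e z"] norm_mult[of "b N z"] x_def y_def by (intro mult_right_mono \<phi>M) auto
   ultimately show ?thesis by (simp add: x_def y_def)
  qed
  have ii: "integrable lborel (%z. \<bar>M\<bar> / 2 * (s * (cmod (b N z))^2 + (cmod (\<psi> z * h z))^2 / s))"
   by (intro integrable_mult_right Bochner_Integration.integrable_add integrable_divide ib iT)
  show i: "integrable lborel (%z. \<phi>e z * (b N z * (\<psi> z * h z)))"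
  proof (rule integrable_dom[OF ii])
   show "AE z in lborel. norm (\<phi>e z * (b N z * (\<psi> z * h z))) <= norm (\<bar>M\<bar> / 2 * (s * (cmod (b N z))^2 + (cmod (\<psi> z * h z))^2 / s))"
   by (rule AE_I2, rule order_trans[OF le]) (unfold real_norm_def, rule abs_ge_self)
  qed measurable
  have "cmod (E N) <= (LINT z|lborel. \<bar>M\<bar> / 2 * (s * (cmod (b N z))^2 + (cmod (\<psi> z * h z))^2 / s))"
   unfolding E_def by (rule Bochner_Integration.integral_norm_bound_integral[OF i ii le])
  also have "... = \<bar>M\<bar> / 2 * (s * (LINT z|lborel. (cmod (b N z))^2) + (LINT z|lborel. (cmod (\<psi> z * h z))^2) / s)"
   using ib(1) iT(1) by simp
  also have "... <= \<bar>M\<bar> / 2 * (s * (9 * L / (s * s)) + T / s)"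
   unfolding s(2) L_def using s(1) ib(2) iT(2) by (intro mult_left_mono add_mono divide_right_mono) auto
  also have "... = \<bar>M\<bar> / 2 * (9 * L + T) * inverse s" using s(1) by (simp add: field_simps)
  finally show "cmod (E N) <= \<bar>M\<bar> / 2 * (9 * L + T) * inverse (sqrt (real (Suc N)))" by (simp add: s_def)
 qed
 have E0: "E \<longlonglongrightarrow> 0"
 proof (rule Lim_null_comparison)
  show "\<forall>\<^sub>F N in sequentially. cmod (E N) <= \<bar>M\<bar> / 2 * (9 * L + T) * inverse (sqrt (real (Suc N)))" using bE by simp
  show "(%N. \<bar>M\<bar> / 2 * (9 * L + T) * inverse (sqrt (real (Suc N)))) \<longlonglongrightarrow> 0" by real_asymp
 qed
 \<comment> \<open>For large \<open>N\<close> the cutoff is 1 on the annulus carrying the derivative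
   of \<open>\<psi>\<close>, which is bounded and at distance at least \<open>r\<close> from
   \<open>z1\<close>. There the integrand is that of \<open>annulus_formula\<close>, up to the term
   with the derivative of the cutoff.\<close>
 have big: "\<forall>\<^sub>F N in sequentially. (LINT z|lborel. \<phi>e z * bt N z) = E N + c0"
 proof -
  have "\<forall>\<^sub>F N in sequentially. cmod z0 + 2 * r <= real (Suc N)" "\<forall>\<^sub>F N in sequentially. 1 / real (Suc N) <= r"
   using r(1) by real_asymp+
  thus ?thesis
  proof eventually_elim
   case (elim N)
   define A where "A z = (if z : ball z0 (3 * r) then complex_of_real (D z) / (z - z0) * \<phi>0 z else 0)" for z
   have A: "integrable lborel A" "integral\<^sup>L lborel A = - c0"
   unfolding A_def[abs_def] D_def c0_def using annulus_formula[OF r(1) \<phi>0(1)] by auto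
   have "\<phi>e z * bt N z = \<phi>e z * (b N z * (\<psi> z * h z)) - A z" if "z ~= z0" for z
   proof -
   have "\<phi>e z * (of_real (\<eta> N z) * of_real (D z) * ((z - z0) * h z)) = A z"
   proof (cases "D z = 0")
   case False
   hence d: "r < cmod (z - z0)" "cmod (z - z0) < 2 * r"
   using bump_inner(2)[of r "2 * r" z z0] bump_outer(2)[of r "2 * r" z z0] r(1) unfolding D_def by force+
   hence b: "z : ball z0 (3 * r)" using r(1) by (simp add: dist_norm norm_minus_commute)
   have "cmod (z1 - z0) >= 3 * r" using r(3) by (simp add: dist_norm norm_minus_commute)
   moreover have "cmod (z1 - z0) <= cmod (z - z1) + cmod (z - z0)" using norm_triangle_ineq4[of "z - z0" "z - z1"] by simp
   ultimately have z1: "r <= cmod (z - z1)" using d by linarith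
   have "cmod z <= cmod z0 + 2 * r" using d norm_triangle_ineq2[of z z0] by linarith
   hence "\<eta> N z = 1" using z1 elim by (intro one) auto
   moreover have "\<phi>e z = \<phi>0 z" using b that z1 r(1) \<phi>0(2) by (auto simp: \<phi>e_def Om_def)
   moreover have "(z - z0) * h z = 1 / (z - z0)" using that by (simp add: h_def power2_eq_square)
   ultimately show ?thesis using b by (simp add: A_def)
   qed (simp add: A_def)
   thus ?thesis by (simp add: bt_def algebra_simps)
   qed
   hence AEq: "AE z in lborel. \<phi>e z * bt N z = \<phi>e z * (b N z * (\<psi> z * h z)) - A z" using AE_lborel_neq[of z0] by (auto elim: eventually_mono)
   have "(LINT z|lborel. \<phi>e z * bt N z) = (LINT z|lborel. \<phi>e z * (b N z * (\<psi> z * h z)) - A z)"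
   proof (rule integral_cong_AE[OF _ _ AEq])
   show "(%z. \<phi>e z * bt N z) : bmeas lborel" unfolding bt_def by measurable
   show "(%z. \<phi>e z * (b N z * (\<psi> z * h z)) - A z) : bmeas lborel"
   using iE[of N] A(1) by (intro borel_measurable_diff borel_measurable_integrable)
   qed
   thus ?case using iE[of N] A by (simp add: E_def)
  qed
 qed
 define X where "X z = \<mu> z * P' z * h z - \<mu> z * h z * h z" for z
 have iX': "integrable lborel X" unfolding X_def[abs_def] using iX iY by simp
 have Xm[measurable]: "X : bmeas borel" unfolding X_def[abs_def] by measurable
 have "(%N. \<integral>z. of_real (\<eta> N z) * X z \<partial>lborel) \<longlonglongrightarrow> integral\<^sup>L lborel X"
 proof (rule integral_dominated_convergence[where w="%z. cmod (X z)"])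
  show "AE z in lborel. (%N. of_real (\<eta> N z) * X z) \<longlonglongrightarrow> X z"
   using AE_lborel_neq[of z1]
  proof eventually_elim
   case (elim z)
   have "\<forall>\<^sub>F N in sequentially. of_real (\<eta> N z) * X z = X z"
   using cutoff_eventually_one[OF c elim elim] by eventually_elim simp
   thus ?case by (rule tendsto_eventually)
  qed
  show "AE z in lborel. norm (of_real (\<eta> N z) * X z) <= cmod (X z)" for N
   using e01[of N] by (intro AE_I2) (simp add: norm_mult mult_left_le_one_le)
 qed (use iX' in auto)
 moreover have "(%N. \<integral>z. of_real (\<eta> N z) * X z \<partial>lborel) \<longlonglongrightarrow> - (0 + c0)"
 proof (rule Lim_transform_eventually)
  show "(%N. - (E N + c0)) \<longlonglongrightarrow> - (0 + c0)" by (intro tendsto_intros E0)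
  show "\<forall>\<^sub>F N in sequentially. - (E N + c0) = (LINT z|lborel. of_real (\<eta> N z) * X z)"
   using big
  proof eventually_elim
   case (elim N)
   show ?case using elim[unfolded EQ] unfolding X_def by (metis minus_minus)
  qed
 qed
 ultimately have "integral\<^sup>L lborel X = - c0" using LIMSEQ_unique by fastforce
 hence "(LINT z|lborel. \<mu> z * P' z * h z) - (LINT z|lborel. \<mu> z * h z * h z) = - c0"
  unfolding X_def using iX iY by simp
 hence "c0 - (LINT z|lborel. \<mu> z * h z * h z) = - (LINT z|lborel. \<mu> z * P' z * h z)" by (simp add: algebra_simps)
 moreover have "(%z. \<mu> z * h z * h z) = (%z. \<mu> z * (1 / (z - z0) ^ 4))"
  by (simp add: h_def fun_eq_iff power2_eq_square power4_eq_xxxx)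
 ultimately show ?thesis using bX by (simp add: c0_def A2_def)
qed

section \<open>Homeomorphisms of the sphere in the finite chart\<close>

lemma open_Dc [simp]: "open Dc" unfolding Dc_def by (intro open_Collect_less continuous_intros)

lemma sets_Dc [simp]: "Dc : sets lebesgue" by simp

lemma openin_sphere_Some: "open S ==> openin sphere_top (Some ` S)"
 by (auto simp: openin_Alexandroff_compactification)

lemma openin_sphere_vimage: "openin sphere_top V ==> open (Some -` V)"
 by (auto simp: openin_Alexandroff_compactification vimage_def image_iff Collect_neg_eq open_Compl)

text \<open>The last two conclusions carry the later arguments. As \<open>W\<close> is open, values
  close to that at \<open>z0\<close> are taken only near \<open>z0\<close>, which bounds the
  reciprocal; as \<open>W\<close> is continuous at a pole, the chart expression tends to infinity
  there, which is used to exclude poles in the disc.\<close>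

lemma sphere_homeo:
 assumes W: "homeomorphic_map sphere_top sphere_top W"
 defines "Om \<equiv> {z. W (Some z) ~= None}"
 shows "open Om" "continuous_on Om (chart W)" "inj_on (chart W) Om"
  "EX z1. Om = UNIV \<or> Om = - {z1}"
  "z0 : Om ==> \<rho> > 0 ==> \<exists>\<delta>>0. \<forall>z\<in>Om. z ~: ball z0 \<rho> --> cmod (chart W z - chart W z0) >= \<delta>"
  "z0 ~: Om ==> \<exists>\<delta>>0. \<forall>z\<in>Om. z : ball z0 \<delta> --> cmod (chart W z) > b"
proof -
 have cont: "continuous_map sphere_top sphere_top W" and op: "open_map sphere_top sphere_top W"
  and inj: "inj_on W (topspace sphere_top)"
  by (rule homeomorphic_imp_continuous_map[OF W] homeomorphic_imp_open_map[OF W] homeomorphic_imp_injective_map[OF W])+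
 have ts: "topspace sphere_top = UNIV" by (auto simp: image_iff)
 have inj: "inj W" using inj unfolding ts .
 have ch: "W (Some z) = Some (chart W z)" if "z : Om" for z using that by (auto simp: Om_def chart_def)
 have pre: "open {z. W (Some z) : Some ` B}" if "open B" for B
 proof -
  have "openin sphere_top {p : topspace sphere_top. W p : Some ` B}"
   by (rule openin_continuous_map_preimage[OF cont openin_sphere_Some[OF that]])
  from openin_sphere_vimage[OF this] show ?thesis by (simp add: ts vimage_def)
 qed
 have "{z. W (Some z) : Some ` UNIV} = Om" by (auto simp: Om_def image_iff)
 with pre[OF open_UNIV] show O: "open Om" by simp
 show "continuous_on Om (chart W)"
  unfolding continuous_on_open_vimage[OF O]
 proof (intro allI impI)
  fix B :: "complex set" assume "open B"
  moreover have "chart W -` B \<inter> Om = {z. W (Some z) : Some ` B}"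
   using ch by (auto simp: Om_def chart_def image_iff)
  ultimately show "open (chart W -` B \<inter> Om)" using pre by simp
 qed
 show "inj_on (chart W) Om"
 proof (rule inj_onI)
  fix x y assume "x : Om" "y : Om" "chart W x = chart W y"
  hence "W (Some x) = W (Some y)" by (simp add: ch)
  thus "x = y" using inj by (auto dest: injD)
 qed
 show "EX z1. Om = UNIV \<or> Om = - {z1}"
 proof (cases "Om = UNIV")
  case False
  then obtain z1 where z1: "W (Some z1) = None" by (auto simp: Om_def)
  have "W (Some x) ~= None" if "x ~= z1" for x using injD[OF inj, of "Some x" "Some z1"] z1 that by auto
  hence "Om = - {z1}" using z1 by (auto simp: Om_def)
  thus ?thesis by blast
 qed simp
 show "\<exists>\<delta>>0. \<forall>z\<in>Om. z : ball z0 \<delta> --> cmod (chart W z) > b" if z0: "z0 ~: Om"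
 proof -
  define V :: "sphere set" where "V = insert None (Some ` (- cball 0 b))"
  have "openin sphere_top V"
   unfolding V_def openin_Alexandroff_compactification by (rule disjI2, rule exI[of _ "cball 0 b"]) (simp add: Compl_eq_Diff_UNIV)
  from openin_continuous_map_preimage[OF cont this] have "openin sphere_top {p. W p : V}" by (simp only: ts UNIV_I simp_thms)
  from openin_sphere_vimage[OF this] have "open {z. W (Some z) : V}" by (simp add: vimage_def)
  moreover have "z0 : {z. W (Some z) : V}" using z0 by (simp add: Om_def V_def)
  ultimately obtain \<delta> where \<delta>: "\<delta> > 0" "ball z0 \<delta> \<subseteq> {z. W (Some z) : V}" using open_contains_ball by blast
  have "cmod (chart W z) > b" if "z : Om" "z : ball z0 \<delta>" for z
   using \<delta>(2) that(2) ch[OF that(1)] by (auto simp: V_def subset_iff)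
  thus ?thesis using \<delta>(1) by blast
 qed
 show "\<exists>\<delta>>0. \<forall>z\<in>Om. z ~: ball z0 \<rho> --> cmod (chart W z - chart W z0) >= \<delta>" if z0: "z0 : Om" and \<rho>: "\<rho> > 0"
 proof -
  have "openin sphere_top (W ` Some ` ball z0 \<rho>)" using op openin_sphere_Some[OF open_ball] by (auto simp: open_map_def)
  hence o: "open (Some -` W ` Some ` ball z0 \<rho>)" by (rule openin_sphere_vimage)
  have "chart W z0 : Some -` W ` Some ` ball z0 \<rho>"
   unfolding vimage_eq using ch[OF z0] \<rho> by (metis centre_in_ball imageI)
  then obtain \<delta> where \<delta>: "\<delta> > 0" "ball (chart W z0) \<delta> \<subseteq> Some -` W ` Some ` ball z0 \<rho>"
   using o open_contains_ball by blast
  have "cmod (chart W z - chart W z0) >= \<delta>" if z: "z : Om" "z ~: ball z0 \<rho>" for z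
  proof (rule ccontr)
   assume "~ cmod (chart W z - chart W z0) >= \<delta>"
   hence "chart W z : ball (chart W z0) \<delta>" by (simp add: dist_norm norm_minus_commute)
   hence "Some (chart W z) : W ` Some ` ball z0 \<rho>" using \<delta>(2) by blast
   then obtain y where y: "y : ball z0 \<rho>" "W (Some z) = W (Some y)" using ch[OF z(1)] by auto
   hence "z = y" using injD[OF inj] by blast
   thus False using y z by simp
  qed
  thus ?thesis using \<delta>(1) by blast
 qed
qed

lemma weak_on_cmult:
 assumes W: "weak_on Om f p q"
 shows "weak_on Om (%z. c * f z) (%z. c * p z) (%z. c * q z)"
proof -
 have O: "open Om" using W by (simp add: weak_on_def)
 have "locally_L2 Om (%z. c * p z)" "locally_L2 Om (%z. c * q z)"
  using W O by (auto simp: weak_on_def intro!: locally_L2_mult)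
 thus ?thesis using W unfolding weak_on_def weak_d_z_def weak_d_zbar_def
  by (auto simp: mult.assoc intro!: continuous_intros)
qed

lemma deriv_shifted_product:
 assumes "open U" "g holomorphic_on U" "\<forall>z\<in>U. f z = c + (z - z0) * g z" "z : U"
 shows "deriv f z = g z + (z - z0) * deriv g z"
proof -
 have d: "(g has_field_derivative deriv g z) (at z)" using assms by (intro holomorphic_derivI)
 have "((%z. c + (z - z0) * g z) has_field_derivative (g z + (z - z0) * deriv g z)) (at z)"
  by (rule derivative_eq_intros refl d | simp)+
 hence "(f has_field_derivative (g z + (z - z0) * deriv g z)) (at z)"
  by (rule has_field_derivative_transform_within_open[OF _ assms(1,4)]) (use assms(3) in simp)
 thus ?thesis by (rule DERIV_imp_deriv)
qed

lemma schwarzian_formula: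
 assumes "open U" "f holomorphic_on U" "z : U" "deriv f z ~= 0"
 shows "schwarzian f z = deriv (deriv (deriv f)) z / deriv f z - 3 / 2 * (deriv (deriv f) z / deriv f z)^2"
proof -
 have h: "deriv f holomorphic_on U" "deriv (deriv f) holomorphic_on U"
  using assms by (auto intro!: holomorphic_deriv)
 have 1: "(deriv f has_field_derivative deriv (deriv f) z) (at z)" "(deriv (deriv f) has_field_derivative deriv (deriv (deriv f)) z) (at z)"
  using h assms by (auto intro!: holomorphic_derivI)
 have "(pre_schwarzian f has_field_derivative
   (deriv (deriv (deriv f)) z * deriv f z - deriv (deriv f) z * deriv (deriv f) z) / (deriv f z * deriv f z)) (at z)"
  unfolding pre_schwarzian_def[abs_def] by (rule DERIV_divide[OF 1(2,1) assms(4)])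
 note e = DERIV_imp_deriv[OF this]
 show ?thesis using assms(4) unfolding schwarzian_def e unfolding pre_schwarzian_def by (simp add: power2_eq_square divide_simps)
qed

text \<open>Expanding \<open>f\<close> to third order at \<open>z0\<close> identifies the derivative of the regular part with the Schwarzian.\<close>

lemma schwarzian_regular_part:
 assumes U: "open U" "z0 : U" and f: "f holomorphic_on U" "inj_on f U"
 shows "EX \<phi>0. \<phi>0 holomorphic_on U & (\<forall>z\<in>U - {z0}. deriv f z0 * (1 / (f z - f z0)) - 1 / (z - z0) = \<phi>0 z) \<and>
  deriv \<phi>0 z0 = - schwarzian f z0 / 6"
proof -
 define w where "w = deriv f z0"
 have w0: "w ~= 0" unfolding w_def by (rule holomorphic_injective_imp_regular[OF f(1) U(1) f(2) U(2)])
 define g where "g z = (if z = z0 then deriv f z0 else (f z - f z0) / (z - z0))" for z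
 have zi: "z0 : interior U" using U by (simp add: interior_open)
 have g: "g holomorphic_on U" unfolding g_def[abs_def] by (rule pole_lemma[OF f(1) zi])
 \<comment> \<open>After two divisions by \<open>z - z0\<close>, the numbers \<open>w\<close>,
   \<open>H z0\<close> and \<open>deriv H z0\<close> are the Taylor coefficients of \<open>f\<close>
   of orders 1, 2 and 3.\<close>
 define H where "H z = (if z = z0 then deriv g z0 else (g z - g z0) / (z - z0))" for z
 have H: "H holomorphic_on U" unfolding H_def[abs_def] by (rule pole_lemma[OF g zi])
 have gn: "g z ~= 0" if "z : U" for z using that w0 U(2) inj_onD[OF f(2), of z z0] by (auto simp: g_def w_def)
 have fg: "\<forall>z\<in>U. f z = f z0 + (z - z0) * g z" by (simp add: g_def)
 have gH: "\<forall>z\<in>U. g z = g z0 + (z - z0) * H z" by (simp add: H_def)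
 have g0: "g z0 = w" by (simp add: g_def w_def)
 have dg: "deriv g z = H z + (z - z0) * deriv H z" if "z : U" for z by (rule deriv_shifted_product[OF U(1) H gH that])
 have df: "deriv f z = w + (z - z0) * (H z + deriv g z)" if z: "z : U" for z
 proof -
  have "g z = w + (z - z0) * H z" using gH z g0 by simp
  thus ?thesis unfolding deriv_shifted_product[OF U(1) g fg z] by (simp only: distrib_left add.assoc)
 qed
 have hd: "deriv g holomorphic_on U" "deriv H holomorphic_on U" using g H U by (auto intro: holomorphic_deriv)
 define k where "k z = H z + deriv g z" for z
 have k: "k holomorphic_on U" unfolding k_def by (intro holomorphic_intros H hd)
 have ddf: "deriv (deriv f) z = k z + (z - z0) * deriv k z" if "z : U" for z
  by (rule deriv_shifted_product[where c=w, OF U(1) k _ that]) (simp add: df k_def)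
 have k2: "k z = 2 * H z + (z - z0) * deriv H z" if "z : U" for z using dg[OF that] by (simp add: k_def)
 have dk: "(k has_field_derivative (2 * deriv H z0 + deriv H z0)) (at z0)"
 proof -
  have d: "(H has_field_derivative deriv H z0) (at z0)" "(deriv H has_field_derivative deriv (deriv H) z0) (at z0)"
   using H hd U by (auto intro: holomorphic_derivI)
  have "((%z. 2 * H z + (z - z0) * deriv H z) has_field_derivative (2 * deriv H z0 + deriv H z0)) (at z0)"
   by (rule derivative_eq_intros refl d | simp)+
  thus ?thesis by (rule has_field_derivative_transform_within_open[OF _ U]) (simp add: k2)
 qed
 have dkh: "deriv k holomorphic_on U" using k U by (auto intro: holomorphic_deriv)
 have d3: "deriv (deriv (deriv f)) z0 = 2 * deriv k z0"
 proof -
  have d: "(k has_field_derivative deriv k z0) (at z0)" "(deriv k has_field_derivative deriv (deriv k) z0) (at z0)"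
   using k dkh U by (auto intro: holomorphic_derivI)
  have "((%z. k z + (z - z0) * deriv k z) has_field_derivative (2 * deriv k z0)) (at z0)"
   by (rule derivative_eq_intros refl d | simp)+
  hence "(deriv (deriv f) has_field_derivative (2 * deriv k z0)) (at z0)"
   by (rule has_field_derivative_transform_within_open[OF _ U]) (simp add: ddf)
  thus ?thesis by (rule DERIV_imp_deriv)
 qed
 have S: "schwarzian f z0 = 6 * deriv H z0 / w - 6 * (H z0 / w)^2"
 proof -
  have "deriv k z0 = 3 * deriv H z0" using DERIV_imp_deriv[OF dk] by simp
  moreover have "deriv (deriv f) z0 = 2 * H z0" using ddf[OF U(2)] k2[OF U(2)] by simp
  ultimately show ?thesis using schwarzian_formula[OF U(1) f(1) U(2)] w0 d3 unfolding w_def[symmetric]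
   by (simp add: power_divide power_mult_distrib)
 qed
 \<comment> \<open>With f - f(z0) = (z - z0) g the difference is (w - g) / ((z - z0) g), and g - w =
   (z - z0) H.\<close>
 define \<phi>0 where "\<phi>0 z = - (H z / g z)" for z
 have "\<phi>0 holomorphic_on U" unfolding \<phi>0_def[abs_def] using gn by (intro holomorphic_intros H g) auto
 moreover have "deriv f z0 * (1 / (f z - f z0)) - 1 / (z - z0) = \<phi>0 z" if z: "z : U - {z0}" for z
 proof -
  have "f z - f z0 = (z - z0) * g z" using fg z by auto
  moreover have "H z = (g z - w) / (z - z0)" using z g0 by (simp add: H_def)
  ultimately show ?thesis using gn[of z] z unfolding w_def[symmetric] \<phi>0_def by (simp add: divide_simps)
 qed
 moreover have "deriv \<phi>0 z0 = - schwarzian f z0 / 6"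
 proof -
  have d: "(H has_field_derivative deriv H z0) (at z0)" "(g has_field_derivative deriv g z0) (at z0)"
   using H g U by (auto intro: holomorphic_derivI)
  have "(\<phi>0 has_field_derivative (- ((deriv H z0 * g z0 - H z0 * deriv g z0) / (g z0 * g z0)))) (at z0)"
   unfolding \<phi>0_def[abs_def] by (intro DERIV_minus DERIV_divide d gn U(2))
  moreover have "deriv g z0 = H z0" using dg[OF U(2)] by simp
  ultimately show ?thesis using w0 unfolding S g0 by (simp add: DERIV_imp_deriv power2_eq_square field_simps)
 qed
 ultimately show ?thesis by blast
qed

lemma tail_Dc:
 assumes z0: "cmod z0 < 1"
 shows "integrable (leb Dc) (%z. 1 / (cmod (z - z0))^4)"
  "(LINT z|leb Dc. 1 / (cmod (z - z0))^4) <= tail_const / (1 - cmod z0)^2"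
proof -
 define f where "f z = (if 1 - cmod z0 <= cmod (z - z0) then 1 / (cmod (z - z0))^4 else 0)" for z
 have Dm: "Dc : sets lebesgue" by simp
 have fm: "f : bmeas lborel" unfolding f_def[abs_def] by measurable
 have f0: "f z >= 0" for z by (simp add: f_def)
 have "(\<integral>\<^sup>+z. ennreal (f z) \<partial>lborel) <= ennreal (tail_const / (1 - cmod z0)^2)"
  unfolding f_def by (rule tail_integral) (use z0 in simp)
 from integrable_of_nn_integral[OF _ f0 this] fm
 have i: "integrable lborel f" "integral\<^sup>L lborel f <= tail_const / (1 - cmod z0)^2" using tail_const_nonneg by auto
 have i': "integrable lebesgue f" using i(1) fm by (simp add: integrable_completion)
 have e: "1 / (cmod (z - z0))^4 = f z" if "z : Dc" for z
  using norm_triangle_ineq2[of z z0] that by (auto simp: f_def Dc_def)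
 have s: "integrable lebesgue (%z. indicator Dc z *\<^sub>R f z)" by (rule integrable_mult_indicator[OF Dm i'])
 hence "integrable (leb Dc) f" using Dm by (simp add: integrable_restrict_space)
 thus "integrable (leb Dc) (%z. 1 / (cmod (z - z0))^4)"
  by (subst Bochner_Integration.integrable_cong[OF refl, of _ _ f]) (auto simp: e)
 have "(LINT z|leb Dc. 1 / (cmod (z - z0))^4) = integral\<^sup>L (leb Dc) f"
  by (rule Bochner_Integration.integral_cong) (auto simp: e)
 also have "... = (LINT z|lebesgue. indicator Dc z *\<^sub>R f z)" using Dm by (simp add: integral_restrict_space)
 also have "... <= integral\<^sup>L lebesgue f" by (rule integral_mono[OF s i']) (simp add: f0 indicator_def)
 also have "... = integral\<^sup>L lborel f" using fm by (simp add: integral_completion)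
 finally show "(LINT z|leb Dc. 1 / (cmod (z - z0))^4) <= tail_const / (1 - cmod z0)^2" using i(2) by simp
qed

text \<open>The regular part has derivative -S/6 at the point, so the representation of
  annulus_const times that derivative turns into S = kap times the integral, up to an error. With
  the value pi of \<open>annulus_const\<close> this is the classical factor -6/pi. In
  \<open>err_const\<close>, 54 is 6 times the 9 of \<open>core_representation\<close>.\<close>

definition kap :: complex where "kap = - 6 / of_real annulus_const"
definition err_const :: real where "err_const = 54 * tail_const / annulus_const"

lemma beltrami_weak:
 assumes "beltrami_homeo (extend_by_0 \<mu>) W"
 defines "Om \<equiv> {z. W (Some z) ~= None}"
 shows "EX p q. weak_on Om (chart W) p q & (AE z in lborel. z : Om --> q z = extend_by_0 \<mu> z * p z)"
proof -
 have h: "homeomorphic_map sphere_top sphere_top W" using assms(1) by (simp add: beltrami_homeo_def)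
 obtain p q where pq: "locally_L2 Om p" "locally_L2 Om q" "weak_d_z Om (chart W) p" "weak_d_zbar Om (chart W) q"
  "AE z in leb Om. q z = extend_by_0 \<mu> z * p z"
  using assms(1) unfolding beltrami_homeo_def Let_def Om_def by blast
 have O: "open Om" "continuous_on Om (chart W)" unfolding Om_def using sphere_homeo[OF h] by auto
 hence "AE z in lebesgue. z : Om --> q z = extend_by_0 \<mu> z * p z"
  using pq(5) by (subst (asm) AE_restrict_space_iff) auto
 hence "AE z in lborel. z : Om --> q z = extend_by_0 \<mu> z * p z" by (simp add: AE_completion_iff)
 thus ?thesis using pq O unfolding weak_on_def by blast
qed

text \<open>The coefficient is 0 on the disc, so Weyl's lemma applies on the part of the disc where
  the map is finite.\<close>

lemma beltrami_holomorphic: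
 assumes B: "beltrami_homeo (extend_by_0 \<mu>) W"
 shows "chart W holomorphic_on (ball 0 1 \<inter> {z. W (Some z) ~= None})"
proof -
 obtain p q where pq: "weak_on {z. W (Some z) ~= None} (chart W) p q" "AE z in lborel. z : {z. W (Some z) ~= None} --> q z = extend_by_0 \<mu> z * p z"
  using beltrami_weak[OF B] by blast
 have O: "open {z. W (Some z) ~= None}" using pq(1) by (simp add: weak_on_def)
 show ?thesis
 proof (rule weyl[OF pq(1)])
  show "AE z in lborel. z : ball 0 1 \<inter> {z. W (Some z) ~= None} --> q z = 0"
   using pq(2) by eventually_elim (auto simp: extend_by_0_def Dc_def)
 qed (use O in auto)
qed

text \<open>It remains to verify the hypotheses of \<open>core_representation\<close> for the
  difference of f'(z0) / (f - f(z0)) and 1 / (z - z0). It is bounded: near \<open>z0\<close> it is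
  the holomorphic regular part, and elsewhere \<open>f\<close> stays away from its value at
  \<open>z0\<close>.\<close>

lemma schwarzian_estimate:
 assumes B: "beltrami_homeo (extend_by_0 \<mu>) W"
  and \<mu>m: "\<mu> : bmeas (leb Dc)" and \<mu>k: "AE z in leb Dc. cmod (\<mu> z) <= k"
  and k: "0 <= k" "k <= 1/4" and z0: "cmod z0 < 1" and W0: "W (Some z0) ~= None"
 shows "cmod (schwarzian (chart W) z0 - kap * (LINT \<zeta>|leb Dc. \<mu> \<zeta> * (1 / (\<zeta> - z0)^4))) <= err_const * k^2 / (1 - cmod z0)^2"
proof -
 define Om where "Om = {z. W (Some z) ~= None}"
 define f where "f = chart W"
 have h: "homeomorphic_map sphere_top sphere_top W" using B by (simp add: beltrami_homeo_def)
 note sh = sphere_homeo[OF h, folded Om_def f_def]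
 have z0Om: "z0 : Om" using W0 by (simp add: Om_def)
 \<comment> \<open>\<open>z1\<close> is the finite pole of the map if there is one. Otherwise a
   second exceptional point outside the disc is harmless, and \<open>z0 + 2\<close> is such a
   point.\<close>
 obtain z1 where z1: "- {z0, z1} \<subseteq> Om" "z1 ~= z0" "z1 ~: ball 0 1 \<inter> Om"
 proof -
  obtain z2 where "Om = UNIV \<or> Om = - {z2}" using sh(4) by blast
  then consider "Om = UNIV" | "Om = - {z2}" by blast
  thus ?thesis
  proof cases
   case 1
   have "cmod (z0 + 2) >= 1" using norm_triangle_ineq2[of 2 "- z0"] z0 by (simp add: add.commute)
   thus ?thesis using that[of "z0 + 2"] 1 by simp
  next
   case 2
   thus ?thesis using that[of z2] z0Om by auto
  qed
 qed
 define Om' where "Om' = - {z0, z1}"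
 have O': "open Om'" unfolding Om'_def by (intro open_Compl finite_imp_closed) auto
 have sub: "Om' \<subseteq> Om" using z1 by (simp add: Om'_def)
 obtain p q where pq: "weak_on Om f p q" "AE z in lborel. z : Om --> q z = extend_by_0 \<mu> z * p z"
  using beltrami_weak[OF B] unfolding Om_def f_def by blast
 define U where "U = ball 0 1 \<inter> Om"
 have U: "open U" "z0 : U" using sh(1) z0 z0Om by (auto simp: U_def)
 have fU: "f holomorphic_on U" using beltrami_holomorphic[OF B] by (simp add: U_def Om_def f_def)
 have fi: "inj_on f U" using sh(3) by (rule inj_on_subset) (auto simp: U_def)
 obtain \<phi>0 where \<phi>0: "\<phi>0 holomorphic_on U" "\<forall>z\<in>U - {z0}. deriv f z0 * (1 / (f z - f z0)) - 1 / (z - z0) = \<phi>0 z"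
  "deriv \<phi>0 z0 = - schwarzian f z0 / 6"
  using schwarzian_regular_part[OF U fU fi] by blast
 obtain e where e: "e > 0" "ball z0 e \<subseteq> U" using U open_contains_ball by blast
 define r where "r = e / 3"
 have r: "r > 0" "ball z0 (3 * r) \<subseteq> U" using e by (auto simp: r_def)
 define w where "w = deriv f z0"
 define \<phi> where "\<phi> z = w * (1 / (f z - f z0)) - 1 / (z - z0)" for z
 define P where "P z = w * ((- 1 / (f z - f z0)^2) * p z) - deriv (%z. 1 / (z - z0)) z" for z
 define Q where "Q z = w * ((- 1 / (f z - f z0)^2) * q z) - 0" for z
 have ne: "\<forall>z\<in>Om'. f z ~= f z0" using inj_onD[OF sh(3) _ _ z0Om] sub by (auto simp: Om'_def subset_iff)
 have WW: "weak_on Om' \<phi> P Q"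
  unfolding \<phi>_def[abs_def] P_def[abs_def] Q_def[abs_def]
  by (intro weak_on_diff weak_on_cmult weak_on_inverse weak_on_holomorphic O' weak_on_subset[OF pq(1) O' sub] ne holomorphic_intros)
   (auto simp: Om'_def)
 have dinv: "deriv (%z. 1 / (z - z0)) z = - (1 / (z - z0)^2)" if "z ~= z0" for z
 proof (rule DERIV_imp_deriv)
  show "((%z. 1 / (z - z0)) has_field_derivative - (1 / (z - z0)^2)) (at z)"
   using that by (auto intro!: derivative_eq_intros simp: power2_eq_square)
 qed
 have Ds: "Dc : sets lebesgue" by simp
 obtain \<nu> where \<nu>m: "\<nu> : bmeas borel" and \<nu>: "AE z in lborel. \<nu> z = (if z : Dc then \<mu> z else 0)"
  using lebesgue_on_borel_rep[OF \<mu>m Ds] by blast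
 \<comment> \<open>Subtracting \<open>1 / (z - z0)^2\<close> from \<open>P\<close> undoes the
   derivative of the singular part and leaves that of w / (f - f(z0)), which inherits the Beltrami
   equation of \<open>f\<close>.\<close>
 have Qeq: "AE z in lborel. z : - {z0, z1} --> Q z = \<nu> z * (P z - 1 / (z - z0)^2)"
  using pq(2) \<nu>
 proof eventually_elim
  case (elim z)
  show ?case
  proof
   assume z: "z : - {z0, z1}"
   hence "q z = \<nu> z * p z" using elim z1(1) by (auto simp: extend_by_0_def)
   thus "Q z = \<nu> z * (P z - 1 / (z - z0)^2)" using dinv[of z] z by (simp add: P_def Q_def)
  qed
 qed
 have "AE z in lebesgue. z : Dc --> cmod (\<mu> z) <= k" using \<mu>k Ds by (simp add: AE_restrict_space_iff)
 hence "AE z in lborel. z : Dc --> cmod (\<mu> z) <= k" by (simp add: AE_completion_iff)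
 hence \<nu>k: "AE z in lborel. cmod (\<nu> z) <= k" using \<nu> by eventually_elim (use k in auto)
 have \<nu>0: "AE z in lborel. z : ball 0 1 --> \<nu> z = 0" using \<nu> by eventually_elim (auto simp: Dc_def)
 have "EX M. \<forall>z\<in>- {z0, z1}. cmod (\<phi> z) <= M"
 proof -
  obtain \<delta> where \<delta>: "\<delta> > 0" "\<forall>z\<in>Om. z ~: ball z0 r --> cmod (f z - f z0) >= \<delta>" using sh(5)[OF z0Om r(1)] by blast
  have cb: "cball z0 r \<subseteq> U" using r by (intro order_trans[OF _ r(2)]) auto
  have "compact (\<phi>0 ` cball z0 r)"
   by (intro compact_continuous_image continuous_on_subset[OF holomorphic_on_imp_continuous_on[OF \<phi>0(1)] cb]) auto
  then obtain M0 where M0: "\<forall>x\<in>\<phi>0 ` cball z0 r. cmod x <= M0" using compact_imp_bounded bounded_iff by metis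
  have "cmod (\<phi> z) <= max M0 (cmod w * (1 / \<delta>) + 1 / r)" if z: "z : - {z0, z1}" for z
  proof (cases "z : ball z0 r")
   case True
   hence "z : cball z0 r" by auto
   hence "cmod (\<phi>0 z) <= M0" "z : U" using M0 cb by auto
   moreover have "\<phi> z = \<phi>0 z" using \<phi>0(2) \<open>z : U\<close> z by (simp add: \<phi>_def w_def)
   ultimately show ?thesis by simp
  next
   case False
   have "z : Om" using z z1(1) by auto
   hence d: "cmod (f z - f z0) >= \<delta>" using \<delta>(2) False by blast
   have d2: "cmod (z - z0) >= r" using False by (simp add: dist_norm norm_minus_commute)
   have "cmod (\<phi> z) <= cmod (w * (1 / (f z - f z0))) + cmod (1 / (z - z0))" unfolding \<phi>_def by (rule norm_triangle_ineq4)
   also have "... <= cmod w * (1 / \<delta>) + 1 / r"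
   unfolding norm_mult norm_divide norm_one using d d2 \<delta>(1) r(1) by (intro add_mono mult_left_mono frac_le) auto
   finally show ?thesis by simp
  qed
  thus ?thesis by blast
 qed
 then obtain M where M: "\<forall>z\<in>- {z0, z1}. cmod (\<phi> z) <= M" by blast
 define I where "I = (LINT \<zeta>|leb Dc. \<mu> \<zeta> * (1 / (\<zeta> - z0)^4))"
 have "cmod (of_real annulus_const * deriv \<phi>0 z0 - (LINT z|lborel. \<nu> z * (1 / (z - z0) ^ 4))) <= 9 * k^2 * (tail_const / (1 - cmod z0)^2)"
 proof (rule core_representation[OF WW[unfolded Om'_def] M Qeq \<nu>m \<nu>k \<nu>0 k z0 r(1)])
  show "ball z0 (3 * r) \<subseteq> ball 0 1" "z1 ~: ball z0 (3 * r)" using r(2) z1(3) by (auto simp: U_def)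
  show "\<phi>0 holomorphic_on ball z0 (3 * r)" using \<phi>0(1) r(2) by (rule holomorphic_on_subset)
  show "\<forall>z\<in>ball z0 (3 * r) - {z0}. \<phi> z = \<phi>0 z" using \<phi>0(2) r(2) by (auto simp: \<phi>_def w_def)
 qed
 also have "(LINT z|lborel. \<nu> z * (1 / (z - z0) ^ 4)) = I"
  unfolding I_def
 proof (rule lebesgue_on_integral_borel[OF Ds, symmetric])
  have "continuous_on Dc (%z. 1 / (z - z0)^4)" using z0 by (intro continuous_intros) (auto simp: Dc_def)
  hence "(%z. 1 / (z - z0)^4) : bmeas (leb Dc)" by (rule continuous_measurable_leb[OF _ Ds])
  thus "(%\<zeta>. \<mu> \<zeta> * (1 / (\<zeta> - z0)^4)) : bmeas (leb Dc)" using \<mu>m by measurable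
  show "(%z. \<nu> z * (1 / (z - z0) ^ 4)) : bmeas borel" using \<nu>m by measurable
  show "AE z in lborel. \<nu> z * (1 / (z - z0) ^ 4) = (if z : Dc then \<mu> z * (1 / (z - z0)^4) else 0)"
   using \<nu> by eventually_elim simp
 qed
 finally have le: "cmod (of_real annulus_const * deriv \<phi>0 z0 - I) <= 9 * k^2 * (tail_const / (1 - cmod z0)^2)" .
 have c0: "annulus_const > 0" by (rule annulus_const_pos)
 have "schwarzian f z0 - kap * I = kap * (of_real annulus_const * deriv \<phi>0 z0 - I)"
  using c0 unfolding \<phi>0(3) kap_def by (simp add: field_simps)
 moreover have "cmod kap = 6 / annulus_const" using c0 by (simp add: kap_def norm_divide)
 ultimately have "cmod (schwarzian f z0 - kap * I) = 6 / annulus_const * cmod (of_real annulus_const * deriv \<phi>0 z0 - I)"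
  by (simp only: norm_mult)
 also have "... <= 6 / annulus_const * (9 * k^2 * (tail_const / (1 - cmod z0)^2))" using c0 le by (intro mult_left_mono) auto
 also have "... = err_const * k^2 / (1 - cmod z0)^2" by (simp add: err_const_def)
 finally show ?thesis by (simp add: f_def I_def)
qed

section \<open>Higher Schwarzians\<close>

text \<open>Along a radius, \<open>cmod (u z)\<close> is compared with 2 M / (1 - s). While this
  bound holds, the derivative of u is at most (M + 2 M^2) / (1 - s)^2, and for
  \<open>M <= 1/2\<close> this does not exceed 2 M / (1 - s)^2, the derivative of the bound
  itself.\<close>

lemma riccati_bound_pos:
 assumes R: "R <= 1" and u: "u holomorphic_on ball 0 R" "u 0 = 0" and M: "0 < M" "M <= 1/2"
  and le: "\<forall>z\<in>ball 0 R. cmod (deriv u z - (u z)^2 / 2) <= M / (1 - cmod z)^2" and z: "z : ball 0 R"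
 shows "cmod (u z) * (1 - cmod z) <= 2 * M"
proof (rule ccontr)
 assume neg: "~ cmod (u z) * (1 - cmod z) <= 2 * M"
 define t where "t = cmod z"
 have z0: "z ~= 0" using neg u(2) M by auto
 define \<zeta> where "\<zeta> = z / of_real t"
 have \<zeta>: "cmod \<zeta> = 1" "of_real t * \<zeta> = z" using z0 by (simp_all add: \<zeta>_def t_def norm_divide)
 have t: "0 < t" "t < R" using z z0 by (auto simp: t_def)
 define v where "v s = u (of_real s * \<zeta>)" for s
 have inb: "of_real s * \<zeta> : ball 0 R" if "0 <= s" "s <= t" for s using that t \<zeta> by (simp add: norm_mult)
 have vd: "(v has_vector_derivative (deriv u (of_real s * \<zeta>) * \<zeta>)) (at s within T)" if "0 <= s" "s <= t" for s T
 proof -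
  have "(u has_field_derivative deriv u (of_real s * \<zeta>)) (at (of_real s * \<zeta>))"
   by (rule holomorphic_derivI[OF u(1) open_ball inb[OF that]])
  note 1 = has_field_derivative_at_within[OF this]
  have "((%s. complex_of_real s * \<zeta>) has_vector_derivative \<zeta>) (at s within T)"
   by (auto intro!: derivative_eq_intros simp: has_vector_derivative_def scaleR_conv_of_real)
  from field_vector_diff_chain_within[OF this 1] have "(u \<circ> (%s. complex_of_real s * \<zeta>) has_vector_derivative (\<zeta> * deriv u (of_real s * \<zeta>))) (at s within T)" .
  thus ?thesis by (simp add: o_def v_def[abs_def] mult.commute)
 qed
 have vc: "continuous_on {0..t} v"
  by (rule continuous_on_vector_derivative) (use vd in auto)
 define S where "S = {s : {0..t}. cmod (v s) * (1 - s) >= 2 * M}"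
 have "closed S"
  unfolding S_def by (intro continuous_on_closed_Collect_le continuous_intros vc closed_real_atLeastAtMost)
 hence "compact S" unfolding compact_eq_bounded_closed by (intro conjI bounded_subset[OF bounded_closed_interval[of 0 t]]) (auto simp: S_def)
 moreover have "t : S" using neg t unfolding S_def mem_Collect_eq v_def \<zeta>(2) by (simp add: t_def)
 \<comment> \<open>The first parameter at which the bound is reached. Integration from
   \<open>u 0 = 0\<close> up to it gives a value that is lower by 2 M, a contradiction.\<close>
 ultimately obtain s where s: "s : S" "\<forall>x\<in>S. s <= x" using compact_attains_inf[of S] by blast
 have st: "0 <= s" "s <= t" "cmod (v s) * (1 - s) >= 2 * M" using s(1) by (auto simp: S_def)
 have "s ~= 0" using st(3) u(2) M by (auto simp: v_def)
 hence s0: "0 < s" "s < 1" using st t R by auto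
 have "norm (v s - v 0) <= 2 * M / (1 - s) - 2 * M / (1 - 0)"
 proof (rule differentiable_bound_general[OF s0(1)])
  show "continuous_on {0..s} v" using vc by (rule continuous_on_subset) (use st in auto)
  show "continuous_on {0..s} (%s. 2 * M / (1 - s))" using s0 by (intro continuous_intros) auto
  show "(v has_vector_derivative deriv u (of_real x * \<zeta>) * \<zeta>) (at x)" if "0 < x" "x < s" for x using vd[of x UNIV] that st by simp
  show "((%s. 2 * M / (1 - s)) has_vector_derivative 2 * M / (1 - x)^2) (at x)" if "0 < x" "x < s" for x
   unfolding has_real_derivative_iff_has_vector_derivative[symmetric]
   using that s0 by (auto intro!: derivative_eq_intros simp: power2_eq_square)
  show "norm (deriv u (of_real x * \<zeta>) * \<zeta>) <= 2 * M / (1 - x)^2" if x: "0 < x" "x < s" for x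
  proof -
   define y where "y = of_real x * \<zeta>"
   have y: "y : ball 0 R" "cmod y = x" using inb[of x] x st \<zeta>(1) by (auto simp: y_def norm_mult)
   have "x ~: S" using s(2) x by auto
   hence b: "cmod (u y) * (1 - x) <= 2 * M" using x st by (simp add: S_def v_def y_def)
   have x1: "0 < 1 - x" using x s0 by simp
   have "cmod (u y) <= 2 * M / (1 - x)" using b x1 by (simp add: field_simps)
   hence "(cmod (u y))^2 <= (2 * M / (1 - x))^2" by (intro power_mono) auto
   also have "... = 2 * (2 * M^2 / (1 - x)^2)" by (simp add: power_divide power_mult_distrib)
   finally have "cmod ((u y)^2 / 2) <= 2 * M^2 / (1 - x)^2" by (simp add: norm_divide norm_power)
   moreover have "cmod (deriv u y) <= cmod (deriv u y - (u y)^2 / 2) + cmod ((u y)^2 / 2)" using norm_triangle_ineq[of "deriv u y - (u y)^2 / 2" "(u y)^2 / 2"] by simp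
   ultimately have "cmod (deriv u y) <= M / (1 - x)^2 + 2 * M^2 / (1 - x)^2" using le y by fastforce
   also have "... = (M + 2 * M^2) / (1 - x)^2" by (simp add: add_divide_distrib)
   also have "... <= 2 * M / (1 - x)^2" using M by (intro divide_right_mono) (auto simp: power2_eq_square)
   finally show ?thesis using \<zeta>(1) by (simp add: y_def norm_mult)
  qed
 qed
 hence "cmod (v s) <= 2 * M / (1 - s) - 2 * M" using u(2) by (simp add: v_def)
 hence "cmod (v s) * (1 - s) <= (2 * M / (1 - s) - 2 * M) * (1 - s)" using s0 by (intro mult_right_mono) auto
 also have "... = 2 * M * s" using s0 by (simp add: field_simps)
 also have "... < 2 * M" using s0 M by simp
 finally show False using st(3) by simp
qed

text \<open>Letting the constant decrease to \<open>M\<close> includes \<open>M = 0\<close>, the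
  case of the zero coefficient.\<close>

lemma riccati_bound:
 assumes R: "R <= 1" and u: "u holomorphic_on ball 0 R" "u 0 = 0" and M: "0 <= M" "M < 1/2"
  and le: "\<forall>z\<in>ball 0 R. cmod (deriv u z - (u z)^2 / 2) <= M / (1 - cmod z)^2" and z: "z : ball 0 R"
 shows "cmod (u z) * (1 - cmod z) <= 2 * M"
proof (rule dense_ge_bounded[of _ 1])
 show "2 * M < 1" using M by simp
 fix x :: real assume x: "2 * M < x" "x < 1"
 have "cmod (u z) * (1 - cmod z) <= 2 * (x / 2)"
 proof (rule riccati_bound_pos[OF R u _ _ _ z])
  show "\<forall>z\<in>ball 0 R. cmod (deriv u z - (u z)^2 / 2) <= x / 2 / (1 - cmod z)^2"
  proof
   fix y :: complex assume "y : ball 0 R"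
   hence "cmod (deriv u y - (u y)^2 / 2) <= M / (1 - cmod y)^2" using le by blast
   also have "... <= x / 2 / (1 - cmod y)^2" using x by (intro divide_right_mono) auto
   finally show "cmod (deriv u y - (u y)^2 / 2) <= x / 2 / (1 - cmod y)^2" .
  qed
 qed (use x M in auto)
 thus "cmod (u z) * (1 - cmod z) <= x" by simp
qed

section \<open>Weighted bounds on the disc and the recursion for higher Schwarzians\<close>

text \<open>The weight uses \<open>1 - cmod z\<close> instead of the \<open>1 - (cmod z)^2\<close>
  of \<open>B_space\<close>: it is convenient for Cauchy estimates, and passing to the latter costs
  at most the factor \<open>2 ^ q\<close>. Exponents add under products and rise by 1 under
  \<open>deriv\<close>.\<close>

definition disc_bound :: "nat => real => cfun => bool" where
 "disc_bound q B g \<longleftrightarrow> g holomorphic_on ball 0 1 & (\<forall>z\<in>ball 0 1. cmod (g z) * (1 - cmod z) ^ q <= B)"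

lemma disc_bound_nonneg: "disc_bound q B g ==> 0 <= B"
 unfolding disc_bound_def using norm_ge_zero[of "g 0"] by (metis centre_in_ball diff_zero mult.right_neutral norm_zero order_trans power_one zero_less_one)

lemma disc_bound_mono: "disc_bound q B g ==> B <= C ==> disc_bound q C g"
 unfolding disc_bound_def by fastforce

lemma disc_bound_cong:
 assumes "disc_bound q B g" "\<And>z. z : ball 0 1 ==> g z = h z"
 shows "disc_bound q B h"
proof -
 have "h holomorphic_on ball 0 1"
  using assms(1) by (intro holomorphic_transform[OF _ assms(2)]) (auto simp: disc_bound_def)
 thus ?thesis using assms unfolding disc_bound_def by auto
qed

lemma disc_bound_add:
 assumes "disc_bound q B g" "disc_bound q C h"
 shows "disc_bound q (B + C) (%z. g z + h z)"
 unfolding disc_bound_def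
proof (intro conjI ballI)
 show "(%z. g z + h z) holomorphic_on ball 0 1" using assms by (auto simp: disc_bound_def intro: holomorphic_intros)
 fix z :: complex assume z: "z : ball 0 1"
 have "cmod (g z + h z) * (1 - cmod z)^q <= (cmod (g z) + cmod (h z)) * (1 - cmod z)^q"
  using z by (intro mult_right_mono norm_triangle_ineq) auto
 also have "... <= B + C" using assms z by (simp add: disc_bound_def distrib_right add_mono)
 finally show "cmod (g z + h z) * (1 - cmod z)^q <= B + C" .
qed

lemma disc_bound_mult:
 assumes "disc_bound q B g" "disc_bound p C h"
 shows "disc_bound (q + p) (B * C) (%z. g z * h z)"
 unfolding disc_bound_def
proof (intro conjI ballI)
 show "(%z. g z * h z) holomorphic_on ball 0 1" using assms by (auto simp: disc_bound_def intro: holomorphic_intros)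
 fix z :: complex assume z: "z : ball 0 1"
 have "cmod (g z * h z) * (1 - cmod z)^(q + p) = (cmod (g z) * (1 - cmod z)^q) * (cmod (h z) * (1 - cmod z)^p)"
  by (simp add: norm_mult power_add)
 also have "... <= B * C"
  using assms z disc_bound_nonneg[OF assms(1)] by (intro mult_mono) (auto simp: disc_bound_def)
 finally show "cmod (g z * h z) * (1 - cmod z)^(q + p) <= B * C" .
qed

lemma disc_bound_cmult: "disc_bound q B g ==> disc_bound q (cmod c * B) (%z. c * g z)"
 unfolding disc_bound_def by (auto simp: norm_mult mult.assoc intro!: holomorphic_intros mult_left_mono)

text \<open>Cauchy's inequality on the disc of half the distance to the boundary: each power of the
  weight loses a factor 2, and the radius contributes one more.\<close>

lemma disc_bound_deriv:
 assumes "disc_bound q B g"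
 shows "disc_bound (Suc q) (2 ^ Suc q * B) (deriv g)"
 unfolding disc_bound_def
proof (intro conjI ballI)
 have g: "g holomorphic_on ball 0 1" and le: "\<And>z. z : ball 0 1 ==> cmod (g z) * (1 - cmod z)^q <= B" using assms by (auto simp: disc_bound_def)
 show "deriv g holomorphic_on ball 0 1" by (rule holomorphic_deriv[OF g open_ball])
 fix z :: complex assume z: "z : ball 0 1"
 define r where "r = (1 - cmod z) / 2"
 have r: "r > 0" using z by (simp add: r_def)
 have sub: "1 - cmod x >= r" if "cmod (z - x) <= r" for x
  using norm_triangle_ineq2[of x z] that by (simp add: r_def norm_minus_commute)
 have cb: "cball z r \<subseteq> ball 0 1" using sub r by (force simp: dist_norm)
 have "cmod ((deriv ^^ 1) g z) <= fact 1 * (B / r^q) / r^1"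
 proof (rule Cauchy_inequality[OF _ _ r])
  show "g holomorphic_on ball z r" using g by (rule holomorphic_on_subset) (use cb in auto)
  show "continuous_on (cball z r) g" by (rule continuous_on_subset[OF holomorphic_on_imp_continuous_on[OF g] cb])
  fix x assume "cmod (z - x) = r"
  hence x: "r <= 1 - cmod x" "x : ball 0 1" using sub[of x] r by auto
  have "cmod (g x) * r^q <= cmod (g x) * (1 - cmod x)^q" using x r by (intro mult_left_mono power_mono) auto
  hence "cmod (g x) * r^q <= B" using le[OF x(2)] by simp
  thus "cmod (g x) <= B / r^q" using r by (simp add: pos_le_divide_eq)
 qed
 hence "cmod (deriv g z) * r^Suc q <= B" using r by (simp add: pos_le_divide_eq mult.commute mult.left_commute)
 hence "2 ^ Suc q * (cmod (deriv g z) * r^Suc q) <= 2 ^ Suc q * B" by (intro mult_left_mono) auto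
 moreover have "2 ^ Suc q * (cmod (deriv g z) * r^Suc q) = cmod (deriv g z) * (1 - cmod z)^Suc q"
 proof -
  have "1 - cmod z = 2 * r" by (simp add: r_def)
  thus ?thesis by (simp only: power_mult_distrib ac_simps)
 qed
 ultimately show "cmod (deriv g z) * (1 - cmod z)^Suc q <= 2 ^ Suc q * B" by linarith
qed

lemma disc_bound_higher_deriv: "\<exists>C\<ge>0. ALL B g. disc_bound q B g --> disc_bound (q + j) (C * B) ((deriv ^^ j) g)"
proof (induction j)
 case 0
 show ?case by (rule exI[of _ 1]) simp
next
 case (Suc j)
 then obtain C where C: "C >= 0" "\<And>B g. disc_bound q B g ==> disc_bound (q + j) (C * B) ((deriv ^^ j) g)" by blast
 have "disc_bound (q + Suc j) (2 ^ Suc (q + j) * C * B) ((deriv ^^ Suc j) g)" if "disc_bound q B g" for B g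
  using disc_bound_deriv[OF C(2)[OF that]] by (simp add: mult.assoc)
 thus ?case using C(1) by (intro exI[of _ "2 ^ Suc (q + j) * C"]) auto
qed

text \<open>Both families of higher Schwarzians have this shape up to a constant factor, with u =
  f''/f' and S the Schwarzian. They differ only in the coefficients, so one estimate serves
  both.\<close>

definition jet_sequence :: "(nat => complex) => complex => complex => cfun => cfun => (nat => complex => complex) => bool" where
 "jet_sequence b \<alpha> \<beta> u S g \<longleftrightarrow> (\<forall>z\<in>ball 0 1. g 0 z = \<alpha> * S z + \<beta> * (u z * u z)) \<and>
  (ALL j. \<forall>z\<in>ball 0 1. g (Suc j) z = deriv (g j) z + b j * (u z * g j z))"

text \<open>\<open>u\<close> and \<open>S\<close> are of order \<open>k\<close>, so every product
  with \<open>u\<close> is of order \<open>k^2\<close>, and to first order only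
  \<open>\<alpha>\<close> times a derivative of \<open>S\<close> remains. \<open>C\<close> is chosen
  before \<open>k\<close>, \<open>u\<close>, \<open>S\<close> and \<open>g\<close>; this uniformity
  is what differentiability in norm needs.\<close>

lemma jet_sequence_bound:
 assumes A: "A >= 0"
 shows "\<exists>C\<ge>0. ALL k u S g. 0 <= k --> k <= 1 --> disc_bound 1 (A * k) u --> disc_bound 2 (A * k) S --> jet_sequence b \<alpha> \<beta> u S g -->
  disc_bound (j + 2) (C * k) (g j) & disc_bound (j + 2) (C * k^2) (%z. g j z - \<alpha> * (deriv ^^ j) S z)"
proof (induction j)
 case 0
 define C where "C = cmod \<alpha> * A + cmod \<beta> * A^2"
 have C0: "C >= 0" using A by (simp add: C_def)
 have "disc_bound (0 + 2) (C * k) (g 0) & disc_bound (0 + 2) (C * k^2) (%z. g 0 z - \<alpha> * (deriv ^^ 0) S z)"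
  if k: "0 <= k" "k <= 1" and u: "disc_bound 1 (A * k) u" and S: "disc_bound 2 (A * k) S" and g: "jet_sequence b \<alpha> \<beta> u S g" for k u S g
 proof
  have u2: "disc_bound 2 (cmod \<beta> * (A * k * (A * k))) (%z. \<beta> * (u z * u z))"
   using disc_bound_cmult[OF disc_bound_mult[OF u u], of \<beta>] by (simp add: numeral_2_eq_2)
  have e: "cmod \<beta> * (A * k * (A * k)) = (cmod \<beta> * A^2) * k^2" by (simp add: power2_eq_square)
  have kk: "k^2 <= k" using k by (simp add: power2_eq_square mult_left_le)
  have s: "disc_bound 2 (cmod \<alpha> * (A * k) + cmod \<beta> * (A * k * (A * k))) (g 0)"
   by (rule disc_bound_cong[OF disc_bound_add[OF disc_bound_cmult[OF S] u2]]) (use g in \<open>auto simp: jet_sequence_def\<close>)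
  show "disc_bound (0 + 2) (C * k) (g 0)"
   unfolding add_0 by (rule disc_bound_mono[OF s]) (insert mult_left_mono[OF kk, of "cmod \<beta> * A^2"], unfold e C_def distrib_right, simp add: mult.assoc)
  have s: "disc_bound 2 (cmod \<beta> * (A * k * (A * k))) (%z. g 0 z - \<alpha> * (deriv ^^ 0) S z)"
   by (rule disc_bound_cong[OF u2]) (use g in \<open>auto simp: jet_sequence_def\<close>)
  show "disc_bound (0 + 2) (C * k^2) (%z. g 0 z - \<alpha> * (deriv ^^ 0) S z)"
   unfolding add_0 by (rule disc_bound_mono[OF s]) (insert mult_nonneg_nonneg[OF mult_nonneg_nonneg[OF norm_ge_zero[of \<alpha>] A] zero_le_power2[of k]], unfold e C_def distrib_right, linarith)
 qed
 thus ?case using C0 by blast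
next
 case (Suc j)
 then obtain C where C: "C >= 0" and IH: "ALL k u S g. 0 <= k --> k <= 1 --> disc_bound 1 (A * k) u --> disc_bound 2 (A * k) S --> jet_sequence b \<alpha> \<beta> u S g -->
  disc_bound (j + 2) (C * k) (g j) & disc_bound (j + 2) (C * k^2) (%z. g j z - \<alpha> * (deriv ^^ j) S z)" by blast
 define C' where "C' = 2 ^ (j + 3) * C + cmod (b j) * A * C"
 have C0: "C' >= 0" using A C by (simp add: C'_def)
 have "disc_bound (Suc j + 2) (C' * k) (g (Suc j)) & disc_bound (Suc j + 2) (C' * k^2) (%z. g (Suc j) z - \<alpha> * (deriv ^^ Suc j) S z)"
  if k: "0 <= k" "k <= 1" and u: "disc_bound 1 (A * k) u" and S: "disc_bound 2 (A * k) S" and g: "jet_sequence b \<alpha> \<beta> u S g" for k u S g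
 proof
  have 1: "disc_bound (j + 2) (C * k) (g j)" and 2: "disc_bound (j + 2) (C * k^2) (%z. g j z - \<alpha> * (deriv ^^ j) S z)"
   using IH k u S g by blast+
  have gs: "g (Suc j) z = deriv (g j) z + b j * (u z * g j z)" if "z : ball 0 1" for z using g that by (simp add: jet_sequence_def)
  have kk: "k^2 <= k" using k by (simp add: power2_eq_square mult_left_le)
  have ug: "disc_bound (Suc j + 2) (cmod (b j) * (A * k * (C * k))) (%z. b j * (u z * g j z))"
   using disc_bound_cmult[OF disc_bound_mult[OF u 1], of "b j"] by simp
  have e: "cmod (b j) * (A * k * (C * k)) = cmod (b j) * A * C * k^2" by (simp add: power2_eq_square)
  have d: "disc_bound (Suc j + 2) (2 ^ (j + 3) * (C * k)) (deriv (g j))" using disc_bound_deriv[OF 1] by (simp add: numeral_3_eq_3)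
  have s: "disc_bound (Suc j + 2) (2 ^ (j + 3) * (C * k) + cmod (b j) * (A * k * (C * k))) (g (Suc j))"
   by (rule disc_bound_cong[OF disc_bound_add[OF d ug]]) (simp add: gs)
  show "disc_bound (Suc j + 2) (C' * k) (g (Suc j))"
   by (rule disc_bound_mono[OF s]) (insert mult_left_mono[OF kk, of "cmod (b j) * A * C"] A C, unfold e C'_def distrib_right, simp add: mult.assoc)
  have Sh: "(deriv ^^ j) S holomorphic_on ball 0 1" using S by (auto simp: disc_bound_def intro!: holomorphic_higher_deriv)
  have gh: "g j holomorphic_on ball 0 1" using 1 by (simp add: disc_bound_def)
  have d2: "disc_bound (Suc j + 2) (2 ^ (j + 3) * (C * k^2)) (deriv (%z. g j z - \<alpha> * (deriv ^^ j) S z))"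
   using disc_bound_deriv[OF 2] by (simp add: numeral_3_eq_3)
  have s: "disc_bound (Suc j + 2) (2 ^ (j + 3) * (C * k^2) + cmod (b j) * (A * k * (C * k))) (%z. g (Suc j) z - \<alpha> * (deriv ^^ Suc j) S z)"
  proof (rule disc_bound_cong[OF disc_bound_add[OF d2 ug]])
   fix z :: complex assume z: "z : ball 0 1"
   have "(g j has_field_derivative deriv (g j) z) (at z)" "((deriv ^^ j) S has_field_derivative deriv ((deriv ^^ j) S) z) (at z)"
   using gh Sh z by (auto intro: holomorphic_derivI)
   hence "((%z. g j z - \<alpha> * (deriv ^^ j) S z) has_field_derivative (deriv (g j) z - \<alpha> * deriv ((deriv ^^ j) S) z)) (at z)"
   by (intro DERIV_diff DERIV_cmult)
   from DERIV_imp_deriv[OF this] show "deriv (%z. g j z - \<alpha> * (deriv ^^ j) S z) z + b j * (u z * g j z) = g (Suc j) z - \<alpha> * (deriv ^^ Suc j) S z"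
   by (simp add: gs[OF z])
  qed
  show "disc_bound (Suc j + 2) (C' * k^2) (%z. g (Suc j) z - \<alpha> * (deriv ^^ Suc j) S z)"
   by (rule disc_bound_mono[OF s]) (unfold e C'_def distrib_right, linarith)
 qed
 thus ?case using C0 by blast
qed

section \<open>Moments of Beltrami coefficients\<close>

lemma integral_bounded_mult:
 fixes f \<nu> :: cfun
 assumes f: "integrable M f" and \<nu>: "\<nu> : bmeas M" "AE z in M. cmod (\<nu> z) <= k"
 shows "integrable M (%z. f z * \<nu> z)" "cmod (LINT z|M. f z * \<nu> z) <= \<bar>k\<bar> * (LINT z|M. cmod (f z))"
proof -
 have b: "AE z in M. cmod (f z * \<nu> z) <= \<bar>k\<bar> * cmod (f z)"
  using \<nu>(2) by eventually_elim (auto simp: norm_mult mult.commute intro!: mult_right_mono)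
 have i: "integrable M (%z. \<bar>k\<bar> * cmod (f z))" using f by simp
 show ii: "integrable M (%z. f z * \<nu> z)"
  by (rule integrable_dom[OF i]) (use f \<nu>(1) b in \<open>auto elim!: eventually_mono simp: abs_mult\<close>)
 have "cmod (LINT z|M. f z * \<nu> z) <= (LINT z|M. \<bar>k\<bar> * cmod (f z))"
  by (rule order_trans[OF integral_norm_bound integral_mono_AE[OF integrable_norm[OF ii] i b]])
 thus "cmod (LINT z|M. f z * \<nu> z) <= \<bar>k\<bar> * (LINT z|M. cmod (f z))" by simp
qed

lemma dist_Dc: "z : ball 0 1 ==> \<zeta> : Dc ==> 1 - cmod z <= cmod (\<zeta> - z)"
 using norm_triangle_ineq2[of \<zeta> z] by (simp add: Dc_def)

text \<open>Four powers of the distance are kept for integrability at infinity; the others are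
  estimated by the distance of \<open>z\<close> to the circle.\<close>

lemma omega_kernel_bound:
 assumes "m >= 4" "z : ball 0 1" "\<zeta> : Dc"
 shows "cmod (omega_kernel m z \<zeta>) <= 1 / (1 - cmod z)^(m - 4) * (1 / (cmod (\<zeta> - z))^4)"
proof -
 have d: "0 < 1 - cmod z" "1 - cmod z <= cmod (\<zeta> - z)" using assms dist_Dc by auto
 have "cmod (omega_kernel m z \<zeta>) = 1 / (cmod (\<zeta> - z))^(m - 4 + 4)" using assms(1) by (simp add: omega_kernel_def norm_inverse norm_power norm_divide inverse_eq_divide)
 also have "... = 1 / (cmod (\<zeta> - z))^(m - 4) * (1 / (cmod (\<zeta> - z))^4)" unfolding power_add by simp
 also have "... <= 1 / (1 - cmod z)^(m - 4) * (1 / (cmod (\<zeta> - z))^4)" using d by (intro mult_right_mono frac_le power_mono zero_less_power) auto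
 finally show ?thesis .
qed

lemma omega_kernel_integrable:
 assumes "m >= 4" "z : ball 0 1"
 shows "integrable (leb Dc) (omega_kernel m z)"
  "(LINT \<zeta>|leb Dc. cmod (omega_kernel m z \<zeta>)) <= 1 / (1 - cmod z)^(m - 4) * (tail_const / (1 - cmod z)^2)"
proof -
 have z: "cmod z < 1" using assms by simp
 note t = tail_Dc[OF z]
 have i: "integrable (leb Dc) (%\<zeta>. 1 / (1 - cmod z)^(m - 4) * (1 / (cmod (\<zeta> - z))^4))" using t(1) by (rule integrable_mult_right)
 have "continuous_on Dc (omega_kernel m z)" unfolding omega_kernel_def[abs_def] using z by (intro continuous_intros) (auto simp: Dc_def)
 hence m: "omega_kernel m z : bmeas (leb Dc)" by (rule continuous_measurable_leb[OF _ sets_Dc])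
 have b: "AE \<zeta> in leb Dc. cmod (omega_kernel m z \<zeta>) <= 1 / (1 - cmod z)^(m - 4) * (1 / (cmod (\<zeta> - z))^4)"
  by (rule AE_I2) (use omega_kernel_bound[OF assms] in auto)
 show ii: "integrable (leb Dc) (omega_kernel m z)"
 proof (rule integrable_dom[OF i m])
  show "AE \<zeta> in leb Dc. norm (omega_kernel m z \<zeta>) <= norm (1 / (1 - cmod z)^(m - 4) * (1 / (cmod (\<zeta> - z))^4))"
   using b by eventually_elim (unfold real_norm_def, rule order_trans[OF _ abs_ge_self])
 qed
 have "(LINT \<zeta>|leb Dc. cmod (omega_kernel m z \<zeta>)) <= (LINT \<zeta>|leb Dc. 1 / (1 - cmod z)^(m - 4) * (1 / (cmod (\<zeta> - z))^4))"
  by (rule integral_mono_AE[OF integrable_norm[OF ii] i b])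
 also have "... = 1 / (1 - cmod z)^(m - 4) * (LINT \<zeta>|leb Dc. 1 / (cmod (\<zeta> - z))^4)" by (rule integral_mult_right_zero)
 also have "... <= 1 / (1 - cmod z)^(m - 4) * (tail_const / (1 - cmod z)^2)" using t(2) z by (intro mult_left_mono) auto
 finally show "(LINT \<zeta>|leb Dc. cmod (omega_kernel m z \<zeta>)) <= 1 / (1 - cmod z)^(m - 4) * (tail_const / (1 - cmod z)^2)" .
qed

text \<open>For m = 4 + j this is, up to a constant, the derivative of order j of the integral that
  gives the Schwarzian to first order.\<close>

definition cauchy_moment :: "nat => cfun => complex => complex" where
 "cauchy_moment m \<mu> z = (LINT \<zeta>|leb Dc. \<mu> \<zeta> * omega_kernel m z \<zeta>)"

definition coeff_bound :: "cfun => real => bool" where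
 "coeff_bound \<mu> k \<longleftrightarrow> \<mu> : bmeas (leb Dc) & (AE z in leb Dc. cmod (\<mu> z) <= k)"

lemma cauchy_moment_integrable:
 assumes "coeff_bound \<mu> k" "m >= 4" "z : ball 0 1"
 shows "integrable (leb Dc) (%\<zeta>. \<mu> \<zeta> * omega_kernel m z \<zeta>)"
 using integral_bounded_mult(1)[OF omega_kernel_integrable(1)[OF assms(2,3)], of \<mu> k] assms(1) by (simp add: coeff_bound_def mult.commute)

lemma cauchy_moment_bound:
 assumes "coeff_bound \<mu> k" "m >= 4" "z : ball 0 1" "k >= 0"
 shows "cmod (cauchy_moment m \<mu> z) * (1 - cmod z)^(m - 2) <= k * tail_const"
proof -
 have d: "0 < 1 - cmod z" using assms by simp
 have e: "m - 2 = m - 4 + 2" using assms(2) by simp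
 have "cmod (cauchy_moment m \<mu> z) <= \<bar>k\<bar> * (LINT \<zeta>|leb Dc. cmod (omega_kernel m z \<zeta>))"
  using integral_bounded_mult(2)[OF omega_kernel_integrable(1)[OF assms(2,3)], of \<mu> k] assms(1) by (simp add: coeff_bound_def mult.commute cauchy_moment_def)
 also have "... <= k * (1 / (1 - cmod z)^(m - 4) * (tail_const / (1 - cmod z)^2))"
  using mult_left_mono[OF omega_kernel_integrable(2)[OF assms(2,3)] assms(4)] assms(4) by simp
 also have "... = k * tail_const / (1 - cmod z)^(m - 2)" unfolding e power_add by simp
 finally show ?thesis using d by (simp add: pos_le_divide_eq)
qed

lemma omega_kernel_deriv:
 assumes "\<zeta> ~= z"
 shows "((%w. omega_kernel m w \<zeta>) has_field_derivative of_nat m * omega_kernel (Suc m) z \<zeta>) (at z within S)"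
proof -
 have n: "(\<zeta> - z)^m ~= 0" using assms by simp
 have "((%w. inverse ((\<zeta> - w)^m)) has_field_derivative - (inverse ((\<zeta> - z)^m) * (of_nat m * (0 - 1) * (\<zeta> - z)^(m - 1)) * inverse ((\<zeta> - z)^m))) (at z within S)"
  using assms by (auto intro!: derivative_eq_intros)
 moreover have "- (inverse ((\<zeta> - z)^m) * (of_nat m * (0 - 1) * (\<zeta> - z)^(m - 1)) * inverse ((\<zeta> - z)^m)) = of_nat m * inverse ((\<zeta> - z)^Suc m)"
 proof -
  define x where "x = \<zeta> - z"
  have "x ~= 0" using assms by (simp add: x_def)
  thus ?thesis unfolding x_def[symmetric] by (cases m) (simp_all add: field_simps)
 qed
 ultimately show ?thesis unfolding omega_kernel_def by (simp only:)
qed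

lemma cauchy_moment_deriv:
 assumes \<mu>: "coeff_bound \<mu> k" and m: "m >= 4" and z: "z : ball 0 1"
 shows "(cauchy_moment m \<mu> has_field_derivative of_nat m * cauchy_moment (Suc m) \<mu> z) (at z)"
 unfolding DERIV_def tendsto_at_iff_sequentially
proof (intro allI impI)
 fix X :: "nat => complex" assume X: "ALL i. X i : UNIV - {0}" "X \<longlonglongrightarrow> 0"
 define d where "d = 1 - cmod z"
 have d: "d > 0" using z by (simp add: d_def)
 have "\<forall>\<^sub>F i in sequentially. cmod (X i) < d / 2" using tendstoD[OF X(2), of "d / 2"] d by simp
 then obtain N where N: "\<And>i. i >= N ==> cmod (X i) < d / 2" by (auto simp: eventually_sequentially)
 \<comment> \<open>Dropping an initial segment keeps all points \<open>z + Y i\<close> within half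
   the distance from \<open>z\<close> to the circle.\<close>
 define Y where "Y i = X (i + N)" for i
 have Y: "Y i ~= 0" "cmod (Y i) < d / 2" for i using X(1) N[of "i + N"] by (auto simp: Y_def)
 have Y0: "Y \<longlonglongrightarrow> 0" unfolding Y_def by (rule LIMSEQ_ignore_initial_segment[OF X(2)])
 have zY: "z + Y i : ball 0 1" for i using norm_triangle_ineq[of z "Y i"] Y(2)[of i] d by (simp add: d_def)
 define q where "q i \<zeta> = \<mu> \<zeta> * ((omega_kernel m (z + Y i) \<zeta> - omega_kernel m z \<zeta>) / Y i)" for i \<zeta>
 \<comment> \<open>Within \<open>d / 2\<close> of \<open>z\<close> the distance to a point of
   \<open>Dc\<close> shrinks to no less than one half, so the mean value inequality dominates all
   difference quotients by the kernel of order \<open>Suc m\<close> at \<open>z\<close> itself, with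
   the factor \<open>2 ^ Suc m\<close>.\<close>
 define w where "w \<zeta> = \<bar>k\<bar> * (real m * 2 ^ Suc m * cmod (omega_kernel (Suc m) z \<zeta>))" for \<zeta>
 have m': "Suc m >= 4" using m by simp
 have \<mu>m: "\<mu> : bmeas (leb Dc)" and \<mu>k: "AE z in leb Dc. cmod (\<mu> z) <= k" using \<mu> by (auto simp: coeff_bound_def)
 have om: "omega_kernel m y : bmeas (leb Dc)" if "m >= 4" "y : ball 0 1" for m y
  using omega_kernel_integrable(1)[OF that] by (rule borel_measurable_integrable)
 have diff: "cmod (omega_kernel m (z + Y i) \<zeta> - omega_kernel m z \<zeta>) <= real m * 2 ^ Suc m * cmod (omega_kernel (Suc m) z \<zeta>) * cmod (Y i)" if \<zeta>: "\<zeta> : Dc" for i \<zeta>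
 proof -
  define B where "B = real m * 2 ^ Suc m * cmod (omega_kernel (Suc m) z \<zeta>)"
  have far: "cmod (\<zeta> - z) / 2 <= cmod (\<zeta> - y)" "0 < cmod (\<zeta> - z)" if "y : cball z (d / 2)" for y
  proof -
   have "d <= cmod (\<zeta> - z)" using dist_Dc[OF z \<zeta>] by (simp add: d_def)
   moreover have "cmod (z - y) <= d / 2" using that by (simp add: dist_norm)
   moreover have "cmod (\<zeta> - z) <= cmod (\<zeta> - y) + cmod (z - y)" using norm_triangle_ineq4[of "\<zeta> - y" "z - y"] by simp
   ultimately show "cmod (\<zeta> - z) / 2 <= cmod (\<zeta> - y)" "0 < cmod (\<zeta> - z)" using d by linarith+
  qed
  have "cmod (omega_kernel m (z + Y i) \<zeta> - omega_kernel m z \<zeta>) <= B * cmod (z + Y i - z)"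
  proof (rule field_differentiable_bound[of "cball z (d / 2)" _ "%y. of_nat m * omega_kernel (Suc m) y \<zeta>"])
   fix y assume y: "y : cball z (d / 2)"
   have y': "y ~= \<zeta>" using far[OF y] by auto
   thus "((%w. omega_kernel m w \<zeta>) has_field_derivative of_nat m * omega_kernel (Suc m) y \<zeta>) (at y within cball z (d / 2))"
   by (intro omega_kernel_deriv) auto
   have "cmod (omega_kernel (Suc m) y \<zeta>) = 1 / (cmod (\<zeta> - y))^Suc m" by (simp add: omega_kernel_def norm_inverse norm_power norm_divide inverse_eq_divide del: power_Suc)
   also have "... <= 1 / (cmod (\<zeta> - z) / 2)^Suc m" using far[OF y] by (intro frac_le power_mono zero_less_power) auto
   also have "... = 2 ^ Suc m * cmod (omega_kernel (Suc m) z \<zeta>)" by (simp only: omega_kernel_def norm_inverse norm_power inverse_eq_divide norm_divide norm_one power_divide) simp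
   finally show "norm (of_nat m * omega_kernel (Suc m) y \<zeta>) <= B" unfolding B_def by (simp add: norm_mult mult_left_mono mult.assoc del: power_Suc)
  qed (use Y(2)[of i] d in \<open>auto simp: dist_norm\<close>)
  thus ?thesis by (simp add: B_def)
 qed
 have "(%i. integral\<^sup>L (leb Dc) (q i)) \<longlonglongrightarrow> (LINT \<zeta>|leb Dc. \<mu> \<zeta> * (of_nat m * omega_kernel (Suc m) z \<zeta>))"
 proof (rule integral_dominated_convergence[where w=w])
  show "(%\<zeta>. \<mu> \<zeta> * (of_nat m * omega_kernel (Suc m) z \<zeta>)) : bmeas (leb Dc)"
   using \<mu>m om[OF m' z] by measurable
  show "q i : bmeas (leb Dc)" for i
   unfolding q_def[abs_def] using \<mu>m om[OF m z] om[OF m zY[of i]] by measurable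
  show "integrable (leb Dc) w" unfolding w_def[abs_def] using omega_kernel_integrable(1)[OF m' z] by (intro integrable_mult_right integrable_norm)
  show "AE \<zeta> in leb Dc. (%i. q i \<zeta>) \<longlonglongrightarrow> \<mu> \<zeta> * (of_nat m * omega_kernel (Suc m) z \<zeta>)"
  proof (rule AE_I2)
   fix \<zeta> assume "\<zeta> : space (leb Dc)"
   hence "\<zeta> ~= z" using dist_Dc[OF z, of \<zeta>] d by (auto simp: d_def)
   from omega_kernel_deriv[OF this, of m UNIV, unfolded DERIV_def]
   have "((%h. (omega_kernel m (z + h) \<zeta> - omega_kernel m z \<zeta>) / h) \<longlongrightarrow> of_nat m * omega_kernel (Suc m) z \<zeta>) (at 0)" .
   moreover have "filterlim Y (at 0) sequentially" using Y0 Y(1) by (simp add: filterlim_at)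
   ultimately have "(%i. (omega_kernel m (z + Y i) \<zeta> - omega_kernel m z \<zeta>) / Y i) \<longlonglongrightarrow> of_nat m * omega_kernel (Suc m) z \<zeta>"
   by (rule filterlim_compose)
   thus "(%i. q i \<zeta>) \<longlonglongrightarrow> \<mu> \<zeta> * (of_nat m * omega_kernel (Suc m) z \<zeta>)" unfolding q_def by (intro tendsto_intros)
  qed
  show "AE \<zeta> in leb Dc. norm (q i \<zeta>) <= w \<zeta>" for i
   using \<mu>k AE_space
  proof eventually_elim
   case (elim \<zeta>)
   have "cmod ((omega_kernel m (z + Y i) \<zeta> - omega_kernel m z \<zeta>) / Y i) <= real m * 2 ^ Suc m * cmod (omega_kernel (Suc m) z \<zeta>)"
   using diff[of \<zeta> i] elim(2) Y(1)[of i] by (simp add: norm_divide pos_divide_le_eq)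
   thus ?case unfolding q_def w_def norm_mult[of "\<mu> \<zeta>"] using elim(1) by (intro mult_mono) auto
  qed
 qed
 moreover have "(LINT \<zeta>|leb Dc. \<mu> \<zeta> * (of_nat m * omega_kernel (Suc m) z \<zeta>)) = of_nat m * cauchy_moment (Suc m) \<mu> z"
  unfolding cauchy_moment_def integral_mult_right_zero[symmetric] by (simp add: ac_simps)
 moreover have "integral\<^sup>L (leb Dc) (q i) = (cauchy_moment m \<mu> (z + Y i) - cauchy_moment m \<mu> z) / Y i" for i
 proof -
  have "integral\<^sup>L (leb Dc) (q i) = (LINT \<zeta>|leb Dc. (\<mu> \<zeta> * omega_kernel m (z + Y i) \<zeta> - \<mu> \<zeta> * omega_kernel m z \<zeta>) / Y i)"
   unfolding q_def by (simp add: right_diff_distrib)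
  thus ?thesis unfolding cauchy_moment_def
   using Bochner_Integration.integral_diff[OF cauchy_moment_integrable[OF \<mu> m zY[of i]] cauchy_moment_integrable[OF \<mu> m z]] by simp
 qed
 ultimately have "(%i. (cauchy_moment m \<mu> (z + X (i + N)) - cauchy_moment m \<mu> z) / X (i + N)) \<longlonglongrightarrow> of_nat m * cauchy_moment (Suc m) \<mu> z"
  by (simp add: Y_def)
 thus "((%h. (cauchy_moment m \<mu> (z + h) - cauchy_moment m \<mu> z) / h) \<circ> X) \<longlonglongrightarrow> of_nat m * cauchy_moment (Suc m) \<mu> z"
  unfolding o_def by (rule LIMSEQ_offset)
qed

lemma cauchy_moment_disc_bound:
 assumes "coeff_bound \<mu> k" "m >= 4" "k >= 0"
 shows "disc_bound (m - 2) (k * tail_const) (cauchy_moment m \<mu>)"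
 unfolding disc_bound_def
proof (intro conjI ballI)
 show "cauchy_moment m \<mu> holomorphic_on ball 0 1"
  unfolding holomorphic_on_open[OF open_ball] using cauchy_moment_deriv[OF assms(1,2)] by blast
qed (rule cauchy_moment_bound[OF assms(1,2) _ assms(3)])

lemma cauchy_moment_higher_deriv:
 assumes "coeff_bound \<mu> k" "z : ball 0 1"
 shows "(deriv ^^ j) (%z. c * cauchy_moment 4 \<mu> z) z = c * of_nat (pochhammer 4 j) * cauchy_moment (4 + j) \<mu> z"
 using assms(2)
proof (induction j arbitrary: z)
 case (Suc j)
 have "((%z. c * of_nat (pochhammer 4 j) * cauchy_moment (4 + j) \<mu> z) has_field_derivative
   c * of_nat (pochhammer 4 j) * (of_nat (4 + j) * cauchy_moment (Suc (4 + j)) \<mu> z)) (at z)"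
  by (intro DERIV_cmult cauchy_moment_deriv[OF assms(1) _ Suc.prems]) simp
 hence "((deriv ^^ j) (%z. c * cauchy_moment 4 \<mu> z) has_field_derivative
   c * of_nat (pochhammer 4 j) * (of_nat (4 + j) * cauchy_moment (Suc (4 + j)) \<mu> z)) (at z)"
  by (rule has_field_derivative_transform_within_open[OF _ open_ball Suc.prems]) (simp add: Suc.IH)
 from DERIV_imp_deriv[OF this] show ?case by (simp add: pochhammer_Suc algebra_simps)
qed simp

section \<open>Excluding a pole in the disc\<close>

lemma holomorphic_primitive_open:
 fixes S :: "complex set"
 assumes "convex S" "open S" "u holomorphic_on S"
 shows "EX L. \<forall>z\<in>S. (L has_field_derivative u z) (at z)"
proof -
 obtain L where L: "\<And>z. z : S ==> (L has_field_derivative u z) (at z)"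
  by (rule holomorphic_convex_primitive'[OF assms]) (use at_within_open[OF _ assms(2)] in auto)
 thus ?thesis by blast
qed

text \<open>f''/f' is the logarithmic derivative of f': with a primitive L of it, f' exp(-L) is
  constant. Hence a bound for f''/f' gives one for f', and then one for f.\<close>

lemma bounded_pre_schwarzian:
 assumes f: "f holomorphic_on ball 0 R" "\<forall>z\<in>ball 0 R. deriv f z ~= 0" and U: "\<forall>z\<in>ball 0 R. cmod (pre_schwarzian f z) <= U"
  and R: "0 < R" "R <= 1"
 shows "EX B. \<forall>z\<in>ball 0 R. cmod (f z) <= B"
proof -
 define u where "u = pre_schwarzian f"
 have df: "deriv f holomorphic_on ball 0 R" by (rule holomorphic_deriv[OF f(1) open_ball])
 have u: "u holomorphic_on ball 0 R" unfolding u_def pre_schwarzian_def[abs_def]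
  by (intro holomorphic_on_divide df holomorphic_deriv[OF df open_ball]) (use f(2) in blast)
 obtain L where "\<forall>z\<in>ball 0 R. (L has_field_derivative u z) (at z)"
  using holomorphic_primitive_open[OF convex_ball open_ball u] by blast
 hence L: "(L has_field_derivative u z) (at z)" if "z : ball 0 R" for z using that by blast
 have z0: "(0::complex) : ball 0 R" using R by simp
 have "cmod (pre_schwarzian f 0) <= U" using U z0 by blast
 hence U0: "U >= 0" using norm_ge_zero[of "pre_schwarzian f 0"] by linarith
 have Lb: "cmod (L z - L 0) <= U * cmod (z - 0)" if "z : ball 0 R" for z
  by (rule field_differentiable_bound[OF convex_ball, of 0 R L u]) (use L U that z0 in \<open>auto simp: u_def intro: has_field_derivative_at_within\<close>)
 have "EX c. \<forall>z\<in>ball 0 R. deriv f z * exp (- L z) = c"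
 proof (rule has_field_derivative_zero_constant[OF convex_ball])
  fix z :: complex assume z: "z : ball 0 R"
  have "(deriv f has_field_derivative deriv (deriv f) z) (at z)" by (rule holomorphic_derivI[OF df open_ball z])
  moreover have "deriv (deriv f) z = u z * deriv f z" using f(2) z by (simp add: u_def pre_schwarzian_def)
  ultimately have 1: "(deriv f has_field_derivative u z * deriv f z) (at z)" by simp
  have "((%z. deriv f z * exp (- L z)) has_field_derivative 0) (at z)"
   by (rule derivative_eq_intros refl 1 L[OF z] | simp)+
  thus "((%z. deriv f z * exp (- L z)) has_field_derivative 0) (at z within ball 0 R)" by (rule has_field_derivative_at_within)
 qed
 then obtain c where c: "\<And>z. z : ball 0 R ==> deriv f z * exp (- L z) = c" by blast
 have db: "cmod (deriv f z) <= cmod (deriv f 0) * exp U" if z: "z : ball 0 R" for z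
 proof -
  have "deriv f z * exp (- L z) = deriv f 0 * exp (- L 0)" using c z z0 by simp
  hence "deriv f z = deriv f 0 * exp (L z - L 0)" by (simp add: exp_minus exp_diff field_simps)
  moreover have "cmod (exp (L z - L 0)) <= exp U"
  proof -
   have "Re (L z - L 0) <= cmod (L z - L 0)" by (rule complex_Re_le_cmod)
   also have "... <= U * cmod (z - 0)" by (rule Lb[OF z])
   also have "... <= U * 1" using z R U0 by (intro mult_left_mono) auto
   finally show ?thesis by (simp add: norm_exp_eq_Re)
  qed
  ultimately show ?thesis by (simp add: norm_mult mult_left_mono)
 qed
 have "cmod (f z) <= cmod (f 0) + cmod (deriv f 0) * exp U" if z: "z : ball 0 R" for z
 proof -
  have "cmod (f z - f 0) <= (cmod (deriv f 0) * exp U) * cmod (z - 0)"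
   by (rule field_differentiable_bound[OF convex_ball, of 0 R f "deriv f"])
   (use db z z0 holomorphic_derivI[OF f(1) open_ball] in \<open>auto intro: has_field_derivative_at_within\<close>)
  also have "... <= (cmod (deriv f 0) * exp U) * 1" using z R by (intro mult_left_mono) auto
  finally show ?thesis using norm_triangle_ineq2[of "f z" "f 0"] by simp
 qed
 thus ?thesis by blast
qed

text \<open>Collects the first-order term of the Schwarzian and its error, in which
  \<open>k^2\<close> is replaced by \<open>k\<close>.\<close>

definition size_const :: real where "size_const = cmod kap * tail_const + err_const"

lemma err_const_nonneg: "err_const >= 0" using annulus_const_pos tail_const_nonneg by (simp add: err_const_def)
lemma size_const_nonneg: "size_const >= 0" using err_const_nonneg tail_const_nonneg by (simp add: size_const_def)

text \<open>The first entry is the bound on \<open>k\<close> in the energy estimate; the second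
  makes \<open>size_const * k\<close> less than 1/2, as the Riccati comparison demands.\<close>

definition small_const :: real where "small_const = min (1 / 4) (1 / (4 * (size_const + 1)))"

lemma small_const: "0 < small_const" "small_const <= 1/4" "k <= small_const ==> size_const * k < 1/2"
proof -
 show "0 < small_const" "small_const <= 1/4" using size_const_nonneg by (auto simp: small_const_def)
 show "size_const * k < 1/2" if "k <= small_const"
 proof -
  have "k <= 1 / (4 * (size_const + 1))" using that by (simp add: small_const_def)
  hence "size_const * k <= size_const * (1 / (4 * (size_const + 1)))" using size_const_nonneg by (intro mult_left_mono) auto
  also have "... < 1/2" using size_const_nonneg by (simp add: field_simps)
  finally show ?thesis .
 qed
qed

text \<open>The Riccati equation \<open>u' = S + u^2/2\<close> turns smallness of the Schwarzian into smallness of \<open>u = f''/f'\<close>;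
 in particular \<open>f\<close> stays bounded as long as it has no pole, so there is none in the disc.\<close>

lemma normalised_disc:
 assumes N: "normalised_beltrami_homeo \<mu> W" and \<mu>: "coeff_bound \<mu> k" and k: "0 <= k" "k <= small_const"
 defines "f \<equiv> chart W"
 shows "f holomorphic_on ball 0 1" "\<forall>z\<in>ball 0 1. deriv f z ~= 0"
  "disc_bound 1 (2 * size_const * k) (pre_schwarzian f)" "disc_bound 2 (2 * size_const * k) (schwarzian f)"
  "disc_bound 2 (err_const * k^2) (%z. schwarzian f z - kap * cauchy_moment 4 \<mu> z)"
proof -
 have B: "beltrami_homeo (extend_by_0 \<mu>) W" and W0: "W (Some 0) = Some 0"
  and f1: "(f has_field_derivative 1) (at 0)" "(deriv f has_field_derivative 0) (at 0)"
  using N by (auto simp: normalised_beltrami_homeo_def f_def)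
 define Om where "Om = {z. W (Some z) ~= None}"
 have h: "homeomorphic_map sphere_top sphere_top W" using B by (simp add: beltrami_homeo_def)
 note sh = sphere_homeo[OF h, folded Om_def f_def]
 have fh: "f holomorphic_on ball 0 1 \<inter> Om" using beltrami_holomorphic[OF B] by (simp add: f_def Om_def)
 define U where "U = ball 0 1 \<inter> Om"
 have U: "open U" unfolding U_def using sh(1) by auto
 have fU: "f holomorphic_on U" using fh by (simp add: U_def)
 have df0: "deriv f z ~= 0" if "z : U" for z
  by (rule holomorphic_injective_imp_regular[OF fU U inj_on_subset[OF sh(3)] that]) (auto simp: U_def)
 define u where "u = pre_schwarzian f"
 have dfh: "deriv f holomorphic_on U" by (rule holomorphic_deriv[OF fU U])
 have uh: "u holomorphic_on U" unfolding u_def pre_schwarzian_def[abs_def]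
  by (intro holomorphic_on_divide dfh holomorphic_deriv[OF dfh U] df0)
 have Sh: "schwarzian f holomorphic_on U" unfolding schwarzian_def[abs_def] u_def[symmetric]
  by (intro holomorphic_on_diff holomorphic_on_divide holomorphic_on_power holomorphic_on_const holomorphic_deriv[OF uh U] uh) auto
 \<comment> \<open>The normalisation of the second derivative at 0 is the initial condition of the
   Riccati comparison.\<close>
 have u0: "u 0 = 0" using DERIV_imp_deriv[OF f1(2)] by (simp add: u_def pre_schwarzian_def)
 have k4: "k <= 1/4" using k small_const(2) by linarith
 have est: "cmod (schwarzian f z - kap * cauchy_moment 4 \<mu> z) <= err_const * k^2 / (1 - cmod z)^2" if "z : U" for z
  using schwarzian_estimate[OF B _ _ k(1) k4, of z] \<mu> that
  by (simp add: coeff_bound_def f_def cauchy_moment_def omega_kernel_def U_def Om_def inverse_eq_divide)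
 have Sb: "cmod (schwarzian f z) <= size_const * k / (1 - cmod z)^2" if z: "z : U" for z
 proof -
  have zb: "z : ball 0 1" using z by (simp add: U_def)
  have d: "0 < (1 - cmod z)^2" using zb by simp
  have "cmod (cauchy_moment 4 \<mu> z) <= k * tail_const / (1 - cmod z)^2"
   using cauchy_moment_bound[OF \<mu> _ zb k(1), of 4] d by (simp add: pos_le_divide_eq)
  hence "cmod (kap * cauchy_moment 4 \<mu> z) <= cmod kap * (k * tail_const / (1 - cmod z)^2)"
   unfolding norm_mult by (rule mult_left_mono) simp
  moreover have "err_const * k^2 / (1 - cmod z)^2 <= err_const * k / (1 - cmod z)^2"
   using k(1) k4 err_const_nonneg by (intro divide_right_mono mult_left_mono) (auto simp: power2_eq_square mult_left_le)
  moreover have "cmod (schwarzian f z) <= cmod (kap * cauchy_moment 4 \<mu> z) + cmod (schwarzian f z - kap * cauchy_moment 4 \<mu> z)"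
   by (rule norm_triangle_sub)
  ultimately have "cmod (schwarzian f z) <= cmod kap * (k * tail_const / (1 - cmod z)^2) + err_const * k / (1 - cmod z)^2" using est[OF z] by linarith
  also have "... = size_const * k / (1 - cmod z)^2" by (simp add: size_const_def add_divide_distrib[symmetric] algebra_simps)
  finally show ?thesis .
 qed
 have ric: "cmod (u z) * (1 - cmod z) <= 2 * (size_const * k)" if R: "R <= 1" "ball 0 R \<subseteq> U" and z: "z : ball 0 R" for R z
 proof (rule riccati_bound[OF R(1) holomorphic_on_subset[OF uh R(2)] u0 _ small_const(3)[OF k(2)] _ z])
  show "0 <= size_const * k" using size_const_nonneg k by simp
  show "\<forall>z\<in>ball 0 R. cmod (deriv u z - (u z)^2 / 2) <= size_const * k / (1 - cmod z)^2"
   using Sb R(2) by (auto simp: schwarzian_def u_def)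
 qed
 have "ball 0 1 \<subseteq> Om"
 proof (rule ccontr)
  assume "~ ball 0 1 \<subseteq> Om"
  then obtain z1 where z1: "z1 : ball 0 1" "z1 ~: Om" by blast
  have Om: "Om = - {z1}" using sh(4) z1(2) by auto
  have "z1 ~= 0" using z1(2) W0 by (auto simp: Om_def)
  \<comment> \<open>The largest disc around 0 that misses the pole. On it the Riccati bound keeps
    f''/f', and hence \<open>f\<close>, bounded, whereas \<open>f\<close> has to tend to infinity at
    the boundary point \<open>z1\<close>.\<close>
  define R where "R = cmod z1"
  have R: "0 < R" "R < 1" using z1 \<open>z1 ~= 0\<close> by (auto simp: R_def)
  have sub: "ball 0 R \<subseteq> U" using R by (auto simp: U_def Om R_def)
  have "EX b. \<forall>z\<in>ball 0 R. cmod (f z) <= b"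
  proof (rule bounded_pre_schwarzian)
   show "f holomorphic_on ball 0 R" by (rule holomorphic_on_subset[OF fU sub])
   show "\<forall>z\<in>ball 0 R. deriv f z ~= 0" using df0 sub by blast
   show "\<forall>z\<in>ball 0 R. cmod (pre_schwarzian f z) <= 2 * (size_const * k) / (1 - R)"
   proof
   fix z :: complex assume z: "z : ball 0 R"
   have "cmod (u z) * (1 - R) <= cmod (u z) * (1 - cmod z)" using z by (intro mult_left_mono) auto
   also have "... <= 2 * (size_const * k)" by (rule ric[OF _ sub z]) (use R in simp)
   finally show "cmod (pre_schwarzian f z) <= 2 * (size_const * k) / (1 - R)" using R by (simp add: pos_le_divide_eq u_def)
   qed
  qed (use R in auto)
  then obtain b where b: "\<forall>z\<in>ball 0 R. cmod (f z) <= b" by blast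
  obtain \<delta> where \<delta>: "\<delta> > 0" "\<forall>z\<in>Om. z : ball z1 \<delta> --> cmod (f z) > b" using sh(6)[OF z1(2), of b] by blast
  have "z1 : closure (ball 0 R)" using R(1) by (simp add: R_def)
  then obtain z where "z : ball 0 R" "dist z z1 < \<delta>" using \<delta>(1) by (meson closure_approachable)
  thus False using b \<delta>(2) sub by (auto simp: U_def dist_commute subset_iff not_less[symmetric])
 qed
 hence Ub: "U = ball 0 1" by (auto simp: U_def)
 show "f holomorphic_on ball 0 1" "\<forall>z\<in>ball 0 1. deriv f z ~= 0" using fU df0 by (auto simp: Ub)
 show "disc_bound 1 (2 * size_const * k) (pre_schwarzian f)"
  unfolding disc_bound_def using uh ric[of 1] by (auto simp: Ub u_def mult.assoc)
 have sq: "x * (1 - cmod z)^2 <= c" if "z : ball 0 1" "x <= c / (1 - cmod z)^2" for x c :: real and z :: complex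
  using that by (simp add: pos_le_divide_eq)
 have "disc_bound 2 (size_const * k) (schwarzian f)"
  unfolding disc_bound_def using Sh Sb sq by (auto simp: Ub)
 thus "disc_bound 2 (2 * size_const * k) (schwarzian f)"
  by (rule disc_bound_mono) (use size_const_nonneg k in simp)
 have "cauchy_moment 4 \<mu> holomorphic_on ball 0 1" using cauchy_moment_disc_bound[OF \<mu> _ k(1), of 4] by (simp add: disc_bound_def)
 hence "(%z. schwarzian f z - kap * cauchy_moment 4 \<mu> z) holomorphic_on ball 0 1" using Sh by (intro holomorphic_intros) (simp_all add: Ub)
 thus "disc_bound 2 (err_const * k^2) (%z. schwarzian f z - kap * cauchy_moment 4 \<mu> z)"
  unfolding disc_bound_def using est sq by (auto simp: Ub)
qed

text \<open>The exponent of f' in \<open>sigmaB\<close>. It vanishes only for \<open>n = 2\<close>,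
  so the first-order term survives for \<open>n >= 3\<close>.\<close>

definition half_weight :: "nat => complex" where "half_weight n = 1 - of_nat n / 2"

fun sig_b :: "schwarzian_kind => nat => nat => complex" where
 "sig_b Kind_A n j = - of_nat (j + 2)" | "sig_b Kind_B n j = half_weight n"

fun sig_\<alpha> :: "schwarzian_kind => nat => complex" where
 "sig_\<alpha> Kind_A n = 1" | "sig_\<alpha> Kind_B n = half_weight n"

text \<open>For kind B put a = 1 - n/2 and let h' = a u h. Then h''/h = a u' + a^2 u^2, and u' = S +
  u^2/2.\<close>

fun sig_\<beta> :: "schwarzian_kind => nat => complex" where
 "sig_\<beta> Kind_A n = 0" | "sig_\<beta> Kind_B n = half_weight n / 2 + (half_weight n)^2"

fun sig_c :: "schwarzian_kind => complex" where
 "sig_c Kind_A = 1" | "sig_c Kind_B = - 2"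

lemma sqrt_deriv_props:
 assumes "f holomorphic_on ball 0 1" "\<forall>z\<in>ball 0 1. deriv f z ~= 0"
 shows "sqrt_deriv f holomorphic_on ball 0 1" "\<forall>z\<in>ball 0 1. (sqrt_deriv f z)^2 = deriv f z"
proof -
 have "deriv f holomorphic_on ball 0 1" by (rule holomorphic_deriv[OF assms(1) open_ball])
 from contractible_imp_holomorphic_sqrt[OF this convex_imp_contractible[OF convex_ball]] assms(2)
 have "EX s. s holomorphic_on ball 0 1 & (\<forall>z\<in>ball 0 1. (s z)^2 = deriv f z)" by metis
 from someI_ex[OF this] show "sqrt_deriv f holomorphic_on ball 0 1" "\<forall>z\<in>ball 0 1. (sqrt_deriv f z)^2 = deriv f z"
  unfolding sqrt_deriv_def by blast+
qed

text \<open>For kind B, the sequence consists of the quotients by \<open>h = (f') powr (1 - n/2)\<close> of the derivatives of \<open>h\<close>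
 of order at least 2.\<close>

lemma sigma_jet:
 assumes f: "f holomorphic_on ball 0 1" "\<forall>z\<in>ball 0 1. deriv f z ~= 0" and n: "n >= 3"
 shows "EX g. jet_sequence (sig_b K n) (sig_\<alpha> K n) (sig_\<beta> K n) (pre_schwarzian f) (schwarzian f) g \<and>
  (\<forall>z\<in>ball 0 1. sigma K n f z = sig_c K * g (n - 3) z)"
proof (cases K)
 case Kind_A
 define g where "g j = sigmaA (j + 3) f" for j
 have "g 0 = schwarzian f" by (simp add: g_def numeral_3_eq_3)
 moreover have "g (Suc j) z = deriv (g j) z + sig_b K n j * (pre_schwarzian f z * g j z)" for j z
 proof -
  have e: "Suc j + 3 = Suc (j + 3)" by simp
  show ?thesis by (simp only: g_def e sigmaA.simps) (simp add: Kind_A algebra_simps)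
 qed
 moreover have "sigma K n f = g (n - 3)" using n by (simp add: g_def Kind_A)
 ultimately show ?thesis by (intro exI[of _ g]) (simp add: jet_sequence_def Kind_A)
next
 case Kind_B
 define a where "a = half_weight n"
 define s where "s = sqrt_deriv f"
 have s: "s holomorphic_on ball 0 1" "\<And>z. z : ball 0 1 ==> (s z)^2 = deriv f z" using sqrt_deriv_props[OF f] by (auto simp: s_def)
 have s0: "s z ~= 0" if "z : ball 0 1" for z using s(2)[OF that] f(2) that by auto
 define u where "u = pre_schwarzian f"
 define h where "h z = s z powi (2 - int n)" for z
 have h: "h holomorphic_on ball 0 1" unfolding h_def[abs_def] using s0 s(1) by (intro holomorphic_on_power_int) auto
 have h0: "h z ~= 0" if "z : ball 0 1" for z using s0[OF that] by (simp add: h_def)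
 have dfh: "deriv f holomorphic_on ball 0 1" by (rule holomorphic_deriv[OF f(1) open_ball])
 have uh: "u holomorphic_on ball 0 1" unfolding u_def pre_schwarzian_def[abs_def]
  by (intro holomorphic_on_divide dfh holomorphic_deriv[OF dfh open_ball]) (use f(2) in blast)
 \<comment> \<open>From s^2 = f' one gets s'/s = u/2, and the exponent 2 - n is twice
   \<open>a\<close>; the branch of the root has dropped out.\<close>
 have dh: "(h has_field_derivative a * u z * h z) (at z)" if z: "z : ball 0 1" for z
 proof -
  have ds: "(s has_field_derivative deriv s z) (at z)" by (rule holomorphic_derivI[OF s(1) open_ball z])
  have "((%z. s z * s z) has_field_derivative (2 * s z * deriv s z)) (at z)"
   by (rule derivative_eq_intros refl ds | simp)+
  hence "(deriv f has_field_derivative (2 * s z * deriv s z)) (at z)"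
   by (rule has_field_derivative_transform_within_open[OF _ open_ball z]) (simp add: s(2)[symmetric] power2_eq_square)
  from DERIV_imp_deriv[OF this] have "u z = 2 * deriv s z / s z"
   using s0[OF z] s(2)[OF z, symmetric] by (simp add: u_def pre_schwarzian_def power2_eq_square)
  hence e: "deriv s z = u z * s z / 2" using s0[OF z] by simp
  define p where "p = s z powi (2 - int n - 1)"
  have d: "(h has_field_derivative of_int (2 - int n) * p * deriv s z) (at z)"
   unfolding h_def[abs_def] p_def by (rule DERIV_power_int[OF ds]) (use s0[OF z] in simp)
  have p: "p * s z = h z" using s0[OF z] unfolding h_def p_def by (subst power_int_diff) auto
  have i: "complex_of_int (2 - int n) = 2 * a" by (simp add: a_def half_weight_def)
  have "of_int (2 - int n) * p * deriv s z = a * u z * (p * s z)" unfolding e i by simp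
  thus ?thesis using d unfolding p by simp
 qed
 define q where "q j z = (deriv ^^ j) h z / h z" for j z
 have hj: "(deriv ^^ j) h holomorphic_on ball 0 1" for j by (rule holomorphic_higher_deriv[OF h open_ball])
 have qr: "q (Suc j) z = deriv (q j) z + a * (u z * q j z)" if z: "z : ball 0 1" for j z
 proof -
  have "(q j has_field_derivative (((deriv ^^ Suc j) h z * h z - (deriv ^^ j) h z * (a * u z * h z)) / (h z * h z))) (at z)"
   unfolding q_def[abs_def] by (intro DERIV_divide dh[OF z] h0[OF z]) (use holomorphic_derivI[OF hj open_ball z] in simp)
  from DERIV_imp_deriv[OF this] show ?thesis using h0[OF z] unfolding q_def by (simp add: diff_divide_distrib)
 qed
 have q1: "q 1 z = a * u z" if "z : ball 0 1" for z
  using DERIV_imp_deriv[OF dh[OF that]] h0[OF that] by (simp add: q_def)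
 have q2: "q 2 z = a * schwarzian f z + sig_\<beta> Kind_B n * (u z * u z)" if z: "z : ball 0 1" for z
 proof -
  have "((%z. a * u z) has_field_derivative (a * deriv u z)) (at z)" by (intro DERIV_cmult holomorphic_derivI[OF uh open_ball z])
  hence "(q 1 has_field_derivative (a * deriv u z)) (at z)"
   by (rule has_field_derivative_transform_within_open[OF _ open_ball z]) (rule q1[symmetric])
  from DERIV_imp_deriv[OF this] have "q 2 z = a * deriv u z + a * (u z * (a * u z))" using qr[OF z, of 1] q1[OF z] by (simp add: numeral_2_eq_2)
  also have "deriv u z = schwarzian f z + u z * u z / 2" by (simp add: schwarzian_def u_def power2_eq_square)
  finally show ?thesis by (simp add: a_def power2_eq_square algebra_simps)
 qed
 \<comment> \<open>The quotients of order 0 and 1 are 1 and a u and contain no Schwarzian, hence the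
   shift by 2; the derivative of order \<open>n - 1\<close> in \<open>sigmaB\<close> is then
   \<open>g (n - 3)\<close>.\<close>
 define g where "g j = q (j + 2)" for j
 have "jet_sequence (sig_b K n) (sig_\<alpha> K n) (sig_\<beta> K n) u (schwarzian f) g"
  unfolding jet_sequence_def
 proof (intro conjI allI ballI)
  fix z :: complex assume z: "z : ball 0 1"
  have e: "0 + 2 = (2::nat)" by simp
  show "g 0 z = sig_\<alpha> K n * schwarzian f z + sig_\<beta> K n * (u z * u z)" unfolding g_def e q2[OF z] Kind_B by (simp add: a_def)
  fix j
  have e: "Suc j + 2 = Suc (j + 2)" by simp
  show "g (Suc j) z = deriv (g j) z + sig_b K n j * (u z * g j z)" unfolding g_def e by (subst qr[OF z]) (simp add: Kind_B a_def)
 qed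
 moreover have "sigma K n f z = sig_c K * g (n - 3) z" if z: "z : ball 0 1" for z
 proof -
  have e: "n - 3 + 2 = n - 1" using n by simp
  have "s z powi (int n - 2) = inverse (h z)" unfolding h_def power_int_minus[symmetric] by simp
  thus ?thesis unfolding g_def e q_def Kind_B by (simp add: sigmaB_def s_def[symmetric] h_def[abs_def, symmetric] divide_inverse ac_simps)
 qed
 ultimately show ?thesis unfolding u_def by blast
qed

text \<open>The first-order part of the recursion applied to
  \<open>kap * cauchy_moment 4 \<mu> z\<close>: differentiating \<open>n - 3\<close> times raises
  the order of the kernel from 4 to \<open>n + 1\<close>, and the Pochhammer symbol collects the
  exponents that come down.\<close>

definition bers_diff :: "schwarzian_kind => nat => cfun => complex => complex" where
 "bers_diff K n \<mu> z = sig_c K * sig_\<alpha> K n * kap * of_nat (pochhammer 4 (n - 3)) * cauchy_moment (n + 1) \<mu> z"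

text \<open>Two errors of order \<open>k^2\<close> add up: the nonlinear terms of the recursion, and
  the derivative of order \<open>n - 3\<close> of the error in the Schwarzian, which Cauchy
  estimates control.\<close>

lemma sigma_estimate:
 assumes n: "n >= 3"
 shows "\<exists>C\<ge>0. ALL \<mu> W k. normalised_beltrami_homeo \<mu> W --> coeff_bound \<mu> k --> 0 <= k --> k <= small_const -->
  disc_bound (n - 1) (C * k^2) (%z. sigma K n (chart W) z - bers_diff K n \<mu> z)"
proof -
 define A where "A = 2 * size_const"
 have A: "A >= 0" using size_const_nonneg by (simp add: A_def)
 define j where "j = n - 3"
 have nj: "j + 2 = n - 1" "2 + j = n - 1" "4 + j = n + 1" using n by (auto simp: j_def)
 obtain C1 where C1: "C1 >= 0" "ALL k u S g. 0 <= k --> k <= 1 --> disc_bound 1 (A * k) u --> disc_bound 2 (A * k) S --> jet_sequence (sig_b K n) (sig_\<alpha> K n) (sig_\<beta> K n) u S g -->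
  disc_bound (j + 2) (C1 * k) (g j) & disc_bound (j + 2) (C1 * k^2) (%z. g j z - sig_\<alpha> K n * (deriv ^^ j) S z)"
  using jet_sequence_bound[OF A] by blast
 obtain C2 where C2: "C2 >= 0" "ALL B g. disc_bound 2 B g --> disc_bound (2 + j) (C2 * B) ((deriv ^^ j) g)"
  using disc_bound_higher_deriv by blast
 define C where "C = cmod (sig_c K) * (C1 + cmod (sig_\<alpha> K n) * (C2 * err_const))"
 have C: "C >= 0" using C1 C2 err_const_nonneg by (simp add: C_def)
 have "disc_bound (n - 1) (C * k^2) (%z. sigma K n (chart W) z - bers_diff K n \<mu> z)"
  if N: "normalised_beltrami_homeo \<mu> W" and \<mu>: "coeff_bound \<mu> k" and k: "0 <= k" "k <= small_const" for \<mu> W k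
 proof -
  define f where "f = chart W"
  note nd = normalised_disc[OF N \<mu> k, folded f_def A_def]
  have k1: "k <= 1" using k small_const(2) by linarith
  obtain g where g: "jet_sequence (sig_b K n) (sig_\<alpha> K n) (sig_\<beta> K n) (pre_schwarzian f) (schwarzian f) g" "\<And>z. z : ball 0 1 ==> sigma K n f z = sig_c K * g j z"
   using sigma_jet[OF nd(1,2) n] unfolding j_def by blast
  have 1: "disc_bound (n - 1) (C1 * k^2) (%z. g j z - sig_\<alpha> K n * (deriv ^^ j) (schwarzian f) z)"
   using C1(2) k(1) k1 nd(3,4) g(1) unfolding nj(1) by blast
  define L where "L z = kap * cauchy_moment 4 \<mu> z" for z
  have Lh: "L holomorphic_on ball 0 1" unfolding L_def
   using cauchy_moment_disc_bound[OF \<mu> _ k(1), of 4] by (intro holomorphic_intros) (simp add: disc_bound_def)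
  have Sh: "schwarzian f holomorphic_on ball 0 1" using nd(4) by (simp add: disc_bound_def)
  have "disc_bound (2 + j) (C2 * (err_const * k^2)) ((deriv ^^ j) (%z. schwarzian f z - L z))"
   using C2(2) nd(5) unfolding L_def by blast
  hence 2: "disc_bound (n - 1) (cmod (sig_\<alpha> K n) * (C2 * (err_const * k^2))) (%z. sig_\<alpha> K n * (deriv ^^ j) (%z. schwarzian f z - L z) z)"
   unfolding nj(2) by (rule disc_bound_cmult)
  have e: "cmod (sig_c K) * (C1 * k^2 + cmod (sig_\<alpha> K n) * (C2 * (err_const * k^2))) = C * k^2" by (simp add: C_def algebra_simps)
  show ?thesis
   unfolding e[symmetric] f_def[symmetric]
  proof (rule disc_bound_cong[OF disc_bound_cmult[OF disc_bound_add[OF 1 2], of "sig_c K"]])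
   fix z :: complex assume z: "z : ball 0 1"
   have "(deriv ^^ j) (%z. schwarzian f z - L z) z = (deriv ^^ j) (schwarzian f) z - (deriv ^^ j) L z"
   by (rule higher_deriv_diff[OF Sh Lh open_ball z])
   moreover have "(deriv ^^ j) L z = kap * of_nat (pochhammer 4 j) * cauchy_moment (n + 1) \<mu> z"
   unfolding L_def using cauchy_moment_higher_deriv[OF \<mu> z, of j kap] by (simp only: nj(3))
   ultimately have dS: "(deriv ^^ j) (schwarzian f) z = (deriv ^^ j) (%z. schwarzian f z - L z) z + kap * of_nat (pochhammer 4 j) * cauchy_moment (n + 1) \<mu> z" by simp
   show "sig_c K * (g j z - sig_\<alpha> K n * (deriv ^^ j) (schwarzian f) z + sig_\<alpha> K n * (deriv ^^ j) (%z. schwarzian f z - L z) z) = sigma K n f z - bers_diff K n \<mu> z"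
   unfolding dS g(2)[OF z] bers_diff_def j_def[symmetric] by (simp only: algebra_simps)
  qed
 qed
 thus ?thesis using C by blast
qed

section \<open>The norm of bounded coefficients and the differential at 0\<close>

lemma Linf_coeff_bound:
 assumes "\<mu> : Linf"
 shows "coeff_bound \<mu> (Linf_norm \<mu>)" "Linf_norm \<mu> >= 0"
proof -
 define e where "e = esssup (leb Dc) (%z. ereal (cmod (\<mu> z)))"
 have m: "\<mu> : bmeas (leb Dc)" and fin: "e < \<infinity>" using assms by (auto simp: Linf_def ess_bounded_def e_def)
 have ae: "AE z in leb Dc. ereal (cmod (\<mu> z)) <= e" unfolding e_def by (rule esssup_AE)
 \<comment> \<open>Over a null set the essential supremum would be minus infinity. Since
   \<open>Dc\<close> has positive measure it is a nonnegative real, and \<open>real_of_ereal\<close>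
   in \<open>Linf_norm\<close> loses nothing.\<close>
 have nonnull: "~ (AE z in leb Dc. False)"
 proof
  assume "AE z in leb Dc. False"
  hence "AE z in lebesgue. z ~: Dc" using sets_Dc by (simp add: AE_restrict_space_iff)
  hence "negligible Dc" using sets_Dc by (simp add: negligible_iff_null_sets AE_iff_null_sets)
  moreover have "open Dc" unfolding Dc_def by (intro open_Collect_less continuous_intros)
  moreover have "(2::complex) : Dc" by (simp add: Dc_def)
  ultimately show False using open_not_negligible by blast
 qed
 have "e >= 0"
 proof (rule ccontr)
  assume "~ e >= 0"
  hence "~ ereal (cmod (\<mu> z)) <= e" for z using order_trans[of 0 "ereal (cmod (\<mu> z))" e] by auto
  hence "AE z in leb Dc. False" using ae by simp
  thus False using nonnull by blast
 qed
 with fin obtain r where r: "e = ereal r" "r >= 0" by (cases e) auto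
 have n: "Linf_norm \<mu> = r" by (simp add: Linf_norm_def e_def[symmetric] r)
 show "coeff_bound \<mu> (Linf_norm \<mu>)" using m ae by (simp add: coeff_bound_def n r)
 show "Linf_norm \<mu> >= 0" using r n by simp
qed

lemma coeff_bound_Linf:
 assumes "coeff_bound \<mu> k" "k >= 0"
 shows "\<mu> : Linf" "Linf_norm \<mu> <= k"
proof -
 have m: "\<mu> : bmeas (leb Dc)" and ae: "AE z in leb Dc. cmod (\<mu> z) <= k" using assms by (auto simp: coeff_bound_def)
 have le: "esssup (leb Dc) (%z. ereal (cmod (\<mu> z))) <= ereal k"
  by (rule esssup_I) (use m ae in \<open>auto elim: eventually_mono\<close>)
 thus "\<mu> : Linf" using m by (auto simp: Linf_def ess_bounded_def intro: le_less_trans)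
 show "Linf_norm \<mu> <= k" unfolding Linf_norm_def using le assms(2)
  by (cases "esssup (leb Dc) (%z. ereal (cmod (\<mu> z)))") auto
qed

lemma Linf_cmult:
 assumes "\<mu> : Linf"
 shows "(%u. c * \<mu> u) : Linf" "Linf_norm (%u. c * \<mu> u) <= cmod c * Linf_norm \<mu>"
proof -
 have "coeff_bound (%u. c * \<mu> u) (cmod c * Linf_norm \<mu>)"
  using Linf_coeff_bound(1)[OF assms] unfolding coeff_bound_def by (auto simp: norm_mult elim!: eventually_mono intro: mult_left_mono)
 from coeff_bound_Linf[OF this] Linf_coeff_bound(2)[OF assms]
 show "(%u. c * \<mu> u) : Linf" "Linf_norm (%u. c * \<mu> u) <= cmod c * Linf_norm \<mu>" by auto
qed

lemma disc_bound_B_space: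
 assumes "disc_bound q B g"
 shows "g : B_space q" "B_norm q g <= 2 ^ q * B"
proof -
 have le: "cmod (g z) * (1 - (cmod z)^2)^q <= 2 ^ q * B" if z: "z : ball 0 1" for z
 proof -
  have "1 - (cmod z)^2 = (1 + cmod z) * (1 - cmod z)" by (simp add: power2_eq_square algebra_simps)
  also have "... <= 2 * (1 - cmod z)" using z by (intro mult_right_mono) auto
  finally have "(1 - (cmod z)^2)^q <= (2 * (1 - cmod z))^q" using z by (intro power_mono) (auto simp: abs_square_le_1 power_le_one)
  hence "cmod (g z) * (1 - (cmod z)^2)^q <= cmod (g z) * (2 * (1 - cmod z))^q" by (rule mult_left_mono) simp
  also have "... = 2 ^ q * (cmod (g z) * (1 - cmod z)^q)" by (simp only: power_mult_distrib ac_simps)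
  also have "... <= 2 ^ q * B" using assms z by (intro mult_left_mono) (auto simp: disc_bound_def)
  finally show ?thesis .
 qed
 thus "g : B_space q" using assms unfolding B_space_def disc_bound_def by (auto intro!: bdd_aboveI)
 show "B_norm q g <= 2 ^ q * B" unfolding B_norm_def by (rule cSUP_least) (use le in auto)
qed

lemma B_norm_point:
 assumes "g : B_space q" "z : ball 0 1"
 shows "cmod (g z) * (1 - (cmod z)^2)^q <= B_norm q g"
 unfolding B_norm_def by (rule cSUP_upper) (use assms in \<open>auto simp: B_space_def\<close>)

lemma bers_diff_disc_bound:
 assumes "\<mu> : Linf" "n >= 3"
 shows "disc_bound (n - 1) (cmod (sig_c K * sig_\<alpha> K n * kap * of_nat (pochhammer 4 (n - 3))) * (Linf_norm \<mu> * tail_const)) (bers_diff K n \<mu>)"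
proof -
 have e: "n + 1 - 2 = n - 1" by simp
 have "disc_bound (n + 1 - 2) (Linf_norm \<mu> * tail_const) (cauchy_moment (n + 1) \<mu>)"
  by (rule cauchy_moment_disc_bound[OF Linf_coeff_bound(1)[OF assms(1)] _ Linf_coeff_bound(2)[OF assms(1)]]) (use assms(2) in simp)
 from disc_bound_cmult[OF this] show ?thesis unfolding bers_diff_def[abs_def] e by blast
qed

lemma bers_has_differential:
 assumes w: "\<And>\<mu>. \<mu> : Linf ==> Linf_norm \<mu> < 1 ==> normalised_beltrami_homeo \<mu> (w \<mu>)" and n: "n >= 3"
 shows "has_differential_at_0 (n - 1) (lifted_bers w K n) (bers_diff K n)"
proof -
 define q where "q = n - 1"
 define \<kappa> where "\<kappa> = sig_c K * sig_\<alpha> K n * kap * of_nat (pochhammer 4 (n - 3))"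
 have Db: "disc_bound q (cmod \<kappa> * (Linf_norm \<mu> * tail_const)) (bers_diff K n \<mu>)" if "\<mu> : Linf" for \<mu>
  using bers_diff_disc_bound[OF that n, of K] by (simp add: q_def \<kappa>_def)
 have D: "bers_diff K n \<mu> z = \<kappa> * cauchy_moment (n + 1) \<mu> z" for \<mu> z by (simp add: bers_diff_def \<kappa>_def)
 have n4: "4 <= n + 1" using n by simp
 have ii: "integrable (leb Dc) (%\<zeta>. \<mu> \<zeta> * omega_kernel (n + 1) z \<zeta>)" if "\<mu> : Linf" "z : ball 0 1" for \<mu> z
  by (rule cauchy_moment_integrable[OF Linf_coeff_bound(1)[OF that(1)] n4 that(2)])
 obtain C where C: "C >= 0" "ALL \<mu> W k. normalised_beltrami_homeo \<mu> W --> coeff_bound \<mu> k --> 0 <= k --> k <= small_const -->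
  disc_bound q (C * k^2) (%z. sigma K n (chart W) z - bers_diff K n \<mu> z)"
  using sigma_estimate[OF n, of K] unfolding q_def by blast
 have est: "disc_bound q (C * (Linf_norm \<mu>)^2) (%z. lifted_bers w K n \<mu> z - bers_diff K n \<mu> z)" if "\<mu> : Linf" "Linf_norm \<mu> <= small_const" for \<mu>
  unfolding lifted_bers_def using C(2) w[OF that(1)] Linf_coeff_bound[OF that(1)] that(2) small_const(2) by auto
 have z: "(%_. 0) : Linf" "Linf_norm (%_. 0) = 0"
  using coeff_bound_Linf[of "%_. 0" 0] Linf_coeff_bound(2)[of "%_. 0"] by (auto simp: coeff_bound_def)
 \<comment> \<open>The zero coefficient satisfies the estimate with \<open>k = 0\<close>, which
   forces the value 0.\<close>
 have \<beta>0: "lifted_bers w K n (%_. 0) y = 0" if y: "y : ball 0 1" for y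
 proof -
  have "cmod (lifted_bers w K n (%_. 0) y - bers_diff K n (%_. 0) y) * (1 - cmod y)^q <= 0"
   using est[OF z(1)] y small_const(1) unfolding z(2) disc_bound_def by auto
  moreover have "0 < (1 - cmod y)^q" using y by simp
  ultimately have "lifted_bers w K n (%_. 0) y - bers_diff K n (%_. 0) y = 0" by (simp add: mult_le_0_iff)
  moreover have "bers_diff K n (%_. 0) y = 0" by (simp add: D cauchy_moment_def)
  ultimately show ?thesis by simp
 qed
 show ?thesis
  unfolding has_differential_at_0_def q_def[symmetric]
 proof (intro conjI ballI allI impI)
  fix \<mu> assume "\<mu> : Linf"
  thus "bers_diff K n \<mu> : B_space q" by (rule disc_bound_B_space(1)[OF Db])
 next
  fix \<mu> \<nu> z assume "\<mu> : Linf" "\<nu> : Linf" and y: "z : ball (0::complex) 1"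
  thus "bers_diff K n (%u. \<mu> u + \<nu> u) z = bers_diff K n \<mu> z + bers_diff K n \<nu> z"
   unfolding D cauchy_moment_def distrib_right using ii[of \<mu> z] ii[of \<nu> z] by (simp add: distrib_left)
 next
  fix c \<mu> z
  show "bers_diff K n (%u. c * \<mu> u) z = c * bers_diff K n \<mu> z"
   unfolding D cauchy_moment_def by (simp add: mult.assoc)
 next
  show "EX C. \<forall>\<mu>\<in>Linf. B_norm q (bers_diff K n \<mu>) <= C * Linf_norm \<mu>"
  proof (intro exI ballI)
   fix \<mu> assume "\<mu> : Linf"
   from disc_bound_B_space(2)[OF Db[OF this]]
   show "B_norm q (bers_diff K n \<mu>) <= (2 ^ q * cmod \<kappa> * tail_const) * Linf_norm \<mu>" by (simp add: ac_simps)
  qed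
 next
  fix \<epsilon> :: real assume \<epsilon>: "\<epsilon> > 0"
  \<comment> \<open>The remainder is at most \<open>2 ^ q * C\<close> times the square of the norm,
    so one factor of the norm has to be below epsilon over that constant; the added 1 keeps the
    denominator positive.\<close>
  define \<delta> where "\<delta> = min small_const (\<epsilon> / (2 ^ q * C + 1))"
  have P: "2 ^ q * C + 1 > 0" using C(1) by (simp add: add_nonneg_pos)
  have \<delta>: "\<delta> > 0" using \<epsilon> P small_const(1) by (simp add: \<delta>_def)
  have main: "(%z. lifted_bers w K n \<mu> z - lifted_bers w K n (%_. 0) z - bers_diff K n \<mu> z) : B_space q \<and>
   B_norm q (%z. lifted_bers w K n \<mu> z - lifted_bers w K n (%_. 0) z - bers_diff K n \<mu> z) <= \<epsilon> * Linf_norm \<mu>"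
   if \<mu>: "\<mu> : Linf" "Linf_norm \<mu> < \<delta>" for \<mu>
  proof -
   define k where "k = Linf_norm \<mu>"
   have k: "0 <= k" "k <= small_const" "k <= \<epsilon> / (2 ^ q * C + 1)" using \<mu> Linf_coeff_bound(2) by (auto simp: k_def \<delta>_def)
   have "disc_bound q (C * k^2) (%z. lifted_bers w K n \<mu> z - lifted_bers w K n (%_. 0) z - bers_diff K n \<mu> z)"
   by (rule disc_bound_cong[OF est[OF \<mu>(1), folded k_def]]) (use k \<beta>0 in auto)
   note b = disc_bound_B_space[OF this]
   have "2 ^ q * (C * k^2) <= (2 ^ q * C + 1) * k * k" using k by (simp add: power2_eq_square algebra_simps)
   also have "... <= \<epsilon> * k" using k P by (intro mult_right_mono) (auto simp: pos_le_divide_eq mult.commute)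
   finally show ?thesis using b by (simp add: k_def)
  qed
  thus "\<exists>\<delta>>0. \<forall>\<mu>\<in>Linf. Linf_norm \<mu> < \<delta> -->
   (%z. lifted_bers w K n \<mu> z - lifted_bers w K n (%_. 0) z - bers_diff K n \<mu> z) : B_space q \<and>
   B_norm q (%z. lifted_bers w K n \<mu> z - lifted_bers w K n (%_. 0) z - bers_diff K n \<mu> z) <= \<epsilon> * Linf_norm \<mu>"
   using \<delta> by blast
 qed
qed

text \<open>\<open>differential_at_0\<close> is a choice among admissible operators, so its values
  are accessible only through uniqueness. On small multiples of \<open>\<mu>\<close> both remainders
  are at most epsilon times the norm; the scalar \<open>t\<close> cancels by homogeneity and epsilon
  is arbitrary.\<close>

lemma differential_unique:
 assumes D: "has_differential_at_0 q \<beta> D" "has_differential_at_0 q \<beta> E" and \<mu>: "\<mu> : Linf" and z: "z : ball 0 1"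
 shows "D \<mu> z = E \<mu> z"
proof -
 define c where "c = (1 - (cmod z)^2)^q"
 have "(cmod z)^2 < 1" using z by (simp add: abs_square_less_1)
 hence c: "c > 0" by (simp add: c_def)
 define N where "N = Linf_norm \<mu>"
 have N: "N >= 0" unfolding N_def by (rule Linf_coeff_bound(2)[OF \<mu>])
 have le: "cmod (D \<mu> z - E \<mu> z) * c <= 2 * \<epsilon> * N" if \<epsilon>: "\<epsilon> > 0" for \<epsilon>
 proof -
  have "\<exists>\<delta>>0. \<forall>\<mu>\<in>Linf. Linf_norm \<mu> < \<delta> --> (%z. \<beta> \<mu> z - \<beta> (%_. 0) z - X \<mu> z) : B_space q \<and>
   B_norm q (%z. \<beta> \<mu> z - \<beta> (%_. 0) z - X \<mu> z) <= \<epsilon> * Linf_norm \<mu>" if "has_differential_at_0 q \<beta> X" for X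
   using that \<epsilon> unfolding has_differential_at_0_def by (elim conjE) blast
  from this[OF D(1)] this[OF D(2)] obtain d e where d: "d > 0" "e > 0" and
   lim: "\<And>\<mu>. \<mu> : Linf ==> Linf_norm \<mu> < d ==> (%z. \<beta> \<mu> z - \<beta> (%_. 0) z - D \<mu> z) : B_space q & B_norm q (%z. \<beta> \<mu> z - \<beta> (%_. 0) z - D \<mu> z) <= \<epsilon> * Linf_norm \<mu>"
   "\<And>\<mu>. \<mu> : Linf ==> Linf_norm \<mu> < e ==> (%z. \<beta> \<mu> z - \<beta> (%_. 0) z - E \<mu> z) : B_space q & B_norm q (%z. \<beta> \<mu> z - \<beta> (%_. 0) z - E \<mu> z) <= \<epsilon> * Linf_norm \<mu>"
   by blast
  define t where "t = min d e / (2 * (N + 1))"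
  have t: "t > 0" using d N by (simp add: t_def)
  have "t * N < min d e"
  proof -
   have "t * N <= t * (N + 1)" using t by simp
   also have "... = min d e / 2" using N by (simp add: t_def field_simps)
   also have "min d e / 2 < min d e" using d by (simp add: min_def)
   finally show ?thesis .
  qed
  define \<nu> where "\<nu> = (%u. complex_of_real t * \<mu> u)"
  have \<nu>: "\<nu> : Linf" "Linf_norm \<nu> <= t * N" using Linf_cmult[OF \<mu>, of "of_real t"] t by (auto simp: \<nu>_def N_def)
  hence small: "Linf_norm \<nu> < d" "Linf_norm \<nu> < e" using \<open>t * N < min d e\<close> by auto
  note l1 = lim(1)[OF \<nu>(1) small(1)] and l2 = lim(2)[OF \<nu>(1) small(2)]
  define x y where "x = \<beta> \<nu> z - \<beta> (%_. 0) z - D \<nu> z" and "y = \<beta> \<nu> z - \<beta> (%_. 0) z - E \<nu> z"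
  have xy: "cmod x * c <= \<epsilon> * (t * N)" "cmod y * c <= \<epsilon> * (t * N)"
   using B_norm_point[OF conjunct1[OF l1] z] B_norm_point[OF conjunct1[OF l2] z] l1 l2 mult_left_mono[OF \<nu>(2), of \<epsilon>] \<epsilon>
   unfolding x_def y_def c_def by linarith+
  have "D \<nu> z = of_real t * D \<mu> z" "E \<nu> z = of_real t * E \<mu> z"
   using D \<mu> z unfolding has_differential_at_0_def \<nu>_def by blast+
  hence "y - x = of_real t * (D \<mu> z - E \<mu> z)" by (simp add: x_def y_def right_diff_distrib)
  hence "t * cmod (D \<mu> z - E \<mu> z) = cmod (y - x)" using t by (simp add: norm_mult)
  also have "... <= cmod y + cmod x" by (rule norm_triangle_ineq4)
  finally have "t * cmod (D \<mu> z - E \<mu> z) * c <= (cmod y + cmod x) * c" using c by (intro mult_right_mono) auto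
  also have "... <= t * (2 * \<epsilon> * N)" using xy by (simp add: distrib_right algebra_simps)
  finally show ?thesis using t by (simp add: mult.assoc)
 qed
 have "cmod (D \<mu> z - E \<mu> z) * c <= 0"
 proof (rule field_le_epsilon)
  fix e :: real assume e: "e > 0"
  have "cmod (D \<mu> z - E \<mu> z) * c <= 2 * (e / (2 * (N + 1))) * N" by (rule le) (use e N in simp)
  also have "... <= 0 + e" using e N by (simp add: field_simps)
  finally show "cmod (D \<mu> z - E \<mu> z) * c <= 0 + e" .
 qed
 thus ?thesis using c by (simp add: mult_le_0_iff)
qed

text \<open>All constant factors of \<open>bers_diff\<close> are nonzero, so the kernel is described
  by the moments alone; for kind B this rests on \<open>n\<close> being different from 2.\<close>

lemma bers_kernel:
 assumes w: "\<And>\<mu>. \<mu> : Linf ==> Linf_norm \<mu> < 1 ==> normalised_beltrami_homeo \<mu> (w \<mu>)" and n: "n >= 3" and \<mu>: "\<mu> : Linf" and z: "z : ball 0 1"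
 shows "differential_at_0 (n - 1) (lifted_bers w K n) \<mu> z = 0 \<longleftrightarrow> (LINT \<zeta>|leb Dc. \<mu> \<zeta> * omega_kernel (n + 1) z \<zeta>) = 0"
proof -
 have h: "has_differential_at_0 (n - 1) (lifted_bers w K n) (bers_diff K n)"
  by (rule bers_has_differential[OF _ n]) (rule w)
 have "has_differential_at_0 (n - 1) (lifted_bers w K n) (differential_at_0 (n - 1) (lifted_bers w K n))"
  unfolding differential_at_0_def by (rule someI[of "has_differential_at_0 (n - 1) (lifted_bers w K n)", OF h])
 from differential_unique[OF this h \<mu> z]
 have e: "differential_at_0 (n - 1) (lifted_bers w K n) \<mu> z = bers_diff K n \<mu> z" by simp
 have "half_weight n ~= 0"
 proof
  assume "half_weight n = 0"
  hence "complex_of_nat n = of_nat 2" by (simp add: half_weight_def)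
  thus False using n by (simp only: of_nat_eq_iff)
 qed
 hence "sig_c K * sig_\<alpha> K n * kap * of_nat (pochhammer 4 (n - 3)) ~= 0"
  using annulus_const_pos by (cases K) (auto simp: kap_def intro: pochhammer_pos)
 thus ?thesis unfolding e bers_diff_def cauchy_moment_def by simp
qed

section \<open>Change of variables and Poincare series\<close>

text \<open>The change of variables theorem applied below speaks of \<open>real^2\<close> and
  determinants; this isomorphism preserves Lebesgue measure and carries the theorem to the complex
  plane.\<close>

definition vec_complex :: "real^2 => complex" where "vec_complex x = Complex (x $ 1) (x $ 2)"
definition complex_vec :: "complex => real^2" where "complex_vec z = (\<chi> i. if i = 1 then Re z else Im z)"

lemma vec_complex_inverse [simp]: "complex_vec (vec_complex x) = x" "vec_complex (complex_vec z) = z"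
 by (auto simp: vec_complex_def complex_vec_def vec_eq_iff complex_eq_iff forall_2)

lemma linear_vec_complex: "linear vec_complex" and linear_complex_vec: "linear complex_vec"
 by (auto intro!: linearI simp: vec_complex_def complex_vec_def vec_eq_iff complex_eq_iff)

lemma bounded_linear_vec_complex: "bounded_linear vec_complex" and bounded_linear_complex_vec: "bounded_linear complex_vec"
 using linear_vec_complex linear_complex_vec linear_linear by blast+

lemma Basis_real2: "(Basis :: (real^2) set) = {axis 1 1, axis 2 1}"
 by (auto simp: Basis_vec_def UNIV_2)

lemma lborel_vec_complex: "distr lborel borel vec_complex = lborel"
proof (rule lborel_eqI[symmetric])
 have [measurable]: "vec_complex : bmeas borel"
  using bounded_linear_vec_complex by (simp add: continuous_bmeas linear_continuous_on)
 fix l u :: complex assume lu: "\<And>b. b : Basis ==> l \<bullet> b <= u \<bullet> b"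
 have "Re l <= Re u" "Im l <= Im u" using lu[of 1] lu[of \<i>] by (auto simp: Basis_complex_def)
 have ne: "axis 1 (1::real) ~= (axis 2 1 :: real^2)" by (simp add: axis_eq_axis)
 have "emeasure (distr lborel borel vec_complex) (box l u) = emeasure lborel (vec_complex -` box l u)"
  by (subst emeasure_distr) auto
 also have "vec_complex -` box l u = box (complex_vec l) (complex_vec u)"
  by (auto simp: box_def Basis_complex_def Basis_real2 vec_complex_def complex_vec_def inner_axis)
 also have "emeasure lborel (box (complex_vec l) (complex_vec u)) = (\<Prod>b\<in>Basis. (complex_vec u - complex_vec l) \<bullet> b)"
  by (rule emeasure_lborel_box) (use \<open>Re l <= Re u\<close> \<open>Im l <= Im u\<close> in \<open>auto simp: Basis_real2 inner_axis complex_vec_def\<close>)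
 also have "(\<Prod>b\<in>Basis. (complex_vec u - complex_vec l) \<bullet> b) = (\<Prod>b\<in>Basis. (u - l) \<bullet> b)"
  using ne by (simp add: Basis_real2 Basis_complex_def inner_axis complex_vec_def)
 finally show "emeasure (distr lborel borel vec_complex) (box l u) = (\<Prod>b\<in>Basis. (u - l) \<bullet> b)" .
qed simp

lemma lebesgue_vec_complex: "vec_complex : lebesgue \<rightarrow>\<^sub>M lebesgue" "lebesgue = distr lebesgue lebesgue vec_complex"
proof -
 have b[measurable]: "vec_complex : borel \<rightarrow>\<^sub>M borel"
  using bounded_linear_vec_complex by (simp add: continuous_bmeas linear_continuous_on)
 have eq0: "distr lebesgue lborel vec_complex = lborel"
  by (subst distr_completion) (use lborel_vec_complex in \<open>auto cong: distr_cong\<close>)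
 hence eq: "null_sets lborel = null_sets (distr lebesgue lborel vec_complex)" by simp
 show m: "vec_complex : lebesgue \<rightarrow>\<^sub>M lebesgue"
  by (simp add: completion.measurable_completion2 eq measurable_completion)
 have "lebesgue = completion (distr lebesgue lborel vec_complex)" by (simp add: eq0)
 also have "... = distr lebesgue lebesgue vec_complex"
  by (subst completion.completion_distr_eq) (auto simp: eq measurable_completion)
 finally show "lebesgue = distr lebesgue lebesgue vec_complex" .
qed

lemma lebesgue_complex_vec: "complex_vec : lebesgue \<rightarrow>\<^sub>M lebesgue"
proof -
 have "distr lborel borel complex_vec = distr (distr lborel borel vec_complex) borel complex_vec"
  by (simp add: lborel_vec_complex)
 have b[measurable]: "complex_vec : borel \<rightarrow>\<^sub>M borel" "vec_complex : borel \<rightarrow>\<^sub>M borel"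
  using bounded_linear_vec_complex bounded_linear_complex_vec by (auto simp: continuous_bmeas linear_continuous_on)
 have "distr (lborel::complex measure) borel complex_vec = distr (distr lborel borel vec_complex) borel complex_vec"
  by (simp add: lborel_vec_complex)
 also have "... = distr lborel borel (complex_vec \<circ> vec_complex)" by (rule distr_distr) auto
 also have "... = lborel" by (simp add: o_def distr_id2)
 finally have l: "distr (lborel::complex measure) borel complex_vec = lborel" .
 have eq0: "distr lebesgue lborel complex_vec = lborel"
  by (subst distr_completion) (use l in \<open>auto cong: distr_cong\<close>)
 hence eq: "null_sets lborel = null_sets (distr lebesgue lborel complex_vec)" by simp
 show ?thesis by (simp add: completion.measurable_completion2 eq measurable_completion)
qed

lemma integrable_vec_complex:
 fixes h :: cfun
 shows "integrable lebesgue (%x. complex_vec (h (vec_complex x))) \<longleftrightarrow> integrable lebesgue h"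
  and "integrable lebesgue h ==> integral\<^sup>L lebesgue (%x. complex_vec (h (vec_complex x))) = complex_vec (integral\<^sup>L lebesgue h)"
proof -
 have *: "integrable lebesgue h \<longleftrightarrow> integrable lebesgue (%x. h (vec_complex x))" if m: "h : bmeas lebesgue" for h :: cfun
  by (subst lebesgue_vec_complex(2), subst integrable_distr_eq) (use lebesgue_vec_complex(1) m in auto)
 have m: "h : bmeas lebesgue" if "integrable lebesgue (%x. complex_vec (h (vec_complex x)))"
 proof -
  have "(%x. complex_vec (h (vec_complex x))) : bmeas lebesgue" using that by auto
  hence "(%z. complex_vec (h (vec_complex (complex_vec z)))) : bmeas lebesgue"
   by (rule measurable_compose[OF lebesgue_complex_vec])
  hence 1: "(%z. complex_vec (h z)) : bmeas lebesgue" by simp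
  have b: "vec_complex : bmeas borel"
   using bounded_linear_vec_complex by (simp add: continuous_bmeas linear_continuous_on)
  from measurable_compose[OF 1 b] have "(%z. vec_complex (complex_vec (h z))) : bmeas lebesgue" .
  thus ?thesis by simp
 qed
 have i2: "integrable lebesgue (%x. h (vec_complex x))" if "integrable lebesgue (%x. complex_vec (h (vec_complex x)))"
  using integrable_bounded_linear[OF bounded_linear_vec_complex that] by simp
 show "integrable lebesgue (%x. complex_vec (h (vec_complex x))) \<longleftrightarrow> integrable lebesgue h"
 proof
  assume a: "integrable lebesgue (%x. complex_vec (h (vec_complex x)))"
  show "integrable lebesgue h" using *[OF m[OF a]] i2[OF a] by blast
 next
  assume a: "integrable lebesgue h"
  hence "integrable lebesgue (%x. h (vec_complex x))" using *[OF borel_measurable_integrable[OF a]] by simp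
  thus "integrable lebesgue (%x. complex_vec (h (vec_complex x)))"
   by (rule integrable_bounded_linear[OF bounded_linear_complex_vec])
 qed
 assume a: "integrable lebesgue h"
 hence i: "integrable lebesgue (%x. h (vec_complex x))" using *[OF borel_measurable_integrable[OF a]] by simp
 have "integral\<^sup>L lebesgue h = integral\<^sup>L lebesgue (%x. h (vec_complex x))"
  by (subst lebesgue_vec_complex(2), subst integral_distr) (use lebesgue_vec_complex(1) a in auto)
 thus "integral\<^sup>L lebesgue (%x. complex_vec (h (vec_complex x))) = complex_vec (integral\<^sup>L lebesgue h)"
  using integral_bounded_linear[OF bounded_linear_complex_vec i] by simp
qed

text \<open>Multiplication by a complex number has its squared modulus as real determinant, so the
  Jacobian of a holomorphic map is \<open>(cmod (g' z))^2\<close>.\<close>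

theorem holomorphic_change_of_variables:
 fixes f g :: cfun
 assumes S: "S : sets lebesgue" and der: "\<And>z. z : S ==> (g has_field_derivative g' z) (at z)" and inj: "inj_on g S"
  and f: "integrable (leb (g ` S)) f" and gS: "g ` S : sets lebesgue"
 shows "integrable (leb S) (%z. of_real ((cmod (g' z))^2) * f (g z))"
  "(LINT z|leb S. of_real ((cmod (g' z))^2) * f (g z)) = (LINT z|leb (g ` S). f z)"
proof -
 define S' where "S' = complex_vec ` S"
 define G where "G x = complex_vec (g (vec_complex x))" for x
 define G' where "G' x h = complex_vec (g' (vec_complex x) * vec_complex h)" for x h
 define f' where "f' x = complex_vec (f (vec_complex x))" for x
 have S'e: "S' = vec_complex -` S"
  unfolding S'_def by (auto simp: image_iff) (metis vec_complex_inverse(1))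
 have S's: "S' : sets lebesgue" unfolding S'e using measurable_sets[OF lebesgue_vec_complex(1) S] by simp
 have derG: "(G has_derivative G' x) (at x within S')" if "x : S'" for x
 proof -
  have "vec_complex x : S" using that S'e by simp
  hence "(g has_derivative (*) (g' (vec_complex x))) (at (vec_complex x))" using der by (simp add: has_field_derivative_def)
  from has_derivative_compose[OF bounded_linear_imp_has_derivative[OF bounded_linear_vec_complex] this]
  have "((%x. g (vec_complex x)) has_derivative (%h. g' (vec_complex x) * vec_complex h)) (at x)" .
  from bounded_linear.has_derivative[OF bounded_linear_complex_vec this]
  show ?thesis unfolding G_def[abs_def] G'_def[abs_def] by (rule has_derivative_at_withinI)
 qed
 have injG: "inj_on G S'"
  using inj unfolding inj_on_def G_def S'e by (metis vec_complex_inverse vimage_eq)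
 have GS: "G ` S' = complex_vec ` (g ` S)" unfolding S'_def G_def by (auto simp: image_image)
 have det: "\<bar>det (matrix (G' x))\<bar> = (cmod (g' (vec_complex x)))^2" for x
 proof -
  have "det (matrix (G' x)) = (Re (g' (vec_complex x)))^2 + (Im (g' (vec_complex x)))^2"
   by (simp add: det_2 matrix_def G'_def complex_vec_def vec_complex_def axis_def power2_eq_square)
  thus ?thesis by (simp add: cmod_power2)
 qed
 have ind: "indicator (complex_vec ` T) x = (indicator T (vec_complex x) :: real)" for T x
  by (auto simp: indicator_def image_iff) (metis vec_complex_inverse)+
 have tr: "set_integrable lebesgue (complex_vec ` T) (%x. complex_vec (h (vec_complex x))) \<longleftrightarrow> set_integrable lebesgue T h" for T h
  unfolding set_integrable_def ind using integrable_vec_complex(1)[of "%z. indicator T z *\<^sub>R h z"]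
  by (simp add: linear_scale[OF linear_complex_vec])
 have tri: "integral (complex_vec ` T) (%x. complex_vec (h (vec_complex x))) = complex_vec (set_lebesgue_integral lebesgue T h)"
  if "set_integrable lebesgue T h" for T h
 proof -
  have "integral (complex_vec ` T) (%x. complex_vec (h (vec_complex x))) = set_lebesgue_integral lebesgue (complex_vec ` T) (%x. complex_vec (h (vec_complex x)))"
   using set_lebesgue_integral_eq_integral(2) tr that by metis
  also have "... = complex_vec (set_lebesgue_integral lebesgue T h)"
   unfolding set_lebesgue_integral_def ind using integrable_vec_complex(2)[of "%z. indicator T z *\<^sub>R h z"] that
   by (simp add: linear_scale[OF linear_complex_vec] set_integrable_def)
  finally show ?thesis .
 qed
 have fi: "set_integrable lebesgue (g ` S) f"
  using f gS by (simp add: set_integrable_def integrable_restrict_space)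
 hence "f' absolutely_integrable_on (G ` S')"
  unfolding GS f'_def[abs_def] using tr by blast
 with has_absolute_integral_change_of_variables[OF S's derG injG, of f' "integral (G ` S') f'"]
 have 1: "(%x. \<bar>det (matrix (G' x))\<bar> *\<^sub>R f' (G x)) absolutely_integrable_on S'"
  and 2: "integral S' (%x. \<bar>det (matrix (G' x))\<bar> *\<^sub>R f' (G x)) = integral (G ` S') f'" by auto
 have e: "\<bar>det (matrix (G' x))\<bar> *\<^sub>R f' (G x) = complex_vec (of_real ((cmod (g' (vec_complex x)))^2) * f (g (vec_complex x)))" for x
 proof -
  have "complex_vec (of_real r * w) = r *\<^sub>R complex_vec w" for r w by (simp add: complex_vec_def vec_eq_iff)
  thus ?thesis unfolding det f'_def G_def vec_complex_inverse by metis
 qed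
 have si: "set_integrable lebesgue S (%z. of_real ((cmod (g' z))^2) * f (g z))"
  using 1 tr[of S "%z. of_real ((cmod (g' z))^2) * f (g z)"] unfolding e S'_def by blast
 thus "integrable (leb S) (%z. of_real ((cmod (g' z))^2) * f (g z))"
  using S by (simp add: set_integrable_def integrable_restrict_space)
 have "complex_vec (set_lebesgue_integral lebesgue S (%z. of_real ((cmod (g' z))^2) * f (g z))) = complex_vec (set_lebesgue_integral lebesgue (g ` S) f)"
  using 2 unfolding e unfolding S'_def tri[OF si] unfolding S'_def[symmetric] GS f'_def[abs_def] tri[OF fi] .
 hence "set_lebesgue_integral lebesgue S (%z. of_real ((cmod (g' z))^2) * f (g z)) = set_lebesgue_integral lebesgue (g ` S) f"
  by (metis vec_complex_inverse(2))
 thus "(LINT z|leb S. of_real ((cmod (g' z))^2) * f (g z)) = (LINT z|leb (g ` S). f z)"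
  using S gS by (simp add: set_lebesgue_integral_def integral_restrict_space)
qed

section \<open>Moebius maps preserving the disc\<close>

lemma su11_b_less_a: "(cmod a)^2 - (cmod b)^2 = 1 ==> cmod b < cmod a"
 by (rule power2_less_imp_less) auto

lemma su11_a_nonzero: "(cmod a)^2 - (cmod b)^2 = 1 ==> a ~= 0"
 using su11_b_less_a[of a b] norm_ge_zero[of b] by auto

text \<open>The matrix preserves the Hermitian form |z|^2 - |w|^2, evaluated here at the vector (z,
  1).\<close>

lemma su11_norm_identity:
 assumes "(cmod a)^2 - (cmod b)^2 = 1"
 shows "(cmod (a * z + b))^2 - (cmod (cnj b * z + cnj a))^2 = (cmod z)^2 - 1"
proof -
 have "(cmod (a * z + b))^2 - (cmod (cnj b * z + cnj a))^2 = ((cmod a)^2 - (cmod b)^2) * ((cmod z)^2 - 1)"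
  unfolding cmod_power2 by (simp add: power2_eq_square algebra_simps)
 thus ?thesis using assms by simp
qed

lemma su11_den_less_num:
 assumes "(cmod a)^2 - (cmod b)^2 = 1" "z : Dc"
 shows "cmod (cnj b * z + cnj a) < cmod (a * z + b)"
proof -
 have "1 < (cmod z)^2" using assms(2) by (simp add: Dc_def)
 hence "(cmod (cnj b * z + cnj a))^2 < (cmod (a * z + b))^2" using su11_norm_identity[OF assms(1), of z] by simp
 thus ?thesis by (rule power2_less_imp_less) simp
qed

text \<open>Composition is the matrix product. The work lies in matching \<open>None\<close> with
  vanishing denominators; at a pole of the inner map the determinant 1 rules out that its numerator
  vanishes too.\<close>

lemma su11_compose:
 assumes "(cmod a)^2 - (cmod b)^2 = 1" "(cmod c)^2 - (cmod d)^2 = 1"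
 shows "su11_map a b \<circ> su11_map c d = su11_map (a * c + b * cnj d) (a * d + b * cnj c)"
  "(cmod (a * c + b * cnj d))^2 - (cmod (a * d + b * cnj c))^2 = 1"
proof -
 have a0: "a ~= 0" "c ~= 0" using assms su11_a_nonzero by blast+
 have det: "a * cnj a - b * cnj b = 1" "c * cnj c - d * cnj d = 1"
  using assms by (simp_all add: complex_norm_square[symmetric] of_real_diff[symmetric] del: of_real_power of_real_diff)
 have cnj_eq: "cnj (a * d + b * cnj c) = cnj a * cnj d + cnj b * c" "cnj (a * c + b * cnj d) = cnj a * cnj c + cnj b * d" by simp_all
 show "su11_map a b \<circ> su11_map c d = su11_map (a * c + b * cnj d) (a * d + b * cnj c)"
 proof
  fix p :: sphere
  show "(su11_map a b \<circ> su11_map c d) p = su11_map (a * c + b * cnj d) (a * d + b * cnj c) p"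
  proof (cases p)
   case None
   show ?thesis
   proof (cases "d = 0")
   case True
   thus ?thesis using None a0 by (simp add: su11_map_def)
   next
   case False
   have e: "cnj b * (c / cnj d) + cnj a = (cnj a * cnj d + cnj b * c) / cnj d"
   "a * (c / cnj d) + b = (a * c + b * cnj d) / cnj d" using False by (simp_all add: field_simps)
   define x y where "x = cnj a * cnj d + cnj b * c" and "y = a * c + b * cnj d"
   have z: "a * d + b * cnj c = 0 \<longleftrightarrow> x = 0"
   using cnj_eq(1) complex_cnj_zero_iff[of "a * d + b * cnj c"] by (simp only: x_def)
   have l: "su11_map a b (Some (c / cnj d)) = (if x / cnj d = 0 then None else Some ((y / cnj d) / (x / cnj d)))"
   by (simp only: su11_map_def option.case e x_def y_def)
   have m: "su11_map c d p = Some (c / cnj d)" using None False by (simp add: su11_map_def)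
   have rr: "su11_map (a * c + b * cnj d) (a * d + b * cnj c) p = (if x = 0 then None else Some (y / x))"
   unfolding None su11_map_def option.case z cnj_eq(1) x_def y_def by simp
   show ?thesis unfolding o_def m l rr using False by simp
   qed
  next
   case (Some z)
   show ?thesis
   proof (cases "cnj d * z + cnj c = 0")
   case True
   have num: "c * z + d ~= 0"
   proof
   assume "c * z + d = 0"
   have "(c * cnj c - d * cnj d) = c * (cnj d * z + cnj c) - cnj d * (c * z + d)" by (simp add: algebra_simps)
   thus False using True \<open>c * z + d = 0\<close> det by simp
   qed
   have cz: "cnj c = - cnj d * z" using True by (simp add: add_eq_0_iff2)
   have d0: "d ~= 0" using cz a0 by auto
   have den: "cnj (a * d + b * cnj c) * z + cnj (a * c + b * cnj d) = cnj b * (c * z + d)"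
   unfolding cnj_eq using cz by (simp add: algebra_simps)
   have nm: "(a * c + b * cnj d) * z + (a * d + b * cnj c) = a * (c * z + d)" using cz by (simp add: algebra_simps)
   show ?thesis using Some True num by (simp add: su11_map_def den nm del: complex_cnj_add complex_cnj_mult)
   next
   case False
   define w where "w = cnj d * z + cnj c"
   have w: "w ~= 0" using False by (simp add: w_def)
   have e: "cnj b * ((c * z + d) / w) + cnj a = (cnj (a * d + b * cnj c) * z + cnj (a * c + b * cnj d)) / w"
   "a * ((c * z + d) / w) + b = ((a * c + b * cnj d) * z + (a * d + b * cnj c)) / w"
   using w unfolding cnj_eq by (simp_all add: field_simps) (simp_all add: w_def algebra_simps)
   have m: "su11_map c d p = Some ((c * z + d) / w)" using Some w by (simp add: su11_map_def w_def)
   define x y where "x = cnj (a * d + b * cnj c) * z + cnj (a * c + b * cnj d)" and "y = (a * c + b * cnj d) * z + (a * d + b * cnj c)"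
   have l: "su11_map a b (Some ((c * z + d) / w)) = (if x / w = 0 then None else Some ((y / w) / (x / w)))"
   by (simp only: su11_map_def option.case e x_def y_def)
   have rr: "su11_map (a * c + b * cnj d) (a * d + b * cnj c) p = (if x = 0 then None else Some (y / x))"
   unfolding Some su11_map_def option.case x_def y_def by simp
   show ?thesis unfolding o_def m l rr using w by simp
   qed
  qed
 qed
 have "(cmod (a * c + b * cnj d))^2 - (cmod (a * d + b * cnj c))^2 = ((cmod a)^2 - (cmod b)^2) * ((cmod c)^2 - (cmod d)^2)"
  unfolding cmod_power2 by (simp add: power2_eq_square algebra_simps)
 thus "(cmod (a * c + b * cnj d))^2 - (cmod (a * d + b * cnj c))^2 = 1" using assms by simp
qed

lemma su11_id: "su11_map 1 0 = id"
 by (auto simp: su11_map_def fun_eq_iff split: option.split)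

lemma su11_inverse:
 assumes "(cmod a)^2 - (cmod b)^2 = 1"
 shows "su11_map (cnj a) (- b) \<circ> su11_map a b = id"
proof -
 have 1: "(cmod (cnj a))^2 - (cmod (- b))^2 = 1" using assms by simp
 have det: "a * cnj a - b * cnj b = 1"
  using assms by (simp add: complex_norm_square[symmetric] of_real_diff[symmetric] del: of_real_power of_real_diff)
 hence "cnj a * a + - b * cnj b = 1" by (simp add: mult.commute)
 moreover have "cnj a * b + - b * cnj a = 0" by simp
 ultimately show ?thesis using su11_compose(1)[OF 1 assms] su11_id by simp
qed

section \<open>Fuchsian groups\<close>

lemma fuchsian_compose:
 assumes G: "fuchsian_group G" and gh: "g : G" "h : G"
 shows "g \<circ> h : G"
proof -
 have s: "subgroup G (BijGroup UNIV)" using G by (simp add: fuchsian_group_def)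
 have "g \<otimes>\<^bsub>BijGroup UNIV\<^esub> h : G" by (rule subgroup.m_closed[OF s gh])
 moreover have "g : Bij UNIV" "h : Bij UNIV" using subgroup.mem_carrier[OF s] gh by (auto simp: BijGroup_def)
 ultimately show ?thesis by (simp add: BijGroup_def compose_def o_def restrict_def)
qed

lemma fuchsian_id: "fuchsian_group G ==> id : G"
 using subgroup.one_closed[of G "BijGroup UNIV"] by (simp add: fuchsian_group_def BijGroup_def id_def restrict_def)

lemma fuchsian_bij: "fuchsian_group G ==> g : G ==> bij g"
 using subgroup.mem_carrier[of G "BijGroup UNIV" g] by (simp add: fuchsian_group_def BijGroup_def Bij_def)

lemma fuchsian_inv:
 assumes G: "fuchsian_group G" and g: "g : G"
 shows "inv_into UNIV g : G"
proof -
 have s: "subgroup G (BijGroup UNIV)" using G by (simp add: fuchsian_group_def)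
 have "g : Bij UNIV" using subgroup.mem_carrier[OF s g] by (simp add: BijGroup_def)
 hence "m_inv (BijGroup UNIV) g = inv_into UNIV g" by (simp add: inv_BijGroup restrict_def)
 thus ?thesis using subgroup.m_inv_closed[OF s g] by simp
qed

text \<open>A map determines its matrix only up to sign, and one matrix is chosen. The modulus of an
  entry, the square of the denominator, and \<open>moeb_weight\<close> for \<open>l >= 4\<close> are
  the same for both choices.\<close>

definition mat_a :: "(sphere => sphere) => complex" where
 "mat_a g = fst (SOME m. (cmod (fst m))^2 - (cmod (snd m))^2 = 1 & g = su11_map (fst m) (snd m))"

definition mat_b :: "(sphere => sphere) => complex" where
 "mat_b g = snd (SOME m. (cmod (fst m))^2 - (cmod (snd m))^2 = 1 & g = su11_map (fst m) (snd m))"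

lemma fuchsian_mat:
 assumes "fuchsian_group G" "g : G"
 shows "(cmod (mat_a g))^2 - (cmod (mat_b g))^2 = 1" "g = su11_map (mat_a g) (mat_b g)"
proof -
 have "g : disc_automorphisms" using assms by (auto simp: fuchsian_group_def)
 hence "EX m. (cmod (fst m))^2 - (cmod (snd m))^2 = 1 & g = su11_map (fst m) (snd m)"
  by (auto simp: disc_automorphisms_def)
 from someI_ex[OF this] show "(cmod (mat_a g))^2 - (cmod (mat_b g))^2 = 1" "g = su11_map (mat_a g) (mat_b g)"
  unfolding mat_a_def mat_b_def by auto
qed

text \<open>If two elements have bounded and close matrices, then the inverse of one times the other
  has a matrix close to the identity, and discreteness makes it the identity map. The matrices in
  question thus form a bounded, uniformly discrete set.\<close>

lemma fuchsian_finite_norm_ball: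
 assumes G: "fuchsian_group G"
 shows "finite {g : G. cmod (mat_a g) <= M}"
proof -
 define S where "S = {g : G. cmod (mat_a g) <= M}"
 define m where "m g = (mat_a g, mat_b g)" for g
 obtain e where e: "e > 0" "ALL a b. (cmod a)^2 - (cmod b)^2 = 1 & su11_map a b : G & cmod (a - 1) < e & cmod b < e --> su11_map a b = id"
  using G unfolding fuchsian_group_def by blast
 define M' where "M' = \<bar>M\<bar> + 1"
 have M': "M' > 0" by (simp add: M'_def)
 have inj: "g = h" if "g : S" "h : S" "dist (m g) (m h) < e / (2 * M')" for g h
 proof -
  define a b a' b' where "a = mat_a g" "b = mat_b g" "a' = mat_a h" "b' = mat_b h"
  note defs = this
  have gG: "g : G" "h : G" and aM: "cmod a <= M" using that by (auto simp: S_def defs)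
  have N: "(cmod a)^2 - (cmod b)^2 = 1" "g = su11_map a b" "(cmod a')^2 - (cmod b')^2 = 1" "h = su11_map a' b'"
   using fuchsian_mat[OF G gG(1)] fuchsian_mat[OF G gG(2)] by (simp_all add: defs)
  have bM: "cmod b <= M" using su11_b_less_a[OF N(1)] aM by simp
  have N1: "(cmod (cnj a))^2 - (cmod (- b))^2 = 1" using N(1) by simp
  have ig: "su11_map (cnj a) (- b) = inv_into UNIV g"
  proof
   fix y
   obtain x where x: "y = g x" using surjE[OF bij_is_surj[OF fuchsian_bij[OF G gG(1)]]] by blast
   have "su11_map (cnj a) (- b) y = x" using fun_cong[OF su11_inverse[OF N(1)], of x] x N(2) by simp
   moreover have "inv_into UNIV g y = x" using x fuchsian_bij[OF G gG(1)] by (simp add: bij_is_inj)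
   ultimately show "su11_map (cnj a) (- b) y = inv_into UNIV g y" by simp
  qed
  \<comment> \<open>The matrix of the quotient. As the determinant is 1, both \<open>A - 1\<close>
    and \<open>B\<close> are linear in the differences \<open>a' - a\<close> and
    \<open>b' - b\<close> with coefficients of modulus at most \<open>M\<close>.\<close>
  define A B where "A = cnj a * a' + - b * cnj b'" and "B = cnj a * b' + - b * cnj a'"
  have comp: "inv_into UNIV g \<circ> h = su11_map A B" "(cmod A)^2 - (cmod B)^2 = 1"
   using su11_compose[OF N1 N(3)] ig N(4) by (simp_all add: A_def B_def)
  have d: "cmod (a' - a) < e / (2 * M')" "cmod (b' - b) < e / (2 * M')"
  proof -
   have "dist (fst (m g)) (fst (m h)) <= dist (m g) (m h)" "dist (snd (m g)) (snd (m h)) <= dist (m g) (m h)"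
   by (rule dist_fst_le dist_snd_le)+
   thus "cmod (a' - a) < e / (2 * M')" "cmod (b' - b) < e / (2 * M')"
   using that(3) by (simp_all add: m_def defs dist_norm norm_minus_commute)
  qed
  have det: "cnj a * a - b * cnj b = 1"
   using N(1) by (simp add: complex_norm_square[symmetric] of_real_diff[symmetric] mult.commute[of "cnj a"] del: of_real_power of_real_diff)
  have b1: "cmod (u * x - v * y) < e" if "cmod u <= M" "cmod v <= M" "cmod x < e / (2 * M')" "cmod y < e / (2 * M')" for u v x y
  proof -
   have "cmod (u * x - v * y) <= cmod u * cmod x + cmod v * cmod y" using norm_triangle_ineq4[of "u * x" "v * y"] by (simp add: norm_mult)
   also have "... <= M' * cmod x + M' * cmod y" using that by (intro add_mono mult_right_mono) (auto simp: M'_def)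
   also have "... < M' * (e / (2 * M')) + M' * (e / (2 * M'))" using that M' by (intro add_strict_mono mult_strict_left_mono) auto
   also have "... = e" using M' by simp
   finally show ?thesis .
  qed
  have "A - 1 = cnj a * (a' - a) - b * cnj (b' - b)" using det unfolding A_def by (simp add: algebra_simps)
  hence "cmod (A - 1) < e" using b1[of "cnj a" b "a' - a" "cnj (b' - b)"] aM bM d by (simp del: complex_cnj_diff)
  moreover have "B = cnj a * (b' - b) - b * cnj (a' - a)" unfolding B_def by (simp add: algebra_simps)
  hence "cmod B < e" using b1[of "cnj a" b "b' - b" "cnj (a' - a)"] aM bM d by (simp del: complex_cnj_diff)
  moreover have "su11_map A B : G" using fuchsian_compose[OF G fuchsian_inv[OF G gG(1)] gG(2)] comp by simp
  ultimately have "su11_map A B = id" using e(2) comp(2) by blast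
  hence "inv_into UNIV g \<circ> h = id" using comp by simp
  hence "g \<circ> (inv_into UNIV g \<circ> h) = g" by simp
  hence "(g \<circ> inv_into UNIV g) \<circ> h = g" by (simp only: o_assoc)
  moreover have "g \<circ> inv_into UNIV g = id" using fuchsian_bij[OF G gG(1)] by (simp add: bij_is_surj surj_iff[symmetric])
  ultimately show "g = h" by simp
 qed
 have "uniform_discrete (m ` S)"
  unfolding uniform_discrete_def using inj e M' by (intro exI[of _ "e / (2 * M')"]) auto
 moreover have "bounded (m ` S)"
 proof (rule boundedI[of _ "2 * \<bar>M\<bar>"])
  fix x assume "x : m ` S"
  then obtain g where g: "g : G" "cmod (mat_a g) <= M" "x = (mat_a g, mat_b g)" by (auto simp: S_def m_def)
  have "norm x <= cmod (mat_a g) + cmod (mat_b g)" unfolding g(3) by (rule norm_Pair_le)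
  thus "norm x <= 2 * \<bar>M\<bar>" using g(2) su11_b_less_a[OF fuchsian_mat(1)[OF G g(1)]] by linarith
 qed
 ultimately have "finite (m ` S)" using uniform_discrete_finite_iff by blast
 moreover have "inj_on m S" using inj e M' by (intro inj_onI) simp
 ultimately show ?thesis unfolding S_def[symmetric] by (rule finite_imageD)
qed

lemma fuchsian_countable:
 assumes G: "fuchsian_group G" shows "countable G"
proof -
 have "G = (\<Union>n::nat. {g : G. cmod (mat_a g) <= real n})" using real_arch_simple by auto
 moreover have "countable (\<Union>n::nat. {g : G. cmod (mat_a g) <= real n})"
  using fuchsian_finite_norm_ball[OF G] by (intro countable_UN) (auto intro: countable_finite)
 ultimately show ?thesis by simp
qed

section \<open>The action in the chart and the terms of the Poincare series\<close>

lemma chart_su11: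
 "cnj b * z + cnj a ~= 0 ==> su11_map a b (Some z) = Some ((a * z + b) / (cnj b * z + cnj a))"
 "cnj b * z + cnj a ~= 0 ==> chart (su11_map a b) z = (a * z + b) / (cnj b * z + cnj a)"
 "su11_map a b (Some z) = None \<longleftrightarrow> cnj b * z + cnj a = 0"
 by (auto simp: su11_map_def chart_def)

lemma chart_su11_deriv:
 assumes N: "(cmod a)^2 - (cmod b)^2 = 1" and z: "cnj b * z + cnj a ~= 0"
 shows "(chart (su11_map a b) has_field_derivative 1 / (cnj b * z + cnj a)^2) (at z)"
proof -
 have det: "a * cnj a - b * cnj b = 1"
  using N by (simp add: complex_norm_square[symmetric] of_real_diff[symmetric] del: of_real_power of_real_diff)
 have "((%z. (a * z + b) / (cnj b * z + cnj a)) has_field_derivative (a * (cnj b * z + cnj a) - (a * z + b) * cnj b) / ((cnj b * z + cnj a) * (cnj b * z + cnj a))) (at z)"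
  using z by (auto intro!: derivative_eq_intros)
 also have "a * (cnj b * z + cnj a) - (a * z + b) * cnj b = 1" using det by (simp add: algebra_simps)
 finally have d: "((%z. (a * z + b) / (cnj b * z + cnj a)) has_field_derivative 1 / (cnj b * z + cnj a)^2) (at z)"
  by (simp add: power2_eq_square)
 have o: "open {z. cnj b * z + cnj a ~= 0}" by (intro open_Collect_neq continuous_intros)
 show ?thesis
  by (rule has_field_derivative_transform_within_open[OF d o]) (use z in \<open>auto simp: chart_su11\<close>)
qed

lemma chart_su11_Dc:
 assumes N: "(cmod a)^2 - (cmod b)^2 = 1" and z: "cnj b * z + cnj a ~= 0" "z : Dc"
 shows "chart (su11_map a b) z : Dc"
 using su11_den_less_num[OF N z(2)] z(1) by (simp add: chart_su11 Dc_def norm_divide)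

lemma poincare_density_invariant:
 assumes N: "(cmod a)^2 - (cmod b)^2 = 1" and z: "cnj b * z + cnj a ~= 0" "z : Dc"
 shows "poincare_density (chart (su11_map a b) z) * (cmod (deriv (chart (su11_map a b)) z)) = poincare_density z"
proof -
 define w where "w = cnj b * z + cnj a"
 have w: "cmod w > 0" using z by (simp add: w_def)
 define v where "v = a * z + b"
 have "chart (su11_map a b) z = v / w" using z by (simp add: chart_su11 v_def w_def)
 hence "(cmod (chart (su11_map a b) z))^2 - 1 = ((cmod v)^2 - (cmod w)^2) / (cmod w)^2"
  using w by (simp add: norm_divide power_divide diff_divide_distrib)
 also have "(cmod v)^2 - (cmod w)^2 = (cmod z)^2 - 1" unfolding v_def w_def by (rule su11_norm_identity[OF N])
 finally have "(cmod (chart (su11_map a b) z))^2 - 1 = ((cmod z)^2 - 1) / (cmod w)^2" .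
 moreover have "deriv (chart (su11_map a b)) z = 1 / w^2"
  using DERIV_imp_deriv[OF chart_su11_deriv[OF N z(1)]] by (simp add: w_def)
 ultimately show ?thesis using w by (simp add: poincare_density_def norm_divide norm_power inverse_eq_divide)
qed

text \<open>This is the kernel at g(z) times g'(z)^2 with the powers of the denominator cancelled.
  For \<open>l >= 4\<close> it is regular at the pole of g, so the analysis of the series is carried
  out with it.\<close>

definition moeb_weight :: "complex => complex => nat => complex => complex => complex" where
 "moeb_weight a b l z0 z = (cnj b * z + cnj a)^(l - 4) / ((a * z + b) - z0 * (cnj b * z + cnj a))^l"

text \<open>The first bound controls the ratio of the two denominators, the second provides decay in
  \<open>cmod a\<close>. For the latter the expression is p z - q with |p|^2 - |q|^2 = 1 - |z0|^2,
  so that |q| <= |p|.\<close>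

lemma moeb_denominator:
 assumes N: "(cmod a)^2 - (cmod b)^2 = 1" and z0: "cmod z0 < 1" and z: "z : Dc"
 shows "cmod (cnj b * z + cnj a) * (1 - cmod z0) <= cmod ((a * z + b) - z0 * (cnj b * z + cnj a))"
  "cmod a * (1 - cmod z0) * (cmod z - 1) <= cmod ((a * z + b) - z0 * (cnj b * z + cnj a))"
  "(a * z + b) - z0 * (cnj b * z + cnj a) ~= 0"
proof -
 have z1: "cmod z > 1" using z by (simp add: Dc_def)
 have l: "cmod (cnj b * z + cnj a) < cmod (a * z + b)" by (rule su11_den_less_num[OF N z])
 have "cmod (a * z + b) - cmod z0 * cmod (cnj b * z + cnj a) <= cmod ((a * z + b) - z0 * (cnj b * z + cnj a))"
  using norm_triangle_ineq2[of "a * z + b" "z0 * (cnj b * z + cnj a)"] by (simp add: norm_mult)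
 thus "cmod (cnj b * z + cnj a) * (1 - cmod z0) <= cmod ((a * z + b) - z0 * (cnj b * z + cnj a))"
  using l by (simp add: algebra_simps)
 define p q where "p = a - z0 * cnj b" and "q = z0 * cnj a - b"
 have e: "(a * z + b) - z0 * (cnj b * z + cnj a) = p * z - q" by (simp add: p_def q_def algebra_simps)
 have "(cmod p)^2 - (cmod q)^2 = ((cmod a)^2 - (cmod b)^2) * (1 - (cmod z0)^2)"
  unfolding cmod_power2 p_def q_def by (simp add: power2_eq_square algebra_simps)
 also have "... >= 0" using N z0 by (simp add: abs_square_le_1 power_le_one)
 finally have "(cmod q)^2 <= (cmod p)^2" by simp
 hence pq: "cmod q <= cmod p" by (rule power2_le_imp_le) simp
 have pa: "cmod a * (1 - cmod z0) <= cmod p"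
 proof -
  have "cmod a - cmod z0 * cmod b <= cmod p" using norm_triangle_ineq2[of a "z0 * cnj b"] by (simp add: p_def norm_mult)
  moreover have "cmod z0 * cmod b <= cmod z0 * cmod a" using su11_b_less_a[OF N] by (intro mult_left_mono) auto
  ultimately show ?thesis by (simp add: algebra_simps)
 qed
 have "cmod a * (1 - cmod z0) * (cmod z - 1) <= cmod p * (cmod z - 1)" using pa z1 by (intro mult_right_mono) auto
 also have "... <= cmod p * cmod z - cmod q" using pq by (simp add: algebra_simps)
 also have "... <= cmod (p * z - q)" using norm_triangle_ineq2[of "p * z" q] by (simp add: norm_mult)
 finally show f: "cmod a * (1 - cmod z0) * (cmod z - 1) <= cmod ((a * z + b) - z0 * (cnj b * z + cnj a))" unfolding e .
 have "cmod a > 0" using su11_b_less_a[OF N] norm_ge_zero[of b] by linarith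
 hence "cmod a * (1 - cmod z0) * (cmod z - 1) > 0" using z0 z1 by simp
 with f show "(a * z + b) - z0 * (cnj b * z + cnj a) ~= 0" by auto
qed

text \<open>Of the \<open>l\<close> factors in the denominator, \<open>l - 4\<close> are paired with
  the numerator; the other four give the decay \<open>1 / (cmod a)^4\<close>, which is summable over
  a Fuchsian group.\<close>

lemma moeb_weight_bound:
 assumes N: "(cmod a)^2 - (cmod b)^2 = 1" and z0: "cmod z0 < 1" and z: "z : Dc" and l: "l >= 4"
 shows "cmod (moeb_weight a b l z0 z) <= 1 / (1 - cmod z0)^l * (1 / (cmod a)^4) * (1 / (cmod z - 1)^4)"
proof -
 define t D w where "t = 1 - cmod z0" and "D = (a * z + b) - z0 * (cnj b * z + cnj a)" and "w = cnj b * z + cnj a"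
 note den = moeb_denominator[OF N z0 z, folded t_def D_def w_def]
 have t: "t > 0" "cmod z - 1 > 0" using z0 z by (auto simp: t_def Dc_def)
 have a: "cmod a > 0" using su11_b_less_a[OF N] norm_ge_zero[of b] by linarith
 have D: "cmod D > 0" using moeb_denominator(3)[OF N z0 z] by (simp add: D_def)
 have Dw: "D = a * z + b - z0 * w" by (simp add: D_def w_def)
 define m where "m = l - 4"
 have lm: "l = m + 4" "l - 4 = m" using l by (auto simp: m_def)
 have "cmod (moeb_weight a b l z0 z) = cmod w ^ m / (cmod D ^ m * cmod D ^ 4)"
  unfolding moeb_weight_def w_def[symmetric] Dw[symmetric] lm(2) by (simp add: lm(1) norm_divide norm_power norm_mult power_add)
 also have "... = (cmod w / cmod D)^m * (1 / (cmod D)^4)" by (simp add: power_divide)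
 also have "... <= (1 / t)^m * (1 / (cmod a * t * (cmod z - 1))^4)"
 proof (intro mult_mono power_mono divide_left_mono)
  show "cmod w / cmod D <= 1 / t" using den(1) D t by (simp add: divide_le_eq field_simps)
 qed (use den(2) a t D in auto)
 also have "... = (1 / t)^m * (1/t)^4 * (1 / (cmod a)^4) * (1 / (cmod z - 1)^4)"
  by (simp add: power_mult_distrib power_divide)
 also have "(1 / t)^m * (1/t)^4 = 1 / t^l" by (simp add: lm(1) power_add power_one_over)
 finally show ?thesis by (simp add: t_def)
qed

text \<open>At the pole of the map the action is a limit by definition; \<open>moeb_weight\<close>
  agrees with it nearby and is continuous there.\<close>

lemma weight_action_omega:
 assumes N: "(cmod a)^2 - (cmod b)^2 = 1" and z0: "cmod z0 < 1" and z: "z : Dc" and l: "l >= 4"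
 shows "weight_action 2 (su11_map a b) (omega_kernel l z0) z = moeb_weight a b l z0 z"
proof -
 have l4: "l = (l - 4) + 4" using l by simp
 have reg: "omega_kernel l z0 (chart (su11_map a b) u) * deriv (chart (su11_map a b)) u ^ 2 = moeb_weight a b l z0 u"
  if u: "u : Dc" "cnj b * u + cnj a ~= 0" for u
 proof -
  define w n where "w = cnj b * u + cnj a" and "n = a * u + b"
  have w: "w ~= 0" using u by (simp add: w_def)
  have D: "n - z0 * w ~= 0" using moeb_denominator(3)[OF N z0 u(1)] by (simp add: n_def w_def)
  have 1: "deriv (chart (su11_map a b)) u = 1 / w^2"
   using DERIV_imp_deriv[OF chart_su11_deriv[OF N u(2)]] by (simp add: w_def)
  have "chart (su11_map a b) u - z0 = (n - z0 * w) / w" using w u by (simp add: chart_su11 n_def w_def[symmetric] diff_divide_distrib)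
  hence "omega_kernel l z0 (chart (su11_map a b) u) * deriv (chart (su11_map a b)) u ^ 2 = w^l / (n - z0 * w)^l * (1 / w^4)"
   unfolding omega_kernel_def 1 by (simp add: power_divide power_mult[symmetric])
  also have "w^l = w^(l - 4) * w^4" using l4 by (metis power_add)
  finally show ?thesis using w by (simp add: moeb_weight_def n_def w_def)
 qed
 show ?thesis
 proof (cases "cnj b * z + cnj a = 0")
  case False
  thus ?thesis using reg[OF z False] by (simp add: weight_action_def chart_su11(3))
 next
  case True
  have ab: "b ~= 0" "a ~= 0"
  proof -
   show "a ~= 0" by (rule su11_a_nonzero[OF N])
   thus "b ~= 0" using True by auto
  qed
  have uniq: "cnj b * u + cnj a ~= 0" if "u ~= z" for u
  proof
   assume "cnj b * u + cnj a = 0"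
   hence "cnj b * u = cnj b * z" using True by (metis add_right_cancel)
   thus False using ab that by simp
  qed
  have "isCont (moeb_weight a b l z0) z"
   unfolding moeb_weight_def[abs_def] using moeb_denominator(3)[OF N z0 z] by (intro continuous_intros) auto
  hence "(moeb_weight a b l z0 \<longlongrightarrow> moeb_weight a b l z0 z) (at z)" by (simp add: isCont_def)
  moreover have "\<forall>\<^sub>F u in at z. moeb_weight a b l z0 u = omega_kernel l z0 (chart (su11_map a b) u) * deriv (chart (su11_map a b)) u ^ 2"
  proof -
   have "open Dc" unfolding Dc_def by (intro open_Collect_less continuous_intros)
   hence "\<forall>\<^sub>F u in at z. u : Dc" using z eventually_at_topological by blast
   moreover have "\<forall>\<^sub>F u in at z. u ~= z" by (simp add: eventually_at_filter)
   ultimately show ?thesis by eventually_elim (use reg uniq in auto)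
  qed
  ultimately have "((%u. omega_kernel l z0 (chart (su11_map a b) u) * deriv (chart (su11_map a b)) u ^ 2) \<longlongrightarrow> moeb_weight a b l z0 z) (at z)"
   by (rule Lim_transform_eventually)
  hence "Lim (at z) (%u. omega_kernel l z0 (chart (su11_map a b) u) * deriv (chart (su11_map a b)) u ^ 2) = moeb_weight a b l z0 z"
   by (intro tendsto_Lim) simp
  thus ?thesis using True by (simp add: weight_action_def chart_su11(3))
 qed
qed

section \<open>Tiling the exterior of the disc\<close>

definition g_den :: "(sphere => sphere) => complex => complex" where
 "g_den g z = cnj (mat_b g) * z + cnj (mat_a g)"

text \<open>Tiles are subsets of the plane, so the point of \<open>F\<close> that is sent to
  infinity, if there is one, is left out.\<close>

definition tile :: "complex set => (sphere => sphere) => complex set" where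
 "tile F g = chart g ` {z : F. g_den g z ~= 0}"

definition tile_int :: "(sphere => sphere) => cfun => complex => complex" where
 "tile_int g f z = of_real ((cmod (1 / (g_den g z)^2))^2) * f (chart g z)"

lemma chart_deriv_fuchsian:
 assumes "fuchsian_group G" "g : G" "g_den g z ~= 0"
 shows "(chart g has_field_derivative 1 / (g_den g z)^2) (at z)"
 using chart_su11_deriv[OF fuchsian_mat(1)[OF assms(1,2)]] assms(3) fuchsian_mat(2)[OF assms(1,2)] by (simp add: g_den_def)

lemma chart_Some_fuchsian:
 assumes "fuchsian_group G" "g : G"
 shows "g_den g z ~= 0 ==> g (Some z) = Some (chart g z)" "g (Some z) = None \<longleftrightarrow> g_den g z = 0"
proof -
 have g: "g = su11_map (mat_a g) (mat_b g)" by (rule fuchsian_mat(2)[OF assms])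
 show "g (Some z) = None \<longleftrightarrow> g_den g z = 0" by (subst g) (simp add: chart_su11(3) g_den_def)
 thus "g_den g z ~= 0 ==> g (Some z) = Some (chart g z)" by (cases "g (Some z)") (auto simp: chart_def)
qed

lemma chart_Dc_fuchsian:
 assumes "fuchsian_group G" "g : G" "g_den g z ~= 0" "z : Dc" shows "chart g z : Dc"
 using chart_su11_Dc[OF fuchsian_mat(1)[OF assms(1,2)]] assms(3,4) fuchsian_mat(2)[OF assms(1,2)] by (simp add: g_den_def)

context
 fixes G :: "(sphere => sphere) set" and F :: "complex set"
 assumes G: "fuchsian_group G" and F: "fundamental_domain G F"
begin

lemma F_sets: "F : sets lebesgue" and F_Dc: "F \<subseteq> Dc"
 using F by (auto simp: fundamental_domain_def)

lemma regular_set: "{z : F. g_den g z ~= 0} : sets lebesgue"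
proof -
 have "open {z. g_den g z ~= 0}" unfolding g_den_def by (intro open_Collect_neq continuous_intros)
 hence "F \<inter> {z. g_den g z ~= 0} : sets lebesgue" using F_sets by auto
 moreover have "F \<inter> {z. g_den g z ~= 0} = {z : F. g_den g z ~= 0}" by auto
 ultimately show ?thesis by simp
qed

lemma chart_differentiable: "g : G ==> S \<subseteq> {z. g_den g z ~= 0} ==> chart g differentiable_on S"
 unfolding differentiable_on_def
proof
 fix z assume g: "g : G" "S \<subseteq> {z. g_den g z ~= 0}" and z: "z : S"
 have "(chart g has_field_derivative 1 / (g_den g z)^2) (at z)"
  by (rule chart_deriv_fuchsian[OF G g(1)]) (use g z in auto)
 hence "(chart g has_derivative (*) (1 / (g_den g z)^2)) (at z within S)"
  unfolding has_field_derivative_def by (rule has_derivative_at_withinI)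
 thus "chart g differentiable at z within S" by (rule differentiableI)
qed

lemma tile_sets: "g : G ==> tile F g : sets lebesgue"
 unfolding tile_def by (rule differentiable_image_in_sets_lebesgue[OF regular_set _ chart_differentiable]) auto

lemma tile_Dc: "g : G ==> tile F g \<subseteq> Dc"
 using chart_Dc_fuchsian[OF G] F_Dc by (auto simp: tile_def)

lemma chart_inj: "g : G ==> inj_on (chart g) {z. g_den g z ~= 0}"
proof (rule inj_onI)
 fix x y assume g: "g : G" and xy: "x : {z. g_den g z ~= 0}" "y : {z. g_den g z ~= 0}" "chart g x = chart g y"
 hence "g (Some x) = g (Some y)" using chart_Some_fuchsian(1)[OF G g] by simp
 thus "x = y" using bij_is_inj[OF fuchsian_bij[OF G g]] by (simp add: inj_eq)
qed

lemma tile_integral: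
 assumes g: "g : G" and f: "integrable (leb Dc) f"
 shows "integrable (leb F) (tile_int g f)" "integral\<^sup>L (leb F) (tile_int g f) = integral\<^sup>L (leb (tile F g)) f"
  "integrable (leb (tile F g)) f"
proof -
 define S where "S = {z : F. g_den g z ~= 0}"
 have T: "tile F g = chart g ` S" by (simp add: tile_def S_def)
 have Ss: "S : sets lebesgue" unfolding S_def by (rule regular_set)
 show fi: "integrable (leb (tile F g)) f"
 proof -
  have "set_integrable lebesgue Dc f" using f by (simp add: set_integrable_def integrable_restrict_space)
  hence "set_integrable lebesgue (tile F g) f" by (rule set_integrable_subset) (use tile_sets[OF g] tile_Dc[OF g] in auto)
  thus ?thesis using tile_sets[OF g] by (simp add: set_integrable_def integrable_restrict_space)
 qed
 have der: "\<And>z. z : S ==> (chart g has_field_derivative 1 / (g_den g z)^2) (at z)"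
  using chart_deriv_fuchsian[OF G g] by (simp add: S_def)
 have inj: "inj_on (chart g) S" by (rule inj_on_subset[OF chart_inj[OF g]]) (auto simp: S_def)
 note cv = holomorphic_change_of_variables[OF Ss der inj fi[unfolded T] tile_sets[OF g, unfolded T]]
 have e: "(%z. indicator F z *\<^sub>R tile_int g f z) = (%z. indicator S z *\<^sub>R tile_int g f z)"
  by (auto simp: fun_eq_iff indicator_def S_def tile_int_def)
 have cv1: "integrable (leb S) (tile_int g f)" using cv(1) by (simp add: tile_int_def[abs_def])
 have cv2: "integral\<^sup>L (leb S) (tile_int g f) = integral\<^sup>L (leb (tile F g)) f"
  using cv(2) unfolding T by (simp add: tile_int_def[abs_def])
 show "integrable (leb F) (tile_int g f)"
  using cv1 Ss F_sets by (simp add: integrable_restrict_space e)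
 show "integral\<^sup>L (leb F) (tile_int g f) = integral\<^sup>L (leb (tile F g)) f"
  using cv2 Ss F_sets by (simp add: integral_restrict_space e)
qed

lemma tiles_cover: "negligible {z : Dc. \<forall>g\<in>G. z ~: tile F g}"
proof (rule negligible_subset)
 show "negligible {z : Dc. \<forall>g\<in>G. Some z ~: g ` Some ` F}" using F by (simp add: fundamental_domain_def)
 show "{z : Dc. \<forall>g\<in>G. z ~: tile F g} \<subseteq> {z : Dc. \<forall>g\<in>G. Some z ~: g ` Some ` F}"
 proof clarify
  fix z g x assume z: "z : Dc" "\<forall>g\<in>G. z ~: tile F g" and g: "g : G" and x: "x : F" "Some z = g (Some x)"
  have "g_den g x ~= 0" using chart_Some_fuchsian(2)[OF G g, of x] x by auto
  moreover from this have "z = chart g x" using chart_Some_fuchsian(1)[OF G g, of x] x by simp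
  ultimately show False using z(2) g x by (auto simp: tile_def)
 qed
qed

text \<open>An overlap comes from points of \<open>F\<close> that the inverse of \<open>g\<close>
  followed after \<open>h\<close> moves back into \<open>F\<close>. They form a null set by the
  definition of a fundamental domain, and \<open>chart h\<close> maps null sets to null
  sets.\<close>

lemma tiles_overlap:
 assumes gh: "g : G" "h : G" "g ~= h"
 shows "negligible (tile F g \<inter> tile F h)"
proof -
 define k where "k = inv_into UNIV g \<circ> h"
 have kG: "k : G" unfolding k_def by (rule fuchsian_compose[OF G fuchsian_inv[OF G gh(1)] gh(2)])
 have kid: "k ~= id"
 proof
  assume "k = id"
  hence "g (inv_into UNIV g (h x)) = g x" for x unfolding k_def by (metis comp_apply id_apply)
  hence "h x = g x" for x using fuchsian_bij[OF G gh(1)] by (simp add: bij_is_surj surj_f_inv_f)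
  thus False using gh(3) by auto
 qed
 define N where "N = {z : F. k (Some z) : Some ` F} \<inter> {z. g_den h z ~= 0}"
 have "negligible {z : F. k (Some z) : Some ` F}" using F kG kid by (simp add: fundamental_domain_def)
 hence "negligible N" unfolding N_def by (rule negligible_subset) auto
 hence "negligible (chart h ` N)"
  by (rule negligible_differentiable_image_negligible[rotated]) (auto intro!: chart_differentiable gh simp: N_def)
 moreover have "tile F g \<inter> tile F h \<subseteq> chart h ` N"
 proof
  fix w assume "w : tile F g \<inter> tile F h"
  then obtain x y where x: "x : F" "g_den g x ~= 0" "w = chart g x" and y: "y : F" "g_den h y ~= 0" "w = chart h y"
   by (auto simp: tile_def)
  have "h (Some y) = g (Some x)" using chart_Some_fuchsian(1)[OF G gh(1) x(2)] chart_Some_fuchsian(1)[OF G gh(2) y(2)] x y by simp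
  hence "k (Some y) = Some x" unfolding k_def using bij_is_inj[OF fuchsian_bij[OF G gh(1)]] by simp
  hence "y : N" using x y by (auto simp: N_def)
  thus "w : chart h ` N" using y by blast
 qed
 ultimately show ?thesis by (rule negligible_subset)
qed

text \<open>An enumeration turns sums over the group into series over the natural numbers, to which
  termwise integration and the Weierstrass test apply. The index set accommodates finite groups as
  well; outside it \<open>gsum\<close> is 0.\<close>

definition gidx :: "nat set" where "gidx = to_nat_on G ` G"
definition genum :: "nat => (sphere => sphere)" where "genum n = from_nat_into G n"

lemma G_countable: "countable G" by (rule fuchsian_countable[OF G])

lemma genum_in: "n : gidx ==> genum n : G"
 using fuchsian_id[OF G] unfolding genum_def by (intro from_nat_into) auto

lemma genum_bij: "bij_betw genum gidx G"
proof -
 have "inj_on genum gidx" unfolding gidx_def genum_def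
  by (rule inj_onI) (auto simp: from_nat_into_to_nat_on G_countable)
 moreover have "genum ` gidx = G" unfolding gidx_def genum_def
  by (auto simp: image_image G_countable)
 ultimately show ?thesis by (simp add: bij_betw_def)
qed

definition gsum :: "((sphere => sphere) => 'b::real_normed_vector) => nat => 'b" where
 "gsum \<phi> n = (if n : gidx then \<phi> (genum n) else 0)"

lemma gsum_has_sum:
 fixes \<phi> :: "(sphere => sphere) => complex"
 assumes "summable (%n. norm (gsum \<phi> n))"
 shows "(\<Sum>\<^sub>\<infinity>g\<in>G. \<phi> g) = suminf (gsum \<phi>)"
proof -
 have "((%n. gsum \<phi> n) has_sum (suminf (gsum \<phi>))) UNIV"
  by (rule norm_summable_imp_has_sum[OF assms summable_sums[OF summable_norm_cancel[OF assms]]])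
 hence "((%n. \<phi> (genum n)) has_sum (suminf (gsum \<phi>))) gidx"
  by (rule iffD2[OF has_sum_cong_neutral[where S=gidx and T=UNIV and f="%n. \<phi> (genum n)" and g="%n. gsum \<phi> n"], rotated -1]) (auto simp: gsum_def)
 hence "(\<phi> has_sum (suminf (gsum \<phi>))) G" by (subst (asm) has_sum_reindex_bij_betw[OF genum_bij])
 thus ?thesis by (rule infsumI)
qed

lemma tiles_AE_unique:
 "AE z in leb Dc. \<exists>n\<in>gidx. z : tile F (genum n) & (\<forall>m\<in>gidx. m ~= n --> z ~: tile F (genum m))"
proof -
 define N where "N = {z : Dc. \<forall>g\<in>G. z ~: tile F g} \<union> (\<Union>(g,h)\<in>{(g,h). g : G & h : G & g ~= h}. tile F g \<inter> tile F h)"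
 have "countable {(g,h). g : G & h : G & g ~= h}"
  by (rule countable_subset[of _ "G \<times> G"]) (auto intro: countable_SIGMA G_countable)
 hence "negligible N"
  unfolding N_def using tiles_cover tiles_overlap by (intro negligible_Un negligible_countable_Union countable_image) auto
 hence "AE z in lebesgue. z ~: N" by (simp add: negligible_iff_null_sets AE_not_in)
 hence "AE z in lebesgue. z : Dc --> z ~: N" by eventually_elim simp
 hence "AE z in leb Dc. z ~: N" by (simp add: AE_restrict_space_iff)
 moreover have "AE z in leb Dc. z : Dc" by (rule AE_I2) simp
 ultimately show ?thesis
 proof eventually_elim
  case (elim z)
  then obtain g where g: "g : G" "z : tile F g" unfolding N_def by blast
  then obtain n where n: "n : gidx" "g = genum n" using genum_bij by (auto simp: bij_betw_def)
  have "z ~: tile F (genum m)" if m: "m : gidx" "m ~= n" for m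
  proof -
   have "genum m ~= genum n" using genum_bij m n by (auto simp: bij_betw_def inj_on_def)
   thus ?thesis using elim(1) g n genum_in[OF m(1)] unfolding N_def by blast
  qed
  thus ?case using n g by blast
 qed
qed

text \<open>Almost every point lies in exactly one tile, so the restrictions of \<open>f\<close> to
  the tiles form a series with one term at that point, dominated by
  \<open>cmod (f z)\<close>.\<close>

lemma tiles_sum:
 fixes f :: cfun
 assumes f: "integrable (leb Dc) f"
 shows "summable (gsum (%g. LINT z|leb (tile F g). cmod (f z)))"
  "suminf (gsum (%g. LINT z|leb (tile F g). f z)) = integral\<^sup>L (leb Dc) f"
  "summable (%n. norm (gsum (%g. LINT z|leb (tile F g). f z) n))"
proof -
 define u where "u n z = (if n : gidx & z : tile F (genum n) then f z else 0)" for n z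
 have conv: "integrable (leb Dc) (%z. if z : tile F g then h z else 0)"
  "(LINT z|leb Dc. (if z : tile F g then h z else 0)) = (LINT z|leb (tile F g). h z)"
  if g: "g : G" and h: "integrable (leb Dc) h" for g and h :: "complex => 'x::{banach, second_countable_topology}"
 proof -
  have e: "(%z. indicator Dc z *\<^sub>R (if z : tile F g then h z else 0)) = (%z. indicator (tile F g) z *\<^sub>R h z)"
   using tile_Dc[OF g] by (auto simp: indicator_def fun_eq_iff)
  have "set_integrable lebesgue Dc h" using h by (simp add: set_integrable_def integrable_restrict_space)
  hence "set_integrable lebesgue (tile F g) h" by (rule set_integrable_subset) (use tile_sets[OF g] tile_Dc[OF g] in auto)
  thus "integrable (leb Dc) (%z. if z : tile F g then h z else 0)"
   by (simp add: integrable_restrict_space e set_integrable_def)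
  show "(LINT z|leb Dc. (if z : tile F g then h z else 0)) = (LINT z|leb (tile F g). h z)"
   using tile_sets[OF g] by (simp add: integral_restrict_space e)
 qed
 have ue: "u n = (if n : gidx then (%z. if z : tile F (genum n) then f z else 0) else (%_. 0))" for n
  by (auto simp: u_def fun_eq_iff)
 have ui: "integrable (leb Dc) (u n)" for n
  unfolding ue using conv(1)[OF genum_in f] by simp
 have un: "(LINT z|leb Dc. cmod (u n z)) = gsum (%g. LINT z|leb (tile F g). cmod (f z)) n" for n
 proof (cases "n : gidx")
  case True
  have "(%z. cmod (u n z)) = (%z. if z : tile F (genum n) then cmod (f z) else 0)" using True by (auto simp: u_def fun_eq_iff)
  thus ?thesis using conv(2)[OF genum_in[OF True] integrable_norm[OF f]] True by (simp add: gsum_def)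
 next
  case False thus ?thesis by (simp add: gsum_def u_def)
 qed
 have ui2: "(LINT z|leb Dc. u n z) = gsum (%g. LINT z|leb (tile F g). f z) n" for n
 proof (cases "n : gidx")
  case True
  thus ?thesis using conv(2)[OF genum_in[OF True] f] by (simp add: gsum_def u_def)
 next
  case False thus ?thesis by (simp add: gsum_def u_def)
 qed
 have AEu: "AE z in leb Dc. EX n. ALL m. u m z = (if m = n then f z else 0)"
  using tiles_AE_unique by eventually_elim (auto simp: u_def)
 have part: "(\<Sum>n\<le>m. LINT z|leb Dc. cmod (u n z)) <= (LINT z|leb Dc. cmod (f z))" for m
 proof -
  have "(\<Sum>n\<le>m. LINT z|leb Dc. cmod (u n z)) = (LINT z|leb Dc. (\<Sum>n\<le>m. cmod (u n z)))"
   by (rule Bochner_Integration.integral_sum[symmetric]) (use ui in auto)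
  also have "... <= (LINT z|leb Dc. cmod (f z))"
  proof (rule integral_mono_AE)
   show "AE z in leb Dc. (\<Sum>n\<le>m. cmod (u n z)) <= cmod (f z)"
   using AEu
   proof eventually_elim
   case (elim z)
   then obtain n where n: "\<And>m. u m z = (if m = n then f z else 0)" by blast
   have "(\<Sum>i\<le>m. cmod (u i z)) = (\<Sum>i\<le>m. if i = n then cmod (f z) else 0)" by (intro sum.cong) (auto simp: n)
   also have "... <= cmod (f z)" by (simp add: sum.delta)
   finally show ?case .
   qed
  qed (use ui f in auto)
  finally show ?thesis .
 qed
 have sm: "summable (%n. LINT z|leb Dc. cmod (u n z))"
  by (rule bounded_imp_summable[OF _ part]) simp
 thus 1: "summable (gsum (%g. LINT z|leb (tile F g). cmod (f z)))" by (simp add: un)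
 show "summable (%n. norm (gsum (%g. LINT z|leb (tile F g). f z) n))"
 proof (rule summable_comparison_test'[OF 1, of 0])
  fix n show "norm (norm (gsum (%g. LINT z|leb (tile F g). f z) n)) <= gsum (%g. LINT z|leb (tile F g). cmod (f z)) n"
   unfolding un[symmetric] ui2[symmetric] using integral_norm_bound[of "leb Dc" "u n"] by simp
 qed
 have "(\<Sum>n. LINT z|leb Dc. u n z) = (LINT z|leb Dc. (\<Sum>n. u n z))"
 proof (rule integral_suminf[symmetric])
  show "AE z in leb Dc. summable (%n. norm (u n z))"
   using AEu
  proof eventually_elim
   case (elim z)
   then obtain n where "\<And>m. u m z = (if m = n then f z else 0)" by blast
   thus ?case by (intro summable_finite[of "{n}"]) auto
  qed
 qed (use ui sm in auto)
 also have "... = integral\<^sup>L (leb Dc) f"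
 proof (rule integral_cong_AE)
  have [measurable]: "u n : bmeas (leb Dc)" for n using ui by auto
  show "(%z. \<Sum>n. u n z) : bmeas (leb Dc)" by measurable
  show "AE z in leb Dc. (\<Sum>n. u n z) = f z"
   using AEu
  proof eventually_elim
   case (elim z)
   then obtain n where n: "\<And>m. u m z = (if m = n then f z else 0)" by blast
   have "(\<Sum>n. u n z) = (\<Sum>m\<in>{n}. u m z)" by (rule suminf_finite) (auto simp: n)
   thus ?case by (simp add: n)
  qed
 qed (use f in auto)
 finally show "suminf (gsum (%g. LINT z|leb (tile F g). f z)) = integral\<^sup>L (leb Dc) f"
  by (simp add: ui2)
qed

end

section \<open>Automorphy factors\<close>

lemma AE_g_den:
 assumes G: "fuchsian_group G" and g: "g : G" and S: "S : sets lebesgue"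
 shows "AE z in leb S. g_den g z ~= 0"
proof -
 have a: "mat_a g ~= 0" by (rule su11_a_nonzero[OF fuchsian_mat(1)[OF G g]])
 have "{z. g_den g z = 0} \<subseteq> {- cnj (mat_a g) / cnj (mat_b g)}"
 proof
  fix z assume "z : {z. g_den g z = 0}"
  hence e: "cnj (mat_b g) * z = - cnj (mat_a g)" by (simp add: g_den_def add_eq_0_iff2)
  hence "mat_b g ~= 0" using a by auto
  hence "z = - cnj (mat_a g) / cnj (mat_b g)" using e by (subst nonzero_eq_divide_eq) (auto simp: mult.commute)
  thus "z : {- cnj (mat_a g) / cnj (mat_b g)}" by simp
 qed
 hence "negligible {z. g_den g z = 0}" by (rule negligible_subset[rotated]) simp
 hence "AE z in lebesgue. z ~: {z. g_den g z = 0}" unfolding negligible_iff_null_sets by (rule AE_not_in)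
 hence "AE z in lebesgue. z : S --> g_den g z ~= 0" by eventually_elim simp
 thus ?thesis using S by (simp add: AE_restrict_space_iff)
qed

lemma AE_in_set: "AE z in leb S. z : S"
 by (rule AE_I2) simp

lemma AE_lebesgue_on_subset:
 assumes "AE z in leb T. P z" "S \<subseteq> T" "S : sets lebesgue" "T : sets lebesgue"
 shows "AE z in leb S. P z"
proof -
 have "AE z in lebesgue. z : T --> P z" using assms by (simp add: AE_restrict_space_iff)
 hence "AE z in lebesgue. z : S --> P z" by eventually_elim (use assms(2) in auto)
 thus ?thesis using assms by (simp add: AE_restrict_space_iff)
qed

definition g_weight :: "nat => complex => (sphere => sphere) => complex => complex" where
 "g_weight l z0 g z = moeb_weight (mat_a g) (mat_b g) l z0 z"

lemma g_weight_action:
 assumes "fuchsian_group G" "g : G" "cmod z0 < 1" "z : Dc" "l >= 4"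
 shows "weight_action 2 g (omega_kernel l z0) z = g_weight l z0 g z"
 using weight_action_omega[OF fuchsian_mat(1)[OF assms(1,2)] assms(3-5)] fuchsian_mat(2)[OF assms(1,2)] by (simp add: g_weight_def)

lemma weight_action_regular:
 assumes "fuchsian_group G" "g : G" "g_den g z ~= 0"
 shows "weight_action 2 g f z = f (chart g z) * (1 / (g_den g z)^2)^2"
proof -
 have "g (Some z) ~= None" using chart_Some_fuchsian(2)[OF assms(1,2), of z] assms(3) by (simp del: not_None_eq)
 thus ?thesis unfolding weight_action_def DERIV_imp_deriv[OF chart_deriv_fuchsian[OF assms]] by (simp only: if_False)
qed

lemma g_weight_regular:
 assumes "fuchsian_group G" "g : G" "cmod z0 < 1" "z : Dc" "l >= 4" "g_den g z ~= 0"
 shows "g_weight l z0 g z = omega_kernel l z0 (chart g z) * (1 / (g_den g z)^2)^2"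
 using g_weight_action[OF assms(1-5)] weight_action_regular[OF assms(1,2,6)] by simp

lemma g_weight_holomorphic:
 assumes "fuchsian_group G" "g : G" "cmod z0 < 1"
 shows "g_weight l z0 g holomorphic_on Dc"
 unfolding g_weight_def[abs_def] moeb_weight_def[abs_def]
 using moeb_denominator(3)[OF fuchsian_mat(1)[OF assms(1,2)] assms(3)] by (intro holomorphic_intros) auto

lemma g_weight_bound:
 assumes "fuchsian_group G" "g : G" "cmod z0 < 1" "z : Dc" "l >= 4"
 shows "cmod (g_weight l z0 g z) <= 1 / (1 - cmod z0)^l * (1 / (cmod (mat_a g))^4) * (1 / (cmod z - 1)^4)"
 unfolding g_weight_def by (rule moeb_weight_bound[OF fuchsian_mat(1)[OF assms(1,2)] assms(3-5)])

text \<open>The chain rule for the automorphy factor, valid also where \<open>h\<close> or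
  \<open>h \<circ> g\<close> has a pole: expressed by \<open>moeb_weight\<close> it is an identity
  between denominators, with \<open>m = l - 4\<close> powers in the numerator against
  \<open>l\<close> below.\<close>

lemma weight_cocycle:
 assumes G: "fuchsian_group G" and gh: "g : G" "h : G" and z0: "cmod z0 < 1" and z: "z : Dc" "g_den g z ~= 0" and l: "l >= 4"
 shows "weight_action 2 h (omega_kernel l z0) (chart g z) * (1 / (g_den g z)^2)^2 = weight_action 2 (h \<circ> g) (omega_kernel l z0) z"
proof -
 define a b c d where "a = mat_a h" and "b = mat_b h" and "c = mat_a g" and "d = mat_b g"
 have N: "(cmod a)^2 - (cmod b)^2 = 1" "(cmod c)^2 - (cmod d)^2 = 1" and hg: "h = su11_map a b" "g = su11_map c d"
  using fuchsian_mat[OF G gh(1)] fuchsian_mat[OF G gh(2)] by (simp_all add: a_def b_def c_def d_def)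
 define A B where "A = a * c + b * cnj d" and "B = a * d + b * cnj c"
 have comp: "h \<circ> g = su11_map A B" "(cmod A)^2 - (cmod B)^2 = 1" using su11_compose[OF N] hg by (simp_all add: A_def B_def)
 define w where "w = cnj d * z + cnj c"
 have w: "w ~= 0" "g_den g z = w" using z by (simp_all add: w_def g_den_def c_def d_def)
 have ch: "chart g z = (c * z + d) / w" using w unfolding hg(2) w_def by (simp add: chart_su11)
 have zD: "chart g z : Dc" by (rule chart_Dc_fuchsian[OF G gh(1) z(2,1)])
 define D1 n1 where "D1 = cnj b * chart g z + cnj a" and "n1 = a * chart g z + b"
 have e1: "cnj B * z + cnj A = D1 * w" "A * z + B = n1 * w"
  using w(1) unfolding D1_def n1_def ch by (simp_all add: A_def B_def distrib_right) (simp_all add: w_def algebra_simps)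
 define m where "m = l - 4"
 have lm: "l = m + 4" "l - 4 = m" using l by (auto simp: m_def)
 have "weight_action 2 (h \<circ> g) (omega_kernel l z0) z = moeb_weight A B l z0 z"
  unfolding comp(1) by (rule weight_action_omega[OF comp(2) z0 z(1) l])
 also have "... = (D1 * w)^m / (n1 * w - z0 * (D1 * w))^l" unfolding moeb_weight_def e1 lm(2) ..
 also have "n1 * w - z0 * (D1 * w) = (n1 - z0 * D1) * w" by (simp add: algebra_simps)
 also have "(D1 * w)^m / ((n1 - z0 * D1) * w)^l = D1^m / (n1 - z0 * D1)^l * (1 / w^2)^2"
  using w(1) by (simp add: lm(1) power_mult_distrib power_add power2_eq_square power4_eq_xxxx)
 also have "D1^m / (n1 - z0 * D1)^l = moeb_weight a b l z0 (chart g z)" unfolding moeb_weight_def D1_def n1_def lm(2) ..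
 also have "... = weight_action 2 h (omega_kernel l z0) (chart g z)"
  unfolding hg(1) by (rule weight_action_omega[OF N(1) z0 zD l, symmetric])
 finally show ?thesis unfolding w(2) by (rule sym)
qed

lemma fuchsian_comp_bij:
 assumes G: "fuchsian_group G" and g: "g : G"
 shows "bij_betw (%h. h \<circ> g) G G"
proof (rule bij_betw_byWitness[where f'="%h. h \<circ> inv_into UNIV g"])
 have b: "bij g" by (rule fuchsian_bij[OF G g])
 have 1: "g \<circ> inv_into UNIV g = id" using b by (simp add: fun_eq_iff bij_is_surj surj_f_inv_f)
 have 2: "inv_into UNIV g \<circ> g = id" using b by (simp add: fun_eq_iff bij_is_inj)
 show "\<forall>h\<in>G. (h \<circ> g) \<circ> inv_into UNIV g = h" by (simp only: o_assoc[symmetric] 1) simp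
 show "\<forall>h\<in>G. (h \<circ> inv_into UNIV g) \<circ> g = h" by (simp only: o_assoc[symmetric] 2) simp
 show "(%h. h \<circ> g) ` G \<subseteq> G" using fuchsian_compose[OF G _ g] by auto
 show "(%h. h \<circ> inv_into UNIV g) ` G \<subseteq> G" using fuchsian_compose[OF G _ fuchsian_inv[OF G g]] by auto
qed

section \<open>Convergence, automorphy and unfolding of the Poincare series\<close>

context
 fixes G :: "(sphere => sphere) set" and F :: "complex set"
 assumes G: "fuchsian_group G" and F: "fundamental_domain G F"
  and om: "\<And>l z0. l >= 4 ==> cmod z0 < 1 ==> integrable (leb Dc) (omega_kernel l z0)"
begin

lemmas gsum_eq = gsum_def[OF G F]

lemma tile_norm_integral:
 assumes g: "g : G" and f: "integrable (leb Dc) f"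
 shows "(LINT z|leb F. cmod (tile_int g f z)) = (LINT z|leb (tile F g). cmod (f z))"
proof -
 have i: "integrable (leb Dc) (%z. complex_of_real (cmod (f z)))" using f by simp
 have e: "tile_int g (%z. complex_of_real (cmod (f z))) = (%z. complex_of_real (cmod (tile_int g f z)))"
  by (simp add: tile_int_def fun_eq_iff norm_mult norm_power)
 have "complex_of_real (LINT z|leb F. cmod (tile_int g f z)) = complex_of_real (LINT z|leb (tile F g). cmod (f z))"
  using tile_integral(2)[OF G F g i] unfolding e by simp
 thus ?thesis using of_real_eq_iff by blast
qed

text \<open>Otherwise the countably many tiles would be null sets that cover almost all of a
  nonempty open set.\<close>

lemma F_not_negligible: "~ negligible F"
proof
 assume nF: "negligible F"
 have "negligible (tile F g)" if g: "g : G" for g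
  unfolding tile_def
 proof (rule negligible_differentiable_image_negligible)
  show "negligible {z : F. g_den g z ~= 0}" using nF by (rule negligible_subset) auto
  show "chart g differentiable_on {z : F. g_den g z ~= 0}" by (rule chart_differentiable[OF G F g]) auto
 qed simp
 hence "negligible (\<Union>(tile F ` G))"
  by (intro negligible_countable_Union countable_image fuchsian_countable[OF G]) auto
 hence "negligible ({z : Dc. \<forall>g\<in>G. z ~: tile F g} \<union> \<Union>(tile F ` G))"
  by (intro negligible_Un tiles_cover[OF G F])
 hence "negligible Dc" by (rule negligible_subset) auto
 moreover have "(2::complex) : Dc" by (simp add: Dc_def)
 ultimately show False using open_not_negligible[OF open_Dc] by blast
qed

text \<open>Unfold the convergent integral of 1 / |z|^4 over the exterior: the tile of g contributes
  the integral of 1 / |a z + b|^4 over \<open>F\<close>, which is at least 1 / |a|^4 times the fixed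
  positive number \<open>cF\<close>.\<close>

lemma sum_inv_a4: "summable (gsum G (%g. 1 / (cmod (mat_a g))^4))"
proof -
 define f where "f = omega_kernel 4 0"
 have fi: "integrable (leb Dc) f" unfolding f_def by (rule om) auto
 have Fs: "F : sets lebesgue" and FD: "F \<subseteq> Dc" using F_sets[OF G F] F_Dc[OF G F] by auto
 \<comment> \<open>What remains of 1 / |a z + b|^4 after |a z + b| <= |a| (1 + |z|), which follows
   from |b| < |a|.\<close>
 define c where "c z = 1 / (1 + cmod z)^4" for z :: complex
 have c0: "c z > 0" for z unfolding c_def by (intro divide_pos_pos zero_less_power) (auto intro: add_pos_nonneg)
 have cm: "c : bmeas (leb F)"
 proof -
  have "1 + cmod z ~= 0" for z :: complex using norm_ge_zero[of z] by linarith
  hence "continuous_on F c" unfolding c_def by (intro continuous_intros) auto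
  thus ?thesis by (rule continuous_measurable_leb[OF _ Fs])
 qed
 have fF: "integrable (leb F) f"
 proof -
  have "set_integrable lebesgue Dc f" using fi by (simp add: set_integrable_def integrable_restrict_space)
  hence "set_integrable lebesgue F f" by (rule set_integrable_subset) (use Fs FD in auto)
  thus ?thesis using Fs by (simp add: set_integrable_def integrable_restrict_space)
 qed
 have ci: "integrable (leb F) c"
 proof (rule integrable_dom[OF fF cm])
  show "AE z in leb F. norm (c z) <= norm (f z)"
   using AE_in_set
  proof eventually_elim
   case (elim z)
   hence "1 < cmod z" using FD by (auto simp: Dc_def)
   hence "c z <= 1 / (cmod z)^4" unfolding c_def by (intro divide_left_mono power_mono mult_pos_pos) auto
   thus ?case using c0[of z] by (simp add: f_def omega_kernel_def norm_inverse norm_power norm_divide inverse_eq_divide)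
  qed
 qed
 define cF where "cF = integral\<^sup>L (leb F) c"
 have "cF > 0"
 proof -
  have "cF >= 0" unfolding cF_def by (rule integral_nonneg_AE) (use c0 in \<open>auto intro: less_imp_le\<close>)
  moreover have "cF ~= 0"
  proof
   assume "cF = 0"
   hence "AE z in leb F. c z = 0"
   unfolding cF_def using integral_nonneg_eq_0_iff_AE[OF ci] c0 by (auto intro: less_imp_le)
   hence "AE z in leb F. False" by eventually_elim (use c0 in \<open>simp add: less_imp_neq[symmetric]\<close>)
   hence "AE z in lebesgue. z ~: F" using Fs by (simp add: AE_restrict_space_iff)
   hence "F : null_sets lebesgue" using Fs by (simp add: AE_iff_null_sets)
   thus False using F_not_negligible by (simp add: negligible_iff_null_sets)
  qed
  ultimately show ?thesis by simp
 qed
 have le: "1 / (cmod (mat_a g))^4 * cF <= (LINT z|leb (tile F g). cmod (f z))" if g: "g : G" for g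
 proof -
  define a b where "a = mat_a g" and "b = mat_b g"
  have N: "(cmod a)^2 - (cmod b)^2 = 1" unfolding a_def b_def by (rule fuchsian_mat(1)[OF G g])
  have ap: "cmod a > 0" using su11_a_nonzero[OF N] by simp
  have "1 / (cmod a)^4 * cF = (LINT z|leb F. 1 / (cmod a)^4 * c z)" unfolding cF_def by simp
  also have "... <= (LINT z|leb F. cmod (tile_int g f z))"
  proof (rule integral_mono_AE)
   show "integrable (leb F) (%z. 1 / (cmod a)^4 * c z)" using ci by simp
   show "integrable (leb F) (%z. cmod (tile_int g f z))" using tile_integral(1)[OF G F g fi] by simp
   show "AE z in leb F. 1 / (cmod a)^4 * c z <= cmod (tile_int g f z)"
   using AE_in_set AE_g_den[OF G g Fs]
   proof eventually_elim
   case (elim z)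
   have zD: "z : Dc" using elim FD by auto
   have "tile_int g f z = of_real ((cmod (1 / (g_den g z)^2))^2) * f (chart g z)" by (simp add: tile_int_def)
   hence "cmod (tile_int g f z) = cmod (g_weight 4 0 g z)"
   using g_weight_regular[OF G g _ zD _ elim(2), of 0 4] by (simp add: f_def norm_mult norm_power)
   also have "... = 1 / (cmod (a * z + b))^4"
   by (simp add: g_weight_def moeb_weight_def a_def b_def norm_divide norm_power)
   also have "... >= 1 / (cmod a * (1 + cmod z))^4"
   proof -
   have "cmod (a * z + b) <= cmod a * cmod z + cmod b" using norm_triangle_ineq[of "a * z" b] by (simp add: norm_mult)
   also have "... <= cmod a * (1 + cmod z)" using su11_b_less_a[OF N] by (simp add: algebra_simps)
   finally have le: "cmod (a * z + b) <= cmod a * (1 + cmod z)" .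
   have "cmod (a * z + b) > 0" using su11_den_less_num[OF N zD] norm_ge_zero[of "cnj b * z + cnj a"] by linarith
   thus ?thesis using le ap by (intro divide_left_mono power_mono mult_pos_pos zero_less_power add_pos_nonneg) auto
   qed
   finally show ?case by (simp add: c_def power_mult_distrib)
   qed
  qed
  also have "... = (LINT z|leb (tile F g). cmod (f z))" by (rule tile_norm_integral[OF g fi])
  finally show ?thesis by (simp add: a_def)
 qed
 have "summable (%n. gsum G (%g. LINT z|leb (tile F g). cmod (f z)) n * (1 / cF))"
  by (rule summable_mult2[OF tiles_sum(1)[OF G F fi]])
 thus ?thesis
 proof (rule summable_comparison_test'[of _ 0])
  fix n
  show "norm (gsum G (%g. 1 / (cmod (mat_a g))^4) n) <= gsum G (%g. LINT z|leb (tile F g). cmod (f z)) n * (1 / cF)"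
  proof (cases "n : gidx G")
   case True
   thus ?thesis using le[OF genum_in[OF G F True]] \<open>cF > 0\<close> by (simp add: gsum_eq field_simps)
  qed (simp add: gsum_eq)
 qed
qed

text \<open>The Poincare series with pole-free terms in the order of the enumeration. Off
  \<open>Dc\<close> it is unrelated to \<open>poincare_series\<close>; on \<open>Dc\<close> the two
  agree by absolute convergence, and this form is open to uniform convergence.\<close>

definition theta :: "nat => complex => complex => complex" where
 "theta l z0 z = suminf (gsum G (%g. g_weight l z0 g z))"

definition sum_a :: real where "sum_a = suminf (gsum G (%g. 1 / (cmod (mat_a g))^4))"

lemma gsum_weight_bound:
 assumes "cmod z0 < 1" "z : Dc" "l >= 4"
 shows "norm (gsum G (%g. g_weight l z0 g z) n) <= 1 / (1 - cmod z0)^l * (1 / (cmod z - 1)^4) * gsum G (%g. 1 / (cmod (mat_a g))^4) n"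
proof (cases "n : gidx G")
 case True
 thus ?thesis using g_weight_bound[OF G genum_in[OF G F True] assms] by (simp add: gsum_eq ac_simps)
qed (simp add: gsum_eq)

lemma theta_summable:
 assumes "cmod z0 < 1" "z : Dc" "l >= 4"
 shows "summable (%n. norm (gsum G (%g. g_weight l z0 g z) n))"
 by (rule summable_comparison_test'[OF summable_mult[OF sum_inv_a4, of "1 / (1 - cmod z0)^l * (1 / (cmod z - 1)^4)"], of 0])
  (use gsum_weight_bound[OF assms] in simp)

lemma poincare_series_theta:
 assumes "cmod z0 < 1" "z : Dc" "l >= 4"
 shows "poincare_series 2 G (omega_kernel l z0) z = theta l z0 z"
proof -
 have "poincare_series 2 G (omega_kernel l z0) z = (\<Sum>\<^sub>\<infinity>g\<in>G. g_weight l z0 g z)"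
  unfolding poincare_series_def by (rule infsum_cong) (rule g_weight_action[OF G _ assms])
 also have "... = theta l z0 z" unfolding theta_def by (rule gsum_has_sum[OF G F theta_summable[OF assms]])
 finally show ?thesis .
qed

lemma theta_bound:
 assumes "cmod z0 < 1" "z : Dc" "l >= 4"
 shows "cmod (theta l z0 z) <= 1 / (1 - cmod z0)^l * (1 / (cmod z - 1)^4) * sum_a"
proof -
 have "cmod (theta l z0 z) <= (\<Sum>n. norm (gsum G (%g. g_weight l z0 g z) n))"
  unfolding theta_def by (rule summable_norm[OF theta_summable[OF assms]])
 also have "... <= (\<Sum>n. 1 / (1 - cmod z0)^l * (1 / (cmod z - 1)^4) * gsum G (%g. 1 / (cmod (mat_a g))^4) n)"
  by (rule suminf_le[OF _ theta_summable[OF assms] summable_mult[OF sum_inv_a4]]) (rule gsum_weight_bound[OF assms])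
 also have "... = 1 / (1 - cmod z0)^l * (1 / (cmod z - 1)^4) * sum_a"
  unfolding sum_a_def by (rule suminf_mult[OF sum_inv_a4])
 finally show ?thesis .
qed

lemma theta_holomorphic:
 assumes z0: "cmod z0 < 1" and l: "l >= 4"
 shows "theta l z0 holomorphic_on Dc"
proof (rule holomorphic_uniform_sequence[OF open_Dc])
 show "(%z. \<Sum>n<m. gsum G (%g. g_weight l z0 g z) n) holomorphic_on Dc" for m
 proof (rule holomorphic_on_sum)
  fix n
  show "(%z. gsum G (%g. g_weight l z0 g z) n) holomorphic_on Dc"
   using g_weight_holomorphic[OF G genum_in[OF G F] z0] by (cases "n : gidx G") (auto simp: gsum_eq)
 qed
 fix x assume x: "x : Dc"
 define d where "d = (cmod x - 1) / 2"
 have d: "d > 0" using x by (simp add: d_def Dc_def)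
 have zd: "d <= cmod z - 1 & z : Dc" if z: "z : cball x d" for z
 proof -
  have "cmod x - cmod z <= d" using z norm_triangle_ineq2[of x z] by (simp add: dist_norm)
  hence "d <= cmod z - 1" by (simp add: d_def field_simps)
  thus ?thesis using d by (simp add: Dc_def)
 qed
 have "uniform_limit (cball x d) (%m z. \<Sum>n<m. gsum G (%g. g_weight l z0 g z) n) (%z. suminf (%n. gsum G (%g. g_weight l z0 g z) n)) sequentially"
 proof (rule Weierstrass_m_test)
  show "summable (%n. 1 / (1 - cmod z0)^l * (1 / d^4) * gsum G (%g. 1 / (cmod (mat_a g))^4) n)"
   by (rule summable_mult[OF sum_inv_a4])
  fix n z assume z: "z : cball x d"
  have "norm (gsum G (%g. g_weight l z0 g z) n) <= 1 / (1 - cmod z0)^l * (1 / (cmod z - 1)^4) * gsum G (%g. 1 / (cmod (mat_a g))^4) n"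
   using gsum_weight_bound[OF z0 _ l] zd[OF z] by blast
  also have "... <= 1 / (1 - cmod z0)^l * (1 / d^4) * gsum G (%g. 1 / (cmod (mat_a g))^4) n"
  proof (intro mult_right_mono mult_left_mono)
   have "d^4 <= (cmod z - 1)^4" using zd[OF z] d by (intro power_mono) auto
   thus "1 / (cmod z - 1)^4 <= 1 / d^4" using d by (intro frac_le) auto
   show "0 <= gsum G (%g. 1 / (cmod (mat_a g))^4) n" by (simp add: gsum_eq)
  qed (use z0 in auto)
  finally show "norm (gsum G (%g. g_weight l z0 g z) n) <= 1 / (1 - cmod z0)^l * (1 / d^4) * gsum G (%g. 1 / (cmod (mat_a g))^4) n" .
 qed
 thus "\<exists>d>0. cball x d \<subseteq> Dc & uniform_limit (cball x d) (%m z. \<Sum>n<m. gsum G (%g. g_weight l z0 g z) n) (theta l z0) sequentially"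
  using d zd by (intro exI[of _ d]) (auto simp: theta_def[abs_def])
qed

lemma theta_bigo:
 assumes z0: "cmod z0 < 1" and l: "l >= 4"
 shows "theta l z0 : O[at_infinity](%z. 1 / z ^ (2 * 2))"
proof (rule bigoI)
 show "\<forall>\<^sub>F z in at_infinity. norm (theta l z0 z) <= (16 / (1 - cmod z0)^l * sum_a) * norm (1 / z ^ (2 * 2))"
  unfolding eventually_at_infinity
 proof (intro exI[of _ 2] allI impI)
  fix z :: complex assume z: "2 <= cmod z"
  have sa: "sum_a >= 0" unfolding sum_a_def by (rule suminf_nonneg[OF sum_inv_a4]) (simp add: gsum_eq)
  \<comment> \<open>For |z| >= 2 the number |z| - 1 is at least |z| / 2, which produces the factor
    16.\<close>
  have "(cmod z / 2)^4 <= (cmod z - 1)^4" using z by (intro power_mono) auto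
  hence "1 / (cmod z - 1)^4 <= 1 / (cmod z / 2)^4" using z by (intro frac_le) auto
  also have "... = 16 / (cmod z)^4" by (simp add: power_divide)
  finally have "1 / (1 - cmod z0)^l * (1 / (cmod z - 1)^4) * sum_a <= 1 / (1 - cmod z0)^l * (16 / (cmod z)^4) * sum_a"
   using z0 sa by (intro mult_right_mono mult_left_mono) auto
  moreover have "z : Dc" using z by (simp add: Dc_def)
  ultimately show "norm (theta l z0 z) <= (16 / (1 - cmod z0)^l * sum_a) * norm (1 / z ^ (2 * 2))"
   using theta_bound[OF z0 _ l, of z] by (simp add: norm_divide norm_power)
 qed
qed

text \<open>Termwise integration: the terms are dominated by the integrals of the kernel over the
  tiles, and these add up to an integral over the exterior. It serves with \<open>\<nu> = 1\<close>
  for integrability of the series and with the Beltrami coefficient for unfolding.\<close>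

lemma weighted_integral:
 assumes z0: "cmod z0 < 1" and l: "l >= 4"
  and \<nu>m: "\<nu> : bmeas (leb Dc)" and \<nu>b: "AE z in leb Dc. cmod (\<nu> z) <= k"
 shows "integrable (leb F) (%z. \<nu> z * theta l z0 z)"
  "(LINT z|leb F. \<nu> z * theta l z0 z) = suminf (gsum G (%g. LINT z|leb F. \<nu> z * g_weight l z0 g z))"
proof -
 define \<omega> where "\<omega> = omega_kernel l z0"
 have \<omega>i: "integrable (leb Dc) \<omega>" unfolding \<omega>_def by (rule om[OF l z0])
 have Fs: "F : sets lebesgue" and FD: "F \<subseteq> Dc" using F_sets[OF G F] F_Dc[OF G F] by auto
 have mF: "\<nu> : bmeas (leb F)" by (rule measurable_restrict_mono[OF \<nu>m FD])
 have bF: "AE z in leb F. cmod (\<nu> z) <= k" by (rule AE_lebesgue_on_subset[OF \<nu>b FD Fs sets_Dc])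
 define u where "u n z = \<nu> z * gsum G (%g. g_weight l z0 g z) n" for n z
 have wm: "g_weight l z0 g : bmeas (leb F)" if g: "g : G" for g
  using continuous_measurable_leb[OF continuous_on_subset[OF holomorphic_on_imp_continuous_on[OF g_weight_holomorphic[OF G g z0]] FD] Fs] .
 have wt: "AE z in leb F. cmod (\<nu> z * g_weight l z0 g z) <= \<bar>k\<bar> * cmod (tile_int g \<omega> z)" if g: "g : G" for g
  using AE_in_set AE_g_den[OF G g Fs] bF
 proof eventually_elim
  case (elim z)
  have zD: "z : Dc" using elim FD by auto
  have "cmod (g_weight l z0 g z) = cmod (tile_int g \<omega> z)"
   using g_weight_regular[OF G g z0 zD l elim(2)] by (simp add: tile_int_def \<omega>_def norm_mult norm_power)
  thus ?case using elim(3) unfolding norm_mult by (intro mult_mono) auto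
 qed
 have wi: "integrable (leb F) (%z. \<nu> z * g_weight l z0 g z)" if g: "g : G" for g
 proof (rule integrable_dom[OF integrable_mult_right[OF integrable_norm[OF tile_integral(1)[OF G F g \<omega>i]], of "\<bar>k\<bar>"]])
  show "(%z. \<nu> z * g_weight l z0 g z) : bmeas (leb F)" using mF wm[OF g] by measurable
  show "AE z in leb F. norm (\<nu> z * g_weight l z0 g z) <= norm (\<bar>k\<bar> * norm (tile_int g \<omega> z))"
   using wt[OF g] by eventually_elim (simp add: abs_mult)
 qed
 have ui: "integrable (leb F) (u n)" for n
  using wi[OF genum_in[OF G F, of n]] by (cases "n : gidx G") (auto simp: u_def[abs_def] gsum_eq)
 have le: "(LINT z|leb F. norm (u n z)) <= \<bar>k\<bar> * gsum G (%g. LINT z|leb (tile F g). cmod (\<omega> z)) n" for n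
 proof (cases "n : gidx G")
  case True
  define g where "g = genum G n"
  have g: "g : G" unfolding g_def by (rule genum_in[OF G F True])
  have "(LINT z|leb F. norm (u n z)) = (LINT z|leb F. cmod (\<nu> z * g_weight l z0 g z))" using True by (simp add: u_def gsum_eq g_def)
  also have "... <= (LINT z|leb F. \<bar>k\<bar> * cmod (tile_int g \<omega> z))"
   by (rule integral_mono_AE[OF _ _ wt[OF g]]) (use wi[OF g] tile_integral(1)[OF G F g \<omega>i] in auto)
  also have "... = \<bar>k\<bar> * (LINT z|leb (tile F g). cmod (\<omega> z))" using tile_norm_integral[OF g \<omega>i] by simp
  finally show ?thesis using True by (simp add: gsum_eq g_def)
 qed (simp add: gsum_eq u_def)
 have sm: "summable (%n. LINT z|leb F. norm (u n z))"
  by (rule summable_comparison_test'[OF summable_mult[OF tiles_sum(1)[OF G F \<omega>i], of "\<bar>k\<bar>"], of 0]) (use le in simp)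
 have AEs: "AE z in leb F. summable (%n. norm (u n z))"
  using AE_in_set
 proof eventually_elim
  case (elim z)
  hence "z : Dc" using FD by auto
  thus ?case unfolding u_def norm_mult by (intro summable_mult theta_summable z0 l)
 qed
 have AEe: "AE z in leb F. (\<Sum>n. u n z) = \<nu> z * theta l z0 z"
  using AE_in_set
 proof eventually_elim
  case (elim z)
  hence "z : Dc" using FD by auto
  hence "summable (gsum G (%g. g_weight l z0 g z))" by (intro summable_norm_cancel[OF theta_summable] z0 l)
  thus ?case unfolding u_def theta_def by (rule suminf_mult)
 qed
 have tm: "(%z. \<nu> z * theta l z0 z) : bmeas (leb F)"
 proof -
  have "theta l z0 : bmeas (leb F)"
   using continuous_measurable_leb[OF continuous_on_subset[OF holomorphic_on_imp_continuous_on[OF theta_holomorphic[OF z0 l]] FD] Fs] .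
  thus ?thesis using mF by measurable
 qed
 have si: "integrable (leb F) (%z. \<Sum>n. u n z)" by (rule integrable_suminf[OF ui AEs sm])
 show "integrable (leb F) (%z. \<nu> z * theta l z0 z)" by (rule integrable_cong_AE_imp[OF si tm AEe])
 have "(LINT z|leb F. \<nu> z * theta l z0 z) = (LINT z|leb F. (\<Sum>n. u n z))"
  by (rule integral_cong_AE[OF tm]) (use si AEe in \<open>auto elim: eventually_mono\<close>)
 also have "... = (\<Sum>n. LINT z|leb F. u n z)" by (rule integral_suminf[OF ui AEs sm])
 also have "(%n. LINT z|leb F. u n z) = gsum G (%g. LINT z|leb F. \<nu> z * g_weight l z0 g z)"
  by (auto simp: fun_eq_iff u_def gsum_eq)
 finally show "(LINT z|leb F. \<nu> z * theta l z0 z) = suminf (gsum G (%g. LINT z|leb F. \<nu> z * g_weight l z0 g z))" .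
qed

text \<open>Right translation by \<open>g\<close> permutes the group and the cocycle identity
  matches the terms. The sum is unordered, so reindexing along a bijection preserves it.\<close>

lemma theta_automorphic:
 assumes z0: "cmod z0 < 1" and l: "l >= 4" and g: "g : G" and z: "z : Dc" "g_den g z ~= 0"
 shows "poincare_series 2 G (omega_kernel l z0) (chart g z) * deriv (chart g) z ^ 2 = poincare_series 2 G (omega_kernel l z0) z"
proof -
 have d: "deriv (chart g) z = 1 / (g_den g z)^2" by (rule DERIV_imp_deriv[OF chart_deriv_fuchsian[OF G g z(2)]])
 have "poincare_series 2 G (omega_kernel l z0) (chart g z) * deriv (chart g) z ^ 2
   = (\<Sum>\<^sub>\<infinity>h\<in>G. weight_action 2 h (omega_kernel l z0) (chart g z) * (1 / (g_den g z)^2)^2)"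
  unfolding poincare_series_def d by (rule infsum_cmult_left'[symmetric])
 also have "... = (\<Sum>\<^sub>\<infinity>h\<in>G. weight_action 2 (h \<circ> g) (omega_kernel l z0) z)"
  by (rule infsum_cong) (rule weight_cocycle[OF G g _ z0 z l])
 also have "... = (\<Sum>\<^sub>\<infinity>h\<in>G. weight_action 2 h (omega_kernel l z0) z)"
  by (rule infsum_reindex_bij_betw[OF fuchsian_comp_bij[OF G g]])
 finally show ?thesis by (simp add: poincare_series_def)
qed

lemma poincare_series_A1:
 assumes z0: "cmod z0 < 1" and l: "l >= 4"
 shows "poincare_series 2 G (omega_kernel l z0) : A1_q 2 G F"
proof -
 define P where "P = poincare_series 2 G (omega_kernel l z0)"
 have Fs: "F : sets lebesgue" and FD: "F \<subseteq> Dc" using F_sets[OF G F] F_Dc[OF G F] by auto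
 have Pt: "P z = theta l z0 z" if "z : Dc" for z unfolding P_def by (rule poincare_series_theta[OF z0 that l])
 have hol: "P holomorphic_on Dc" using theta_holomorphic[OF z0 l] by (rule holomorphic_transform) (simp add: Pt)
 have m: "P : bmeas (leb Dc)"
  by (rule continuous_measurable_leb[OF holomorphic_on_imp_continuous_on[OF hol] sets_Dc])
 have aut: "automorphic 2 G P"
  unfolding automorphic_def
 proof
  fix g assume g: "g : G"
  show "AE z in leb Dc. P (chart g z) * deriv (chart g) z ^ 2 = P z"
   using AE_in_set AE_g_den[OF G g sets_Dc]
   by eventually_elim (unfold P_def, rule theta_automorphic[OF z0 l g])
 qed
 have "integrable (leb F) (%z. 1 * theta l z0 z)" by (rule weighted_integral(1)[OF z0 l, of _ 1]) auto
 hence "integrable (leb F) (%z. cmod (theta l z0 z))" by simp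
 hence "integrable (leb F) (%z. cmod (P z))"
  by (subst Bochner_Integration.integrable_cong[OF refl, of _ _ "%z. cmod (theta l z0 z)"]) (use FD Pt in auto)
 moreover have "(%z. poincare_density z powi (2 - int 2) * cmod (P z)) = (%z. cmod (P z))" by simp
 ultimately have L1: "P : L1_q 2 G F" using m aut by (simp add: L1_q_def)
 have "P : O[at_infinity](%z. 1 / z ^ (2 * 2))"
 proof (rule landau_o.big.in_cong[THEN iffD2, OF _ theta_bigo[OF z0 l]])
  show "\<forall>\<^sub>F z in at_infinity. P z = theta l z0 z"
   unfolding eventually_at_infinity by (rule exI[of _ 2]) (auto simp: Dc_def intro!: Pt)
 qed
 thus ?thesis using L1 hol unfolding P_def[symmetric] by (simp add: A1_q_def)
qed

text \<open>Invariance turns \<open>\<nu>\<close> at z times g'(z)^2 into \<open>\<nu>\<close> at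
  g(z) times the Jacobian |g'(z)|^2. Each term of the series is then a change of variables from
  \<open>F\<close> to a tile, and the tiles fill the exterior.\<close>

lemma unfolding_identity:
 assumes z0: "cmod z0 < 1" and l: "l >= 4"
  and \<nu>m: "\<nu> : bmeas (leb Dc)" and \<nu>b: "AE z in leb Dc. cmod (\<nu> z) <= k"
  and \<nu>a: "\<And>g. g : G ==> AE z in leb Dc. \<nu> z = \<nu> (chart g z) * cnj (deriv (chart g) z) / deriv (chart g) z"
 shows "integrable (leb F) (%z. \<nu> z * poincare_series 2 G (omega_kernel l z0) z)"
  "(LINT z|leb F. \<nu> z * poincare_series 2 G (omega_kernel l z0) z) = (LINT z|leb Dc. \<nu> z * omega_kernel l z0 z)"
proof -
 define \<omega> where "\<omega> = omega_kernel l z0"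
 have \<omega>i: "integrable (leb Dc) \<omega>" unfolding \<omega>_def by (rule om[OF l z0])
 have Fs: "F : sets lebesgue" and FD: "F \<subseteq> Dc" using F_sets[OF G F] F_Dc[OF G F] by auto
 have mF: "\<nu> : bmeas (leb F)" by (rule measurable_restrict_mono[OF \<nu>m FD])
 have fi: "integrable (leb Dc) (%z. \<nu> z * \<omega> z)"
 proof (rule integrable_dom[OF integrable_mult_right[OF integrable_norm[OF \<omega>i], of "\<bar>k\<bar>"]])
  have "\<omega> : bmeas (leb Dc)" using \<omega>i by auto
  thus "(%z. \<nu> z * \<omega> z) : bmeas (leb Dc)" using \<nu>m by measurable
  show "AE z in leb Dc. norm (\<nu> z * \<omega> z) <= norm (\<bar>k\<bar> * norm (\<omega> z))"
   using \<nu>b by eventually_elim (auto simp: norm_mult abs_mult intro!: mult_right_mono)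
 qed
 have eq: "(LINT z|leb F. \<nu> z * g_weight l z0 g z) = (LINT z|leb (tile F g). \<nu> z * \<omega> z)" if g: "g : G" for g
 proof -
  have wm: "g_weight l z0 g : bmeas (leb F)"
   using continuous_measurable_leb[OF continuous_on_subset[OF holomorphic_on_imp_continuous_on[OF g_weight_holomorphic[OF G g z0]] FD] Fs] .
  have "(LINT z|leb F. \<nu> z * g_weight l z0 g z) = integral\<^sup>L (leb F) (tile_int g (%z. \<nu> z * \<omega> z))"
  proof (rule integral_cong_AE)
   show "(%z. \<nu> z * g_weight l z0 g z) : bmeas (leb F)" using mF wm by measurable
   show "tile_int g (%z. \<nu> z * \<omega> z) : bmeas (leb F)" using tile_integral(1)[OF G F g fi] by auto
   show "AE z in leb F. \<nu> z * g_weight l z0 g z = tile_int g (%z. \<nu> z * \<omega> z) z"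
   using AE_in_set AE_g_den[OF G g Fs] AE_lebesgue_on_subset[OF \<nu>a[OF g] FD Fs sets_Dc]
   proof eventually_elim
   case (elim z)
   define d where "d = 1 / (g_den g z)^2"
   have d0: "d ~= 0" using elim(2) by (simp add: d_def)
   have dd: "deriv (chart g) z = d" unfolding d_def by (rule DERIV_imp_deriv[OF chart_deriv_fuchsian[OF G g elim(2)]])
   have zD: "z : Dc" using elim FD by auto
   have w: "g_weight l z0 g z = \<omega> (chart g z) * d^2" using g_weight_regular[OF G g z0 zD l elim(2)] by (simp add: \<omega>_def d_def)
   have nu: "\<nu> z = \<nu> (chart g z) * cnj d / d" using elim(3) unfolding dd .
   have n: "complex_of_real ((cmod d)^2) = d * cnj d" by (rule complex_norm_square)
   show ?case unfolding tile_int_def d_def[symmetric] n w using d0 by (subst nu) (simp add: power2_eq_square)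
   qed
  qed
  also have "... = (LINT z|leb (tile F g). \<nu> z * \<omega> z)" by (rule tile_integral(2)[OF G F g fi])
  finally show ?thesis .
 qed
 have Pt: "poincare_series 2 G (omega_kernel l z0) z = theta l z0 z" if "z : F" for z
  using poincare_series_theta[OF z0 _ l] that FD by auto
 show "integrable (leb F) (%z. \<nu> z * poincare_series 2 G (omega_kernel l z0) z)"
  by (subst Bochner_Integration.integrable_cong[OF refl, of _ _ "%z. \<nu> z * theta l z0 z"])
   (use weighted_integral(1)[OF z0 l \<nu>m \<nu>b] Pt in auto)
 have "(LINT z|leb F. \<nu> z * poincare_series 2 G (omega_kernel l z0) z) = (LINT z|leb F. \<nu> z * theta l z0 z)"
  by (rule Bochner_Integration.integral_cong) (auto simp: Pt)
 also have "... = suminf (gsum G (%g. LINT z|leb F. \<nu> z * g_weight l z0 g z))"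
  by (rule weighted_integral(2)[OF z0 l \<nu>m \<nu>b])
 also have "gsum G (%g. LINT z|leb F. \<nu> z * g_weight l z0 g z) = gsum G (%g. LINT z|leb (tile F g). \<nu> z * \<omega> z)"
  using eq[OF genum_in[OF G F]] by (auto simp: gsum_eq fun_eq_iff)
 also have "suminf ... = (LINT z|leb Dc. \<nu> z * \<omega> z)" by (rule tiles_sum(2)[OF G F fi])
 finally show "(LINT z|leb F. \<nu> z * poincare_series 2 G (omega_kernel l z0) z) = (LINT z|leb Dc. \<nu> z * omega_kernel l z0 z)"
  by (simp add: \<omega>_def)
qed

end

section \<open>Orthogonality in terms of moments\<close>

lemma poincare_density_pos: "z : Dc ==> poincare_density z > 0"
 by (simp add: poincare_density_def Dc_def one_less_power)

text \<open>The powers of the density in \<open>psi2\<close> and in the pairing cancel, leaving the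
  integral of \<open>f z * \<nu> z\<close> over \<open>F\<close>. For a generator, unfolding makes
  it a moment over the exterior. It is bounded by the norm of \<open>\<nu>\<close> times the L1 norm
  of \<open>f\<close>, so vanishing on the generators passes to the closure of their span.\<close>

lemma WP_orthogonal_iff:
 assumes G: "fuchsian_group G" and F: "fundamental_domain G F"
  and om: "\<And>l z0. l >= 4 ==> cmod z0 < 1 ==> integrable (leb Dc) (omega_kernel l z0)"
  and l: "l >= 4"
  and \<nu>m: "\<nu> : bmeas (leb Dc)" and \<nu>b: "AE z in leb Dc. cmod (\<nu> z) <= k"
  and \<nu>a: "\<And>g. g : G ==> AE z in leb Dc. \<nu> z = \<nu> (chart g z) * cnj (deriv (chart g) z) / deriv (chart g) z"
 shows "psi2 \<nu> : WP_orthogonal 2 G F (poincare_closure 2 l G F) \<longleftrightarrow>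
  (\<forall>z\<in>ball 0 1. (LINT \<zeta>|leb Dc. \<nu> \<zeta> * omega_kernel l z \<zeta>) = 0)"
proof -
 note om' = om
 have Fs: "F : sets lebesgue" and FD: "F \<subseteq> Dc" using F_sets[OF G F] F_Dc[OF G F] by auto
 have dp: "poincare_density z > 0" if "z : Dc" for z by (rule poincare_density_pos[OF that])
 have mF: "\<nu> : bmeas (leb F)" by (rule measurable_restrict_mono[OF \<nu>m FD])
 have bF: "AE z in leb F. cmod (\<nu> z) <= k" by (rule AE_lebesgue_on_subset[OF \<nu>b FD Fs sets_Dc])
 have pw: "x powi (2 - 2 * int 2) = inverse (x^2)" "x powi (- int 2) = inverse (x^2)" "x powi (2 - int 2) = 1" for x :: real
  by (simp_all add: power_int_def power_inverse)
 have pair: "WP_pairing 2 F f (psi2 \<nu>) = (LINT z|leb F. f z * \<nu> z)" for f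
  unfolding WP_pairing_def
 proof (rule Bochner_Integration.integral_cong[OF refl])
  fix z assume "z : space (leb F)"
  hence p: "poincare_density z ~= 0" using dp[of z] FD by auto
  have "cnj (psi2 \<nu> z) * of_real (inverse ((poincare_density z)^2)) = \<nu> z * of_real ((poincare_density z)^2 * inverse ((poincare_density z)^2))"
   by (simp add: psi2_def)
  also have "... = \<nu> z" using p by simp
  finally show "f z * cnj (psi2 \<nu> z) * of_real (poincare_density z powi (2 - 2 * int 2)) = f z * \<nu> z"
   unfolding pw by (simp add: mult.assoc)
 qed
 have psi: "psi2 \<nu> : Linf_q 2 G F"
  unfolding Linf_q_def mem_Collect_eq
 proof (intro conjI)
  have "continuous_on Dc poincare_density"
   unfolding poincare_density_def
  proof (intro continuous_intros ballI)
   fix z :: complex assume "z : Dc"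
   hence "1 < (cmod z)^2" by (simp add: Dc_def one_less_power)
   thus "(cmod z)^2 - 1 ~= 0" by simp
  qed
  hence "continuous_on Dc (%z. complex_of_real ((poincare_density z)^2))" by (intro continuous_intros)
  hence "(%z. complex_of_real ((poincare_density z)^2)) : bmeas (leb Dc)"
   by (rule continuous_measurable_leb[OF _ sets_Dc])
  moreover have "(%z. cnj (\<nu> z)) : bmeas (leb Dc)"
   by (rule measurable_compose[OF \<nu>m]) (intro continuous_bmeas continuous_intros)
  ultimately show "psi2 \<nu> : bmeas (leb Dc)" unfolding psi2_def[abs_def] by measurable
  \<comment> \<open>The conjugated invariance of \<open>\<nu>\<close> gives the factor
    \<open>d / cnj d\<close>, the squared density gives \<open>d * cnj d\<close>; their product is
    \<open>d ^ 2\<close>, which is weight 2.\<close>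
  show "automorphic 2 G (psi2 \<nu>)"
   unfolding automorphic_def
  proof
   fix g assume g: "g : G"
   show "AE z in leb Dc. psi2 \<nu> (chart g z) * deriv (chart g) z ^ 2 = psi2 \<nu> z"
   using AE_in_set AE_g_den[OF G g sets_Dc] \<nu>a[OF g]
   proof eventually_elim
   case (elim z)
   define d where "d = deriv (chart g) z"
   have dd: "d = 1 / (g_den g z)^2" unfolding d_def by (rule DERIV_imp_deriv[OF chart_deriv_fuchsian[OF G g elim(2)]])
   have d0: "d ~= 0" using elim(2) by (simp add: dd)
   have nu: "cnj (\<nu> z) = cnj (\<nu> (chart g z)) * d / cnj d" using arg_cong[OF elim(3), of cnj] by (simp add: d_def)
   have inv: "poincare_density z = poincare_density (chart g z) * cmod d"
   using poincare_density_invariant[OF fuchsian_mat(1)[OF G g], of z] fuchsian_mat(2)[OF G g, symmetric] elim(1,2) by (simp add: g_den_def d_def)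
   have n: "complex_of_real ((cmod d)^2) = d * cnj d" by (rule complex_norm_square)
   have "complex_of_real ((poincare_density z)^2) = of_real ((poincare_density (chart g z))^2) * (d * cnj d)"
   unfolding inv power_mult_distrib of_real_mult n ..
   thus ?case unfolding psi2_def nu d_def[symmetric] using d0 by (simp add: power2_eq_square)
   qed
  qed
  have "esssup (leb F) (%z. ereal (poincare_density z powi (- int 2) * cmod (psi2 \<nu> z))) <= ereal k"
  proof (rule esssup_I)
   have "(%z. cmod (\<nu> z)) : bmeas (leb F)" using mF by measurable
   moreover have e: "poincare_density z powi (- int 2) * cmod (psi2 \<nu> z) = cmod (\<nu> z)" if "z : F" for z
   using dp[of z] that FD unfolding pw psi2_def by (auto simp: norm_mult norm_power)
   ultimately show "(%z. ereal (poincare_density z powi (- int 2) * cmod (psi2 \<nu> z))) : bmeas (leb F)"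
   by (subst measurable_cong[of _ _ "%z. ereal (cmod (\<nu> z))"]) auto
   show "AE z in leb F. ereal (poincare_density z powi (- int 2) * cmod (psi2 \<nu> z)) <= ereal k"
   using bF AE_in_set by eventually_elim (simp only: e ereal_less_eq)
  qed
  thus "esssup (leb F) (%z. ereal (poincare_density z powi (- int 2) * cmod (psi2 \<nu> z))) < \<infinity>"
   using le_less_trans ereal_infty_less(1) by fastforce
 qed
 define P where "P z = poincare_series 2 G (omega_kernel l z)" for z
 have PA: "P z : A1_q 2 G F" if "z : ball 0 1" for z
  unfolding P_def by (rule poincare_series_A1[OF G F om' _ l]) (use that in auto)
 have PI: "integrable (leb F) (%\<zeta>. P z \<zeta> * \<nu> \<zeta>)" "(LINT \<zeta>|leb F. P z \<zeta> * \<nu> \<zeta>) = (LINT \<zeta>|leb Dc. \<nu> \<zeta> * omega_kernel l z \<zeta>)"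
  if "z : ball 0 1" for z
  using unfolding_identity[OF G F om' _ l \<nu>m \<nu>b \<nu>a, of z] that unfolding P_def by (simp_all add: mult.commute)
 have L1: "L1_q_norm 2 F f = (LINT z|leb F. cmod (f z))" for f unfolding L1_q_norm_def pw by simp
 have A1i: "integrable (leb F) f" if "f : A1_q 2 G F" for f
 proof -
  have f: "f : L1_q 2 G F" using that by (simp only: A1_q_def mem_Collect_eq)
  have m: "f : bmeas (leb Dc)" and "integrable (leb F) (%z. poincare_density z powi (2 - int 2) * cmod (f z))"
   using f by (simp_all only: L1_q_def mem_Collect_eq)
  hence i: "integrable (leb F) (%z. cmod (f z))" by (simp only: pw mult_1)
  show ?thesis by (rule integrable_norm_cancel[OF i measurable_restrict_mono[OF m FD]])
 qed
 show ?thesis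
 proof
  assume o: "psi2 \<nu> : WP_orthogonal 2 G F (poincare_closure 2 l G F)"
  show "\<forall>z\<in>ball 0 1. (LINT \<zeta>|leb Dc. \<nu> \<zeta> * omega_kernel l z \<zeta>) = 0"
  proof
   fix z :: complex assume z: "z : ball 0 1"
   have "P z : poincare_span 2 l G"
   unfolding poincare_span_def mem_Collect_eq by (rule exI[of _ "{z}"], rule exI[of _ "%_. 1"]) (use z in \<open>auto simp: P_def\<close>)
   hence "P z : poincare_closure 2 l G F"
   unfolding poincare_closure_def using PA[OF z] by (auto simp: L1 intro!: bexI[of _ "P z"])
   hence "WP_pairing 2 F (P z) (psi2 \<nu>) = 0" using o by (simp add: WP_orthogonal_def)
   thus "(LINT \<zeta>|leb Dc. \<nu> \<zeta> * omega_kernel l z \<zeta>) = 0" using PI(2)[OF z] by (simp add: pair)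
  qed
 next
  assume z: "\<forall>z\<in>ball 0 1. (LINT \<zeta>|leb Dc. \<nu> \<zeta> * omega_kernel l z \<zeta>) = 0"
  have "WP_pairing 2 F f (psi2 \<nu>) = 0" if f: "f : poincare_closure 2 l G F" for f
  proof -
   have fA: "f : A1_q 2 G F" using f by (simp add: poincare_closure_def)
   note fi = A1i[OF fA]
   have le: "cmod (LINT z|leb F. f z * \<nu> z) <= \<bar>k\<bar> * \<epsilon>" if e0: "\<epsilon> > 0" for \<epsilon>
   proof -
   obtain h where h: "h : poincare_span 2 l G" "h : A1_q 2 G F" "L1_q_norm 2 F (%z. f z - h z) < \<epsilon>"
   using f e0 unfolding poincare_closure_def by blast
   obtain Z c where Z: "finite Z" "Z \<subseteq> ball 0 1" and hz: "h = (%w. \<Sum>z\<in>Z. c z * P z w)"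
   using h(1) unfolding poincare_span_def P_def by blast
   have "(LINT \<zeta>|leb F. h \<zeta> * \<nu> \<zeta>) = (LINT \<zeta>|leb F. (\<Sum>z\<in>Z. c z * (P z \<zeta> * \<nu> \<zeta>)))"
   unfolding hz by (simp add: sum_distrib_right mult.assoc)
   also have "... = (\<Sum>z\<in>Z. c z * (LINT \<zeta>|leb F. P z \<zeta> * \<nu> \<zeta>))"
   using Z(2) PI(1) by (subst Bochner_Integration.integral_sum) (auto simp: subset_iff)
   also have "... = 0" using Z(2) PI(2) z by (intro sum.neutral) auto
   finally have h0: "(LINT \<zeta>|leb F. h \<zeta> * \<nu> \<zeta>) = 0" .
   note hi = A1i[OF h(2)]
   have "(LINT z|leb F. f z * \<nu> z) = (LINT z|leb F. (f z - h z) * \<nu> z)"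
   using integral_bounded_mult(1)[OF fi mF bF] integral_bounded_mult(1)[OF hi mF bF] h0 by (simp add: left_diff_distrib)
   moreover have "cmod (LINT z|leb F. (f z - h z) * \<nu> z) <= \<bar>k\<bar> * (LINT z|leb F. cmod (f z - h z))"
   by (rule integral_bounded_mult(2)[OF Bochner_Integration.integrable_diff[OF fi hi] mF bF])
   moreover have "... <= \<bar>k\<bar> * \<epsilon>" using h(3) by (intro mult_left_mono) (auto simp: L1)
   ultimately show ?thesis by simp
   qed
   have "cmod (LINT z|leb F. f z * \<nu> z) <= 0"
   proof (rule field_le_epsilon)
   fix e :: real assume "e > 0"
   \<comment> \<open>The added 1 keeps the quotient meaningful when \<open>k\<close> is 0.\<close>
   hence "cmod (LINT z|leb F. f z * \<nu> z) <= \<bar>k\<bar> * (e / (\<bar>k\<bar> + 1))" by (intro le) auto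
   also have "... <= 0 + e" using \<open>e > 0\<close> by (simp add: field_simps)
   finally show "cmod (LINT z|leb F. f z * \<nu> z) <= 0 + e" .
   qed
   thus ?thesis by (simp add: pair)
  qed
  thus "psi2 \<nu> : WP_orthogonal 2 G F (poincare_closure 2 l G F)" using psi by (simp add: WP_orthogonal_def)
 qed
qed

theorem theorem4p18:
  fixes G :: "(sphere \<Rightarrow> sphere) set" and F :: "complex set"
    and w :: "(complex \<Rightarrow> complex) \<Rightarrow> sphere \<Rightarrow> sphere"
    and n :: nat and k :: schwarzian_kind
  assumes "fuchsian_group G"
    and "fundamental_domain G F"
    and "\<And>\<mu>. \<mu> \<in> Linf \<Longrightarrow> Linf_norm \<mu> < 1 \<Longrightarrow> normalised_beltrami_homeo \<mu> (w \<mu>)"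
    and "n \<ge> 3"
  shows "{\<mu> \<in> Linf_m11 G. \<forall>z\<in>ball 0 1. differential_at_0 (n - 1) (lifted_bers w k n) \<mu> z = 0} =
         {\<nu> \<in> Linf_m11 G. psi2 \<nu> \<in> WP_orthogonal 2 G F (poincare_closure 2 (n + 1) G F)}"
proof -
  have n4: "n + 1 \<ge> 4" using assms(4) by simp
  have om: "integrable (lebesgue_on Dc) (omega_kernel l z0)" if "l \<ge> 4" "cmod z0 < 1" for l z0
    by (rule omega_kernel_integrable(1)) (use that in auto)
  \<comment> \<open>For each invariant coefficient both conditions reduce to the vanishing of its
    moments of order \<open>n + 1\<close> at all points of the disc.\<close>
  have "(\<forall>z\<in>ball 0 1. differential_at_0 (n - 1) (lifted_bers w k n) \<mu> z = 0) \<longleftrightarrow>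
      psi2 \<mu> \<in> WP_orthogonal 2 G F (poincare_closure 2 (n + 1) G F)" if \<mu>: "\<mu> \<in> Linf_m11 G" for \<mu>
  proof -
    have L: "\<mu> \<in> Linf" using \<mu> by (simp add: Linf_m11_def)
    have m: "\<mu> \<in> borel_measurable (lebesgue_on Dc)" and b: "AE z in lebesgue_on Dc. cmod (\<mu> z) \<le> Linf_norm \<mu>"
      using Linf_coeff_bound(1)[OF L] by (auto simp: coeff_bound_def)
    have a: "AE z in lebesgue_on Dc. \<mu> z = \<mu> (chart g z) * cnj (deriv (chart g) z) / deriv (chart g) z" if "g \<in> G" for g
      using \<mu> that by (simp add: Linf_m11_def)
    have d: "differential_at_0 (n - 1) (lifted_bers w k n) \<mu> z = 0 \<longleftrightarrow> (LINT \<zeta>|lebesgue_on Dc. \<mu> \<zeta> * omega_kernel (n + 1) z \<zeta>) = 0"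
      if "z \<in> ball 0 1" for z
      by (rule bers_kernel[OF _ assms(4) L that]) (rule assms(3))
    have o: "psi2 \<mu> \<in> WP_orthogonal 2 G F (poincare_closure 2 (n + 1) G F) \<longleftrightarrow>
        (\<forall>z\<in>ball 0 1. (LINT \<zeta>|lebesgue_on Dc. \<mu> \<zeta> * omega_kernel (n + 1) z \<zeta>) = 0)"
      by (rule WP_orthogonal_iff[OF assms(1,2) om n4 m b a])
    show ?thesis unfolding o using d by blast
  qed
  then show ?thesis by blast
qed

end
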